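(* Let $\phi:\mathbb{C}^n\times\mathbb{C}^n\to\mathbb{C}^m$ be a sesquilinear form with $\phi(z,z')=\overline{\phi(z',z)}$ and let $0\le q\le n$. For any $\lambda\in\mathbb{R}^m$, let $\rho_s(z,\widehat\lambda)$ be the partial Fourier transform in $t$, at $\lambda$, of the fundamental solution to the $\Box_b$-heat equation on $(0,q)$-forms on $\mathbb{C}^n\times\mathbb{R}^m$. Then the function $$H^\lambda(s,z,\tilde z)=(2\pi)^{m/2}\rho_s(z-\tilde z,\widehat\lambda)\,e^{-2i\lambda\cdot\operatorname{Im}\phi(z,\tilde z)}$$ satisfies the following: if $f$ is a $(0,q)$-form on $\mathbb{C}^n$ with $L^2(\mathbb{C}^n)$ coefficients and $$H^\lambda\{f\}(s,z)=\int_{\mathbb{C}^n}H^\lambda(s,z,\tilde z)f(\tilde z)\,d\tilde z ,$$ then $H^\lambda\{f\}$ solves the initial value problem for the weighted heat equation $$\begin{cases}(\partial_s+\Box^\lambda_b)\{H^\lambda\{f\}\}=0 & \text{in }(0,\infty)\times\mathbb{C}^n,\\ H^\lambda\{f\}(s=0,z)=f(z) & \text{on }\{s=0\}\times\mathbb{C}^n.\end{cases}$$ In particular, in the coordinates given by an orthonormal basis $v_1^\lambda,\dots,v_n^\lambda$ diagonalizing $\phi^\lambda$ (see context), the component of $H^\lambda(s,z,\tilde z)$ on $d\bar z^L$ for $L\in\mathcal{I}_q$ is $$H^\lambda_L(s,z,\tilde z)=\frac{2^{\,n-\nu(\lambda)}(2\pi)^{-n}}{s^{\,n-\nu(\lambda)}}\;e^{-\frac{|z''-\tilde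 z''|^2}{s}}\;\prod_{j=1}^{\nu(\lambda)}\frac{2e^{s\epsilon^\lambda_j|\mu^\lambda_j|}\mu^\lambda_j}{\sinh(s\mu^\lambda_j)}\;e^{-\mu^\lambda_j\coth(\mu^\lambda_j s)|z_j-\tilde z_j|^2}\;e^{-2i\lambda\cdot\operatorname{Im}\phi(z,\tilde z)} .$$
   Context: **The form and the basis.** A sesquilinear form $\phi:\mathbb{C}^n\times\mathbb{C}^n\to\mathbb{C}^m$ is complex linear in the first variable, conjugate linear in the second, and satisfies $\phi(z,z')=\overline{\phi(z',z)}$ (componentwise conjugation). For $\lambda\in\mathbb{R}^m$ put $\phi^\lambda(z,z')=\phi(z,z')\cdot\lambda$, where $\cdot$ is the dot product without conjugation. Let $v^\lambda_1,\dots,v^\lambda_n$ be an orthonormal basis of $\mathbb{C}^n$ with $\phi^\lambda(v^\lambda_j,v^\lambda_k)=\delta_{jk}\mu^\lambda_j$, $\mu^\lambda_j\in\mathbb{R}$. Let $\nu(\lambda)=\operatorname{rank}(\phi^\lambda)$; the basis is ordered so that $\mu^\lambda_j\neq0$ for $1\le j\le\nu(\lambda)$ and $\mu^\lambda_j=0$ for $j>\nu(\lambda)$. Write $z=\sum_{j=1}^nz_jv^\lambda_j$, $z''=(z_{\nu(\lambda)+1},\dots,z_n)$, and similarly for $\tilde z$; $d\tilde z$ is Lebesgue measure on $\mathbb{C}^n=\mathbb{R}^{2n}$. **Forms, index sets and signs.** $\mathcal{I}_q=\{(k_1,\dots,k_q):1\le k_1<\cdots<k_q\le n\}$; $(0,q)$-forms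 are written $\sum_{K\in\mathcal{I}_q}f_K\,d\bar z^K$ in the coordinates $(z_1,\dots,z_n)$ given by $z=\sum_{j=1}^nz_jv^\lambda_j$. For $L\in\mathcal{I}_q$ and $1\le j\le\nu(\lambda)$, $\epsilon^\lambda_j=\operatorname{sgn}(\mu^\lambda_j)$ if $j\in L$, and $\epsilon^\lambda_j=-\operatorname{sgn}(\mu^\lambda_j)$ if $j\notin L$. **The Kohn Laplacian.** The quadric $M=\{(z,w)\in\mathbb{C}^n\times\mathbb{C}^m:\operatorname{Im}w=\phi(z,z)\}$ is identified with $G=\mathbb{C}^n\times\mathbb{R}^m$ with group law $(z,t)(z',t')=(z+z',t+t'+2\operatorname{Im}\phi(z,z'))$. Let $D_t=(\partial_{t_1},\dots,\partial_{t_m})$ and, with $v_k=v_k^\lambda$, $\overline Z_k=\partial_{\bar z_k}+i\,\phi(z,v_k)\cdot D_t$ and $Z_k=\partial_{z_k}-i\,\overline{\phi(z,v_k)}\cdot D_t$. The tangential Cauchy–Riemann operator on $(0,q)$-forms is $\bar\partial_bf=\sum_{K\in\mathcal{I}_{q+1}}\sum_{J\in\mathcal{I}_q}\sum_{j=1}^n\epsilon^{jJ}_K\,\overline Z_jf_J\,d\bar z^K$, where $\epsilon^{jJ}_K$ is the sign of the permutation taking $\{j\}\cup J$ to $K$ if $\{j\}\cup J=K$ as sets, and $0$ otherwise. $\Box_b=\bar\partial_b\bar\partial_b^*+\bar\partial_b^*\bar\partial_b$, with $\bar\partial_b^*$ the $L^2$-adjoint. **The weighted operator.** The partial Fourier transform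 in $t$ (replace $D_t$ by $i\lambda$) of $\bar\partial_b$ is $\bar\partial_b^\lambda g=e^{\phi(z,z)\cdot\lambda}\,\bar\partial\{e^{-\phi(z,z)\cdot\lambda}g\}$, where $\bar\partial$ is the usual Cauchy–Riemann operator on $\mathbb{C}^n$, and $\Box_b^\lambda=\bar\partial_b^\lambda(\bar\partial_b^\lambda)^*+(\bar\partial_b^\lambda)^*\bar\partial_b^\lambda$, with adjoints in (unweighted) $L^2(\mathbb{C}^n)$. In the coordinates $(z_1,\dots,z_n)$ given by $z=\sum_{j=1}^nz_jv^\lambda_j$, $\Box_b^\lambda$ acts diagonally on $(0,q)$-forms, acting on the coefficient of $d\bar z^L$ by $$\Box^\lambda_{LL}=-\tfrac14\Delta+2i\sum_{k=1}^n\mu^\lambda_k\operatorname{Im}\{z_k\partial_{z_k}\}+\sum_{k=1}^n(\mu^\lambda_k)^2|z_k|^2-\Big(\sum_{k\in L}\mu^\lambda_k-\sum_{k\notin L}\mu^\lambda_k\Big),$$ where $\operatorname{Im}\{z_k\partial_{z_k}\}=\frac1{2i}(z_k\partial_{z_k}-\bar z_k\partial_{\bar z_k})$. **Fundamental solution.** The fundamental solution $\rho_s(z,t)=\rho(s,z,t)$ of the $\Box_b$-heat equation solves $\partial_s\rho+\Box_b\rho=0$ on $(0,\infty)\times G$ with $\rho_{s=0}=\delta_0(z,t)$ (Dirac mass at the origin; $\rho$ is the kernel of $e^{-s\Box_b}$). For a function on $\mathbb{C}^n\times\mathbb{R}^m$, $g(z,\widehat\lambda)=(2\pi)^{-m/2}\int_{\mathbb{R}^m}e^{-i\lambda\cdot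 t}g(z,t)\,dt$, extended to distributions in the usual way. At $\lambda$ the transformed equation is diagonal in the orthonormal basis $v^\lambda_1,\dots,v^\lambda_n$ diagonalizing $\phi^\lambda$: the component of $\rho_s(z,\widehat\lambda)$ on $d\bar z^L$ solves $\partial_s\rho+\Box_{LL}^\lambda\rho=0$ with initial value $(2\pi)^{-m/2}\delta_0(z)$. Correspondingly, $H^\lambda$ acts on $f=\sum_Lf_L\,d\bar z^L$ by $H^\lambda\{f\}(s,z)=\sum_{L\in\mathcal{I}_q}\Big(\int_{\mathbb{C}^n}H^\lambda_L(s,z,\tilde z)f_L(\tilde z)\,d\tilde z\Big)d\bar z^L$, where $H^\lambda_L$ is the component of $H^\lambda$ on $d\bar z^L$. The value at $s=0$ is understood as the limit $s\to0^+$ (in the sense of distributions). *)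

theory Defs
  imports "HOL-Analysis.Analysis"
begin

section \<open>Test functions and tempered distributions\<close>

text \<open>Iterated directional derivatives, in the directions listed.\<close>

primrec dirderivs :: "'x::euclidean_space list \<Rightarrow> ('x \<Rightarrow> complex) \<Rightarrow> 'x \<Rightarrow> complex" where
  "dirderivs [] f = f"
| "dirderivs (d # ds) f = (\<lambda>x. frechet_derivative (dirderivs ds f) (at x) d)"

definition smooth :: "('x::euclidean_space \<Rightarrow> complex) \<Rightarrow> bool" where
  "smooth f \<longleftrightarrow> (\<forall>ds x. dirderivs ds f differentiable (at x))"

definition test_function :: "('x::euclidean_space \<Rightarrow> complex) \<Rightarrow> bool" where
  "test_function f \<longleftrightarrow> smooth f \<and> compact (closure {x. f x \<noteq> 0})"

definition schwartz :: "('x::euclidean_space \<Rightarrow> complex) \<Rightarrow> bool" where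
  "schwartz f \<longleftrightarrow> smooth f \<and>
     (\<forall>ds N. bounded (range (\<lambda>x. (1 + norm x) ^ N * cmod (dirderivs ds f x))))"

definition tempered :: "(('x::euclidean_space \<Rightarrow> complex) \<Rightarrow> complex) \<Rightarrow> bool" where
  "tempered T \<longleftrightarrow>
     (\<forall>f g a b. schwartz f \<longrightarrow> schwartz g \<longrightarrow>
        T (\<lambda>x. a * f x + b * g x) = a * T f + b * T g) \<and>
     (\<exists>C N. \<forall>f B. schwartz f \<longrightarrow>
        (\<forall>ds x. set ds \<subseteq> Basis \<longrightarrow> length ds \<le> N \<longrightarrow>
           (1 + norm x) ^ N * cmod (dirderivs ds f x) \<le> B) \<longrightarrow>
        cmod (T f) \<le> C * B)"

section \<open>The sesquilinear form\<close>

type_synonym 'n cspace = "(complex, 'n) vec"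
type_synonym 'm rspace = "(real, 'm) vec"
type_synonym ('n, 'm) quadric = "'n cspace \<times> 'm rspace"

definition cinner :: "'n::finite cspace \<Rightarrow> 'n cspace \<Rightarrow> complex" where
  "cinner z w = (\<Sum>i\<in>UNIV. z $ i * cnj (w $ i))"

definition sesquilinear_form :: "('n::finite cspace \<Rightarrow> 'n cspace \<Rightarrow> 'm::finite cspace) \<Rightarrow> bool" where
  "sesquilinear_form \<phi> \<longleftrightarrow>
     (\<forall>x y z. \<phi> (x + y) z = \<phi> x z + \<phi> y z) \<and>
     (\<forall>c x z. \<phi> (c *s x) z = c *s \<phi> x z) \<and>
     (\<forall>x y z. \<phi> x (y + z) = \<phi> x y + \<phi> x z) \<and>
     (\<forall>c x z. \<phi> x (c *s z) = cnj c *s \<phi> x z) \<and>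
     (\<forall>x z i. \<phi> x z $ i = cnj (\<phi> z x $ i))"

definition form_at ::
  "('n::finite cspace \<Rightarrow> 'n cspace \<Rightarrow> 'm::finite cspace) \<Rightarrow> 'm rspace \<Rightarrow> 'n cspace \<Rightarrow> 'n cspace \<Rightarrow> complex"
  where "form_at \<phi> \<xi> z w = (\<Sum>i\<in>UNIV. \<phi> z w $ i * of_real (\<xi> $ i))"

definition im_form ::
  "('n::finite cspace \<Rightarrow> 'n cspace \<Rightarrow> 'm::finite cspace) \<Rightarrow> 'n cspace \<Rightarrow> 'n cspace \<Rightarrow> 'm rspace"
  where "im_form \<phi> z w = (\<chi> i. Im (\<phi> z w $ i))"

definition form_rank :: "('n::finite cspace \<Rightarrow> 'n cspace \<Rightarrow> 'm::finite cspace) \<Rightarrow> 'm rspace \<Rightarrow> nat" where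
  "form_rank \<phi> \<xi> = rank (\<chi> i j. form_at \<phi> \<xi> (axis i 1) (axis j 1))"

text \<open>The 1-based position of an index.\<close>

definition pos :: "'n::{finite,linorder} \<Rightarrow> nat" where
  "pos j = card {..j}"

definition diagonalizing_basis ::
  "('n cspace \<Rightarrow> 'n cspace \<Rightarrow> 'm::finite cspace) \<Rightarrow> 'm rspace \<Rightarrow>
   ('n::{finite,linorder} \<Rightarrow> 'n cspace) \<Rightarrow> ('n \<Rightarrow> real) \<Rightarrow> bool" where
  "diagonalizing_basis \<phi> \<xi> v \<mu> \<longleftrightarrow>
     (\<forall>j k. cinner (v j) (v k) = (if j = k then 1 else 0)) \<and>
     (\<forall>j k. form_at \<phi> \<xi> (v j) (v k) = (if j = k then of_real (\<mu> j) else 0)) \<and>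
     (\<forall>j. \<mu> j \<noteq> 0 \<longleftrightarrow> pos j \<le> form_rank \<phi> \<xi>)"

section \<open>Forms of type \<open>(0,q)\<close>\<close>

text \<open>A form is given by its coefficients with respect to the \<open>d\<zbar>\<^sup>K\<close> of the coordinates
  belonging to an orthonormal basis \<open>v\<close>; an increasing multi-index is identified with its set of
  entries. The \<open>d\<zbar>\<^sup>K\<close> are taken to be orthonormal. Only the coefficients with
  \<open>K \<in> multi_indices q\<close> of a \<open>(0,q)\<close>-form are ever looked at.\<close>

type_synonym ('n, 'x) form = "'n set \<Rightarrow> 'x \<Rightarrow> complex"

definition multi_indices :: "nat \<Rightarrow> 'n::finite set set" where
  "multi_indices q = {K. card K = q}"

text \<open>Sign of the permutation that sorts \<open>(j, J)\<close>: its inversions are the \<open>i \<in> J\<close> below \<open>j\<close>.\<close>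

definition eps :: "'n::{finite,linorder} \<Rightarrow> 'n set \<Rightarrow> 'n set \<Rightarrow> complex" where
  "eps j J K = (if j \<notin> J \<and> insert j J = K then (-1) ^ card {i\<in>J. i < j} else 0)"

definition L2_fun :: "('x::euclidean_space \<Rightarrow> complex) \<Rightarrow> bool" where
  "L2_fun f \<longleftrightarrow> f \<in> borel_measurable lborel \<and> integrable lborel (\<lambda>x. (cmod (f x))\<^sup>2)"

definition L2_form :: "nat \<Rightarrow> ('n::finite, 'x::euclidean_space) form \<Rightarrow> bool" where
  "L2_form q f \<longleftrightarrow> (\<forall>K\<in>multi_indices q. L2_fun (f K))"

definition L2_inner ::
  "nat \<Rightarrow> ('n::finite, 'x::euclidean_space) form \<Rightarrow> ('n, 'x) form \<Rightarrow> complex" where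
  "L2_inner q f g = (\<Sum>K\<in>multi_indices q. LINT x|lborel. f K x * cnj (g K x))"

definition L2_norm :: "nat \<Rightarrow> ('n::finite, 'x::euclidean_space) form \<Rightarrow> real" where
  "L2_norm q f = sqrt (\<Sum>K\<in>multi_indices q. LINT x|lborel. (cmod (f K x))\<^sup>2)"

section \<open>Cauchy--Riemann operators and their Laplacians on \<open>L\<^sup>2\<close>\<close>

text \<open>\<open>dbar_distr W q f g\<close> says that \<open>g = (\<Sum>K J j. eps j J K * W j f J) d\<zbar>\<^sup>K\<close> in the sense of
  distributions, for vector fields \<open>W j\<close> whose transpose is \<open>- W j\<close>. Both \<open>d_zbar\<close> and
  \<open>Zbar\<close> below have this property: the coefficients of \<open>Zbar\<close> in front of the \<open>t\<close>-derivatives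
  depend on \<open>z\<close> only.\<close>

definition dbar_distr ::
  "('n \<Rightarrow> ('x \<Rightarrow> complex) \<Rightarrow> 'x \<Rightarrow> complex) \<Rightarrow> nat \<Rightarrow>
   ('n::{finite,linorder}, 'x::euclidean_space) form \<Rightarrow> ('n, 'x) form \<Rightarrow> bool" where
  "dbar_distr W q f g \<longleftrightarrow>
     (\<forall>K\<in>multi_indices (q + 1). \<forall>\<psi>. test_function \<psi> \<longrightarrow>
        (LINT x|lborel. g K x * \<psi> x) =
        (\<Sum>J\<in>multi_indices q. \<Sum>j\<in>UNIV. eps j J K * - (LINT x|lborel. f J x * W j \<psi> x)))"

text \<open>An operator on \<open>L\<^sup>2\<close>-forms is given by its graph: \<open>D q f g\<close> means that \<open>f\<close>, a \<open>(0,q)\<close>-form, is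
  in the domain and is mapped to the \<open>(0,q+1)\<close>-form \<open>g\<close>.\<close>

type_synonym ('n, 'x) form_op = "nat \<Rightarrow> ('n, 'x) form \<Rightarrow> ('n, 'x) form \<Rightarrow> bool"

definition L2_adjoint :: "('n::finite, 'x::euclidean_space) form_op \<Rightarrow> ('n, 'x) form_op" where
  "L2_adjoint D q g h \<longleftrightarrow> L2_form (q + 1) g \<and> L2_form q h \<and>
     (\<forall>u w. D q u w \<longrightarrow> L2_inner (q + 1) w g = L2_inner q u h)"

text \<open>\<open>D D\<^sup>* + D\<^sup>* D\<close>; the first summand is absent on functions.\<close>

definition laplacian :: "('n::finite, 'x::euclidean_space) form_op \<Rightarrow> ('n, 'x) form_op" where
  "laplacian D q f w \<longleftrightarrow>
     (\<exists>g h c d. D q f g \<and> L2_adjoint D q g h \<and>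
        (if q = 0 then d = (\<lambda>K x. 0) else L2_adjoint D (q - 1) f c \<and> D (q - 1) c d) \<and>
        (\<forall>K\<in>multi_indices q. \<forall>x. w K x = h K x + d K x))"

text \<open>\<open>u s = exp (- s A) f\<close> for a nonnegative self-adjoint \<open>A\<close>, as the solution of the Cauchy problem
  in \<open>L\<^sup>2\<close>.\<close>

definition heat_flow ::
  "(('n, 'x) form \<Rightarrow> ('n, 'x) form \<Rightarrow> bool) \<Rightarrow> nat \<Rightarrow> ('n::finite, 'x::euclidean_space) form \<Rightarrow>
   (real \<Rightarrow> ('n, 'x) form) \<Rightarrow> bool" where
  "heat_flow A q f u \<longleftrightarrow>
     (\<forall>s>0. \<exists>w. A (u s) w \<and>
        ((\<lambda>h. L2_norm q (\<lambda>K x. (u (s + h) K x - u s K x) / of_real h + w K x)) \<longlongrightarrow> 0) (at 0)) \<and>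
     ((\<lambda>s. L2_norm q (\<lambda>K x. u s K x - f K x)) \<longlongrightarrow> 0) (at_right 0)"

subsection \<open>On the quadric\<close>

definition qmul ::
  "('n::finite cspace \<Rightarrow> 'n cspace \<Rightarrow> 'm::finite cspace) \<Rightarrow>
   ('n, 'm) quadric \<Rightarrow> ('n, 'm) quadric \<Rightarrow> ('n, 'm) quadric"
  where "qmul \<phi> g h = (fst g + fst h, snd g + snd h + 2 *\<^sub>R im_form \<phi> (fst g) (fst h))"

lemma qmul_inverse:
  assumes "sesquilinear_form \<phi>"
  shows "qmul \<phi> (- h) h = 0" "qmul \<phi> h (- h) = 0"
proof -
  obtain z t where h: "h = (z, t)" by (cases h)
  have "\<phi> ((-1) *s z) z = (-1) *s \<phi> z z" "\<phi> z ((-1) *s z) = cnj (-1) *s \<phi> z z"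
    using assms unfolding sesquilinear_form_def by blast+
  then have l: "\<phi> (- z) z = - \<phi> z z" and r: "\<phi> z (- z) = - \<phi> z z"
    by (simp_all add: vector_sneg_minus1 [symmetric])
  have "Im (\<phi> z z $ i) = 0" for i
  proof -
    have "\<phi> z z $ i = cnj (\<phi> z z $ i)"
      using assms unfolding sesquilinear_form_def by blast
    then have "Im (\<phi> z z $ i) = - Im (\<phi> z z $ i)"
      by (metis complex_cnj complex.sel(2) complex_surj)
    then show ?thesis by simp
  qed
  then show "qmul \<phi> (- h) h = 0" "qmul \<phi> h (- h) = 0"
    by (simp_all add: h qmul_def im_form_def l r zero_prod_def vec_eq_iff)
qed

definition Zbar ::
  "('n::finite cspace \<Rightarrow> 'n cspace \<Rightarrow> 'm::finite cspace) \<Rightarrow> ('n \<Rightarrow> 'n cspace) \<Rightarrow> 'n \<Rightarrow>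
   (('n, 'm) quadric \<Rightarrow> complex) \<Rightarrow> ('n, 'm) quadric \<Rightarrow> complex" where
  "Zbar \<phi> v k f p =
     (frechet_derivative f (at p) (v k, 0) + \<i> * frechet_derivative f (at p) (\<i> *s v k, 0)) / 2
     + \<i> * (\<Sum>i\<in>UNIV. \<phi> (fst p) (v k) $ i * frechet_derivative f (at p) (0, axis i 1))"

definition dbar_b ::
  "('n cspace \<Rightarrow> 'n cspace \<Rightarrow> 'm::finite cspace) \<Rightarrow> ('n \<Rightarrow> 'n cspace) \<Rightarrow>
   ('n::{finite,linorder}, ('n, 'm) quadric) form_op" where
  "dbar_b \<phi> v q f g \<longleftrightarrow> L2_form q f \<and> L2_form (q + 1) g \<and> dbar_distr (Zbar \<phi> v) q f g"

abbreviation "Box_b \<phi> v \<equiv> laplacian (dbar_b \<phi> v)"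

text \<open>The fundamental solution is the convolution kernel of \<open>exp (- s Box_b)\<close>, a matrix of tempered
  distributions: \<open>(exp (- s Box_b) f) (g) = \<integral> \<rho>\<^sub>s(h) f(h\<^sup>-\<^sup>1 g) dh\<close> for Schwartz forms \<open>f\<close>. The
  convolution is on this side because the \<open>Zbar\<close> commute with right translations for the group
  law \<open>qmul\<close>; the inverse of \<open>h\<close> is \<open>- h\<close>. That this converges to \<open>f\<close> as \<open>s \<rightarrow> 0\<close> expresses
  \<open>\<rho>\<^sub>0 = \<delta>\<^sub>0\<close>.\<close>

definition heat_fundamental_solution ::
  "('n cspace \<Rightarrow> 'n cspace \<Rightarrow> 'm::finite cspace) \<Rightarrow> ('n::{finite,linorder} \<Rightarrow> 'n cspace) \<Rightarrow> nat \<Rightarrow>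
   (real \<Rightarrow> 'n set \<Rightarrow> 'n set \<Rightarrow> (('n, 'm) quadric \<Rightarrow> complex) \<Rightarrow> complex) \<Rightarrow> bool" where
  "heat_fundamental_solution \<phi> v q \<rho> \<longleftrightarrow>
     (\<forall>s>0. \<forall>K\<in>multi_indices q. \<forall>L\<in>multi_indices q. tempered (\<rho> s K L)) \<and>
     (\<forall>f. (\<forall>L\<in>multi_indices q. schwartz (f L)) \<longrightarrow>
        heat_flow (Box_b \<phi> v q) q f
          (\<lambda>s K g. \<Sum>L\<in>multi_indices q. \<rho> s K L (\<lambda>h. f L (qmul \<phi> (- h) g))))"

subsection \<open>The weighted operator\<close>

definition d_zbar ::
  "('n::finite \<Rightarrow> 'n cspace) \<Rightarrow> 'n \<Rightarrow> ('n cspace \<Rightarrow> complex) \<Rightarrow> 'n cspace \<Rightarrow> complex" where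
  "d_zbar v k f z =
     (frechet_derivative f (at z) (v k) + \<i> * frechet_derivative f (at z) (\<i> *s v k)) / 2"

definition weighted_dbar ::
  "('n cspace \<Rightarrow> 'n cspace \<Rightarrow> 'm::finite cspace) \<Rightarrow> 'm rspace \<Rightarrow> ('n \<Rightarrow> 'n cspace) \<Rightarrow>
   ('n::{finite,linorder}, 'n cspace) form_op" where
  "weighted_dbar \<phi> \<xi> v q f g \<longleftrightarrow> L2_form q f \<and> L2_form (q + 1) g \<and>
     dbar_distr (d_zbar v) q
       (\<lambda>K z. exp (- form_at \<phi> \<xi> z z) * f K z) (\<lambda>K z. exp (- form_at \<phi> \<xi> z z) * g K z)"

abbreviation "weighted_Box \<phi> \<xi> v \<equiv> laplacian (weighted_dbar \<phi> \<xi> v)"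

section \<open>Partial Fourier transform and the kernel\<close>

definition fourier_t ::
  "(('n::finite, 'm::finite) quadric \<Rightarrow> complex) \<Rightarrow> ('n, 'm) quadric \<Rightarrow> complex" where
  "fourier_t g p = of_real ((2 * pi) powr (- real CARD('m) / 2)) *
     (LINT t|lborel. exp (- \<i> * of_real (snd p \<bullet> t)) * g (fst p, t))"

text \<open>The partial Fourier transform of the tempered distribution \<open>T\<close> is the function \<open>r\<close>. Continuity
  makes the value of \<open>r\<close> at every point well defined.\<close>

definition has_fourier_t ::
  "((('n::finite, 'm::finite) quadric \<Rightarrow> complex) \<Rightarrow> complex) \<Rightarrow>
   (('n, 'm) quadric \<Rightarrow> complex) \<Rightarrow> bool" where
  "has_fourier_t T r \<longleftrightarrow> continuous_on UNIV r \<and>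
     (\<forall>\<psi>. schwartz \<psi> \<longrightarrow> integrable lborel (\<lambda>p. r p * \<psi> p) \<and>
        T (fourier_t \<psi>) = (LINT p|lborel. r p * \<psi> p))"

definition heat_kernel ::
  "('n::finite cspace \<Rightarrow> 'n cspace \<Rightarrow> 'm::finite cspace) \<Rightarrow> 'm rspace \<Rightarrow>
   (real \<Rightarrow> 'n set \<Rightarrow> 'n set \<Rightarrow> ('n, 'm) quadric \<Rightarrow> complex) \<Rightarrow>
   real \<Rightarrow> 'n set \<Rightarrow> 'n set \<Rightarrow> 'n cspace \<Rightarrow> 'n cspace \<Rightarrow> complex" where
  "heat_kernel \<phi> \<xi> \<rho>hat s K L z z' =
     of_real ((2 * pi) powr (real CARD('m) / 2)) * \<rho>hat s K L (z - z', \<xi>) *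
     exp (- 2 * \<i> * of_real (\<xi> \<bullet> im_form \<phi> z z'))"

definition apply_kernel ::
  "nat \<Rightarrow> (real \<Rightarrow> 'n set \<Rightarrow> 'n set \<Rightarrow> 'n cspace \<Rightarrow> 'n cspace \<Rightarrow> complex) \<Rightarrow>
   ('n::finite, 'n cspace) form \<Rightarrow> real \<Rightarrow> ('n, 'n cspace) form" where
  "apply_kernel q H f s K z = (\<Sum>L\<in>multi_indices q. LINT z'|lborel. H s K L z z' * f L z')"

definition eps_sign :: "('n::finite \<Rightarrow> real) \<Rightarrow> 'n set \<Rightarrow> 'n \<Rightarrow> real" where
  "eps_sign \<mu> L j = (if j \<in> L then sgn (\<mu> j) else - sgn (\<mu> j))"

definition coth :: "real \<Rightarrow> real" where
  "coth x = cosh x / sinh x"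

end

theory Submission
 imports Defs "HOL-Probability.Characteristic_Functions" "HOL-Computational_Algebra.Polynomial"
begin

text \<open>
 Fix \<open>\<lambda> = \<xi>\<close> and let \<open>p\<^sub>s\<close> be the Mehler kernel of the diagonalized form. The kernel
 \<open>p\<^sub>s(z - z') exp (- 2 i \<xi> \<bullet> Im \<phi>(z, z'))\<close> satisfies the weighted heat equation in \<open>z\<close>. The Laplacian is an
 operator on \<open>L\<^sup>2\<close> given by its graph, so the superposition over \<open>z'\<close> needs the equation for the
 intermediate forms of \<open>\<partial>\<^sub>b\<close> and of its adjoint; these have Gaussian kernels, and Fubini moves
 \<open>L\<^sup>2\<close> pairings under the integral.

 The fundamental solution has Fourier transform \<open>(2 pi)\<^sup>-\<^sup>m\<^sup>/\<^sup>2 p\<^sub>s\<close> at \<open>\<xi>\<close>. The wave packets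
 \<open>V(\<sigma>) = p\<^sub>\<sigma>\<^sub>+\<^sub>s(z) exp (i \<xi> \<bullet> t - e\<^sup>2 |t|\<^sup>2 / 2)\<close> solve the heat equation of the quadric up to an error of
 relative size \<open>e\<close>. Since the Laplacian is symmetric and its heat flow \<open>u\<close> contracts, the pairing of
 \<open>u(\<sigma>)\<close> with \<open>V(T - \<sigma>)\<close> is constant up to that error. For \<open>u(0)\<close> a packet at the same frequency, the limit
 \<open>e \<rightarrow> 0\<close> localizes the transform of \<open>u(T)\<close> at \<open>\<xi>\<close>, and \<open>s \<rightarrow> 0\<close> evaluates it at \<open>z = 0\<close>. The transform
 is merely continuous, without growth bounds for single frequencies, so the first limit is taken over a bounded set
 of \<open>z\<close>, the rest being small by the Cauchy--Schwarz inequality.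
\<close>

text \<open>All that is known of the fundamental solution is an L^2 heat flow of an operator given
  by its graph; neither self-adjointness nor uniqueness is at hand. Pairing with explicit
  approximate solutions run backwards in time gets by with symmetry. The error has relative size e
  because a t-derivative of the envelope exp(-e^2 |t|^2 / 2) is e times a bounded function of e t.
  Squared norms of packets are of order e^-m, so the pairings have a limit after multiplication by
  e^m. The graphs are defined by testing with compactly supported functions, whereas kernels and
  packets are Gaussian. Two classes mediate: an inductively generated one of Gaussian functions,
  closed under all derivatives, and the C^1 functions that are Gaussian bounded together with their
  derivatives; cutoffs lead from one kind of testing to the other. The weighted operator and the one
  on the quadric are instances of one locale. There the signs enter only through the anticommutation
  of exterior multiplication and contraction, so a single calculation gives both Laplacians, the
  second with extra terms of order e^2.\<close>

abbreviation (input) "borel_funs \<equiv> borel_measurable borel"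

abbreviation (input) lborel_integral :: "('x::euclidean_space \<Rightarrow> 'b::{banach,second_countable_topology}) \<Rightarrow> 'b"
 (binder "LI " 60) where "lborel_integral f \<equiv> integral\<^sup>L lborel f"

abbreviation (input) index_sets :: "nat \<Rightarrow> 'n::finite set set" ("\<I>") where
 "\<I> \<equiv> multi_indices"

abbreviation (input) gauss :: "real \<Rightarrow> 'x::real_normed_vector \<Rightarrow> real" where
 "gauss c x \<equiv> exp (- (c * (norm x)\<^sup>2))"

abbreviation (input) fder ::
 "('x::real_normed_vector \<Rightarrow> 'y::real_normed_vector) \<Rightarrow> 'x \<Rightarrow> 'x \<Rightarrow> 'y" where
 "fder f x \<equiv> frechet_derivative f (at x)"

abbreviation (input) dbar_test ::
 "('n \<Rightarrow> ('x \<Rightarrow> complex) \<Rightarrow> 'x \<Rightarrow> complex) \<Rightarrow> nat \<Rightarrow> ('n::{finite,linorder}, 'x::euclidean_space) form \<Rightarrow>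
  'n set \<Rightarrow> ('x \<Rightarrow> complex) \<Rightarrow> complex" where
 "dbar_test W q f K \<psi> \<equiv> \<Sum>J\<in>\<I> q. \<Sum>j\<in>UNIV. eps j J K * - (LI x. f J x * W j \<psi> x)"

lemmas B_integrable_add = Bochner_Integration.integrable_add
lemmas B_integrable_bound = Bochner_Integration.integrable_bound
lemmas B_integrable_sum = Bochner_Integration.integrable_sum
lemmas B_integral_add = Bochner_Integration.integral_add
lemmas B_integral_cong = Bochner_Integration.integral_cong
lemmas B_integral_sum = Bochner_Integration.integral_sum

section \<open>Gaussian integrals and their Fourier transforms\<close>

lemma gauss_fourier_1:
 fixes c t :: real assumes c: "c > 0"
 shows "has_bochner_integral lborel (\<lambda>x::real. exp (\<i> * of_real (t * x)) * of_real (exp (- c * x^2)))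
   (of_real (sqrt (pi / c) * exp (- t\<^sup>2 / (4 * c))))"
proof -
 \<comment> \<open>At \<open>?r * x\<close> the standard normal density is a multiple of exp(-c
   x^2), so the claim is a rescaling of the characteristic function of the normal
   distribution.\<close>
 let ?r = "sqrt (2 * c)"
 have r: "?r > 0" "?r^2 = 2 * c" using c by auto
 have e: "(LI x. std_normal_density x *\<^sub>R exp (\<i> * of_real (u * x))) = of_real (exp (- u\<^sup>2 / 2))" for u
  using fun_cong[OF char_std_normal_distribution, of u]
  by (simp add: char_def integral_density)
 have i: "integrable lborel (\<lambda>x. std_normal_density x *\<^sub>R exp (\<i> * of_real (u * x)))" for u
  by (rule B_integrable_bound[OF integrable_normal_density[of 1 0]]) auto
 have h: "has_bochner_integral lborel (\<lambda>x. std_normal_density x *\<^sub>R exp (\<i> * of_real (u * x))) (of_real (exp (- u\<^sup>2 / 2)))" for u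
  using e i by (simp add: has_bochner_integral_iff)
 have "has_bochner_integral lborel (\<lambda>x. std_normal_density (0 + ?r * x) *\<^sub>R exp (\<i> * of_real ((t/?r) * (0 + ?r * x)))) (of_real (exp (- (t/?r)\<^sup>2 / 2)) /\<^sub>R \<bar>?r\<bar>)"
  using lborel_has_bochner_integral_real_affine_iff[of ?r "\<lambda>x. std_normal_density x *\<^sub>R exp (\<i> * of_real ((t/?r) * x))" "of_real (exp (- (t/?r)\<^sup>2 / 2))" 0] r(1) h[of "t/?r"]
  by simp
 hence "has_bochner_integral lborel (\<lambda>x. sqrt (2 * pi) *\<^sub>R (std_normal_density (0 + ?r * x) *\<^sub>R exp (\<i> * of_real ((t/?r) * (0 + ?r * x))))) (sqrt (2 * pi) *\<^sub>R (of_real (exp (- (t/?r)\<^sup>2 / 2)) /\<^sub>R \<bar>?r\<bar>))"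
  by (intro has_bochner_integral_scaleR_right)
 also have "(\<lambda>x. sqrt (2 * pi) *\<^sub>R (std_normal_density (0 + ?r * x) *\<^sub>R exp (\<i> * of_real ((t/?r) * (0 + ?r * x))))) = (\<lambda>x::real. exp (\<i> * of_real (t * x)) * of_real (exp (- c * x^2)))"
 proof
  fix x
  have "sqrt (2 * pi) * std_normal_density (0 + ?r * x) = exp (- c * x^2)"
   using c by (simp add: std_normal_density_def power_mult_distrib)
  moreover have "(t/?r) * (0 + ?r * x) = t * x" using r by (simp del: of_real_divide)
  ultimately show "sqrt (2 * pi) *\<^sub>R (std_normal_density (0 + ?r * x) *\<^sub>R exp (\<i> * of_real ((t/?r) * (0 + ?r * x)))) = exp (\<i> * of_real (t * x)) * of_real (exp (- c * x^2))"
   by (metis scaleR_conv_of_real scaleR_scaleR mult.commute)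
 qed
 also have "(sqrt (2 * pi) *\<^sub>R (of_real (exp (- (t/?r)\<^sup>2 / 2)) /\<^sub>R \<bar>?r\<bar>)) = complex_of_real (sqrt (pi / c) * exp (- t\<^sup>2 / (4 * c)))"
 proof -
  have "sqrt (2 * pi) / ?r = sqrt (pi / c)" by (simp flip: real_sqrt_divide)
  moreover have "(t/?r)^2 / 2 = t^2 / (4 * c)" using c by (simp add: power_divide)
  ultimately show ?thesis using r(1)
   by (simp add: scaleR_conv_of_real field_simps flip: of_real_mult of_real_divide)
 qed
 finally show ?thesis .
qed

interpretation lborel_product: product_sigma_finite "\<lambda>_::'a::euclidean_space. lborel :: real measure"
 by standard

text \<open>\<open>lborel\<close> on a Euclidean space is the image of the product of
  one-dimensional Lebesgue measures indexed by \<open>Basis\<close>, so products of functions of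
  single coordinates integrate factorwise.\<close>

lemma lborel_integral_prod:
 fixes f :: "'a::euclidean_space => real => complex"
 assumes "\<And>b. b \<in> Basis ==> has_bochner_integral lborel (f b) (I b)"
 shows "has_bochner_integral lborel (\<lambda>x::'a. \<Prod>b\<in>Basis. f b (x \<bullet> b)) (\<Prod>b\<in>Basis. I b)"
proof -
 let ?T = "\<lambda>g. \<Sum>b\<in>Basis. g b *\<^sub>R b :: 'a"
 have i: "\<And>b. b \<in> Basis ==> integrable lborel (f b)" and v: "\<And>b. b \<in> Basis ==> integral\<^sup>L lborel (f b) = I b"
  using assms by (auto simp: has_bochner_integral_iff)
 have [measurable]: "\<And>b. b \<in> Basis ==> f b \<in> borel_funs"
  using borel_measurable_integrable[OF i] by simp
 have m[measurable]: "(\<lambda>x. \<Prod>b\<in>Basis. f b (x \<bullet> b)) \<in> borel_measurable (borel :: 'a measure)"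
  by measurable
 have T[measurable]: "?T \<in> measurable (\<Pi>\<^sub>M b\<in>Basis. lborel) borel"
  by measurable
 have eq: "(\<lambda>g. \<Prod>b\<in>Basis. f b (?T g \<bullet> b)) = (\<lambda>g. \<Prod>b\<in>Basis. f b (g b))"
  by (auto intro!: prod.cong)
 have "integrable (\<Pi>\<^sub>M b\<in>(Basis::'a set). lborel) (\<lambda>g. \<Prod>b\<in>Basis. f b (g b))"
  by (rule lborel_product.product_integrable_prod) (auto simp: i)
 hence 1: "integrable lborel (\<lambda>x::'a. \<Prod>b\<in>Basis. f b (x \<bullet> b))"
  by (subst lborel_eq, subst integrable_distr_eq) (simp_all only: T m eq)
 have "(LI x. (\<Prod>b\<in>Basis. f b ((x::'a) \<bullet> b))) = (LINT g|Pi\<^sub>M (Basis::'a set) (\<lambda>b. lborel). (\<Prod>b\<in>Basis. f b (g b)))"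
  by (subst lborel_eq, subst integral_distr) (simp_all only: T m eq)
 also have "\<dots> = (\<Prod>b\<in>Basis. I b)"
  by (subst lborel_product.product_integral_prod) (auto simp: i v)
 finally show ?thesis using 1 by (simp add: has_bochner_integral_iff)
qed

lemma gauss_fourier:
 fixes y :: "'a::euclidean_space" assumes c: "c > 0"
 shows "has_bochner_integral lborel (\<lambda>x::'a. exp (\<i> * of_real (y \<bullet> x)) * of_real (exp (- c * (norm x)^2)))
   (of_real (sqrt (pi / c) ^ DIM('a) * exp (- (norm y)\<^sup>2 / (4 * c))))"
proof -
 have n: "(norm x)^2 = (\<Sum>b\<in>Basis. (x \<bullet> b)^2)" for x :: 'a
  by (metis (no_types, lifting) euclidean_inner power2_eq_square power2_norm_eq_inner sum.cong)
 have "has_bochner_integral lborel (\<lambda>x::'a. \<Prod>b\<in>Basis. exp (\<i> * of_real ((y \<bullet> b) * (x \<bullet> b))) * of_real (exp (- c * (x \<bullet> b)^2)))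
   (\<Prod>b\<in>Basis. of_real (sqrt (pi / c) * exp (- (y \<bullet> b)\<^sup>2 / (4 * c))))"
  by (rule lborel_integral_prod[of "\<lambda>b x. exp (\<i> * of_real ((y \<bullet> b) * x)) * of_real (exp (- c * x^2))"])
   (rule gauss_fourier_1[OF c])
 moreover have "(\<Prod>b\<in>Basis. exp (\<i> * of_real ((y \<bullet> b) * (x \<bullet> b))) * of_real (exp (- c * (x \<bullet> b)^2)))
   = exp (\<i> * of_real (y \<bullet> x)) * of_real (exp (- c * (norm x)^2))" for x :: 'a
  by (simp add: prod.distrib n euclidean_inner[of y x] sum_distrib_left flip: exp_sum of_real_prod)
 moreover have "(\<Prod>b\<in>(Basis::'a set). complex_of_real (sqrt (pi / c) * exp (- (y \<bullet> b)\<^sup>2 / (4 * c)))) = of_real (sqrt (pi / c) ^ DIM('a) * exp (- (norm y)\<^sup>2 / (4 * c)))"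
  by (simp add: prod.distrib n sum_divide_distrib flip: exp_sum of_real_prod sum_negf)
 ultimately show ?thesis by simp
qed

lemma gauss_integral:
 assumes c: "c > 0"
 shows "has_bochner_integral lborel (\<lambda>x::'a::euclidean_space. exp (- c * (norm x)^2)) (sqrt (pi / c) ^ DIM('a))"
proof -
 have "has_bochner_integral lborel (\<lambda>x::'a. complex_of_real (exp (- c * (norm x)^2))) (of_real (sqrt (pi / c) ^ DIM('a)))"
  using gauss_fourier[OF c, of "0::'a"] by simp
 thus ?thesis
  by (simp only: has_bochner_integral_iff complex_of_real_integrable_eq integral_complex_of_real of_real_eq_iff)
qed

lemma gauss_integrable [simp, intro]:
 "c > 0 ==> integrable lborel (\<lambda>x::'a::euclidean_space. gauss c x)"
 using gauss_integral[of c, where 'a='a] by (simp add: has_bochner_integral_iff)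

section \<open>Square integrable forms, their pairing and their norm\<close>

lemma L2_funI: "f \<in> borel_funs ==> integrable lborel (\<lambda>x. (cmod (f x))^2) ==> L2_fun f"
 by (simp add: L2_fun_def)

lemma L2_fun_measurable: "L2_fun f ==> f \<in> borel_funs"
 by (simp add: L2_fun_def)

lemma L2_fun_integrable: "L2_fun f ==> integrable lborel (\<lambda>x. (cmod (f x))^2)"
 by (simp add: L2_fun_def)

lemma L2_fun_bound:
 assumes "integrable lborel h" "f \<in> borel_funs" "\<And>x. (cmod (f x))^2 \<le> h x"
 shows "L2_fun f"
proof (rule L2_funI)
 show "integrable lborel (\<lambda>x. (cmod (f x))^2)"
  by (rule B_integrable_bound[OF assms(1)])
   (use assms(2) in measurable, use assms(3) in \<open>auto intro: order_trans[OF _ abs_ge_self]\<close>)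
qed fact

lemma L2_fun_mult_integrable:
 assumes "L2_fun f" "L2_fun g" shows "integrable lborel (\<lambda>x. f x * g x)"
proof (rule B_integrable_bound)
 note [measurable] = assms[THEN L2_fun_measurable]
 show "integrable lborel (\<lambda>x. (cmod (f x))^2 + (cmod (g x))^2)"
  by (intro B_integrable_add L2_fun_integrable assms)
 show "(\<lambda>x. f x * g x) \<in> borel_measurable lborel" by measurable
 have "a * b \<le> a^2 + b^2" for a b :: real
  using sum_squares_bound[of a b] sum_power2_ge_zero[of a b] by linarith
 thus "AE x in lborel. norm (f x * g x) \<le> norm ((cmod (f x))^2 + (cmod (g x))^2)"
  by (simp add: norm_mult)
qed

lemma L2_fun_add:
 assumes "L2_fun f" "L2_fun g" shows "L2_fun (\<lambda>x. f x + g x)"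
proof (rule L2_fun_bound)
 note [measurable] = assms[THEN L2_fun_measurable]
 show "integrable lborel (\<lambda>x. 2 * (cmod (f x))^2 + 2 * (cmod (g x))^2)"
  by (intro B_integrable_add integrable_mult_right L2_fun_integrable assms)
 show "(\<lambda>x. f x + g x) \<in> borel_funs" by measurable
 fix x
 have "(cmod (f x + g x))^2 \<le> (cmod (f x) + cmod (g x))^2"
  by (intro power_mono norm_triangle_ineq) auto
 also have "\<dots> \<le> 2 * (cmod (f x))^2 + 2 * (cmod (g x))^2"
  using sum_squares_bound[of "cmod (f x)" "cmod (g x)"] by (simp add: power2_sum)
 finally show "(cmod (f x + g x))^2 \<le> 2 * (cmod (f x))^2 + 2 * (cmod (g x))^2" .
qed

lemma L2_fun_cmult: "L2_fun f ==> L2_fun (\<lambda>x. c * f x)"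
 by (auto simp: L2_fun_def norm_mult power_mult_distrib)

lemma borel_measurable_cnj [measurable]:
 "f \<in> borel_measurable M ==> (\<lambda>x. cnj (f x)) \<in> borel_measurable M"
 by (rule measurable_compose[OF _ borel_measurable_continuous_onI]) (auto intro: continuous_intros)

lemma L2_fun_cnj: "L2_fun f ==> L2_fun (\<lambda>x. cnj (f x))"
 by (auto simp: L2_fun_def)

lemma L2_fun_zero [simp]: "L2_fun (\<lambda>x. 0)"
 by (auto simp: L2_fun_def)

lemma L2_fun_diff: "L2_fun f ==> L2_fun g ==> L2_fun (\<lambda>x. f x - g x)"
 using L2_fun_add[of f "\<lambda>x. (-1) * g x"] L2_fun_cmult[of g "-1"] by simp

lemma L2_fun_sum: "(\<And>i. i \<in> I ==> L2_fun (f i)) ==> L2_fun (\<lambda>x. \<Sum>i\<in>I. f i x)"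
 by (induction I rule: infinite_finite_induct) (auto intro: L2_fun_add)

lemma L2_formD: "L2_form q f ==> K \<in> \<I> q ==> L2_fun (f K)"
 by (simp add: L2_form_def)

lemma L2_form_add: "L2_form q f ==> L2_form q g ==> L2_form q (\<lambda>K x. f K x + g K x)"
 and L2_form_diff: "L2_form q f ==> L2_form q g ==> L2_form q (\<lambda>K x. f K x - g K x)"
 and L2_form_cmult: "L2_form q f ==> L2_form q (\<lambda>K x. c * f K x)"
 and L2_form_zero: "L2_form q (\<lambda>K x. 0)"
 by (auto simp: L2_form_def intro: L2_fun_add L2_fun_diff L2_fun_cmult)

lemma L2_form_integrable:
 "L2_form q f ==> L2_form q g ==> K \<in> \<I> q ==> integrable lborel (\<lambda>x. f K x * cnj (g K x))"
 by (intro L2_fun_mult_integrable L2_fun_cnj) (auto simp: L2_form_def)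

lemma L2_inner_add_left:
 assumes "L2_form q f" "L2_form q g" "L2_form q h"
 shows "L2_inner q (\<lambda>K x. f K x + g K x) h = L2_inner q f h + L2_inner q g h"
 unfolding L2_inner_def sum.distrib[symmetric]
 by (intro sum.cong refl)
  (simp add: ring_distribs L2_form_integrable[OF assms(1,3)] L2_form_integrable[OF assms(2,3)])

lemma L2_inner_cmult_left: "L2_inner q (\<lambda>K x. c * f K x) h = c * L2_inner q f h"
 unfolding L2_inner_def sum_distrib_left
 by (intro sum.cong refl) (simp add: mult.assoc)

lemma L2_inner_diff_left:
 assumes "L2_form q f" "L2_form q g" "L2_form q h"
 shows "L2_inner q (\<lambda>K x. f K x - g K x) h = L2_inner q f h - L2_inner q g h"
 unfolding L2_inner_def sum_subtractf[symmetric]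
 by (intro sum.cong refl)
  (simp add: ring_distribs L2_form_integrable[OF assms(1,3)] L2_form_integrable[OF assms(2,3)])

lemma L2_inner_cnj: "L2_inner q f g = cnj (L2_inner q g f)"
 unfolding L2_inner_def cnj_sum
 by (intro sum.cong refl, subst Bochner_Integration.integral_cnj[symmetric]) (simp only: complex_cnj_mult complex_cnj_cnj mult.commute)

lemma L2_inner_add_right:
 assumes "L2_form q f" "L2_form q g" "L2_form q h"
 shows "L2_inner q h (\<lambda>K x. f K x + g K x) = L2_inner q h f + L2_inner q h g"
 by (subst (1 2 3) L2_inner_cnj) (simp add: L2_inner_add_left assms)

lemma L2_inner_diff_right:
 assumes "L2_form q f" "L2_form q g" "L2_form q h"
 shows "L2_inner q h (\<lambda>K x. f K x - g K x) = L2_inner q h f - L2_inner q h g"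
 by (subst (1 2 3) L2_inner_cnj) (simp add: L2_inner_diff_left assms)

lemma L2_inner_cmult_right: "L2_inner q h (\<lambda>K x. c * f K x) = cnj c * L2_inner q h f"
 by (subst (1 2) L2_inner_cnj) (simp add: L2_inner_cmult_left)

lemma L2_norm_nonneg [simp]: "0 \<le> L2_norm q f"
 by (simp add: L2_norm_def sum_nonneg)

lemma L2_norm_sq: "(L2_norm q f)^2 = (\<Sum>K\<in>\<I> q. LI x. (cmod (f K x))^2)"
 by (simp add: L2_norm_def sum_nonneg)

lemma L2_inner_self: "L2_inner q f f = of_real ((L2_norm q f)^2)"
 unfolding L2_norm_sq L2_inner_def of_real_sum
 by (simp only: complex_norm_square[symmetric] integral_complex_of_real)

lemma L2_norm_cmult: "L2_norm q (\<lambda>K x. c * f K x) = cmod c * L2_norm q f"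
proof -
 have "(L2_norm q (\<lambda>K x. c * f K x))^2 = (cmod c * L2_norm q f)^2"
  by (simp add: L2_norm_sq norm_mult power_mult_distrib sum_distrib_left)
 thus ?thesis by (simp add: power2_eq_iff_nonneg)
qed

lemma L2_norm_cong: "(\<And>K x. K \<in> \<I> q ==> f K x = g K x) ==> L2_norm q f = L2_norm q g"
 by (simp add: L2_norm_def)

lemma L2_inner_cong:
 "(\<And>K x. K \<in> \<I> q ==> f K x = f' K x) ==> (\<And>K x. K \<in> \<I> q ==> g K x = g' K x)
  ==> L2_inner q f g = L2_inner q f' g'"
 by (simp add: L2_inner_def)

text \<open>The squared norm of f - c g is nonnegative for all c. The choice c = <f, g> / |g|^2
  gives the inequality; if |g| = 0, then c = t <f, g> with large t forces <f, g> = 0.\<close>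

lemma L2_Cauchy_Schwarz:
 assumes f: "L2_form q f" and g: "L2_form q g"
 shows "cmod (L2_inner q f g) \<le> L2_norm q f * L2_norm q g"
proof -
 let ?i = "L2_inner q f g" and ?f = "(L2_norm q f)^2" and ?g = "(L2_norm q g)^2"
 have *: "0 \<le> ?f - 2 * Re (cnj c * ?i) + (cmod c)^2 * ?g" for c
 proof -
  let ?d = "\<lambda>K x. f K x - c * g K x"
  have cg: "L2_form q (\<lambda>K x. c * g K x)" by (rule L2_form_cmult[OF g])
  have "of_real ((L2_norm q ?d)^2) = L2_inner q ?d ?d" by (simp add: L2_inner_self)
  also have "\<dots> = L2_inner q f ?d - L2_inner q (\<lambda>K x. c * g K x) ?d"
   by (rule L2_inner_diff_left[OF f cg L2_form_diff[OF f cg]])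
  also have "\<dots> = L2_inner q f f - c * L2_inner q g f - cnj c * (L2_inner q f g - c * L2_inner q g g)"
   unfolding L2_inner_diff_right[OF f cg f] L2_inner_diff_right[OF f cg g] L2_inner_cmult_left L2_inner_cmult_right
   by (simp add: algebra_simps)
  also have "\<dots> = of_real ?f - (cnj c * ?i + cnj (cnj c * ?i)) + of_real ((cmod c)^2) * of_real ?g"
   unfolding L2_inner_self complex_norm_square by (subst L2_inner_cnj[of q g f]) (simp add: algebra_simps)
  finally have "Re (of_real ((L2_norm q ?d)^2)) = Re (of_real ?f - (cnj c * ?i + cnj (cnj c * ?i)) + of_real ((cmod c)^2) * of_real ?g)"
   by simp
  hence "(L2_norm q ?d)^2 = ?f - 2 * Re (cnj c * ?i) + (cmod c)^2 * ?g" by simp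
  thus ?thesis using zero_le_power2[of "L2_norm q ?d"] by linarith
 qed
 show ?thesis
 proof (cases "?g = 0")
  case True
  have t: "0 \<le> ?f - 2 * (t * (cmod ?i)^2)" for t
  proof -
   have r: "cnj (of_real t * ?i) * ?i = of_real (t * (cmod ?i)^2)"
    by (simp only: complex_cnj_mult complex_cnj_complex_of_real of_real_mult complex_norm_square mult.assoc mult.commute[of "cnj ?i"])
   show ?thesis using *[of "of_real t * ?i"] True unfolding r Re_complex_of_real by simp
  qed
  have "(cmod ?i)^2 = 0"
  proof (rule ccontr)
   assume n: "(cmod ?i)^2 \<noteq> 0"
   show False using t[of "(?f + 1) / (2 * (cmod ?i)^2)"] n by (simp add: field_simps)
  qed
  thus ?thesis by simp
 next
  case False
  hence gp: "?g > 0" by simp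
  have r: "cnj (?i / of_real ?g) * ?i = of_real ((cmod ?i)^2 / ?g)"
   by (simp only: complex_cnj_divide complex_cnj_complex_of_real of_real_divide complex_norm_square times_divide_eq_left times_divide_eq_right mult.commute)
  have "0 \<le> ?f - 2 * ((cmod ?i)^2 / ?g) + (cmod ?i / ?g)^2 * ?g"
   using *[of "?i / of_real ?g"] unfolding r by (simp add: norm_divide norm_power)
  moreover have "x^2 \<le> F * G" if "G > 0" "0 \<le> F - 2 * (x^2 / G) + (x / G)^2 * G" for x F G :: real
  proof -
   have "(x / G)^2 * G = x^2 / G" using that(1) by (simp add: power2_eq_square)
   hence "x^2 / G \<le> F" using that(2) by linarith
   thus ?thesis using that(1) by (simp add: pos_divide_le_eq)
  qed
  ultimately have "(cmod ?i)^2 \<le> ?f * ?g" using gp by blast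
  hence "(cmod ?i)^2 \<le> (L2_norm q f * L2_norm q g)^2" by (simp add: power_mult_distrib)
  thus ?thesis by (rule power2_le_imp_le) simp
 qed
qed

lemma L2_norm_triangle:
 assumes f: "L2_form q f" and g: "L2_form q g"
 shows "L2_norm q (\<lambda>K x. f K x + g K x) \<le> L2_norm q f + L2_norm q g"
proof (rule power2_le_imp_le)
 have "of_real ((L2_norm q (\<lambda>K x. f K x + g K x))^2) = L2_inner q f f + L2_inner q f g + (L2_inner q g f + L2_inner q g g)"
  by (simp add: L2_inner_add_left L2_inner_add_right f g L2_form_add del: of_real_power flip: L2_inner_self)
 also have "\<dots> = of_real ((L2_norm q f)^2) + (L2_inner q f g + cnj (L2_inner q f g)) + of_real ((L2_norm q g)^2)"
  by (simp add: L2_inner_self L2_inner_cnj[of q g f])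
 finally have "(L2_norm q (\<lambda>K x. f K x + g K x))^2 = (L2_norm q f)^2 + 2 * Re (L2_inner q f g) + (L2_norm q g)^2"
  by (simp add: complex_eq_iff)
 also have "Re (L2_inner q f g) \<le> L2_norm q f * L2_norm q g"
  using L2_Cauchy_Schwarz[OF f g] complex_Re_le_cmod order_trans by blast
 finally show "(L2_norm q (\<lambda>K x. f K x + g K x))^2 \<le> (L2_norm q f + L2_norm q g)^2"
  by (simp add: power2_sum)
qed (simp)

lemma L2_norm_diff_bound:
 assumes f: "L2_form q f" and g: "L2_form q g"
 shows "\<bar>L2_norm q f - L2_norm q g\<bar> \<le> L2_norm q (\<lambda>K x. f K x - g K x)"
proof -
 have d: "L2_form q (\<lambda>K x. f K x - g K x)" "L2_form q (\<lambda>K x. (-1) * (f K x - g K x))"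
  using f g by (auto intro: L2_form_diff L2_form_cmult)
 have "L2_norm q f \<le> L2_norm q (\<lambda>K x. f K x - g K x) + L2_norm q g"
  using L2_norm_triangle[OF d(1) g] by simp
 moreover have "L2_norm q g \<le> L2_norm q (\<lambda>K x. f K x - g K x) + L2_norm q f"
  using L2_norm_triangle[OF d(2) f] L2_norm_cmult[of q "-1" "\<lambda>K x. f K x - g K x"] by simp
 ultimately show ?thesis by linarith
qed

section \<open>The Laplacian of a graph\<close>

text \<open>What the abstract arguments know about \<open>D\<close>. The pairing is additive on
  square integrable forms; elsewhere its integrals may take their default value 0.\<close>

definition L2_graph :: "('n::finite, 'x::euclidean_space) form_op => bool" where
 "L2_graph D \<longleftrightarrow> (\<forall>q f g. D q f g \<longrightarrow> L2_form q f \<and> L2_form (q + 1) g)"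

lemma L2_adjointD: "L2_adjoint D q g h ==> D q u w ==> L2_inner (q + 1) w g = L2_inner q u h"
 unfolding L2_adjoint_def by blast

lemma L2_adjoint_L2: "L2_adjoint D q g h ==> L2_form (q + 1) g \<and> L2_form q h"
 unfolding L2_adjoint_def by blast

text \<open>Names the witnesses hidden in \<open>laplacian\<close>: \<open>g\<close> is the image of
  \<open>f\<close>, \<open>h\<close> the adjoint applied to \<open>g\<close>, \<open>c\<close> the
  adjoint applied to \<open>f\<close>, and \<open>d\<close> the image of \<open>c\<close>.\<close>

definition laplacian_via ::
 "('n::finite, 'x::euclidean_space) form_op => nat => ('n, 'x) form => ('n, 'x) form =>
  ('n, 'x) form => ('n, 'x) form => ('n, 'x) form => ('n, 'x) form => bool" where
 "laplacian_via D q f w g h c d \<longleftrightarrow> D q f g \<and> L2_adjoint D q g h \<and>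
    (if q = 0 then d = (\<lambda>K x. 0) else L2_adjoint D (q - 1) f c \<and> D (q - 1) c d) \<and>
    (\<forall>K\<in>\<I> q. \<forall>x. w K x = h K x + d K x)"

lemma laplacian_viaD:
 assumes "laplacian_via D q f w g h c d"
 shows "D q f g" "L2_adjoint D q g h" "q \<noteq> 0 ==> L2_adjoint D (q - 1) f c" "q \<noteq> 0 ==> D (q - 1) c d"
  "q = 0 ==> d = (\<lambda>K x. 0)" "K \<in> \<I> q ==> w K x = h K x + d K x"
 using assms unfolding laplacian_via_def by (auto simp only: if_False if_True)

lemma laplacian_iff_via: "laplacian D q f w \<longleftrightarrow> (\<exists>g h c d. laplacian_via D q f w g h c d)"
 by (simp add: laplacian_def laplacian_via_def)

lemma laplacian_via_L2:
 assumes D: "L2_graph D" and v: "laplacian_via D q f w g h c d"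
 shows "L2_form q f" "L2_form (q + 1) g" "L2_form q h" "L2_form q d"
proof -
 show "L2_form q f" "L2_form (q + 1) g" "L2_form q h"
  using D v unfolding laplacian_via_def L2_graph_def L2_adjoint_def by blast+
 show "L2_form q d"
 proof (cases "q = 0")
  case True
  hence "d = (\<lambda>K x. 0)" using v by (simp only: laplacian_via_def if_True)
  thus ?thesis by (simp add: L2_form_zero)
 next
  case False
  hence "D (q - 1) c d" using v by (simp only: laplacian_via_def if_False)
  hence "L2_form (q - 1 + 1) d" using D unfolding L2_graph_def by blast
  thus ?thesis using False by simp
 qed
qed

lemma laplacian_via_L2_image:
 assumes D: "L2_graph D" and v: "laplacian_via D q f w g h c d"
 shows "L2_form q w"
proof -
 have "L2_form q (\<lambda>K x. h K x + d K x)"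
  using laplacian_via_L2[OF D v] by (intro L2_form_add)
 moreover have "w K = (\<lambda>x. h K x + d K x)" if "K \<in> \<I> q" for K
  using v that by (auto simp: laplacian_via_def)
 ultimately show ?thesis by (simp add: L2_form_def)
qed

lemma laplacian_L2:
 assumes "L2_graph D" "laplacian D q f w" shows "L2_form q f" "L2_form q w"
 using assms(2) laplacian_via_L2(1)[OF assms(1)] laplacian_via_L2_image[OF assms(1)] unfolding laplacian_iff_via by blast+

text \<open>In \<open>wu\<close>, which is \<open>h + d\<close>, the outer operator is moved to
  \<open>v\<close> by the definition of the adjoint. The right-hand side is the quadratic form of
  the Laplacian, from which symmetry and nonnegativity can be read off.\<close>

lemma laplacian_via_inner:
 assumes D: "L2_graph D" and u: "laplacian_via D q u wu g h c d" and v: "laplacian_via D q v wv g' h' c' d'"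
 shows "L2_inner q wu v = L2_inner (q + 1) g g' + (if q = 0 then 0 else L2_inner (q - 1) c c')"
proof -
 have "L2_inner q wu v = L2_inner q (\<lambda>K x. h K x + d K x) v"
  by (intro L2_inner_cong refl laplacian_viaD(6)[OF u])
 moreover have "L2_inner q (\<lambda>K x. h K x + d K x) v = L2_inner q h v + L2_inner q d v"
  by (rule L2_inner_add_left[OF laplacian_via_L2(3,4)[OF D u] laplacian_via_L2(1)[OF D v]])
 moreover have "L2_inner q h v = L2_inner (q + 1) g g'"
  using L2_adjointD[OF laplacian_viaD(2)[OF u], OF laplacian_viaD(1)[OF v]]
   L2_inner_cnj[of q h v] L2_inner_cnj[of "q + 1" g g'] by metis
 moreover have "L2_inner q d v = (if q = 0 then 0 else L2_inner (q - 1) c c')"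
 proof (cases "q = 0")
  case True
  hence "d = (\<lambda>K x. 0)" by (rule laplacian_viaD(5)[OF u])
  thus ?thesis using True by (simp add: L2_inner_def)
 next
  case False
  hence *: "q - 1 + 1 = q" by simp
  from L2_adjointD[OF laplacian_viaD(3)[OF v False], OF laplacian_viaD(4)[OF u False]]
  have "L2_inner q d v = L2_inner (q - 1) c c'" unfolding * .
  thus ?thesis using False by (simp only: if_False)
 qed
 ultimately show ?thesis by (simp only:)
qed

lemma laplacian_symmetric:
 assumes D: "L2_graph D" and u: "laplacian D q u wu" and v: "laplacian D q v wv"
 shows "L2_inner q wu v = L2_inner q u wv"
proof -
 obtain g h c d where U: "laplacian_via D q u wu g h c d"
  using u unfolding laplacian_iff_via by (elim exE)
 obtain g' h' c' d' where V: "laplacian_via D q v wv g' h' c' d'"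
  using v unfolding laplacian_iff_via by (elim exE)
 show ?thesis
  unfolding L2_inner_cnj[of q u wv] laplacian_via_inner[OF D U V] laplacian_via_inner[OF D V U]
  using L2_inner_cnj[of "q + 1" g g'] L2_inner_cnj[of "q - 1" c c'] by simp
qed

lemma laplacian_nonneg:
 assumes D: "L2_graph D" and u: "laplacian D q u w"
 shows "0 \<le> Re (L2_inner q w u)"
proof -
 obtain g h c d where "laplacian_via D q u w g h c d"
  using u unfolding laplacian_iff_via by (elim exE)
 from laplacian_via_inner[OF D this this] show ?thesis
  by (simp add: L2_inner_self flip: of_real_power)
qed

section \<open>Heat flows\<close>

lemma heat_flow_L2:
 assumes "L2_graph D" "heat_flow (laplacian D q) q f u" "s > 0"
 obtains w where "laplacian D q (u s) w" "L2_form q (u s)" "L2_form q w"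
  "((\<lambda>h. L2_norm q (\<lambda>K x. (u (s + h) K x - u s K x) / of_real h + w K x)) \<longlongrightarrow> 0) (at 0)"
 using assms laplacian_L2 unfolding heat_flow_def by blast

text \<open>\<open>L2_norm\<close> has a value also on forms that are not square integrable, so
  square integrability at \<open>s\<close> and near \<open>s\<close> is part of the
  definition.\<close>

definition has_L2_derivative ::
 "nat => (real => ('n::finite, 'x::euclidean_space) form) => ('n, 'x) form => real => bool" where
 "has_L2_derivative q V v s \<longleftrightarrow> L2_form q v \<and> (\<forall>\<^sub>F h in at 0. L2_form q (V (s + h))) \<and> L2_form q (V s) \<and>
   ((\<lambda>h. L2_norm q (\<lambda>K x. (V (s + h) K x - V s K x) / of_real h - v K x)) \<longlongrightarrow> 0) (at 0)"

lemma has_L2_derivative_continuous: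
 assumes "has_L2_derivative q V v s"
 shows "((\<lambda>h. L2_norm q (\<lambda>K x. V (s + h) K x - V s K x)) \<longlongrightarrow> 0) (at 0)"
proof -
 let ?d = "\<lambda>h K x. (V (s + h) K x - V s K x) / of_real h - v K x"
 note A = assms[unfolded has_L2_derivative_def]
 have ev: "\<forall>\<^sub>F h in at 0. norm (L2_norm q (\<lambda>K x. V (s + h) K x - V s K x)) \<le> \<bar>h\<bar> * (L2_norm q (?d h) + L2_norm q v)"
  using A[THEN conjunct2, THEN conjunct1] eventually_at_ball'[of 1 0 UNIV, simplified]
 proof eventually_elim
  case (elim h)
  have d: "L2_form q (?d h)"
   using A elim L2_form_cmult[OF L2_form_diff[of q "V (s + h)" "V s"], of "1 / of_real h"]
   by (intro L2_form_diff) (auto simp: divide_inverse mult.commute)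
  have "L2_norm q (\<lambda>K x. V (s + h) K x - V s K x) = L2_norm q (\<lambda>K x. of_real h * (?d h K x + v K x))"
   using elim by (intro L2_norm_cong) (simp add: field_simps)
  also have "\<dots> \<le> \<bar>h\<bar> * (L2_norm q (?d h) + L2_norm q v)"
   using L2_norm_triangle[OF d, of v] A by (subst L2_norm_cmult) (auto intro: mult_left_mono)
  finally show ?case by simp
 qed
 show ?thesis
 proof (rule tendsto_0_le[where K=1])
  show "((\<lambda>h. \<bar>h\<bar> * (L2_norm q (?d h) + L2_norm q v)) \<longlongrightarrow> 0) (at 0)"
   by (rule tendsto_eq_intros A[THEN conjunct2, THEN conjunct2, THEN conjunct2] tendsto_rabs_zero tendsto_ident_at refl | simp)+
  show "\<forall>\<^sub>F h in at 0. norm (L2_norm q (\<lambda>K x. V (s + h) K x - V s K x)) \<le> norm (\<bar>h\<bar> * (L2_norm q (?d h) + L2_norm q v)) * 1"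
   using ev by eventually_elim simp
 qed
qed

lemma L2_inner_has_derivative:
 assumes du: "has_L2_derivative q u w s" and dV: "has_L2_derivative q V v s"
 shows "((\<lambda>s. L2_inner q (u s) (V s)) has_vector_derivative (L2_inner q w (V s) + L2_inner q (u s) v)) (at s)"
proof -
 note U = du[unfolded has_L2_derivative_def] and VV = dV[unfolded has_L2_derivative_def]
 let ?du = "\<lambda>h K x. (u (s + h) K x - u s K x) / of_real h - w K x"
 let ?dV = "\<lambda>h K x. (V (s + h) K x - V s K x) / of_real h - v K x"
 let ?e = "\<lambda>h K x. V (s + h) K x - V s K x"
 let ?c = "\<lambda>s. L2_inner q (u s) (V s)" and ?d = "L2_inner q w (V s) + L2_inner q (u s) v"
 let ?B = "\<lambda>h. L2_norm q (?du h) * (L2_norm q (?e h) + L2_norm q (V s)) + L2_norm q w * L2_norm q (?e h) + L2_norm q (u s) * L2_norm q (?dV h)"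
 have "((\<lambda>h. (?c (s + h) - ?c s) /\<^sub>R h - ?d) \<longlongrightarrow> 0) (at 0)"
 proof (rule tendsto_0_le[where K=1])
  show "(?B \<longlongrightarrow> 0) (at 0)"
   by (rule tendsto_eq_intros U[THEN conjunct2, THEN conjunct2, THEN conjunct2] VV[THEN conjunct2, THEN conjunct2, THEN conjunct2]
      has_L2_derivative_continuous[OF dV] refl | simp)+
  show "\<forall>\<^sub>F h in at 0. norm ((?c (s + h) - ?c s) /\<^sub>R h - ?d) \<le> norm (?B h) * 1"
   using U[THEN conjunct2, THEN conjunct1] VV[THEN conjunct2, THEN conjunct1] eventually_at_ball'[of 1 0 UNIV, simplified]
  proof eventually_elim
   case (elim h)
   have q: "L2_form q (\<lambda>K x. (f K x - g K x) / of_real h)" if "L2_form q f" "L2_form q g" for f g :: "('a, 'b) form"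
    using L2_form_cmult[OF L2_form_diff[OF that], of "1 / of_real h"] by (simp add: divide_inverse mult.commute)
   have L: "L2_form q (?du h)" "L2_form q (?dV h)" "L2_form q (?e h)" "L2_form q (V (s + h))" "L2_form q (V s)" "L2_form q w" "L2_form q v" "L2_form q (u s)" "L2_form q (u (s + h))"
    using U VV elim by (auto intro!: L2_form_diff q)
   have h: "h \<noteq> 0" using elim by simp
   have 1: "L2_inner q (?du h) (V (s + h)) = (L2_inner q (u (s + h)) (V (s + h)) - L2_inner q (u s) (V (s + h))) / of_real h - L2_inner q w (V (s + h))"
    using L by (simp add: L2_inner_diff_left q L2_inner_cmult_left[where c="1 / of_real h", simplified])
   have 2: "L2_inner q (u s) (?dV h) = (L2_inner q (u s) (V (s + h)) - L2_inner q (u s) (V s)) / of_real h - L2_inner q (u s) v"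
    using L by (simp add: L2_inner_diff_right q L2_inner_cmult_right[where c="1 / of_real h", simplified])
   have 3: "L2_inner q w (?e h) = L2_inner q w (V (s + h)) - L2_inner q w (V s)"
    using L by (simp add: L2_inner_diff_right)
   \<comment> \<open>Telescoping: the error of the quotient of \<open>u\<close> against V(s + h),
     the change of \<open>V\<close> against \<open>w\<close>, and the error of the quotient of
     \<open>V\<close>. Cauchy-Schwarz bounds each of the three.\<close>
   have e: "(?c (s + h) - ?c s) /\<^sub>R h - ?d = L2_inner q (?du h) (V (s + h)) + L2_inner q w (?e h) + L2_inner q (u s) (?dV h)"
    unfolding 1 2 3 using h by (simp add: scaleR_conv_of_real field_simps)
   have n: "norm (L2_inner q (?du h) (V (s + h)) + L2_inner q w (?e h) + L2_inner q (u s) (?dV h)) \<le> L2_norm q (?du h) * L2_norm q (V (s + h)) + L2_norm q w * L2_norm q (?e h) + L2_norm q (u s) * L2_norm q (?dV h)"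
    using L by (intro norm_triangle_le add_mono L2_Cauchy_Schwarz)
   have n': "L2_norm q (?du h) * L2_norm q (V (s + h)) + L2_norm q w * L2_norm q (?e h) + L2_norm q (u s) * L2_norm q (?dV h) \<le> ?B h"
    using L2_norm_triangle[OF L(3,5)] by (intro add_mono mult_left_mono order_refl) auto
   have "norm ((?c (s + h) - ?c s) /\<^sub>R h - ?d) \<le> ?B h"
    unfolding e by (rule order_trans[OF n n'])
   thus ?case by simp
  qed
 qed
 hence lim: "((\<lambda>h. norm ((?c (s + h) - ?c s) /\<^sub>R h - ?d)) \<longlongrightarrow> 0) (at 0)"
  by (rule tendsto_norm_zero)
 have eq: "norm ((?c (s + h) - ?c s) /\<^sub>R h - ?d) = norm (?c (s + h) - ?c s - h *\<^sub>R ?d) / norm h" if "h \<noteq> 0" for h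
 proof -
  have "(?c (s + h) - ?c s) /\<^sub>R h - ?d = (?c (s + h) - ?c s - h *\<^sub>R ?d) /\<^sub>R h"
   using that by (simp add: scaleR_diff_right)
  thus ?thesis by (simp add: divide_inverse mult.commute)
 qed
 have "((\<lambda>h. norm (?c (s + h) - ?c s - h *\<^sub>R ?d) / norm h) \<longlongrightarrow> 0) (at 0)"
  by (rule Lim_transform_eventually[OF lim]) (auto simp: eventually_at_filter eq)
 thus ?thesis
  unfolding has_vector_derivative_def has_derivative_at
  by (simp only: bounded_linear_scaleR_left simp_thms)
qed

lemma heat_flow_has_L2_derivative:
 assumes "L2_graph D" "heat_flow (laplacian D q) q f u" "s > 0"
 obtains w where "laplacian D q (u s) w" "has_L2_derivative q u (\<lambda>K x. - w K x) s"
proof -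
 obtain w where w: "laplacian D q (u s) w" "L2_form q (u s)" "L2_form q w"
  "((\<lambda>h. L2_norm q (\<lambda>K x. (u (s + h) K x - u s K x) / of_real h + w K x)) \<longlongrightarrow> 0) (at 0)"
  using heat_flow_L2[OF assms] .
 have "\<forall>\<^sub>F h in at 0. s + h > 0"
 proof -
  have "((\<lambda>h. s + h) \<longlongrightarrow> s + 0) (at 0)" by (intro tendsto_intros)
  from order_tendstoD(1)[OF this, of 0] assms(3) show ?thesis by simp
 qed
 hence "\<forall>\<^sub>F h in at 0. L2_form q (u (s + h))"
  by eventually_elim (use heat_flow_L2[OF assms(1,2)] in blast)
 with w L2_form_cmult[OF w(3), of "-1"] have "has_L2_derivative q u (\<lambda>K x. - w K x) s"
  by (simp add: has_L2_derivative_def)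
 with w show thesis by (intro that)
qed

lemma heat_flow_L2_form:
 "L2_graph D ==> heat_flow (laplacian D q) q f u ==> s > 0 ==> L2_form q (u s)"
 using heat_flow_L2 by blast

text \<open>The squared norm has derivative -2 Re <A u, u> <= 0. \<open>heat_flow\<close> does not
  constrain the value \<open>u 0\<close>, so the norm of \<open>f\<close> enters as the limit of the
  norms of u(a) from the right.\<close>

lemma heat_flow_contractive:
 assumes D: "L2_graph D" and u: "heat_flow (laplacian D q) q f u" and f: "L2_form q f" and s: "s > 0"
 shows "L2_norm q (u s) \<le> L2_norm q f"
proof -
 have mono: "(L2_norm q (u b))^2 \<le> (L2_norm q (u a))^2" if "0 < a" "a \<le> b" for a b
 proof (rule DERIV_nonpos_imp_nonincreasing[OF that(2)])
  fix x assume "a \<le> x" "x \<le> b"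
  with that have "x > 0" by simp
  then obtain w where w: "laplacian D q (u x) w" "has_L2_derivative q u (\<lambda>K x. - w K x) x"
   using heat_flow_has_L2_derivative[OF D u] by blast
  let ?y = "L2_inner q (\<lambda>K x. - w K x) (u x) + L2_inner q (u x) (\<lambda>K x. - w K x)"
  have "((\<lambda>s. L2_inner q (u s) (u s)) has_vector_derivative ?y) (at x)"
   by (rule L2_inner_has_derivative[OF w(2) w(2)])
  from bounded_linear.has_vector_derivative[OF bounded_linear_Re this]
  have "((\<lambda>s. (L2_norm q (u s))^2) has_real_derivative Re ?y) (at x)"
   by (simp add: L2_inner_self has_real_derivative_iff_has_vector_derivative flip: of_real_power)
  moreover have "Re ?y \<le> 0"
   using laplacian_nonneg[OF D w(1)] L2_inner_cmult_left[of q "-1" w "u x"]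
   by (subst (2) L2_inner_cnj) simp
  ultimately show "\<exists>y. ((\<lambda>s. (L2_norm q (u s))^2) has_real_derivative y) (at x) \<and> y \<le> 0" by blast
 qed
 have lim: "((\<lambda>a. L2_norm q (\<lambda>K x. u a K x - f K x) + L2_norm q f) \<longlongrightarrow> 0 + L2_norm q f) (at_right 0)"
  using u unfolding heat_flow_def by (intro tendsto_intros) auto
 have "\<forall>\<^sub>F a in at_right 0. a < s \<and> 0 < a"
  using s by (auto simp: eventually_at_right_field)
 hence "\<forall>\<^sub>F a in at_right 0. L2_norm q (u s) \<le> L2_norm q (\<lambda>K x. u a K x - f K x) + L2_norm q f"
 proof eventually_elim
  case (elim a)
  have "L2_norm q (u s) \<le> L2_norm q (u a)"
   using mono[of a s] elim by (auto simp: power2_le_iff_abs_le)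
  also have "\<dots> \<le> L2_norm q (\<lambda>K x. u a K x - f K x) + L2_norm q f"
   using L2_norm_diff_bound[OF heat_flow_L2_form[OF D u, of a] f] elim by simp
  finally show ?case .
 qed
 from tendsto_lowerbound[OF lim this] show ?thesis by simp
qed

lemma has_L2_derivative_reflect:
 assumes "has_L2_derivative q V v (T - s)"
 shows "has_L2_derivative q (\<lambda>s. V (T - s)) (\<lambda>K x. - v K x) s"
proof -
 note A = assms[unfolded has_L2_derivative_def]
 have m: "filterlim (\<lambda>h. - h) (at 0) (at (0::real))"
  by (rule filterlim_atI) (auto intro!: tendsto_eq_intros simp: eventually_at_filter)
 have e: "\<forall>\<^sub>F h in at 0. L2_form q (V (T - (s + h)))"
  using eventually_compose_filterlim[OF A[THEN conjunct2, THEN conjunct1] m] by (simp add: algebra_simps)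
 have "((\<lambda>h. L2_norm q (\<lambda>K x. (V (T - s + - h) K x - V (T - s) K x) / of_real (- h) - v K x)) \<longlongrightarrow> 0) (at 0)"
  by (rule filterlim_compose[OF A[THEN conjunct2, THEN conjunct2, THEN conjunct2] m])
 moreover have "L2_norm q (\<lambda>K x. (V (T - s + - h) K x - V (T - s) K x) / of_real (- h) - v K x)
   = L2_norm q (\<lambda>K x. (V (T - (s + h)) K x - V (T - s) K x) / of_real h - - v K x)" for h
 proof -
  have t: "T - s + - h = T - (s + h)" by simp
  have "L2_norm q (\<lambda>K x. (V (T - (s + h)) K x - V (T - s) K x) / of_real h - - v K x)
   = L2_norm q (\<lambda>K x. (-1) * ((V (T - (s + h)) K x - V (T - s) K x) / of_real (- h) - v K x))"
   by (intro L2_norm_cong) simp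
  thus ?thesis unfolding t L2_norm_cmult by simp
 qed
 ultimately have "((\<lambda>h. L2_norm q (\<lambda>K x. (V (T - (s + h)) K x - V (T - s) K x) / of_real h - - v K x)) \<longlongrightarrow> 0) (at 0)"
  by (simp only:)
 moreover have "L2_form q (\<lambda>K x. - v K x)" using A L2_form_cmult[of q v "-1"] by simp
 ultimately show ?thesis unfolding has_L2_derivative_def using A e by (simp only: simp_thms)
qed

text \<open>With A the Laplacian, the derivative of <u(s), V(T - s)> is -<A u, V> - <u, V'>, by
  symmetry -<u, w + V'>. The pairing thus changes at a rate of at most the residual
  \<open>w + V'\<close> times the norm of \<open>u\<close>, and that norm is at most the one of
  \<open>f\<close> by contraction.\<close>

lemma heat_flow_pairing:
 assumes D: "L2_graph D" and u: "heat_flow (laplacian D q) q f u" and f: "L2_form q f" and T: "T > 0"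
  and V: "\<And>\<sigma>. 0 \<le> \<sigma> ==> \<sigma> \<le> T ==> has_L2_derivative q V (V' \<sigma>) \<sigma>"
  and A: "\<And>\<sigma>. 0 \<le> \<sigma> ==> \<sigma> \<le> T ==> laplacian D q (V \<sigma>) (w \<sigma>)"
  and B: "\<And>\<sigma>. 0 \<le> \<sigma> ==> \<sigma> \<le> T ==> L2_norm q (\<lambda>K x. w \<sigma> K x + V' \<sigma> K x) \<le> B"
 shows "cmod (L2_inner q (u T) (V 0) - L2_inner q f (V T)) \<le> T * (L2_norm q f * B)"
proof -
 let ?c = "\<lambda>s. L2_inner q (u s) (V (T - s))"
 have B0: "B \<ge> 0" using B[of 0] T L2_norm_nonneg order_trans by (metis less_eq_real_def)
 have dc: "\<exists>y. (?c has_vector_derivative y) (at s) \<and> norm y \<le> L2_norm q f * B" if s: "0 < s" "s \<le> T" for s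
 proof -
  have ts: "0 \<le> T - s" "T - s \<le> T" using s by auto
  obtain x where x: "laplacian D q (u s) x" "has_L2_derivative q u (\<lambda>K y. - x K y) s"
   using heat_flow_has_L2_derivative[OF D u s(1)] by blast
  note L = laplacian_L2[OF D x(1)] laplacian_L2[OF D A[OF ts]]
  have v: "L2_form q (V' (T - s))" using V[OF ts] by (simp add: has_L2_derivative_def)
  let ?y = "L2_inner q (\<lambda>K y. - x K y) (V (T - s)) + L2_inner q (u s) (\<lambda>K x. - V' (T - s) K x)"
  have "(?c has_vector_derivative ?y) (at s)"
   by (rule L2_inner_has_derivative[OF x(2) has_L2_derivative_reflect[OF V[OF ts]]])
  moreover have "?y = - L2_inner q (u s) (\<lambda>K x. w (T - s) K x + V' (T - s) K x)"
   using L2_inner_cmult_left[of q "-1" x "V (T - s)"] L2_inner_cmult_right[of q "u s" "-1" "V' (T - s)"]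
   by (simp add: laplacian_symmetric[OF D x(1) A[OF ts]] L2_inner_add_right L v)
  moreover have "norm (L2_inner q (u s) (\<lambda>K x. w (T - s) K x + V' (T - s) K x)) \<le> L2_norm q f * B"
   by (rule order_trans[OF L2_Cauchy_Schwarz])
    (auto intro!: L L2_form_add v mult_mono B ts heat_flow_contractive[OF D u f] s B0)
  ultimately show ?thesis by auto
 qed
 have d: "cmod (?c T - ?c r) \<le> T * (L2_norm q f * B)" if "0 < r" "r < T" for r
 proof -
  obtain c' where c': "\<And>s. 0 < s ==> s \<le> T ==> (?c has_vector_derivative c' s) (at s)" "\<And>s. 0 < s ==> s \<le> T ==> norm (c' s) \<le> L2_norm q f * B"
   using dc by metis
  have "norm (?c T - ?c r) \<le> L2_norm q f * B * norm (T - r)"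
  proof (rule differentiable_bound[where f'="\<lambda>s h. h *\<^sub>R c' s" and S="{r..T}"])
   show "onorm (\<lambda>h. h *\<^sub>R c' s) \<le> L2_norm q f * B" if "s \<in> {r..T}" for s
    using c'(2)[of s] that \<open>0 < r\<close>
    by (intro onorm_le) (simp add: mult.commute mult_left_mono)
   show "(?c has_derivative (\<lambda>h. h *\<^sub>R c' s)) (at s within {r..T})" if "s \<in> {r..T}" for s
    using c'(1)[of s] that \<open>0 < r\<close> by (auto simp: has_vector_derivative_def intro: has_derivative_at_withinI)
  qed (use that in auto)
  also have "\<dots> \<le> L2_norm q f * B * T"
   using that B0 by (intro mult_left_mono) auto
  finally show ?thesis by (simp add: mult.commute)
 qed
 have VT: "L2_form q (V T)" using V[of T] T by (simp add: has_L2_derivative_def)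
 \<comment> \<open>\<open>u\<close> is differentiable for s > 0 only; the value at s = 0 is
   recovered from the convergence of u(r) to \<open>f\<close> and the continuity of \<open>V\<close>
   at \<open>T\<close>.\<close>
 have "(?c \<longlongrightarrow> L2_inner q f (V T)) (at_right 0)"
 proof (rule LIM_zero_cancel, rule tendsto_0_le[where K=1])
  let ?e = "\<lambda>r. L2_norm q (\<lambda>K x. V (T - r) K x - V T K x)"
  let ?d = "\<lambda>r. L2_norm q (\<lambda>K x. u r K x - f K x)"
  have "has_L2_derivative q (\<lambda>s. V (T - s)) (\<lambda>K x. - V' T K x) 0"
   using V[of T] T by (intro has_L2_derivative_reflect) auto
  note A = this[unfolded has_L2_derivative_def]
  have e: "(?e \<longlongrightarrow> 0) (at_right 0)"
   using has_L2_derivative_continuous[OF \<open>has_L2_derivative q (\<lambda>s. V (T - s)) (\<lambda>K x. - V' T K x) 0\<close>]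
   by (simp add: filterlim_at_split)
  have dl: "(?d \<longlongrightarrow> 0) (at_right 0)" using u by (simp add: heat_flow_def)
  show "((\<lambda>r. ?d r * (?e r + L2_norm q (V T)) + L2_norm q f * ?e r) \<longlongrightarrow> 0) (at_right 0)"
   by (rule tendsto_eq_intros e dl refl | simp)+
  have "\<forall>\<^sub>F r in at_right 0. L2_form q (V (T - r))"
   using A by (simp add: eventually_at_split)
  thus "\<forall>\<^sub>F r in at_right 0. norm (?c r - L2_inner q f (V T)) \<le> norm (?d r * (?e r + L2_norm q (V T)) + L2_norm q f * ?e r) * 1"
   using eventually_at_right_less
  proof eventually_elim
   case (elim r)
   have L: "L2_form q (u r)" using elim heat_flow_L2_form[OF D u] by auto
   have e: "?c r - L2_inner q f (V T) = L2_inner q (\<lambda>K x. u r K x - f K x) (V (T - r)) + L2_inner q f (\<lambda>K x. V (T - r) K x - V T K x)"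
    using L f VT elim by (simp add: L2_inner_diff_left L2_inner_diff_right)
   have n: "norm (L2_inner q (\<lambda>K x. u r K x - f K x) (V (T - r)) + L2_inner q f (\<lambda>K x. V (T - r) K x - V T K x)) \<le> ?d r * L2_norm q (V (T - r)) + L2_norm q f * ?e r"
    using L f VT elim by (intro norm_triangle_le add_mono L2_Cauchy_Schwarz L2_form_diff) auto
   have n': "?d r * L2_norm q (V (T - r)) + L2_norm q f * ?e r \<le> ?d r * (?e r + L2_norm q (V T)) + L2_norm q f * ?e r"
    using L2_norm_triangle[OF L2_form_diff[of q "V (T - r)" "V T"] VT] elim VT
    by (intro add_mono mult_left_mono order_refl) auto
   have "norm (?c r - L2_inner q f (V T)) \<le> ?d r * (?e r + L2_norm q (V T)) + L2_norm q f * ?e r"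
    unfolding e by (rule order_trans[OF n n'])
   thus ?case by simp
  qed
 qed
 hence lim: "((\<lambda>r. cmod (?c T - ?c r)) \<longlongrightarrow> cmod (?c T - L2_inner q f (V T))) (at_right 0)"
  by (intro tendsto_intros)
 have "\<forall>\<^sub>F r in at_right 0. cmod (?c T - ?c r) \<le> T * (L2_norm q f * B)"
  using d T by (auto simp: eventually_at_right_field)
 from tendsto_upperbound[OF lim this] show ?thesis by simp
qed

section \<open>Functions of Gaussian decay\<close>

text \<open>\<open>H k\<close> is the k-th derivative; carrying the whole sequence makes the passage
  to the derivative a shift of the index.\<close>

definition bounded_smooth :: "(real => complex) => bool" where
 "bounded_smooth h \<longleftrightarrow> (\<exists>H. H 0 = h \<and> (\<forall>k x. (H k has_vector_derivative H (Suc k) x) (at x)) \<and>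
   (\<forall>k. bounded (range (H k))))"

lemma bounded_smooth_deriv:
 assumes "bounded_smooth h"
 shows "\<exists>h' B. bounded_smooth h' \<and> (\<forall>x. (h has_vector_derivative h' x) (at x)) \<and> (\<forall>x. cmod (h x) \<le> B) \<and> (B::real) > 0"
proof -
 obtain H where H: "H 0 = h" "\<And>k x. (H k has_vector_derivative H (Suc k) x) (at x)" "\<And>k. bounded (range (H k))"
  using assms unfolding bounded_smooth_def by blast
 obtain B where B: "B > 0" "\<And>x. cmod (H 0 x) \<le> B" using H(3)[of 0] unfolding bounded_pos by auto
 have "bounded_smooth (H (Suc 0))"
  unfolding bounded_smooth_def by (rule exI[of _ "\<lambda>k. H (Suc k)"]) (use H in auto)
 thus ?thesis using H(2)[of 0] B H(1) by (intro exI[of _ "H (Suc 0)"] exI[of _ B]) auto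
qed

lemma bounded_smooth_cnj: "bounded_smooth h ==> bounded_smooth (\<lambda>x. cnj (h x))"
proof -
 assume "bounded_smooth h"
 then obtain H where H: "H 0 = h" "\<And>k x. (H k has_vector_derivative H (Suc k) x) (at x)" "\<And>k. bounded (range (H k))"
  unfolding bounded_smooth_def by blast
 have "bounded (range (\<lambda>x. cnj (H k x)))" for k
  using H(3)[of k] unfolding bounded_iff by auto
 thus ?thesis
  unfolding bounded_smooth_def
  by (intro exI[of _ "\<lambda>k x. cnj (H k x)"]) (use H in \<open>auto intro: has_vector_derivative_cnj\<close>)
qed

text \<open>Functions of polynomial growth, generated in such a way that closure under directional
  derivatives is an induction; \<open>smooth\<close> and \<open>schwartz\<close> speak of all
  iterated derivatives. The clause \<open>comp\<close> is there for cutoffs, which are bump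
  functions of quadratic polynomials.\<close>

inductive tame :: "('x::euclidean_space => complex) => bool" where
 const: "tame (\<lambda>x. c)"
| linear: "bounded_linear f ==> tame f"
| add: "tame f ==> tame g ==> tame (\<lambda>x. f x + g x)"
| mult: "tame f ==> tame g ==> tame (\<lambda>x. f x * g x)"
| comp: "bounded_smooth h ==> tame (\<lambda>x. of_real (q x)) ==> tame (\<lambda>x. h (q x))"

lemma tame_cnj: "tame f ==> tame (\<lambda>x. cnj (f x))"
proof (induction rule: tame.induct)
 case (linear f)
 thus ?case by (intro tame.linear bounded_linear_compose[OF bounded_linear_cnj])
qed (auto intro: tame.intros bounded_smooth_cnj)

lemma tame_cmult: "tame f ==> tame (\<lambda>x. c * f x)"
 by (intro tame.mult tame.const)

lemma tame_minus: "tame f ==> tame (\<lambda>x. - f x)"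
 using tame_cmult[of f "-1"] by simp

lemma tame_diff: "tame f ==> tame g ==> tame (\<lambda>x. f x - g x)"
 using tame.add[of f "\<lambda>x. - g x", OF _ tame_minus[of g]] by simp

lemma tame_sum: "(\<And>i. i \<in> I ==> tame (f i)) ==> tame (\<lambda>x. \<Sum>i\<in>I. f i x)"
 by (induction I rule: infinite_finite_induct) (auto intro: tame.intros)

lemma tame_Re: "tame f ==> tame (\<lambda>x. of_real (Re (f x)))"
proof -
 assume f: "tame f"
 have "(\<lambda>x. of_real (Re (f x))) = (\<lambda>x. (1/2) * (f x + cnj (f x)))"
  by (auto simp: fun_eq_iff complex_eq_iff)
 thus ?thesis using f by (simp only: tame_cmult tame.add tame_cnj)
qed

lemma tame_linear_real: "bounded_linear f ==> tame (\<lambda>x. of_real (f x))"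
 by (intro tame.linear bounded_linear_compose[OF bounded_linear_of_real])

lemma tame_norm_sq: "tame (\<lambda>x::'x::euclidean_space. of_real ((norm x)^2))"
proof -
 have "(\<lambda>x::'x. complex_of_real ((norm x)^2)) = (\<lambda>x. \<Sum>b\<in>Basis. of_real (x \<bullet> b) * of_real (x \<bullet> b))"
 proof
  fix x :: 'x
  have "(norm x)^2 = (\<Sum>b\<in>Basis. (x \<bullet> b) * (x \<bullet> b))"
   unfolding power2_norm_eq_inner by (rule euclidean_inner)
  thus "complex_of_real ((norm x)^2) = (\<Sum>b\<in>Basis. of_real (x \<bullet> b) * of_real (x \<bullet> b))"
   by (simp only: of_real_mult of_real_sum)
 qed
 thus ?thesis
  by (simp only:) (intro tame_sum tame.mult tame_linear_real bounded_linear_inner_left)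
qed

lemma tame_deriv:
 "tame f ==> \<exists>f'. (\<forall>x. (f has_derivative f' x) (at x)) \<and> (\<forall>d. tame (\<lambda>x. f' x d))"
proof (induction rule: tame.induct)
 case (const c)
 show ?case by (intro exI[of _ "\<lambda>x d. 0"]) (auto intro: tame.const)
next
 case (linear f)
 thus ?case by (intro exI[of _ "\<lambda>x. f"]) (auto intro: tame.const bounded_linear_imp_has_derivative)
next
 case (add f g)
 then obtain f' g' where "\<forall>x. (f has_derivative f' x) (at x)" "\<forall>d. tame (\<lambda>x. f' x d)"
   "\<forall>x. (g has_derivative g' x) (at x)" "\<forall>d. tame (\<lambda>x. g' x d)" by blast
 thus ?case
  by (intro exI[of _ "\<lambda>x d. f' x d + g' x d"]) (auto intro: tame.add has_derivative_add)
next
 case (mult f g)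
 then obtain f' g' where "\<forall>x. (f has_derivative f' x) (at x)" "\<forall>d. tame (\<lambda>x. f' x d)"
   "\<forall>x. (g has_derivative g' x) (at x)" "\<forall>d. tame (\<lambda>x. g' x d)" by blast
 with mult show ?case
  by (intro exI[of _ "\<lambda>x d. f x * g' x d + f' x d * g x"]) (auto intro!: tame.add tame.mult has_derivative_mult)
next
 case (comp h q)
 then obtain F' where F: "\<And>x. ((\<lambda>x. complex_of_real (q x)) has_derivative F' x) (at x)" "\<And>d. tame (\<lambda>x. F' x d)" by blast
 obtain h' and B :: real where h': "bounded_smooth h'" "\<And>x. (h has_vector_derivative h' x) (at x)" "B > 0" "\<And>x. cmod (h x) \<le> B"
  using bounded_smooth_deriv[OF comp(1)] by (elim exE conjE) (blast)
 \<comment> \<open>The induction hypothesis treats \<open>q\<close> as a complex function; the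
   derivative of the real function is the real part.\<close>
 have q: "(q has_derivative (\<lambda>d. Re (F' x d))) (at x)" for x
  using has_derivative_compose[OF F(1)[of x] bounded_linear_imp_has_derivative[OF bounded_linear_Re]] by simp
 have "((\<lambda>x. h (q x)) has_derivative (\<lambda>d. Re (F' x d) *\<^sub>R h' (q x))) (at x)" for x
  using has_derivative_compose[OF q[of x] h'(2)[of "q x", unfolded has_vector_derivative_def]] .
 thus ?case
  by (intro exI[of _ "\<lambda>x d. of_real (Re (F' x d)) * h' (q x)"])
   (auto simp: scaleR_conv_of_real intro!: tame.mult tame_Re F(2) tame.comp[OF h'(1) comp(2)])
qed

lemma tame_growth:
 "tame f ==> \<exists>C N. C \<ge> 0 \<and> (\<forall>x. cmod (f x) \<le> C * (1 + norm x) ^ N)"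
proof (induction rule: tame.induct)
 case (const c)
 show ?case by (intro exI[of _ "cmod c"] exI[of _ 0]) auto
next
 case (linear f)
 then obtain K where K: "K > 0" "\<And>x. cmod (f x) \<le> norm x * K" using bounded_linear.pos_bounded by blast
 show ?case
  by (intro exI[of _ K] exI[of _ 1]) (use K in \<open>auto simp: algebra_simps intro: order_trans[OF K(2)]\<close>)
next
 case (add f g)
 then obtain C N C' N' where *: "C \<ge> 0" "\<And>x. cmod (f x) \<le> C * (1 + norm x) ^ N" "C' \<ge> 0" "\<And>x. cmod (g x) \<le> C' * (1 + norm x) ^ N'" by metis
 show ?case
 proof (intro exI[of _ "C + C'"] exI[of _ "N + N'"] conjI allI)
  fix x
  have "cmod (f x) \<le> C * (1 + norm x) ^ (N + N')" "cmod (g x) \<le> C' * (1 + norm x) ^ (N + N')"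
   using * by (auto intro!: order_trans[OF *(2)] order_trans[OF *(4)] mult_left_mono power_increasing)
  thus "cmod (f x + g x) \<le> (C + C') * (1 + norm x) ^ (N + N')"
   by (intro norm_triangle_le) (simp add: distrib_right)
 qed (use * in auto)
next
 case (mult f g)
 then obtain C N C' N' where *: "C \<ge> 0" "\<And>x. cmod (f x) \<le> C * (1 + norm x) ^ N" "C' \<ge> 0" "\<And>x. cmod (g x) \<le> C' * (1 + norm x) ^ N'" by metis
 show ?case
 proof (intro exI[of _ "C * C'"] exI[of _ "N + N'"] conjI allI)
  fix x
  have "cmod (f x * g x) \<le> (C * (1 + norm x) ^ N) * (C' * (1 + norm x) ^ N')"
   unfolding norm_mult using * by (intro mult_mono) auto
  thus "cmod (f x * g x) \<le> C * C' * (1 + norm x) ^ (N + N')"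
   by (simp add: power_add mult_ac)
 qed (use * in auto)
next
 case (comp h q)
 obtain h' and B :: real where "bounded_smooth h'" "\<And>x. (h has_vector_derivative h' x) (at x)" "B > 0" "\<And>x. cmod (h x) \<le> B"
  using bounded_smooth_deriv[OF comp(1)] by (elim exE conjE) (blast)
 thus ?case by (intro exI[of _ B] exI[of _ 0]) auto
qed

text \<open>With \<open>decay\<close> these are Schwartz functions with Gaussian bounds, the class
  of kernels and packets. Without it the exponent is arbitrary, so that the weights exp(form) and
  exp(-form) are covered too.\<close>

inductive tame_exp :: "bool => ('x::euclidean_space => complex) => bool" for decay where
 base: "tame T ==> tame Q ==> (decay ==> \<exists>C c. c > 0 \<and> (\<forall>x. Re (Q x) \<le> C - c * (norm x)^2)) ==>
  tame_exp decay (\<lambda>x. T x * exp (Q x))"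
| add: "tame_exp decay f ==> tame_exp decay g ==> tame_exp decay (\<lambda>x. f x + g x)"

abbreviation "gs \<equiv> tame_exp True"

lemma tame_exp_False: "tame_exp d f ==> tame_exp False f"
 by (induction rule: tame_exp.induct) (auto intro: tame_exp.intros)

lemma tame_exp_mult: "tame_exp d f ==> tame t ==> tame_exp d (\<lambda>x. t x * f x)"
proof (induction rule: tame_exp.induct)
 case (base T Q)
 have "tame_exp d (\<lambda>x. (t x * T x) * exp (Q x))" using base by (intro tame_exp.base tame.mult) auto
 thus ?case by (simp add: mult.assoc)
next
 case (add f g)
 thus ?case using tame_exp.add[of d "\<lambda>x. t x * f x" "\<lambda>x. t x * g x"] by (simp add: distrib_left)
qed

text \<open>The factor may grow, so only the class without decay is stable. The intended factor is
  the weight, applied to compactly supported functions.\<close>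

lemma tame_exp_exp_mult: "tame_exp False f ==> tame R ==> tame_exp False (\<lambda>x. exp (R x) * f x)"
proof (induction rule: tame_exp.induct)
 case (base T Q)
 have "tame_exp False (\<lambda>x. T x * exp (R x + Q x))" using base by (intro tame_exp.base tame.add) auto
 thus ?case by (simp add: exp_add mult_ac)
next
 case (add f g)
 thus ?case using tame_exp.add[of False "\<lambda>x. exp (R x) * f x" "\<lambda>x. exp (R x) * g x"] by (simp add: distrib_left)
qed

lemma tame_exp_cnj: "tame_exp d f ==> tame_exp d (\<lambda>x. cnj (f x))"
proof (induction rule: tame_exp.induct)
 case (base T Q)
 have "tame_exp d (\<lambda>x. cnj (T x) * exp (cnj (Q x)))"
  using base by (intro tame_exp.base tame_cnj) auto
 thus ?case by (simp add: exp_cnj)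
next
 case (add f g)
 thus ?case using tame_exp.add[of d "\<lambda>x. cnj (f x)" "\<lambda>x. cnj (g x)"] by simp
qed

lemma tame_exp_zero: "tame_exp d (\<lambda>x::'x::euclidean_space. 0)"
proof -
 have "tame_exp d (\<lambda>x::'x. 0 * exp (- of_real ((norm x)^2)))"
  by (intro tame_exp.base tame.const tame_minus tame_norm_sq) (auto intro!: exI[of _ 0] exI[of _ 1])
 thus ?thesis by simp
qed

lemma tame_exp_sum: "(\<And>i. i \<in> I ==> tame_exp d (f i)) ==> tame_exp d (\<lambda>x. \<Sum>i\<in>I. f i x)"
 by (induction I rule: infinite_finite_induct) (auto intro: tame_exp.add tame_exp_zero)

lemma tame_exp_cmult: "tame_exp d f ==> tame_exp d (\<lambda>x. c * f x)"
 by (rule tame_exp_mult[OF _ tame.const])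

lemma tame_exp_minus: "tame_exp d f ==> tame_exp d (\<lambda>x. - f x)"
 using tame_exp_cmult[of d f "-1"] by simp

lemma tame_exp_deriv:
 "tame_exp d f ==> \<exists>f'. (\<forall>x. (f has_derivative f' x) (at x)) \<and> (\<forall>v. tame_exp d (\<lambda>x. f' x v))"
proof (induction rule: tame_exp.induct)
 case (base T Q)
 obtain T' where T: "\<And>x. (T has_derivative T' x) (at x)" "\<And>v. tame (\<lambda>x. T' x v)" using tame_deriv[OF base(1)] by blast
 obtain Q' where Q: "\<And>x. (Q has_derivative Q' x) (at x)" "\<And>v. tame (\<lambda>x. Q' x v)" using tame_deriv[OF base(2)] by blast
 have e: "((\<lambda>x. exp (Q x)) has_derivative (\<lambda>v. exp (Q x) * Q' x v)) (at x)" for x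
  using has_derivative_compose[OF Q(1)[of x] DERIV_exp[of "Q x", unfolded has_field_derivative_def]] .
 have "((\<lambda>x. T x * exp (Q x)) has_derivative (\<lambda>v. (T x * Q' x v + T' x v) * exp (Q x))) (at x)" for x
  using has_derivative_mult[OF T(1)[of x] e[of x]] by (simp add: algebra_simps)
 moreover have "tame_exp d (\<lambda>x. (T x * Q' x v + T' x v) * exp (Q x))" for v
  using base T Q by (intro tame_exp.base tame.add tame.mult) auto
 ultimately show ?case by (intro exI[of _ "\<lambda>x v. (T x * Q' x v + T' x v) * exp (Q x)"]) auto
next
 case (add f g)
 then obtain f' g' where "\<forall>x. (f has_derivative f' x) (at x)" "\<forall>v. tame_exp d (\<lambda>x. f' x v)"
   "\<forall>x. (g has_derivative g' x) (at x)" "\<forall>v. tame_exp d (\<lambda>x. g' x v)" by blast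
 thus ?case
  by (intro exI[of _ "\<lambda>x v. f' x v + g' x v"]) (auto intro: tame_exp.add has_derivative_add)
qed

lemma tame_exp_differentiable: "tame_exp d f ==> f differentiable (at x)"
 using tame_exp_deriv unfolding differentiable_def by blast

lemma tame_exp_frechet: "tame_exp d f ==> tame_exp d (\<lambda>x. fder f x v)"
proof -
 assume "tame_exp d f"
 then obtain f' where f': "\<And>x. (f has_derivative f' x) (at x)" "\<And>v. tame_exp d (\<lambda>x. f' x v)"
  using tame_exp_deriv by blast
 hence "fder f x = f' x" for x
  by (metis frechet_derivative_at)
 thus ?thesis using f'(2) by simp
qed

lemma tame_exp_continuous: "tame_exp d f ==> continuous_on UNIV f"
 by (simp add: continuous_on_eq_continuous_within differentiable_imp_continuous_within tame_exp_differentiable)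

lemma tame_exp_measurable: "tame_exp d f ==> f \<in> borel_funs"
 using tame_exp_continuous borel_measurable_continuous_onI by blast

lemma tame_exp_dirderivs: "tame_exp d f ==> tame_exp d (dirderivs ds f)"
 by (induction ds) (auto intro: tame_exp_frechet)

lemma tame_exp_smooth: "tame_exp d f ==> smooth f"
 unfolding smooth_def using tame_exp_dirderivs tame_exp_differentiable by blast

section \<open>Pointwise Gaussian bounds\<close>

definition gauss_bounded :: "('x::euclidean_space => complex) => bool" where
 "gauss_bounded f \<longleftrightarrow> (\<exists>C c. C \<ge> 0 \<and> c > 0 \<and> (\<forall>x. cmod (f x) \<le> C * gauss c x))"

text \<open>Induction along Horner's scheme: half of the exponent pays for the factor y, because y
  exp(-c y / 2) <= 2 / c, and the other half goes to the induction hypothesis.\<close>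

lemma poly_exp_bounded:
 fixes p :: "real poly" assumes "c > 0"
 shows "\<exists>B. \<forall>y\<ge>0. \<bar>poly p y\<bar> * exp (- (c * y)) \<le> B"
 using assms
proof (induction p arbitrary: c)
 case 0
 show ?case by (intro exI[of _ 0]) auto
next
 case (pCons a p)
 obtain B where B: "\<And>y. y \<ge> 0 ==> \<bar>poly p y\<bar> * exp (- (c / 2 * y)) \<le> B"
  using pCons(2)[of "c / 2"] pCons(3) by auto
 have B0: "B \<ge> 0" using B[of 0] by (auto intro: order_trans[rotated])
 show ?case
 proof (intro exI[of _ "\<bar>a\<bar> + 2 / c * B"] allI impI)
  fix y :: real assume y: "y \<ge> 0"
  have "c / 2 * y \<le> exp (c / 2 * y)" using exp_ge_add_one_self[of "c / 2 * y"] by linarith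
  hence ye: "y * exp (- (c / 2 * y)) \<le> 2 / c"
   using pCons(3) by (simp add: exp_minus field_simps)
  have "\<bar>poly (pCons a p) y\<bar> * exp (- (c * y)) \<le> (\<bar>a\<bar> + y * \<bar>poly p y\<bar>) * exp (- (c * y))"
   using y by (intro mult_right_mono) (auto intro!: order_trans[OF abs_triangle_ineq] simp: abs_mult)
  also have "\<dots> = \<bar>a\<bar> * exp (- (c * y)) + (y * exp (- (c / 2 * y))) * (\<bar>poly p y\<bar> * exp (- (c / 2 * y)))"
   by (simp add: algebra_simps flip: exp_add)
  also have "\<dots> \<le> \<bar>a\<bar> * 1 + 2 / c * B"
   using y pCons(3) B[OF y] ye B0 by (intro add_mono mult_mono) auto
  finally show "\<bar>poly (pCons a p) y\<bar> * exp (- (c * y)) \<le> \<bar>a\<bar> + 2 / c * B" by simp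
 qed
qed

text \<open>Since c (r - 1)^2 >= 0, the Gaussian is at most exp(c) exp(-2 c r), which reduces the
  claim to a linear exponent.\<close>

lemma poly_gauss_bound:
 fixes c :: real assumes "c > 0"
 shows "\<exists>B\<ge>0. \<forall>r\<ge>0. (1 + r) ^ N * exp (- (c * r^2)) \<le> B"
proof -
 obtain B where B: "\<And>y. y \<ge> 0 ==> \<bar>poly ([:1, 1:] ^ N) y\<bar> * exp (- ((2 * c) * y)) \<le> B"
  using poly_exp_bounded[of "2 * c" "[:1, 1:] ^ N"] assms by auto
 have B0: "B \<ge> 0" using B[of 0] by (auto intro: order_trans[rotated])
 have "(1 + r) ^ N * exp (- (c * r^2)) \<le> exp c * B" if r: "r \<ge> 0" for r
 proof -
  have "0 \<le> c * (r - 1)^2" using assms by simp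
  hence "exp (- (c * r^2)) \<le> exp (c + - ((2 * c) * r))"
   by (simp add: power2_eq_square algebra_simps)
  hence "(1 + r) ^ N * exp (- (c * r^2)) \<le> (1 + r) ^ N * (exp c * exp (- ((2 * c) * r)))"
   using r unfolding exp_add by (intro mult_left_mono) auto
  also have "\<dots> = exp c * (\<bar>poly ([:1, 1:] ^ N) r\<bar> * exp (- ((2 * c) * r)))"
   using r by (simp add: poly_power)
  also have "\<dots> \<le> exp c * B" using B[OF r] by (intro mult_left_mono) auto
  finally show ?thesis .
 qed
 thus ?thesis using B0 by (intro exI[of _ "exp c * B"]) auto
qed

text \<open>Polynomial growth costs half of the Gaussian exponent. The same halving recurs in all
  later estimates.\<close>

lemma gauss_bounded_growth:
 assumes f: "gauss_bounded f" and t: "\<And>x. cmod (t x) \<le> D * (1 + norm x) ^ N"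
 shows "gauss_bounded (\<lambda>x. t x * f x)"
proof -
 obtain C c where C: "C \<ge> 0" "c > 0" "\<And>x. cmod (f x) \<le> C * gauss c x"
  using f unfolding gauss_bounded_def by blast
 obtain B where B: "B \<ge> 0" "\<And>r. r \<ge> 0 ==> (1 + r) ^ N * exp (- (c / 2 * r^2)) \<le> B"
  using poly_gauss_bound[of "c / 2" N] C(2) by auto
 have D: "D \<ge> 0" using t[of 0] by (simp add: order_trans[OF norm_ge_zero])
 have "cmod (t x * f x) \<le> (D * B * C) * gauss (c / 2) x" for x
 proof -
  have e: "gauss c x = gauss (c / 2) x * gauss (c / 2) x"
   by (simp flip: exp_add)
  have "cmod (t x * f x) \<le> (D * (1 + norm x) ^ N) * (C * gauss c x)"
   unfolding norm_mult using t C D by (intro mult_mono) auto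
  also have "\<dots> = (D * C * gauss (c / 2) x) * ((1 + norm x) ^ N * gauss (c / 2) x)"
   unfolding e by (simp add: mult_ac)
  also have "\<dots> \<le> (D * C * gauss (c / 2) x) * B"
   using B(2)[of "norm x"] C D by (intro mult_left_mono) auto
  finally show ?thesis by (simp add: mult_ac)
 qed
 thus ?thesis unfolding gauss_bounded_def using B C D
  by (intro exI[of _ "D * B * C"] exI[of _ "c / 2"]) auto
qed

lemma gauss_bounded_tame: "gauss_bounded f ==> tame t ==> gauss_bounded (\<lambda>x. t x * f x)"
 using tame_growth gauss_bounded_growth by metis

lemma gauss_bounded_add:
 assumes "gauss_bounded f" "gauss_bounded g" shows "gauss_bounded (\<lambda>x. f x + g x)"
proof -
 obtain C c where C: "C \<ge> 0" "c > 0" "\<And>x. cmod (f x) \<le> C * gauss c x"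
  using assms(1) unfolding gauss_bounded_def by blast
 obtain D d where D: "D \<ge> 0" "d > 0" "\<And>x. cmod (g x) \<le> D * gauss d x"
  using assms(2) unfolding gauss_bounded_def by blast
 have "cmod (f x + g x) \<le> (C + D) * gauss (min c d) x" for x
 proof -
  have "cmod (f x) \<le> C * gauss (min c d) x"
   using C(1) by (intro order_trans[OF C(3)]) (auto intro!: mult_left_mono mult_right_mono)
  moreover have "cmod (g x) \<le> D * gauss (min c d) x"
   using D(1) by (intro order_trans[OF D(3)]) (auto intro!: mult_left_mono mult_right_mono)
  ultimately show ?thesis by (intro norm_triangle_le) (simp add: distrib_right)
 qed
 thus ?thesis unfolding gauss_bounded_def using C D
  by (intro exI[of _ "C + D"] exI[of _ "min c d"]) auto
qed

lemma gs_gauss_bounded: "gs f ==> gauss_bounded f"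
proof (induction rule: tame_exp.induct)
 case (base T Q)
 obtain C c where C: "c > 0" "\<And>x. Re (Q x) \<le> C - c * (norm x)^2" using base(3) by auto
 have "cmod (exp (Q x)) \<le> exp C * gauss c x" for x
  using C(2)[of x] by (simp flip: exp_add)
 hence "gauss_bounded (\<lambda>x. exp (Q x))"
  unfolding gauss_bounded_def using C(1) by (intro exI[of _ "exp C"] exI[of _ c]) auto
 thus ?case using base(1) by (rule gauss_bounded_tame)
qed (rule gauss_bounded_add)

lemma gauss_bounded_L2:
 assumes "gauss_bounded f" "f \<in> borel_funs" shows "L2_fun f"
proof -
 obtain C c where C: "C \<ge> 0" "c > 0" "\<And>x. cmod (f x) \<le> C * gauss c x"
  using assms(1) unfolding gauss_bounded_def by blast
 show ?thesis
 proof (rule L2_fun_bound[OF _ assms(2)])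
  show "integrable lborel (\<lambda>x::'a. C^2 * gauss (2 * c) x)"
   using C(2) by (intro integrable_mult_right gauss_integrable) simp
  fix x
  have "(cmod (f x))^2 \<le> (C * gauss c x)^2" using C by (intro power_mono) auto
  thus "(cmod (f x))^2 \<le> C^2 * gauss (2 * c) x"
   by (simp add: power_mult_distrib exp_of_nat_mult[of 2, symmetric] mult_ac)
 qed
qed

lemma gauss_bounded_integrable:
 assumes "gauss_bounded f" "f \<in> borel_funs" shows "integrable lborel f"
proof -
 obtain C c where C: "C \<ge> 0" "c > 0" "\<And>x. cmod (f x) \<le> C * gauss c x"
  using assms(1) unfolding gauss_bounded_def by blast
 show ?thesis
  by (rule B_integrable_bound[of _ "\<lambda>x. C * gauss c x"])
   (use C assms(2) in \<open>auto\<close>)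
qed

lemma gs_L2: "gs f ==> L2_fun f"
 by (intro gauss_bounded_L2 gs_gauss_bounded tame_exp_measurable)

lemma gs_schwartz:
 assumes "gs f" shows "schwartz f"
proof -
 have "bounded (range (\<lambda>x. (1 + norm x) ^ N * cmod (dirderivs ds f x)))" for ds N
 proof -
  have "gauss_bounded (\<lambda>x. of_real ((1 + norm x) ^ N) * dirderivs ds f x)"
   using gs_gauss_bounded[OF tame_exp_dirderivs[OF assms]]
   by (rule gauss_bounded_growth[where D=1 and N=N]) (simp add: norm_power del: of_real_add of_real_power)
  then obtain C c where C: "C \<ge> 0" "c > 0" "\<And>x. cmod (of_real ((1 + norm x) ^ N) * dirderivs ds f x) \<le> C * gauss c x"
   unfolding gauss_bounded_def by blast
  have "norm ((1 + norm x) ^ N * cmod (dirderivs ds f x)) \<le> C" for x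
  proof -
   have "C * gauss c x \<le> C * 1" using C by (intro mult_left_mono) auto
   moreover have "norm ((1 + norm x) ^ N * cmod (dirderivs ds f x)) = cmod (of_real ((1 + norm x) ^ N) * dirderivs ds f x)"
    by (simp add: norm_mult norm_power abs_mult del: of_real_add of_real_power)
   ultimately show ?thesis using C(3)[of x] by simp
  qed
  thus ?thesis unfolding bounded_iff by blast
 qed
 thus ?thesis using tame_exp_smooth[OF assms] by (simp add: schwartz_def)
qed

section \<open>A bump function\<close>

text \<open>The derivative of p(1/u) exp(-1/u) is u^-2 (p - p')(1/u) exp(-1/u). This recursion
  produces the polynomials in the derivatives of exp(-1/u).\<close>

fun bump_poly :: "nat => real poly" where
 "bump_poly 0 = 1"
| "bump_poly (Suc k) = [:0, 0, 1:] * (bump_poly k - pderiv (bump_poly k))"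

definition bump_deriv :: "nat => real => real" where
 "bump_deriv k u = (if u > 0 then poly (bump_poly k) (1 / u) * exp (- (1 / u)) else 0)"

abbreviation "bump \<equiv> bump_deriv 0"

lemma bump_deriv_bounded: "\<exists>B. \<forall>u. \<bar>bump_deriv k u\<bar> \<le> B"
proof -
 obtain B where B: "\<And>y. y \<ge> 0 ==> \<bar>poly (bump_poly k) y\<bar> * exp (- (1 * y)) \<le> B"
  using poly_exp_bounded[of 1] by auto
 have "0 \<le> B" using B[of 0] by (auto intro: order_trans[rotated])
 hence "\<bar>bump_deriv k u\<bar> \<le> B" for u
  using B[of "1 / u"] by (simp add: bump_deriv_def abs_mult)
 thus ?thesis by blast
qed

lemma bump_deriv_has_derivative:
 "(bump_deriv k has_real_derivative bump_deriv (Suc k) u) (at u)"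
proof -
 consider "u > 0" | "u < 0" | "u = 0" by linarith
 thus ?thesis
 proof cases
  case 1
  have "((\<lambda>u. poly (bump_poly k) (1 / u) * exp (- (1 / u))) has_real_derivative
    (poly (pderiv (bump_poly k)) (1 / u) * (- 1 / u^2)) * exp (- (1 / u)) + (exp (- (1 / u)) * (1 / u^2)) * poly (bump_poly k) (1 / u)) (at u)"
   using 1 by (auto intro!: derivative_eq_intros poly_DERIV[THEN DERIV_chain2] simp: power2_eq_square)
  moreover have "(poly (pderiv (bump_poly k)) (1 / u) * (- 1 / u^2)) * exp (- (1 / u)) + (exp (- (1 / u)) * (1 / u^2)) * poly (bump_poly k) (1 / u) = bump_deriv (Suc k) u"
   using 1 by (simp add: bump_deriv_def power2_eq_square field_simps)
  ultimately have "((\<lambda>u. poly (bump_poly k) (1 / u) * exp (- (1 / u))) has_real_derivative bump_deriv (Suc k) u) (at u)"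
   by simp
  thus ?thesis
   by (rule has_field_derivative_transform_within_open[where S="{0<..}"]) (use 1 in \<open>auto simp: bump_deriv_def\<close>)
 next
  case 2
  have "((\<lambda>u. 0) has_real_derivative 0) (at u)" by simp
  hence "(bump_deriv k has_real_derivative 0) (at u)"
   by (rule has_field_derivative_transform_within_open[where S="{..<0}"]) (use 2 in \<open>auto simp: bump_deriv_def\<close>)
  thus ?thesis using 2 by (simp add: bump_deriv_def)
 next
  case 3
  \<comment> \<open>The two additional powers of 1/u give |bump_deriv k h| <= B h^2, so the
    difference quotient at 0 tends to 0.\<close>
  obtain B where B: "\<And>y. y \<ge> 0 ==> \<bar>poly ([:0, 0, 1:] * bump_poly k) y\<bar> * exp (- (1 * y)) \<le> B"
   using poly_exp_bounded[of 1 "[:0, 0, 1:] * bump_poly k"] by auto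
  have B0: "0 \<le> B" using B[of 0] by (auto intro: order_trans[rotated])
  have b: "\<bar>bump_deriv k h\<bar> \<le> B * h^2" for h
  proof (cases "h > 0")
   case True
   hence "\<bar>poly (bump_poly k) (1 / h)\<bar> * exp (- (1 / h)) / h^2 \<le> B"
    using B[of "1 / h"] by (simp add: abs_mult power2_eq_square field_simps)
   thus ?thesis using True by (simp add: bump_deriv_def abs_mult divide_le_eq)
  qed (use B0 in \<open>simp add: bump_deriv_def\<close>)
  have "((\<lambda>h. (bump_deriv k (0 + h) - bump_deriv k 0) / h) \<longlongrightarrow> 0) (at 0)"
  proof (rule tendsto_0_le[where K=B])
   show "((\<lambda>h::real. h) \<longlongrightarrow> 0) (at 0)" by (rule tendsto_ident_at)
   have "norm ((bump_deriv k (0 + h) - bump_deriv k 0) / h) \<le> norm h * B" if "h \<noteq> 0" for h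
   proof -
    have "\<bar>bump_deriv k h\<bar> / \<bar>h\<bar> \<le> B * h^2 / \<bar>h\<bar>" using b by (intro divide_right_mono) auto
    also have "B * h^2 / \<bar>h\<bar> = \<bar>h\<bar> * B"
     using that by (simp add: field_simps power2_eq_square abs_mult_self_eq flip: abs_mult)
    finally show ?thesis by (simp add: bump_deriv_def[of _ 0])
   qed
   thus "\<forall>\<^sub>F h in at 0. norm ((bump_deriv k (0 + h) - bump_deriv k 0) / h) \<le> norm h * B"
    by (auto simp: eventually_at_filter)
  qed
  thus ?thesis using 3 by (simp add: DERIV_def bump_deriv_def[of "Suc k" 0])
 qed
qed

lemma bounded_smooth_bump: "bounded_smooth (\<lambda>u. of_real (bump u))"
 unfolding bounded_smooth_def
proof (intro exI[of _ "\<lambda>k u. of_real (bump_deriv k u)"] conjI allI refl)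
 fix k u
 show "((\<lambda>u. complex_of_real (bump_deriv k u)) has_vector_derivative of_real (bump_deriv (Suc k) u)) (at u)"
  using bounded_linear.has_vector_derivative[OF bounded_linear_of_real bump_deriv_has_derivative[unfolded has_real_derivative_iff_has_vector_derivative]] .
 show "bounded (range (\<lambda>u. complex_of_real (bump_deriv k u)))"
  using bump_deriv_bounded[of k] unfolding bounded_iff by auto
qed

section \<open>Integration by parts\<close>

text \<open>The widest class of test functions in use: it contains the Gaussian functions
  \<open>gs\<close> and also the compactly supported C^1 functions, and it admits integration by
  parts.\<close>

definition nice :: "('x::euclidean_space => complex) => bool" where
 "nice f \<longleftrightarrow> (\<forall>x. f differentiable (at x)) \<and> gauss_bounded f \<and>
   (\<forall>d. continuous_on UNIV (\<lambda>x. fder f x d) \<and> gauss_bounded (\<lambda>x. fder f x d))"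

text \<open>An arbitrary test function times a weight is needed only to first order; this class
  makes it unnecessary to iterate the product rule.\<close>

definition C1c :: "('x::euclidean_space => complex) => bool" where
 "C1c f \<longleftrightarrow> (\<forall>x. f differentiable (at x)) \<and> compact (closure {x. f x \<noteq> 0}) \<and>
   (\<forall>d. continuous_on UNIV (\<lambda>x. fder f x d))"

lemma nice_continuous: "nice f ==> continuous_on UNIV f"
 by (simp add: nice_def continuous_on_eq_continuous_within differentiable_imp_continuous_within)

lemma nice_frechet:
 assumes "nice f"
 shows "(f has_derivative fder f x) (at x)" "gauss_bounded f"
  "continuous_on UNIV (\<lambda>x. fder f x d)" "gauss_bounded (\<lambda>x. fder f x d)"
 using assms by (simp_all add: nice_def frechet_derivative_works)

lemma niceI:
 assumes "\<And>x. (f has_derivative f' x) (at x)" "gauss_bounded f"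
  "\<And>d. continuous_on UNIV (\<lambda>x. f' x d)" "\<And>d. gauss_bounded (\<lambda>x. f' x d)"
 shows "nice f"
proof -
 have "fder f x = f' x" for x using frechet_derivative_at[OF assms(1)] by metis
 moreover have "f differentiable (at x)" for x using assms(1) unfolding differentiable_def by blast
 ultimately show ?thesis using assms by (simp add: nice_def)
qed

lemma nice_measurable:
 assumes "nice f"
 shows "f \<in> borel_funs" "(\<lambda>x. fder f x d) \<in> borel_funs"
 by (rule borel_measurable_continuous_onI[OF nice_continuous[OF assms]],
   rule borel_measurable_continuous_onI[OF nice_frechet(3)[OF assms]])

lemma nice_L2:
 assumes "nice f" shows "L2_fun f" "L2_fun (\<lambda>x. fder f x d)"
 by (rule gauss_bounded_L2[OF nice_frechet(2)[OF assms] nice_measurable(1)[OF assms]],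
   rule gauss_bounded_L2[OF nice_frechet(4)[OF assms] nice_measurable(2)[OF assms]])

lemma gs_nice: "gs f ==> nice f"
 by (simp add: nice_def tame_exp_differentiable gs_gauss_bounded tame_exp_frechet tame_exp_continuous[OF tame_exp_frechet])

lemma test_function_C1c: "test_function f ==> C1c f"
proof -
 assume f: "test_function f"
 have d: "dirderivs ds f differentiable (at x)" for ds x
  using f by (simp add: test_function_def smooth_def)
 have "continuous_on UNIV (\<lambda>x. fder f x v)" for v
  using d[of "[v]"] by (simp add: continuous_on_eq_continuous_within differentiable_imp_continuous_within)
 thus ?thesis using f d[of "[]"] by (simp add: C1c_def test_function_def)
qed

lemma frechet_derivative_mult:
 assumes "f differentiable (at x)" "g differentiable (at x)"
 shows "fder (\<lambda>x. f x * g x) x d =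
  f x * fder g x d + fder f x d * (g x :: complex)"
proof -
 have "(f has_derivative fder f x) (at x)" "(g has_derivative fder g x) (at x)"
  using assms by (simp_all add: frechet_derivative_works)
 from frechet_derivative_at[OF has_derivative_mult[OF this]] show ?thesis by metis
qed

lemma C1c_mult:
 assumes f: "C1c f" and t: "tame_exp False t" shows "C1c (\<lambda>x. t x * f x)"
proof -
 have "closure {x. t x * f x \<noteq> 0} \<subseteq> closure {x. f x \<noteq> 0}" by (intro closure_mono) auto
 hence 1: "compact (closure {x. t x * f x \<noteq> 0})"
  using f compact_Int_closed[of "closure {x. f x \<noteq> 0}" "closure {x. t x * f x \<noteq> 0}"]
  by (simp add: C1c_def Int_absorb1)
 have c: "continuous_on UNIV f"
  using f by (simp add: C1c_def continuous_on_eq_continuous_within differentiable_imp_continuous_within)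
 have d: "f differentiable (at x)" "t differentiable (at x)" for x
  using f tame_exp_differentiable[OF t] by (auto simp: C1c_def)
 have fr: "fder (\<lambda>x. t x * f x) x = (\<lambda>d. t x * fder f x d + fder t x d * f x)" for x
  using d by (simp add: frechet_derivative_mult fun_eq_iff)
 have "continuous_on UNIV (\<lambda>x. t x * fder f x d + fder t x d * f x)" for d
  using f by (intro continuous_on_add continuous_on_mult c tame_exp_continuous[OF t] tame_exp_continuous[OF tame_exp_frechet[OF t]]) (simp add: C1c_def)
 thus ?thesis unfolding C1c_def fr using 1 d by (simp add: differentiable_mult)
qed

lemma gauss_bounded_compact:
 assumes c: "continuous_on UNIV f" and K: "compact K" and z: "\<And>x. x \<notin> K ==> f x = (0::complex)"
 shows "gauss_bounded f"
proof -
 have "compact ((\<lambda>x. cmod (f x) * exp ((norm x)^2)) ` K)"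
  using continuous_on_subset[OF c, of K] K by (intro compact_continuous_image continuous_intros) auto
 from bounded_imp_bdd_above[OF compact_imp_bounded[OF this]]
 obtain B where B: "\<And>y. y \<in> (\<lambda>x. cmod (f x) * exp ((norm x)^2)) ` K ==> y \<le> B"
  unfolding bdd_above_def by blast
 have "cmod (f x) \<le> max B 0 * gauss 1 x" for x
 proof (cases "x \<in> K")
  case True
  thus ?thesis using B[OF imageI[OF True]] by (simp add: exp_minus divide_simps le_max_iff_disj)
 qed (simp add: z)
 thus ?thesis unfolding gauss_bounded_def by (intro exI[of _ "max B 0"] exI[of _ 1]) auto
qed

lemma C1c_nice:
 assumes "C1c f" shows "nice f"
proof -
 let ?K = "closure {x. f x \<noteq> 0}"
 have z: "f x = 0" if "x \<notin> ?K" for x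
  using that subsetD[OF closure_subset, of x "{x. f x \<noteq> 0}"] by blast
 have dz: "fder f x d = 0" if "x \<notin> ?K" for x d
 proof -
  have "((\<lambda>x. 0) has_derivative (\<lambda>_. 0)) (at x)" by simp
  hence "(f has_derivative (\<lambda>_. 0)) (at x)"
  proof (rule has_derivative_transform_within_open[where s="- ?K"])
   show "0 = f y" if "y \<in> - ?K" for y by (rule z[symmetric]) (use that in blast)
   show "open (- ?K)" by (rule open_Compl[OF closed_closure])
   show "x \<in> - ?K" using that by blast
  qed
  from frechet_derivative_at[OF this] show ?thesis by metis
 qed
 have c: "continuous_on UNIV f"
  using assms by (simp add: C1c_def continuous_on_eq_continuous_within differentiable_imp_continuous_within)
 have K: "compact ?K" and d: "\<And>x. f differentiable (at x)"
  and c': "\<And>d. continuous_on UNIV (\<lambda>x. fder f x d)"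
  using assms by (simp_all only: C1c_def)
 have "gauss_bounded f" by (rule gauss_bounded_compact[OF c K z])
 moreover have "gauss_bounded (\<lambda>x. fder f x d)" for d
  by (rule gauss_bounded_compact[OF c' K dz])
 ultimately show ?thesis using d c' by (simp only: nice_def simp_thms)
qed

lemma gauss_bounded_mult: "gauss_bounded f ==> gauss_bounded g ==> gauss_bounded (\<lambda>x. f x * g x)"
proof -
 assume f: "gauss_bounded f" and g: "gauss_bounded g"
 obtain C c where C: "C \<ge> 0" "c > 0" "\<And>x. cmod (f x) \<le> C * gauss c x"
  using f unfolding gauss_bounded_def by blast
 have "cmod (f x) \<le> C * (1 + norm x) ^ 0" for x
 proof -
  have "C * gauss c x \<le> C * 1" using C by (intro mult_left_mono) auto
  thus ?thesis using C(3)[of x] by simp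
 qed
 from gauss_bounded_growth[OF g this] show ?thesis .
qed

lemma nice_mult:
 assumes f: "nice f" and g: "nice g" shows "nice (\<lambda>x. f x * g x)"
proof (rule niceI[where f'="\<lambda>x d. f x * fder g x d + fder f x d * g x"])
qed (intro has_derivative_mult nice_frechet f g continuous_on_add continuous_on_mult nice_continuous gauss_bounded_add gauss_bounded_mult)+

lemma tame_tame_exp: "tame t ==> tame_exp False t"
 using tame_exp.base[OF _ tame.const, of t False 0] by simp

lemma nice_tame:
 assumes f: "nice f" and t: "tame t" shows "nice (\<lambda>x. t x * f x)"
proof -
 note t' = tame_tame_exp[OF t]
 obtain T' where T: "\<And>x. (t has_derivative T' x) (at x)" "\<And>v. tame (\<lambda>x. T' x v)" using tame_deriv[OF t] by blast
 have "continuous_on UNIV (\<lambda>x. T' x d)" for d by (rule tame_exp_continuous[OF tame_tame_exp[OF T(2)]])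
 thus ?thesis
  by (intro niceI[where f'="\<lambda>x d. t x * fder f x d + T' x d * f x"]
    has_derivative_mult T(1) nice_frechet[OF f] continuous_on_add continuous_on_mult nice_continuous[OF f]
    tame_exp_continuous[OF t'] gauss_bounded_add gauss_bounded_tame[OF _ t] gauss_bounded_tame[OF _ T(2)])
qed

lemma lborel_integral_translate:
 fixes f :: "'x::euclidean_space => complex"
 assumes "f \<in> borel_funs"
 shows "(LI x. f (a + x)) = (LI x. f x)"
proof -
 have "(LI x. f x) = (LINT x|distr lborel borel ((+) a). f x)" by (simp only: lborel_distr_plus)
 also have "\<dots> = (LI x. f (a + x))" by (rule integral_distr) (use assms in auto)
 finally show ?thesis by simp
qed

lemma lborel_integrable_translate:
 fixes f :: "'x::euclidean_space => 'b::{banach,second_countable_topology}"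
 assumes "integrable lborel f"
 shows "integrable lborel (\<lambda>x. f (a + x))"
proof -
 have "integrable (distr lborel borel ((+) a)) f" using assms by (simp only: lborel_distr_plus)
 thus ?thesis by (rule integrable_distr[rotated]) simp
qed

lemma gauss_fourier_shift:
 fixes y :: "'a::euclidean_space" assumes c: "c > 0"
 shows "has_bochner_integral lborel (\<lambda>x. exp (\<i> * of_real (y \<bullet> x)) * of_real (gauss c (x - a)))
   (exp (\<i> * of_real (y \<bullet> a)) * of_real (sqrt (pi / c) ^ DIM('a) * exp (- (norm y)\<^sup>2 / (4 * c))))"
proof -
 define f where "f x = exp (\<i> * of_real (y \<bullet> a)) * (exp (\<i> * of_real (y \<bullet> x)) * of_real (exp (- c * (norm x)^2)))" for x
 have f: "has_bochner_integral lborel f (exp (\<i> * of_real (y \<bullet> a)) * of_real (sqrt (pi / c) ^ DIM('a) * exp (- (norm y)\<^sup>2 / (4 * c))))"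
  unfolding f_def[abs_def] by (intro has_bochner_integral_mult_right gauss_fourier c)
 hence i: "integrable lborel f" by (simp add: has_bochner_integral_iff)
 have eq: "f (- a + x) = exp (\<i> * of_real (y \<bullet> x)) * of_real (gauss c (x - a))" for x
  by (simp add: f_def inner_diff_right exp_diff[symmetric] right_diff_distrib mult.assoc[symmetric] flip: exp_add)
 show ?thesis
  using lborel_integrable_translate[OF i, of "- a"] lborel_integral_translate[of f "- a"] borel_measurable_integrable[OF i] f
  unfolding eq by (simp add: has_bochner_integral_iff)
qed

lemma gauss_shift:
 fixes a :: "'a::euclidean_space" assumes c: "c > 0"
 shows "integrable lborel (\<lambda>x. gauss c (x - a))"
  "(LI x. gauss c (x - a)) = sqrt (pi / c) ^ DIM('a)"
proof -
 have h: "has_bochner_integral lborel (\<lambda>x. complex_of_real (gauss c (x - a))) (of_real (sqrt (pi / c) ^ DIM('a)))"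
  using gauss_fourier_shift[OF c, of 0 a] by simp
 show "integrable lborel (\<lambda>x. gauss c (x - a))"
  using h unfolding has_bochner_integral_iff by (simp only: complex_of_real_integrable_eq)
 show "(LI x. gauss c (x - a)) = sqrt (pi / c) ^ DIM('a)"
  using h unfolding has_bochner_integral_iff integral_complex_of_real by (simp only: of_real_eq_iff)
qed

text \<open>From |x|^2 <= 2 |a|^2 + 2 |a - x|^2: a Gaussian centred at \<open>a\<close> is dominated
  by one centred at 0 with half the exponent.\<close>

lemma norm_sq_shift:
 fixes x :: "'x::real_normed_vector" shows "- (norm (a - x))\<^sup>2 \<le> (norm a)^2 - (norm x)\<^sup>2 / 2"
proof -
 have "norm x \<le> norm a + norm (a - x)" using norm_triangle_ineq4[of a "a - x"] by simp
 hence "(norm x)^2 \<le> (norm a + norm (a - x))^2" by (intro power_mono) auto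
 also have "\<dots> \<le> 2 * (norm a)^2 + 2 * (norm (a - x))^2"
  using zero_le_power2[of "norm a - norm (a - x)"] by (simp add: power2_eq_square algebra_simps)
 finally show ?thesis by simp
qed

text \<open>Lebesgue measure is translation invariant, so the difference quotients along
  \<open>d\<close> have integral 0. They are dominated by one Gaussian for all steps up to 1 and
  converge to the derivative.\<close>

lemma nice_integral_derivative:
 assumes f: "nice f" shows "(LI x. fder f x d) = 0"
proof -
 let ?f' = "\<lambda>x. fder f x d"
 obtain C c where C: "C \<ge> 0" "c > 0" "\<And>x. cmod (?f' x) \<le> C * gauss c x"
  using f unfolding nice_def gauss_bounded_def by blast
 have der: "(f has_derivative fder f x) (at x)" for x
  using f by (simp add: nice_def frechet_derivative_works)
 have fi: "integrable lborel f" using f nice_measurable[OF f] by (intro gauss_bounded_integrable) (auto simp: nice_def)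
 let ?e = "\<lambda>n. 1 / real (Suc n)"
 let ?s = "\<lambda>n x. (f (?e n *\<^sub>R d + x) - f x) /\<^sub>R ?e n"
 have path: "((\<lambda>t. f (x + t *\<^sub>R d)) has_vector_derivative ?f' (x + t *\<^sub>R d)) (at t within S)" for x t S
 proof -
  have "((\<lambda>t. x + t *\<^sub>R d) has_derivative (\<lambda>h. h *\<^sub>R d)) (at t within S)"
   by (auto intro!: derivative_eq_intros)
  from has_derivative_compose[OF this der]
  have "((\<lambda>t. f (x + t *\<^sub>R d)) has_derivative (\<lambda>h. fder f (x + t *\<^sub>R d) (h *\<^sub>R d))) (at t within S)" .
  moreover have "fder f y (h *\<^sub>R d) = h *\<^sub>R ?f' y" for h y
   using linear_cmul[OF linear_frechet_derivative] f unfolding nice_def by blast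
  ultimately show ?thesis by (simp add: has_vector_derivative_def)
 qed
 have bound: "cmod (?s n x) \<le> C * exp (c * (norm d)^2) * gauss (c / 2) x" for n x
 proof -
  let ?B = "C * exp (c * (norm d)^2) * gauss (c / 2) x"
  have b: "cmod (?f' (x + t *\<^sub>R d)) \<le> ?B" if "t \<in> {0..1}" for t
  proof -
   have "(norm (t *\<^sub>R d))^2 \<le> (norm d)^2" using that by (intro power_mono) (auto simp: mult_left_le_one_le)
   moreover have "- (norm (x + t *\<^sub>R d - x))\<^sup>2 \<le> (norm (x + t *\<^sub>R d))^2 - (norm x)\<^sup>2 / 2" by (rule norm_sq_shift)
   ultimately have "(norm x)^2 / 2 \<le> (norm (x + t *\<^sub>R d))^2 + (norm d)^2"
    unfolding add_diff_cancel_left' by linarith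
   hence "c * ((norm x)^2 / 2) \<le> c * ((norm (x + t *\<^sub>R d))^2 + (norm d)^2)"
    using C(2) by (intro mult_left_mono) auto
   hence "gauss c (x + t *\<^sub>R d) \<le> exp (c * (norm d)^2 + - (c / 2 * (norm x)^2))"
    by (simp add: algebra_simps)
   hence "C * gauss c (x + t *\<^sub>R d) \<le> C * (exp (c * (norm d)^2) * gauss (c / 2) x)"
    using C(1) unfolding exp_add by (intro mult_left_mono) auto
   thus ?thesis using C(3)[of "x + t *\<^sub>R d"] by (simp add: mult.assoc)
  qed
  have "norm (f (x + ?e n *\<^sub>R d) - f (x + 0 *\<^sub>R d)) \<le> ?B * norm (?e n - 0)"
  proof (rule differentiable_bound[where f'="\<lambda>t h. h *\<^sub>R ?f' (x + t *\<^sub>R d)" and S="{0..1}"])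
   show "((\<lambda>t. f (x + t *\<^sub>R d)) has_derivative (\<lambda>h. h *\<^sub>R ?f' (x + t *\<^sub>R d))) (at t within {0..1})" if "t \<in> {0..1}" for t
    using path[of x t "{0..1}"] by (simp add: has_vector_derivative_def)
   show "onorm (\<lambda>h. h *\<^sub>R ?f' (x + t *\<^sub>R d)) \<le> ?B" if "t \<in> {0..1}" for t
    using b[OF that] by (intro onorm_le) (simp add: mult.commute mult_left_mono)
  qed auto
  hence 1: "norm (f (?e n *\<^sub>R d + x) - f x) \<le> ?B * ?e n" by (simp add: add.commute)
  have 2: "norm (X /\<^sub>R e) \<le> b" if "norm X \<le> b * e" "e > 0" for X :: complex and e b :: real
   using that by (simp add: pos_divide_le_eq flip: divide_inverse_commute)
  show ?thesis by (rule 2[OF 1]) simp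
 qed
 have lim: "(\<lambda>n. ?s n x) \<longlonglongrightarrow> ?f' x" for x
 proof -
  have *: "((\<lambda>h. norm (f (x + (0 + h) *\<^sub>R d) - f (x + 0 *\<^sub>R d) - h *\<^sub>R ?f' x) / norm h) \<longlongrightarrow> 0) (at 0)"
   using path[of x 0 UNIV] unfolding has_vector_derivative_def has_derivative_at by simp
  have e: "filterlim ?e (at 0) sequentially"
   by (rule filterlim_atI[OF LIMSEQ_Suc[OF lim_1_over_n]]) auto
  have "(\<lambda>n. norm (f (x + (0 + ?e n) *\<^sub>R d) - f (x + 0 *\<^sub>R d) - ?e n *\<^sub>R ?f' x) / norm (?e n)) \<longlonglongrightarrow> 0"
   by (rule filterlim_compose[OF * e])
  moreover have "norm (f (x + (0 + ?e n) *\<^sub>R d) - f (x + 0 *\<^sub>R d) - ?e n *\<^sub>R ?f' x) / norm (?e n) = norm (?s n x - ?f' x)" for n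
  proof -
   have "?s n x - ?f' x = (f (x + (0 + ?e n) *\<^sub>R d) - f (x + 0 *\<^sub>R d) - ?e n *\<^sub>R ?f' x) /\<^sub>R ?e n"
    by (simp add: scaleR_diff_right add.commute)
   thus ?thesis by (simp only: norm_scaleR) (simp add: divide_inverse)
  qed
  ultimately have "(\<lambda>n. norm (?s n x - ?f' x)) \<longlonglongrightarrow> 0" by (simp only:)
  thus ?thesis by (rule LIM_zero_cancel[OF tendsto_norm_zero_cancel])
 qed
 have "(\<lambda>n. LI x. ?s n x) \<longlonglongrightarrow> (LI x. ?f' x)"
 proof (rule integral_dominated_convergence)
  note [measurable] = nice_measurable[OF f]
  show "?f' \<in> borel_measurable lborel" "\<And>n. ?s n \<in> borel_measurable lborel" by measurable
  show "integrable lborel (\<lambda>x. C * exp (c * (norm d)^2) * gauss (c / 2) x)"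
   using C(2) by (intro integrable_mult_right gauss_integrable) simp
 qed (use lim bound in auto)
 moreover have "(LI x. ?s n x) = 0" for n
 proof -
  have "(LI x. f (?e n *\<^sub>R d + x) - f x) = 0"
   using fi lborel_integrable_translate[OF fi] lborel_integral_translate[OF nice_measurable(1)[OF f]] by simp
  thus ?thesis by (simp only: integral_scaleR_right scaleR_zero_right)
 qed
 ultimately have "(\<lambda>n. 0) \<longlonglongrightarrow> (LI x. ?f' x)" by (simp only:)
 thus ?thesis by (simp add: LIMSEQ_const_iff)
qed

lemma nice_integration_by_parts:
 assumes f: "nice f" and g: "nice g"
 shows "(LI x. fder f x d * g x) = - (LI x. f x * fder g x d)"
proof -
 have "(LI x. fder (\<lambda>x. f x * g x) x d) = 0"
  by (rule nice_integral_derivative[OF nice_mult[OF f g]])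
 moreover have "fder (\<lambda>x. f x * g x) x d = f x * fder g x d + fder f x d * g x" for x
  using f g by (simp add: nice_def frechet_derivative_mult)
 ultimately have "(LI x. f x * fder g x d + fder f x d * g x) = 0" by (simp only:)
 hence "(LI x. f x * fder g x d) + (LI x. fder f x d * g x) = 0"
  by (simp only: B_integral_add[OF L2_fun_mult_integrable[OF nice_L2(1)[OF f] nice_L2(2)[OF g]]
    L2_fun_mult_integrable[OF nice_L2(2)[OF f] nice_L2(1)[OF g]]])
 thus ?thesis by (simp only: add_eq_0_iff)
qed

section \<open>Cutoff functions\<close>

text \<open>\<open>bump 1\<close> is 1/e, so the factor \<open>exp 1\<close> makes the value at the
  origin 1. The argument is quadratic in x rather than a function of |x|, which keeps the cutoff
  \<open>tame\<close>.\<close>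

definition cutoff :: "real => 'x::euclidean_space => complex" where
 "cutoff R x = of_real (exp 1) * of_real (bump (1 - (norm x)\<^sup>2 / R^2))"

lemma cutoff_tame: "tame (cutoff R)"
proof -
 have "tame (\<lambda>x::'a. of_real (1 - (norm x)\<^sup>2 / R^2))"
  using tame_diff[OF tame.const[of 1] tame_cmult[OF tame_norm_sq, of "of_real (1 / R^2)"]] by simp
 thus ?thesis unfolding cutoff_def
  by (intro tame_cmult tame.comp[OF bounded_smooth_bump])
qed

lemma cutoff_supp: "R > 0 ==> cutoff R x \<noteq> 0 ==> norm x \<le> R"
proof (rule ccontr)
 assume R: "R > 0" and nz: "cutoff R x \<noteq> 0" and "\<not> norm x \<le> R"
 hence "R^2 \<le> (norm x)^2" by (intro power_mono) auto
 hence "1 - (norm x)\<^sup>2 / R^2 \<le> 0" using R by simp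
 thus False using nz by (simp add: cutoff_def bump_deriv_def)
qed

lemma cutoff_bound: "cmod (cutoff R x) \<le> 1"
proof -
 have "exp 1 * exp (- (1 / u)) \<le> 1" if "0 < u" "u \<le> 1" for u :: real
  using that by (simp flip: exp_add)
 moreover have "1 - (norm x)\<^sup>2 / R^2 \<le> 1" by simp
 ultimately show ?thesis by (auto simp: cutoff_def bump_deriv_def norm_mult simp del: exp_le_one_iff)
qed

lemma cutoff_lim: "(\<lambda>n. cutoff (real (Suc n)) x) \<longlonglongrightarrow> 1"
proof -
 have "(\<lambda>n. (norm x)^2 * (inverse (real (Suc n)))^2) \<longlonglongrightarrow> (norm x)\<^sup>2 * 0^2"
  by (intro tendsto_intros LIMSEQ_inverse_real_of_nat)
 hence "(\<lambda>n. 1 - (norm x)\<^sup>2 / (real (Suc n))^2) \<longlonglongrightarrow> 1 - 0"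
  by (intro tendsto_intros) (simp add: power_inverse divide_inverse)
 moreover have "isCont bump 1" using bump_deriv_has_derivative DERIV_isCont by blast
 ultimately have "(\<lambda>n. bump (1 - (norm x)\<^sup>2 / (real (Suc n))^2)) \<longlonglongrightarrow> bump 1"
  using isCont_tendsto_compose[of 1 bump "\<lambda>n. 1 - (norm x)\<^sup>2 / (real (Suc n))^2" sequentially] by simp
 hence "(\<lambda>n. of_real (exp 1) * complex_of_real (bump (1 - (norm x)\<^sup>2 / (real (Suc n))^2))) \<longlonglongrightarrow> of_real (exp 1) * of_real (bump 1)"
  by (intro tendsto_intros)
 moreover have "of_real (exp 1) * complex_of_real (bump 1) = 1"
  by (simp add: bump_deriv_def exp_minus flip: of_real_mult)
 ultimately show ?thesis by (simp add: cutoff_def del: of_nat_Suc)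
qed

text \<open>Differentiating |x|^2 / R^2 gives |x| |d| / R^2 up to a constant. The weaker power 1/R
  is enough, because the factor |x| is going to be absorbed by Gaussian decay.\<close>

lemma cutoff_deriv_bound:
 "\<exists>B\<ge>0. \<forall>R\<ge>1. \<forall>x::'x::euclidean_space. \<forall>d. cmod (fder (cutoff R) x d) \<le> B * norm x * norm d / R"
proof -
 obtain B where B: "\<And>u. \<bar>bump_deriv 1 u\<bar> \<le> B" using bump_deriv_bounded by blast
 have B0: "B \<ge> 0" using B[of 0] by linarith
 have "cmod (fder (cutoff R) x d) \<le> (exp 1 * B * 2) * norm x * norm d / R" if R: "R \<ge> 1" for R :: real and x d :: 'x
 proof -
  have n: "((\<lambda>x::'x. 1 - (norm x)\<^sup>2 / R^2) has_derivative (\<lambda>h. - (2 * (x \<bullet> h) / R^2))) (at x)"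
  proof -
   have "((\<lambda>x::'x. 1 - (1 / R^2) * (x \<bullet> x)) has_derivative (\<lambda>h. 0 - (1 / R^2) * (x \<bullet> h + h \<bullet> x))) (at x)"
    by (intro has_derivative_diff has_derivative_const has_derivative_mult_right has_derivative_inner has_derivative_ident)
   moreover have "(\<lambda>h. 0 - (1 / R^2) * (x \<bullet> h + h \<bullet> x)) = (\<lambda>h. - (2 * (x \<bullet> h) / R^2))"
    by (simp add: fun_eq_iff inner_commute)
   moreover have "(\<lambda>x::'x. 1 - (1 / R^2) * (x \<bullet> x)) = (\<lambda>x. 1 - (norm x)\<^sup>2 / R^2)"
    by (simp add: fun_eq_iff power2_norm_eq_inner)
   ultimately show ?thesis by (simp only:)
  qed
  have "(bump has_derivative (\<lambda>h. h * bump_deriv 1 u)) (at u)" for u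
   using bump_deriv_has_derivative[of 0 u] by (simp add: has_field_derivative_def mult_commute_abs)
  from has_derivative_compose[OF n this]
  have "((\<lambda>x. bump (1 - (norm x)\<^sup>2 / R^2)) has_derivative (\<lambda>h. - (2 * (x \<bullet> h) / R^2) * bump_deriv 1 (1 - (norm x)\<^sup>2 / R^2))) (at x)" .
  from has_derivative_mult_right[OF has_derivative_of_real[OF this]]
  have "(cutoff R has_derivative (\<lambda>h. of_real (exp 1) * of_real (- (2 * (x \<bullet> h) / R^2) * bump_deriv 1 (1 - (norm x)\<^sup>2 / R^2)))) (at x)"
   unfolding cutoff_def[abs_def] .
  from fun_cong[OF frechet_derivative_at[OF this], of d]
  have "fder (cutoff R) x d = of_real (exp 1 * (- (2 * (x \<bullet> d) / R^2) * bump_deriv 1 (1 - (norm x)\<^sup>2 / R^2)))" by (simp only: of_real_mult)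
  hence "cmod (fder (cutoff R) x d) = exp 1 * (2 * \<bar>x \<bullet> d\<bar> / R^2 * \<bar>bump_deriv 1 (1 - (norm x)\<^sup>2 / R^2)\<bar>)"
   by (simp only: norm_of_real) (simp add: abs_mult)
  also have "\<dots> \<le> exp 1 * (2 * (norm x * norm d) / R * B)"
  proof (intro mult_left_mono mult_mono B frac_le)
   show "R \<le> R^2" using R by (simp add: power2_eq_square)
  qed (use R Cauchy_Schwarz_ineq2[of x d] in auto)
  finally show ?thesis by (simp add: mult_ac)
 qed
 thus ?thesis using B0 by (intro exI[of _ "exp 1 * B * 2"]) auto
qed

lemma cutoff_test:
 fixes f :: "'x::euclidean_space => complex"
 assumes "tame_exp d f" "R > 0"
 shows "tame_exp d (\<lambda>x. cutoff R x * f x)" "compact (closure {x. cutoff R x * f x \<noteq> 0})"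
proof -
 show "tame_exp d (\<lambda>x. cutoff R x * f x)" by (rule tame_exp_mult[OF assms(1) cutoff_tame])
 have "{x. cutoff R x * f x \<noteq> 0} \<subseteq> cball 0 R" using cutoff_supp[OF assms(2)] by (auto simp: dist_norm)
 hence "bounded {x. cutoff R x * f x \<noteq> 0}" using bounded_cball bounded_subset by blast
 thus "compact (closure {x. cutoff R x * f x \<noteq> 0})" by simp
qed

section \<open>Signs\<close>

lemma eps_cnj [simp]: "cnj (eps j J K) = eps j J K"
 by (simp add: eps_def)

text \<open>The nonzero value of \<open>eps\<close>, detached from the target set, so that signs can
  be compared after an insertion.\<close>

definition sg :: "'n::{finite,linorder} => 'n set => complex" where
 "sg j J = (-1) ^ card {i\<in>J. i < j}"

lemma sg_sq [simp]: "sg j J * sg j J = 1"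
 by (simp add: sg_def flip: power_add mult_2)

lemma sg_insert: "k \<notin> J ==> sg j (insert k J) = (if k < j then - sg j J else sg j J)"
proof -
 assume k: "k \<notin> J"
 have "{i \<in> insert k J. i < j} = (if k < j then insert k {i\<in>J. i < j} else {i\<in>J. i < j})" by auto
 thus ?thesis using k by (simp add: sg_def)
qed

lemma sum_eps_up:
 fixes J K0 :: "'n::{finite,linorder} set"
 assumes J: "J \<in> \<I> q" "K0 \<in> \<I> q"
 shows "(\<Sum>K\<in>\<I> (q + 1). eps k J K * eps j K0 K) =
  (if k \<notin> J \<and> j \<notin> K0 \<and> insert k J = insert j K0 then sg k J * sg j K0 else 0)"
proof (cases "k \<notin> J \<and> j \<notin> K0 \<and> insert k J = insert j K0")
 case True
 have m: "insert k J \<in> \<I> (q + 1)" using J True by (simp add: multi_indices_def)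
 have "(\<Sum>K\<in>\<I> (q + 1). eps k J K * eps j K0 K) = (\<Sum>K\<in>{insert k J}. eps k J K * eps j K0 K)"
 proof (rule sum.mono_neutral_right)
  show "\<forall>K\<in>\<I> (q + 1) - {insert k J}. eps k J K * eps j K0 K = 0"
   by (auto simp: eps_def)
 qed (use m in auto)
 also have "\<dots> = sg k J * sg j K0" using True by (simp add: eps_def sg_def)
 finally show ?thesis using True by simp
next
 case False
 have "eps k J K * eps j K0 K = 0" for K using False by (auto simp: eps_def)
 thus ?thesis using False by (simp only: sum.neutral_const if_False)
qed

lemma sum_eps_down:
 fixes J K0 :: "'n::{finite,linorder} set"
 assumes J: "J \<in> \<I> q" "K0 \<in> \<I> q"
 shows "(\<Sum>I\<in>\<I> (q - 1). eps j I J * eps k I K0) =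
  (if j \<in> J \<and> k \<in> K0 \<and> J - {j} = K0 - {k} then sg j (J - {j}) * sg k (K0 - {k}) else 0)"
proof (cases "j \<in> J \<and> k \<in> K0 \<and> J - {j} = K0 - {k}")
 case True
 have m: "J - {j} \<in> \<I> (q - 1)" using J True by (simp add: multi_indices_def)
 have "(\<Sum>I\<in>\<I> (q - 1). eps j I J * eps k I K0) = (\<Sum>I\<in>{J - {j}}. eps j I J * eps k I K0)"
 proof (rule sum.mono_neutral_right)
  show "\<forall>I\<in>\<I> (q - 1) - {J - {j}}. eps j I J * eps k I K0 = 0"
   by (auto simp: eps_def)
 qed (use m in auto)
 also have "\<dots> = sg j (J - {j}) * sg k (K0 - {k})" using True by (auto simp: eps_def sg_def insert_absorb)
 finally show ?thesis using True by simp
next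
 case False
 have "eps j I J * eps k I K0 = 0" for I using False by (auto simp: eps_def)
 thus ?thesis using False by (simp only: sum.neutral_const if_False)
qed


text \<open>The first sum is the matrix of exterior multiplication by j followed by contraction with
  k, the second that of the reverse order: this is their anticommutation relation.\<close>

lemma eps_anticommute:
 fixes J K0 :: "'n::{finite,linorder} set"
 assumes J: "J \<in> \<I> q" "K0 \<in> \<I> q"
 shows "(\<Sum>K\<in>\<I> (q + 1). eps k J K * eps j K0 K) + (\<Sum>I\<in>\<I> (q - 1). eps j I J * eps k I K0)
  = (if j = k \<and> J = K0 then 1 else 0)"
proof (cases "j = k")
 case True
 show ?thesis unfolding sum_eps_up[OF J] sum_eps_down[OF J] using True by auto
next
 case False
 have iff: "(k \<notin> J \<and> j \<notin> K0 \<and> insert k J = insert j K0) \<longleftrightarrow> (j \<in> J \<and> k \<in> K0 \<and> J - {j} = K0 - {k})"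
  using False by (auto simp: set_eq_iff)
 show ?thesis
 proof (cases "j \<in> J \<and> k \<in> K0 \<and> J - {j} = K0 - {k}")
  case True
  \<comment> \<open>\<open>J\<close> and \<open>K0\<close> arise from the same \<open>I\<close> by
    adding j and k. Exactly one of the two signs flips, depending on which of j and k is
    smaller.\<close>
  define I where "I = J - {j}"
  have I: "J = insert j I" "K0 = insert k I" "j \<notin> I" "k \<notin> I" using True False by (auto simp: I_def)
  have "sg k J * sg j K0 = - (sg k I * sg j I)"
   using False I by (auto simp: sg_insert)
  moreover have "sg j (J - {j}) * sg k (K0 - {k}) = sg j I * sg k I" using True by (simp add: I_def)
  ultimately show ?thesis unfolding sum_eps_up[OF J] sum_eps_down[OF J] iff using True False by simp
 next
  case F: False
  thus ?thesis unfolding sum_eps_up[OF J] sum_eps_down[OF J] iff using False by (simp only: if_False simp_thms add_0_right)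
 qed
qed

section \<open>First-order systems\<close>

text \<open>Common frame for the weighted operator and the operator on the quadric.
  \<open>Wt j\<close> acts on coefficients and \<open>- W j\<close> is its transpose; both have the
  principal part X + i Y. \<open>D_test\<close> says what an element of the graph satisfies, namely
  the weak equation for compactly supported test functions; \<open>D_I\<close> says what puts a pair
  into the graph, the weak equation for all \<open>nice\<close> test functions.\<close>

locale dbar_system =
 fixes D :: "('n::{finite,linorder}, 'x::euclidean_space) form_op"
  and W Wt :: "'n => ('x => complex) => 'x => complex"
  and X Y :: "'n => 'x => 'x" and c ct :: "'n => 'x => complex"
 assumes W_eq: "\<And>\<psi> x j. \<psi> differentiable (at x) ==> W j \<psi> x =
   fder \<psi> x (X j x) + \<i> * fder \<psi> x (Y j x) + c j x * \<psi> x"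
  and Wt_eq: "\<And>\<psi> x j. \<psi> differentiable (at x) ==> Wt j \<psi> x =
   fder \<psi> x (X j x) + \<i> * fder \<psi> x (Y j x) + ct j x * \<psi> x"
  and XY: "\<And>j. \<exists>C N. \<forall>x. norm (X j x) + norm (Y j x) \<le> C * (1 + norm x) ^ N"
  and gs_W: "\<And>\<psi> j. gs \<psi> ==> gs (W j \<psi>)" and gs_Wt: "\<And>\<psi> j. gs \<psi> ==> gs (Wt j \<psi>)"
  and nice_W: "\<And>\<psi> j. nice \<psi> ==> L2_fun (W j \<psi>)"
  and ibp: "\<And>f \<psi> j. gs f ==> nice \<psi> ==> (LI x. Wt j f x * \<psi> x) = - (LI x. f x * W j \<psi> x)"
  and D_L2: "\<And>q f g. D q f g ==> L2_form q f \<and> L2_form (q + 1) g"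
  and D_test: "\<And>q f g K \<psi>. D q f g ==> K \<in> \<I> (q + 1) ==> tame_exp False \<psi> ==> compact (closure {x. \<psi> x \<noteq> 0}) ==>
   (LI x. g K x * \<psi> x) = dbar_test W q f K \<psi>"
  and D_I: "\<And>q f g. L2_form q f ==> L2_form (q + 1) g ==>
   (\<And>K \<psi>. K \<in> \<I> (q + 1) ==> nice \<psi> ==>
    (LI x. g K x * \<psi> x) = dbar_test W q f K \<psi>)
   ==> D q f g"
begin

lemma L2_graph: "L2_graph D"
 using D_L2 by (auto simp: L2_graph_def)

lemma cutoff_lim_0:
 assumes f: "L2_fun f" and p: "gs \<psi>"
 shows "(\<lambda>n. LI x. f x * (cutoff (real (Suc n)) x * \<psi> x)) \<longlonglongrightarrow> (LI x. f x * \<psi> x)"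
proof (rule integral_dominated_convergence)
 note [measurable] = L2_fun_measurable[OF f] tame_exp_measurable[OF p] tame_exp_measurable[OF tame_tame_exp[OF cutoff_tame]]
 show "(\<lambda>x. f x * \<psi> x) \<in> borel_measurable lborel" by measurable
 show "(\<lambda>x. f x * (cutoff (real (Suc n)) x * \<psi> x)) \<in> borel_measurable lborel" for n by measurable
 show "integrable lborel (\<lambda>x. norm (f x * \<psi> x))"
  by (intro integrable_norm L2_fun_mult_integrable f gs_L2 p)
 show "AE x in lborel. (\<lambda>n. f x * (cutoff (real (Suc n)) x * \<psi> x)) \<longlonglongrightarrow> f x * \<psi> x"
 proof (rule AE_I2)
  fix x
  from tendsto_mult[OF tendsto_const[of "f x"] tendsto_mult[OF cutoff_lim tendsto_const[of "\<psi> x"]]]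
  show "(\<lambda>n. f x * (cutoff (real (Suc n)) x * \<psi> x)) \<longlonglongrightarrow> f x * \<psi> x" by (simp only: mult_1)
 qed
 show "AE x in lborel. norm (f x * (cutoff (real (Suc n)) x * \<psi> x)) \<le> norm (f x * \<psi> x)" for n
  by (intro AE_I2) (simp add: norm_mult mult_left_mono mult_left_le_one_le cutoff_bound del: of_nat_Suc)
qed

text \<open>The derivative of the n-th cutoff contributes 1/(n + 1) times polynomial growth times
  \<open>\<psi>\<close>. This tends to 0 and is dominated by \<open>M\<close>, whose product with
  |f| is integrable.\<close>

lemma cutoff_lim_W:
 assumes f: "L2_fun f" and p: "gs \<psi>"
 shows "(\<lambda>n. LI x. f x * W j (\<lambda>x. cutoff (real (Suc n)) x * \<psi> x) x) \<longlonglongrightarrow> (LI x. f x * W j \<psi> x)"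
proof -
 obtain B where B: "B \<ge> 0" "\<And>R (x::'x) d. R \<ge> 1 ==> cmod (fder (cutoff R) x d) \<le> B * norm x * norm d / R"
  using cutoff_deriv_bound by blast
 obtain C N where C: "\<And>x. norm (X j x) + norm (Y j x) \<le> C * (1 + norm x) ^ N"
  using XY[of j] by blast
 have C0: "C \<ge> 0" using C[of 0] by (simp add: order_trans[OF add_nonneg_nonneg[OF norm_ge_zero norm_ge_zero]])
 define M where "M x = B * C * (1 + norm x) ^ (N + 1) * cmod (\<psi> x)" for x
 have Mg: "gauss_bounded (\<lambda>x. complex_of_real (B * C * (1 + norm x) ^ (N + 1)) * \<psi> x)"
  by (rule gauss_bounded_growth[OF gs_gauss_bounded[OF p], where D="B * C" and N="N + 1"])
    (use B C0 in \<open>simp only: norm_of_real abs_mult abs_of_nonneg power_abs abs_add_abs norm_ge_zero zero_le_power order_refl add_nonneg_nonneg zero_le_one\<close>)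
 let ?r = "\<lambda>n x. frechet_derivative (cutoff (real (Suc n))) (at x) (X j x) + \<i> * frechet_derivative (cutoff (real (Suc n))) (at x) (Y j x)"
 let ?W = "\<lambda>n x. W j (\<lambda>x. cutoff (real (Suc n)) x * \<psi> x) x"
 have eq: "?W n x = cutoff (real (Suc n)) x * W j \<psi> x + ?r n x * \<psi> x" for n x
 proof -
  have d: "cutoff (real (Suc n)) differentiable (at x)" "\<psi> differentiable (at x)"
   using tame_exp_differentiable[OF tame_tame_exp[OF cutoff_tame]] tame_exp_differentiable[OF p] by blast+
  show ?thesis
   unfolding W_eq[OF d(2)] W_eq[OF differentiable_mult[OF d]] frechet_derivative_mult[OF d] by (simp add: algebra_simps)
 qed
 have rb: "cmod (?r n x * \<psi> x) \<le> M x / real (Suc n)" for n x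
 proof -
  have "cmod (?r n x) \<le> B * norm x * norm (X j x) / real (Suc n) + B * norm x * norm (Y j x) / real (Suc n)"
   by (rule norm_triangle_le) (auto simp: norm_mult intro!: add_mono B(2))
  also have "\<dots> = (B * norm x) * (norm (X j x) + norm (Y j x)) / real (Suc n)"
   by (simp add: add_divide_distrib distrib_left)
  also have "\<dots> \<le> (B * (1 + norm x)) * (C * (1 + norm x) ^ N) / real (Suc n)"
   using B(1) C[of x] by (intro divide_right_mono mult_mono) auto
  finally have "cmod (?r n x) * cmod (\<psi> x) \<le> (B * (1 + norm x)) * (C * (1 + norm x) ^ N) / real (Suc n) * cmod (\<psi> x)"
   by (rule mult_right_mono) simp
  thus ?thesis by (simp add: M_def norm_mult mult_ac del: of_nat_Suc)
 qed
 have M0: "M x \<ge> 0" for x using B(1) C0 by (simp add: M_def)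
 have "(\<lambda>n. LI x. f x * ?W n x) \<longlonglongrightarrow> (LI x. f x * W j \<psi> x)"
 proof (rule integral_dominated_convergence)
  have ms: "W j \<psi> \<in> borel_funs" by (rule tame_exp_measurable[OF gs_W[OF p]])
  have mw: "?W n \<in> borel_funs" for n
   using tame_exp_measurable[OF gs_W[OF cutoff_test(1)[OF p, of "real (Suc n)"]]] by simp
  note [measurable] = L2_fun_measurable[OF f] ms mw
  show "(\<lambda>x. f x * W j \<psi> x) \<in> borel_measurable lborel" by measurable
  show "(\<lambda>x. f x * ?W n x) \<in> borel_measurable lborel" for n by measurable
  have "integrable lborel (\<lambda>x. f x * (complex_of_real (B * C * (1 + norm x) ^ (N + 1)) * \<psi> x))"
   using tame_exp_measurable[OF p]
   by (intro L2_fun_mult_integrable f gauss_bounded_L2 Mg) measurable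
  from integrable_norm[OF this] have "integrable lborel (\<lambda>x. cmod (f x) * M x)"
   using B(1) C0 by (simp add: M_def norm_mult norm_power abs_mult mult.assoc del: of_real_add of_real_mult of_real_power)
  thus "integrable lborel (\<lambda>x. cmod (f x) * M x + norm (f x * W j \<psi> x))"
   by (intro B_integrable_add integrable_norm L2_fun_mult_integrable f gs_L2 gs_W p)
  show "AE x in lborel. (\<lambda>n. f x * ?W n x) \<longlonglongrightarrow> f x * W j \<psi> x"
  proof (rule AE_I2)
   fix x
   have "(\<lambda>n. ?r n x * \<psi> x) \<longlonglongrightarrow> 0"
   proof (rule tendsto_0_le[where K=1])
    have "(\<lambda>n. M x * inverse (real (Suc n))) \<longlonglongrightarrow> M x * 0"
     by (intro tendsto_intros LIMSEQ_inverse_real_of_nat)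
    thus "(\<lambda>n. M x / real (Suc n)) \<longlonglongrightarrow> 0" by (simp add: divide_inverse)
    show "\<forall>\<^sub>F n in sequentially. norm (?r n x * \<psi> x) \<le> norm (M x / real (Suc n)) * 1"
     using rb M0 by (intro always_eventually allI) (simp add: abs_div del: of_nat_Suc)
   qed
   from tendsto_mult[OF tendsto_const[of "f x"] tendsto_add[OF tendsto_mult[OF cutoff_lim tendsto_const] this]]
   show "(\<lambda>n. f x * ?W n x) \<longlonglongrightarrow> f x * W j \<psi> x" unfolding eq by (simp only: mult_1 add_0_right)
  qed
  show "AE x in lborel. norm (f x * ?W n x) \<le> cmod (f x) * M x + norm (f x * W j \<psi> x)" for n
  proof (rule AE_I2)
   fix x
   have "cmod (?W n x) \<le> cmod (W j \<psi> x) + M x"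
   proof -
    have "M x / real (Suc n) \<le> M x" using M0[of x] by (simp add: divide_le_eq mult_le_cancel_left1 del: of_nat_Suc)
    hence "cmod (?r n x * \<psi> x) \<le> M x" using rb[of n x] by linarith
    moreover have "cmod (cutoff (real (Suc n)) x * W j \<psi> x) \<le> cmod (W j \<psi> x)"
     by (simp add: norm_mult mult_left_le_one_le cutoff_bound del: of_nat_Suc)
    ultimately show ?thesis unfolding eq by (intro norm_triangle_le) linarith
   qed
   hence "cmod (f x) * cmod (?W n x) \<le> cmod (f x) * (cmod (W j \<psi> x) + M x)" by (rule mult_left_mono) simp
   thus "norm (f x * ?W n x) \<le> cmod (f x) * M x + norm (f x * W j \<psi> x)"
    by (simp add: norm_mult distrib_left)
  qed
 qed
 thus ?thesis .
qed

text \<open>Cutoffs remove the compact support of the test function. Hence every element of the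
  graph can be tested against Gaussian functions, and adjoints can be computed on them.\<close>

lemma D_gs_test:
 assumes D: "D q f g" and K: "K \<in> \<I> (q + 1)" and p: "gs \<psi>"
 shows "(LI x. g K x * \<psi> x) = dbar_test W q f K \<psi>"
proof (rule LIMSEQ_unique)
 let ?p = "\<lambda>n x. cutoff (real (Suc n)) x * \<psi> x"
 note L = D_L2[OF D]
 show "(\<lambda>n. LI x. g K x * ?p n x) \<longlonglongrightarrow> (LI x. g K x * \<psi> x)"
  using L K by (intro cutoff_lim_0 p) (auto simp: L2_form_def)
 have "(LI x. g K x * ?p n x) = (\<Sum>J\<in>\<I> q. \<Sum>j\<in>UNIV. eps j J K * - (LI x. f J x * W j (?p n) x))" for n
  by (rule D_test[OF D K]) (rule cutoff_test[OF tame_exp_False[OF p]], simp)+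
 moreover have "(\<lambda>n. \<Sum>J\<in>\<I> q. \<Sum>j\<in>UNIV. eps j J K * - (LI x. f J x * W j (?p n) x))
   \<longlonglongrightarrow> dbar_test W q f K \<psi>"
  using L by (intro tendsto_sum tendsto_mult tendsto_const tendsto_minus cutoff_lim_W p) (auto simp: L2_form_def)
 ultimately show "(\<lambda>n. LI x. g K x * ?p n x) \<longlonglongrightarrow> dbar_test W q f K \<psi>"
  by (simp only:)
qed

text \<open>The formal adjoint of \<open>Wt j\<close>: \<open>ibp\<close> with the conjugate of
  \<open>g\<close> as test function reads <Wt f, g> = <f, Ws g>.\<close>

definition Ws :: "'n => ('x => complex) => 'x => complex" where
 "Ws j g x = - cnj (W j (\<lambda>x. cnj (g x)) x)"

lemma gs_Ws: "gs g ==> gs (Ws j g)"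
 unfolding Ws_def[abs_def] by (intro tame_exp_minus tame_exp_cnj gs_W)

text \<open>The graph of the operator tested against more functions than \<open>D\<close>, so that superpositions of
 its elements are easy to form.\<close>

definition Dn :: "('n, 'x) form_op" where
 "Dn q f g \<longleftrightarrow> L2_form q f \<and> L2_form (q + 1) g \<and> (\<forall>K\<in>\<I> (q + 1). \<forall>\<psi>. nice \<psi> \<longrightarrow>
   (LI x. g K x * \<psi> x) = dbar_test W q f K \<psi>)"

lemma Dn_D: "Dn q f g ==> D q f g"
 unfolding Dn_def by (intro D_I) auto

lemma Dn_gs:
 assumes f: "\<And>J. J \<in> \<I> q ==> gs (f J)"
 shows "Dn q f (\<lambda>K x. \<Sum>J\<in>\<I> q. \<Sum>j\<in>UNIV. eps j J K * Wt j (f J) x)"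
 unfolding Dn_def
proof (intro conjI ballI allI impI)
 show "L2_form q f" using f by (simp add: L2_form_def gs_L2)
 show "L2_form (q + 1) (\<lambda>K x. \<Sum>J\<in>\<I> q. \<Sum>j\<in>UNIV. eps j J K * Wt j (f J) x)"
  unfolding L2_form_def by (intro ballI L2_fun_sum L2_fun_cmult gs_L2 gs_Wt f)
 fix K :: "'n set" and \<psi> :: "'x => complex" assume K: "K \<in> \<I> (q + 1)" and p: "nice \<psi>"
 have i: "integrable lborel (\<lambda>x. Wt j (f J) x * \<psi> x)" if "J \<in> \<I> q" for J j
  by (intro L2_fun_mult_integrable gs_L2 gs_Wt f that nice_L2 p)
 have "(LI x. (\<Sum>J\<in>\<I> q. \<Sum>j\<in>UNIV. eps j J K * Wt j (f J) x) * \<psi> x)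
   = (LI x. (\<Sum>J\<in>\<I> q. \<Sum>j\<in>UNIV. eps j J K * (Wt j (f J) x * \<psi> x)))"
  by (simp only: sum_distrib_right mult.assoc)
 also have "\<dots> = (\<Sum>J\<in>\<I> q. (LI x. (\<Sum>j\<in>UNIV. eps j J K * (Wt j (f J) x * \<psi> x))))"
  by (rule B_integral_sum) (intro B_integrable_sum integrable_mult_right i)
 also have "\<dots> = (\<Sum>J\<in>\<I> q. \<Sum>j\<in>UNIV. (LI x. eps j J K * (Wt j (f J) x * \<psi> x)))"
  by (intro sum.cong refl B_integral_sum integrable_mult_right i)
 also have "\<dots> = dbar_test W q f K \<psi>"
  by (intro sum.cong refl) (simp only: integral_mult_right_zero ibp[OF f p])
 finally show "(LI x. (\<Sum>J\<in>\<I> q. \<Sum>j\<in>UNIV. eps j J K * Wt j (f J) x) * \<psi> x)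
   = dbar_test W q f K \<psi>" .
qed

text \<open>On Gaussian forms the formal adjoint is the Hilbert space adjoint: the adjoint relation
  for a pair in \<open>D\<close> is its weak equation tested against the conjugates of the
  \<open>g K\<close>.\<close>

lemma adjoint_gs:
 assumes g: "\<And>K. K \<in> \<I> (q + 1) ==> gs (g K)"
 shows "L2_adjoint D q g (\<lambda>J x. \<Sum>K\<in>\<I> (q + 1). \<Sum>j\<in>UNIV. eps j J K * Ws j (g K) x)"
 unfolding L2_adjoint_def
proof (intro conjI allI impI)
 show "L2_form (q + 1) g" using g by (simp add: L2_form_def gs_L2)
 show "L2_form q (\<lambda>J x. \<Sum>K\<in>\<I> (q + 1). \<Sum>j\<in>UNIV. eps j J K * Ws j (g K) x)"
  unfolding L2_form_def by (intro ballI L2_fun_sum L2_fun_cmult gs_L2 gs_Ws g)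
 fix u w assume D: "D q u w"
 have u: "L2_fun (u J)" if "J \<in> \<I> q" for J using D_L2[OF D] that by (simp add: L2_form_def)
 let ?I = "\<lambda>J K j. LI x. u J x * W j (\<lambda>x. cnj (g K x)) x"
 have i: "integrable lborel (\<lambda>x. u J x * W j (\<lambda>x. cnj (g K x)) x)" if "J \<in> \<I> q" "K \<in> \<I> (q + 1)" for J K j
  by (intro L2_fun_mult_integrable u gs_L2 gs_W tame_exp_cnj g that)
 have "L2_inner (q + 1) w g = (\<Sum>K\<in>\<I> (q + 1). \<Sum>J\<in>\<I> q. \<Sum>j\<in>UNIV. eps j J K * - ?I J K j)"
  unfolding L2_inner_def by (intro sum.cong refl) (rule D_gs_test[OF D _ tame_exp_cnj[OF g]])
 also have "\<dots> = (\<Sum>J\<in>\<I> q. \<Sum>K\<in>\<I> (q + 1). \<Sum>j\<in>UNIV. eps j J K * - ?I J K j)"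
  by (rule sum.swap)
 also have "\<dots> = L2_inner q u (\<lambda>J x. \<Sum>K\<in>\<I> (q + 1). \<Sum>j\<in>UNIV. eps j J K * Ws j (g K) x)"
  unfolding L2_inner_def
 proof (intro sum.cong refl)
  fix J :: "'n set" assume J: "J \<in> \<I> q"
  have "(LI x. u J x * cnj (\<Sum>K\<in>\<I> (q + 1). \<Sum>j\<in>UNIV. eps j J K * Ws j (g K) x))
   = (LI x. (\<Sum>K\<in>\<I> (q + 1). \<Sum>j\<in>UNIV. - eps j J K * (u J x * W j (\<lambda>x. cnj (g K x)) x)))"
   unfolding Ws_def cnj_sum sum_distrib_left by (intro B_integral_cong refl sum.cong) simp
  also have "\<dots> = (\<Sum>K\<in>\<I> (q + 1). (LI x. (\<Sum>j\<in>UNIV. - eps j J K * (u J x * W j (\<lambda>x. cnj (g K x)) x))))"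
   by (rule B_integral_sum) (intro B_integrable_sum integrable_mult_right i J)
  also have "\<dots> = (\<Sum>K\<in>\<I> (q + 1). \<Sum>j\<in>UNIV. (LI x. - eps j J K * (u J x * W j (\<lambda>x. cnj (g K x)) x)))"
   by (intro sum.cong refl B_integral_sum integrable_mult_right i J)
  also have "\<dots> = (\<Sum>K\<in>\<I> (q + 1). \<Sum>j\<in>UNIV. eps j J K * - ?I J K j)"
   by (intro sum.cong refl) (subst integral_mult_right_zero, simp)
  finally show "(\<Sum>K\<in>\<I> (q + 1). \<Sum>j\<in>UNIV. eps j J K * - ?I J K j)
   = (LI x. u J x * cnj (\<Sum>K\<in>\<I> (q + 1). \<Sum>j\<in>UNIV. eps j J K * Ws j (g K) x))" by (rule sym)
 qed
 finally show "L2_inner (q + 1) w g = L2_inner q u (\<lambda>J x. \<Sum>K\<in>\<I> (q + 1). \<Sum>j\<in>UNIV. eps j J K * Ws j (g K) x)" .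
qed

lemma W_sum:
 assumes "\<And>i. i \<in> I ==> f i differentiable (at x)"
 shows "W j (\<lambda>x. \<Sum>i\<in>I. a i * f i x) x = (\<Sum>i\<in>I. a i * W j (f i) x)"
  and "Wt j (\<lambda>x. \<Sum>i\<in>I. a i * f i x) x = (\<Sum>i\<in>I. a i * Wt j (f i) x)"
proof -
 have "((\<lambda>x. \<Sum>i\<in>I. a i * f i x) has_derivative (\<lambda>h. \<Sum>i\<in>I. a i * fder (f i) x h)) (at x)"
  using assms by (intro has_derivative_sum has_derivative_mult_right) (simp add: frechet_derivative_works)
 note d = this frechet_derivative_at[OF this, symmetric]
 have diff: "(\<lambda>x. \<Sum>i\<in>I. a i * f i x) differentiable (at x)" using d(1) unfolding differentiable_def by blast
 show "W j (\<lambda>x. \<Sum>i\<in>I. a i * f i x) x = (\<Sum>i\<in>I. a i * W j (f i) x)"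
  unfolding W_eq[OF diff] d(2) sum_distrib_left sum.distrib[symmetric]
  by (intro sum.cong refl) (simp add: W_eq assms algebra_simps)
 show "Wt j (\<lambda>x. \<Sum>i\<in>I. a i * f i x) x = (\<Sum>i\<in>I. a i * Wt j (f i) x)"
  unfolding Wt_eq[OF diff] d(2) sum_distrib_left sum.distrib[symmetric]
  by (intro sum.cong refl) (simp add: Wt_eq assms algebra_simps)
qed

lemma Ws_sum:
 assumes "\<And>i. i \<in> I ==> gs (f i)"
 shows "Ws j (\<lambda>x. \<Sum>i\<in>I. a i * f i x) x = (\<Sum>i\<in>I. a i * Ws j (f i) x)"
proof -
 have "W j (\<lambda>x. \<Sum>i\<in>I. cnj (a i) * cnj (f i x)) x = (\<Sum>i\<in>I. cnj (a i) * W j (\<lambda>x. cnj (f i x)) x)"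
  by (rule W_sum(1)) (rule tame_exp_differentiable[OF tame_exp_cnj[OF assms]])
 thus ?thesis by (simp add: Ws_def cnj_sum sum_negf)
qed

lemma zero_ops: "Wt j (\<lambda>x. 0) x = 0" "Ws j (\<lambda>x. 0) x = 0"
 using W_sum(2)[of "{}" "\<lambda>_ _. 0" x j "\<lambda>_. 0"] Ws_sum[of "{}" "\<lambda>_ _. 0" j "\<lambda>_. 0" x] by simp_all

definition single :: "'n set => ('x => complex) => ('n, 'x) form" where
 "single K0 V K x = (if K = K0 then V x else 0)"

text \<open>The matrix entry of contraction with k followed by exterior multiplication by j.\<close>

definition up_down :: "nat => 'n set => 'n set => 'n => 'n => complex" where
 "up_down q J K0 j k = (\<Sum>I\<in>\<I> (q - 1). eps j I J * eps k I K0)"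

lemma single_gs: "gs V ==> gs (single K0 V K)"
 unfolding single_def[abs_def] by (cases "K = K0") (simp_all add: tame_exp_zero)

lemma sum_single:
 assumes "K0 \<in> A" "finite A" "\<And>K x. K \<noteq> K0 ==> F K x = 0"
 shows "(\<Sum>K\<in>A. F K x) = (F K0 x :: complex)"
proof -
 have "(\<Sum>K\<in>A. F K x) = (\<Sum>K\<in>{K0}. F K x)"
  by (rule sum.mono_neutral_right) (use assms in auto)
 thus ?thesis by simp
qed

text \<open>\<open>up\<close> and \<open>down\<close> are the operator and its adjoint on the form
  with the single component \<open>V\<close> at \<open>K0\<close>; \<open>up'\<close> and
  \<open>down'\<close> return to degree q and are the two halves of the Laplacian.\<close>

definition up :: "'n set => ('x => complex) => ('n, 'x) form" where
 "up K0 V K x = (\<Sum>j\<in>UNIV. eps j K0 K * Wt j V x)"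

definition down :: "'n set => ('x => complex) => ('n, 'x) form" where
 "down K0 V I x = (\<Sum>k\<in>UNIV. eps k I K0 * Ws k V x)"

definition up' :: "nat => 'n set => ('x => complex) => ('n, 'x) form" where
 "up' q K0 V J x = (\<Sum>K\<in>\<I> (q + 1). \<Sum>k\<in>UNIV. eps k J K * Ws k (up K0 V K) x)"

definition down' :: "nat => 'n set => ('x => complex) => ('n, 'x) form" where
 "down' q K0 V J x = (\<Sum>I\<in>\<I> (q - 1). \<Sum>j\<in>UNIV. eps j I J * Wt j (down K0 V I) x)"

lemma up'_expand:
 assumes V: "gs V"
 shows "up' q K0 V J x = (\<Sum>K\<in>\<I> (q + 1). \<Sum>k\<in>UNIV. \<Sum>j\<in>UNIV. (eps k J K * eps j K0 K) * Ws k (Wt j V) x)"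
 unfolding up'_def up_def[abs_def] Ws_sum[OF gs_Wt[OF V]] sum_distrib_left by (simp only: mult.assoc)

lemma down'_expand:
 assumes V: "gs V"
 shows "down' q K0 V J x = (\<Sum>I\<in>\<I> (q - 1). \<Sum>j\<in>UNIV. \<Sum>k\<in>UNIV. (eps j I J * eps k I K0) * Wt j (Ws k V) x)"
 unfolding down'_def down_def[abs_def] W_sum(2)[OF tame_exp_differentiable[OF gs_Ws[OF V]]] sum_distrib_left by (simp only: mult.assoc)

text \<open>For q = 0 the truncated difference q - 1 is again 0, but no insertion yields the empty
  set, so all signs vanish.\<close>

lemma down'_0: "J \<in> \<I> 0 ==> down' 0 K0 V J x = 0"
 by (simp add: down'_def multi_indices_def eps_def)

lemma parts:
 assumes V: "gs V" and K0: "K0 \<in> \<I> q"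
 shows "Dn q (single K0 V) (up K0 V)" "L2_adjoint D q (up K0 V) (up' q K0 V)"
  "q \<noteq> 0 ==> L2_adjoint D (q - 1) (single K0 V) (down K0 V)" "q \<noteq> 0 ==> Dn (q - 1) (down K0 V) (down' q K0 V)"
proof -
 let ?V = "single K0 V"
 have gg: "gs (up K0 V K)" for K unfolding up_def[abs_def] by (intro tame_exp_sum tame_exp_cmult gs_Wt V)
 have gc: "gs (down K0 V K)" for K unfolding down_def[abs_def] by (intro tame_exp_sum tame_exp_cmult gs_Ws V)
 have z: "Wt j (?V J) x = (if J = K0 then Wt j V x else 0)" "Ws j (?V J) x = (if J = K0 then Ws j V x else 0)" for j J x
  by (cases "J = K0"; simp add: single_def[abs_def] zero_ops)+
 have fin: "finite (\<I> r :: 'n set set)" for r by simp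
 have "Dn q ?V (\<lambda>K x. \<Sum>J\<in>\<I> q. \<Sum>j\<in>UNIV. eps j J K * Wt j (?V J) x)"
  by (rule Dn_gs) (rule single_gs[OF V])
 moreover have "(\<lambda>K x. \<Sum>J\<in>\<I> q. \<Sum>j\<in>UNIV. eps j J K * Wt j (?V J) x) = up K0 V"
 proof (intro ext)
  fix K x
  have "(\<Sum>J\<in>\<I> q. (\<lambda>J x. \<Sum>j\<in>UNIV. eps j J K * Wt j (?V J) x) J x) = (\<lambda>J x. \<Sum>j\<in>UNIV. eps j J K * Wt j (?V J) x) K0 x"
   by (rule sum_single[OF K0 fin]) (simp add: z)
  thus "(\<Sum>J\<in>\<I> q. \<Sum>j\<in>UNIV. eps j J K * Wt j (?V J) x) = up K0 V K x" by (simp add: z up_def)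
 qed
 ultimately show "Dn q ?V (up K0 V)" by (simp only:)
 show "L2_adjoint D q (up K0 V) (up' q K0 V)" unfolding up'_def[abs_def] by (rule adjoint_gs[OF gg])
 show "L2_adjoint D (q - 1) ?V (down K0 V)" "Dn (q - 1) (down K0 V) (down' q K0 V)" if q: "q \<noteq> 0"
 proof -
  have q1: "q - 1 + 1 = q" using q by simp
  have "L2_adjoint D (q - 1) ?V (\<lambda>J x. \<Sum>K\<in>\<I> (q - 1 + 1). \<Sum>j\<in>UNIV. eps j J K * Ws j (?V K) x)"
   by (rule adjoint_gs) (rule single_gs[OF V])
  moreover have "(\<lambda>J x. \<Sum>K\<in>\<I> (q - 1 + 1). \<Sum>j\<in>UNIV. eps j J K * Ws j (?V K) x) = down K0 V"
  proof (intro ext)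
   fix J x
   have "(\<Sum>K\<in>\<I> q. (\<lambda>K x. \<Sum>j\<in>UNIV. eps j J K * Ws j (?V K) x) K x) = (\<lambda>K x. \<Sum>j\<in>UNIV. eps j J K * Ws j (?V K) x) K0 x"
    by (rule sum_single[OF K0 fin]) (simp add: z)
   thus "(\<Sum>K\<in>\<I> (q - 1 + 1). \<Sum>j\<in>UNIV. eps j J K * Ws j (?V K) x) = down K0 V J x" unfolding q1 by (simp add: z down_def)
  qed
  ultimately show "L2_adjoint D (q - 1) ?V (down K0 V)" by (simp only:)
  show "Dn (q - 1) (down K0 V) (down' q K0 V)" unfolding down'_def[abs_def] by (rule Dn_gs[OF gc])
 qed
qed

text \<open>A Weitzenboeck formula: anticommutation of the signs leaves the diagonal sum of
  \<open>Ws j\<close> after \<open>Wt j\<close>, and each exchange of two first-order operators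
  costs a commutator, here multiplication by \<open>\<kappa> j k\<close>.\<close>

lemma parts_sum:
 assumes V: "gs V" and K0: "K0 \<in> \<I> q"
  and com: "\<And>j k x. Wt j (Ws k V) x - Ws k (Wt j V) x = \<kappa> j k x * V x" and J: "J \<in> \<I> q"
 shows "up' q K0 V J x + down' q K0 V J x = (if J = K0 then \<Sum>j\<in>UNIV. Ws j (Wt j V) x else 0)
   + (\<Sum>j\<in>UNIV. \<Sum>k\<in>UNIV. up_down q J K0 j k * \<kappa> j k x) * V x"
proof -
  let ?A = "\<lambda>j k. \<Sum>K\<in>\<I> (q + 1). eps k J K * eps j K0 K"
  have "up' q K0 V J x = (\<Sum>K\<in>\<I> (q + 1). \<Sum>k\<in>UNIV. \<Sum>j\<in>UNIV. (eps k J K * eps j K0 K) * Ws k (Wt j V) x)"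
   by (rule up'_expand[OF V])
  also have "\<dots> = (\<Sum>j\<in>UNIV. \<Sum>k\<in>UNIV. ?A j k * Ws k (Wt j V) x)"
   unfolding sum_distrib_right by (subst sum.swap, subst (2) sum.swap, subst sum.swap) (rule refl)
  finally have h: "up' q K0 V J x = (\<Sum>j\<in>UNIV. \<Sum>k\<in>UNIV. ?A j k * Ws k (Wt j V) x)" .
  have "down' q K0 V J x = (\<Sum>I\<in>\<I> (q - 1). \<Sum>j\<in>UNIV. \<Sum>k\<in>UNIV. (eps j I J * eps k I K0) * Wt j (Ws k V) x)"
   by (rule down'_expand[OF V])
  also have "\<dots> = (\<Sum>j\<in>UNIV. \<Sum>k\<in>UNIV. up_down q J K0 j k * Wt j (Ws k V) x)"
   unfolding up_down_def sum_distrib_right by (subst sum.swap, subst (2) sum.swap) (rule refl)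
  finally have d: "down' q K0 V J x = (\<Sum>j\<in>UNIV. \<Sum>k\<in>UNIV. up_down q J K0 j k * Wt j (Ws k V) x)" .
  have "?A j k * Ws k (Wt j V) x + up_down q J K0 j k * Wt j (Ws k V) x
    = (if j = k \<and> J = K0 then Ws k (Wt j V) x else 0) + (up_down q J K0 j k * \<kappa> j k x) * V x" for j k
  proof -
   have A: "?A j k = (if j = k \<and> J = K0 then 1 else 0) - up_down q J K0 j k"
    using eps_anticommute[OF J K0, of k j] by (simp add: up_down_def eq_diff_eq)
   have B: "Wt j (Ws k V) x = \<kappa> j k x * V x + Ws k (Wt j V) x" using com[of j k x] by (simp add: diff_eq_eq)
   show ?thesis unfolding A B by (simp add: algebra_simps)
  qed
  hence "up' q K0 V J x + down' q K0 V J x = (\<Sum>j\<in>UNIV. \<Sum>k\<in>UNIV. (if j = k \<and> J = K0 then Ws k (Wt j V) x else 0)) + (\<Sum>j\<in>UNIV. \<Sum>k\<in>UNIV. (up_down q J K0 j k * \<kappa> j k x) * V x)"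
   unfolding h d by (simp only: sum.distrib[symmetric])
  moreover have "(\<Sum>j\<in>UNIV. \<Sum>k\<in>UNIV. (if j = k \<and> J = K0 then Ws k (Wt j V) x else 0)) = (if J = K0 then \<Sum>j\<in>UNIV. Ws j (Wt j V) x else 0)"
   by (cases "J = K0") simp_all
  ultimately show ?thesis by (simp only: sum_distrib_right)
qed

lemma laplacian_single:
 assumes V: "gs V" and K0: "K0 \<in> \<I> q"
  and com: "\<And>j k x. Wt j (Ws k V) x - Ws k (Wt j V) x = \<kappa> j k x * V x"
 shows "laplacian D q (single K0 V) (\<lambda>J x. (if J = K0 then \<Sum>j\<in>UNIV. Ws j (Wt j V) x else 0)
   + (\<Sum>j\<in>UNIV. \<Sum>k\<in>UNIV. up_down q J K0 j k * \<kappa> j k x) * V x)"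
proof -
 note p = parts[OF V K0] and ps = parts_sum[OF V K0 com, symmetric]
 \<comment> \<open>\<open>laplacian\<close> prescribes the zero form for q = 0; \<open>down'\<close>
   agrees with it on the only index set of size 0.\<close>
 let ?d = "if q = 0 then (\<lambda>K x. 0) else down' q K0 V"
 have 1: "if q = 0 then ?d = (\<lambda>K x. 0) else L2_adjoint D (q - 1) (single K0 V) (down K0 V) \<and> D (q - 1) (down K0 V) ?d"
  using p(3,4) Dn_D by simp
 have 2: "\<forall>J\<in>\<I> q. \<forall>x. (if J = K0 then \<Sum>j\<in>UNIV. Ws j (Wt j V) x else 0)
   + (\<Sum>j\<in>UNIV. \<Sum>k\<in>UNIV. up_down q J K0 j k * \<kappa> j k x) * V x = up' q K0 V J x + ?d J x"
 proof (intro ballI allI)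
  fix J :: "'n set" and x assume J: "J \<in> \<I> q"
  have "?d J x = down' q K0 V J x" using down'_0 J by (cases "q = 0") simp_all
  thus "(if J = K0 then \<Sum>j\<in>UNIV. Ws j (Wt j V) x else 0)
   + (\<Sum>j\<in>UNIV. \<Sum>k\<in>UNIV. up_down q J K0 j k * \<kappa> j k x) * V x = up' q K0 V J x + ?d J x"
   using ps[OF J] by (simp only:)
 qed
 show ?thesis unfolding laplacian_iff_via laplacian_via_def
  by (rule exI[of _ "up K0 V"], rule exI[of _ "up' q K0 V"], rule exI[of _ "down K0 V"], rule exI[of _ ?d])
   (intro conjI 1 2 p(2) Dn_D[OF p(1)])
qed

text \<open>The principal part of \<open>Wt j\<close> and of \<open>W j\<close>, i.e. the derivation
  in the product rules below.\<close>

definition L :: "'n => ('x => complex) => 'x => complex" where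
 "L j t x = fder t x (X j x) + \<i> * fder t x (Y j x)"

lemma Wt_mult:
 assumes "t differentiable (at x)" "V differentiable (at x)"
 shows "Wt j (\<lambda>x. t x * V x) x = t x * Wt j V x + L j t x * V x"
 unfolding Wt_eq[OF assms(2)] Wt_eq[OF differentiable_mult[OF assms]] frechet_derivative_mult[OF assms] L_def
 by (simp add: algebra_simps)

lemma Ws_mult:
 assumes "(\<lambda>x. cnj (t x)) differentiable (at x)" "(\<lambda>x. cnj (V x)) differentiable (at x)"
 shows "Ws j (\<lambda>x. t x * V x) x = t x * Ws j V x - cnj (L j (\<lambda>x. cnj (t x)) x) * V x"
 unfolding Ws_def complex_cnj_mult
  W_eq[OF assms(2)] W_eq[OF differentiable_mult[OF assms]] frechet_derivative_mult[OF assms] L_def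
 by (simp add: algebra_simps)

end

section \<open>Coefficients of the Mehler kernel\<close>

text \<open>\<open>mehler_a\<close> is the decay rate in |z_j|^2 and \<open>mehler_b\<close> the
  normalization of the kernel; the value 1/s is their common limit for m to 0. They satisfy a' =
  -b^2, b' = -a b and a^2 - m^2 = b^2, which is all that the heat equation needs.\<close>

definition mehler_a :: "real => real => real" where
 "mehler_a m s = (if m = 0 then 1 / s else m * coth (m * s))"

definition mehler_b :: "real => real => real" where
 "mehler_b m s = (if m = 0 then 1 / s else m / sinh (m * s))"

lemma sinh_gt_self: "x > 0 ==> x < sinh (x::real)"
proof -
 assume x: "x > 0"
 have "(\<lambda>x. sinh x - x) 0 < (\<lambda>x. sinh x - x) x"
 proof (rule DERIV_pos_imp_increasing_open[OF x])
  fix y :: real assume "0 < y" "y < x"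
  moreover have "((\<lambda>x. sinh x - x) has_real_derivative (cosh y - 1)) (at y)"
   by (auto intro!: derivative_eq_intros)
  moreover have "cosh y > 1" if "y > 0" using cosh_real_strict_mono[of 0 y] that by simp
  ultimately show "\<exists>z. ((\<lambda>x. sinh x - x) has_real_derivative z) (at y) \<and> 0 < z" by (intro exI[of _ "cosh y - 1"]) auto
 qed (intro continuous_intros)
 thus ?thesis by simp
qed

lemma sinh_le_self_cosh: "x > 0 ==> sinh x \<le> x * cosh (x::real)"
proof -
 assume x: "x > 0"
 have "(\<lambda>x. x * cosh x - sinh x) 0 \<le> (\<lambda>x. x * cosh x - sinh x) x"
 proof (rule DERIV_nonneg_imp_nondecreasing[OF less_imp_le[OF x]])
  fix y :: real assume "0 \<le> y" "y \<le> x"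
  moreover have "((\<lambda>x. x * cosh x - sinh x) has_real_derivative (y * sinh y)) (at y)"
   by (auto intro!: derivative_eq_intros)
  ultimately show "\<exists>z. ((\<lambda>x. x * cosh x - sinh x) has_real_derivative z) (at y) \<and> 0 \<le> z" by (intro exI[of _ "y * sinh y"]) auto
 qed
 thus ?thesis by simp
qed

text \<open>x (cosh x - sinh x) = x exp(-x) <= x < sinh x.\<close>

lemma self_cosh_le: "x > 0 ==> x * cosh x \<le> (1 + x) * sinh (x::real)"
proof -
 assume x: "x > 0"
 have "x * exp (- x) \<le> x * 1" using x by (intro mult_left_mono) auto
 hence "x * (cosh x - sinh x) \<le> sinh x" using sinh_gt_self[OF x] by (simp add: cosh_minus_sinh)
 thus ?thesis by (simp add: algebra_simps)
qed

lemma mehler_minus: "mehler_a (- m) s = mehler_a m s" "mehler_b (- m) s = mehler_b m s"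
 by (simp_all add: mehler_a_def mehler_b_def coth_def)

lemma mehler_bounds_pos:
 assumes s: "s > 0" and m: "m \<ge> 0"
 shows "0 < mehler_b m s" "mehler_b m s \<le> 1 / s" "1 / s \<le> mehler_a m s" "mehler_a m s \<le> 1 / s + m"
proof -
 have x: "m * s > 0" if "m \<noteq> 0" using s m that by simp
 show "0 < mehler_b m s" using x s m by (auto simp: mehler_b_def)
 show "mehler_b m s \<le> 1 / s"
  using sinh_gt_self[OF x] x s m by (auto simp: mehler_b_def field_simps)
 show "1 / s \<le> mehler_a m s"
  using sinh_le_self_cosh[OF x] x s m by (auto simp: mehler_a_def coth_def field_simps)
 show "mehler_a m s \<le> 1 / s + m"
  using self_cosh_le[OF x] x s m by (auto simp: mehler_a_def coth_def field_simps)
qed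

text \<open>Both coefficients are even in \<open>m\<close>, which reduces to m >= 0. Comparison with
  the flat value 1/s will dominate all kernels by flat heat kernels.\<close>

lemma mehler_bounds:
 assumes s: "s > 0"
 shows "0 < mehler_b m s" "mehler_b m s \<le> 1 / s" "1 / s \<le> mehler_a m s" "mehler_a m s \<le> 1 / s + \<bar>m\<bar>" "0 < mehler_a m s"
proof -
 show 1: "0 < mehler_b m s" "mehler_b m s \<le> 1 / s" "1 / s \<le> mehler_a m s" "mehler_a m s \<le> 1 / s + \<bar>m\<bar>"
 proof -
  have "mehler_b \<bar>m\<bar> s = mehler_b m s" "mehler_a \<bar>m\<bar> s = mehler_a m s"
   by (cases "m \<ge> 0"; simp add: mehler_minus)+
  with mehler_bounds_pos[OF s abs_ge_zero[of m]]
  show "0 < mehler_b m s" "mehler_b m s \<le> 1 / s" "1 / s \<le> mehler_a m s" "mehler_a m s \<le> 1 / s + \<bar>m\<bar>"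
   by (simp_all only:)
 qed
 have "0 < 1 / s" using s by simp
 with 1(3) show "0 < mehler_a m s" by linarith
qed

lemma mehler_sq: "s > 0 ==> (mehler_a m s)^2 - m\<^sup>2 = (mehler_b m s)^2"
proof (cases "m = 0")
 case False
 assume "s > 0"
 hence sh: "sinh (m * s) \<noteq> 0" using False by simp
 have "(m * coth (m * s))^2 - m\<^sup>2 = m^2 * ((cosh (m * s))^2 - (sinh (m * s))\<^sup>2) / (sinh (m * s))^2"
  using sh by (simp add: coth_def power_mult_distrib power_divide field_simps)
 thus ?thesis using False by (simp add: mehler_a_def mehler_b_def cosh_square_eq power_divide)
qed (simp add: mehler_a_def mehler_b_def)

lemma mehler_deriv:
 assumes s: "s > 0"
 shows "(mehler_a m has_real_derivative - (mehler_b m s)\<^sup>2) (at s)"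
  "(mehler_b m has_real_derivative - (mehler_a m s * mehler_b m s)) (at s)"
proof -
 have z: "((\<lambda>s. 1 / s) has_real_derivative - (1 / s^2)) (at s)"
  using s by (auto intro!: derivative_eq_intros simp: power2_eq_square)
 have sh: "sinh (m * s) \<noteq> 0" if "m \<noteq> 0" using s that by simp
 show "(mehler_a m has_real_derivative - (mehler_b m s)\<^sup>2) (at s)"
 proof (cases "m = 0")
  case True
  hence "mehler_a m = (\<lambda>s. 1 / s)" by (simp add: fun_eq_iff mehler_a_def)
  thus ?thesis using z True by (simp add: mehler_b_def power_divide)
 next
  case False
  hence e: "mehler_a m = (\<lambda>s. m * (cosh (m * s) / sinh (m * s)))" by (simp add: fun_eq_iff mehler_a_def coth_def)
  have "((\<lambda>s. m * (cosh (m * s) / sinh (m * s))) has_real_derivative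
    m * ((sinh (m * s) * m * sinh (m * s) - cosh (m * s) * (cosh (m * s) * m)) / (sinh (m * s) * sinh (m * s)))) (at s)"
   using sh[OF False] by (auto intro!: derivative_eq_intros simp: algebra_simps)
  moreover have "m * ((sinh (m * s) * m * sinh (m * s) - cosh (m * s) * (cosh (m * s) * m)) / (sinh (m * s) * sinh (m * s))) = - (mehler_b m s)\<^sup>2"
  proof -
   have n: "m * (sinh (m * s) * m * sinh (m * s) - cosh (m * s) * (cosh (m * s) * m)) = - (m^2)"
    using cosh_square_eq[of "m * s"] by (simp add: power2_eq_square algebra_simps)
   show ?thesis unfolding times_divide_eq_right n using False by (simp add: mehler_b_def power_divide power2_eq_square)
  qed
  ultimately show ?thesis unfolding e by (simp only:)
 qed
 show "(mehler_b m has_real_derivative - (mehler_a m s * mehler_b m s)) (at s)"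
 proof (cases "m = 0")
  case True
  hence "mehler_b m = (\<lambda>s. 1 / s)" by (simp add: fun_eq_iff mehler_b_def)
  thus ?thesis using z True by (simp add: mehler_a_def mehler_b_def power2_eq_square)
 next
  case False
  hence e: "mehler_b m = (\<lambda>s. m / sinh (m * s))" by (simp add: fun_eq_iff mehler_b_def)
  have "((\<lambda>s. m / sinh (m * s)) has_real_derivative
    (0 * sinh (m * s) - m * (cosh (m * s) * m)) / (sinh (m * s) * sinh (m * s))) (at s)"
   using sh[OF False] by (auto intro!: derivative_eq_intros)
  moreover have "(0 * sinh (m * s) - m * (cosh (m * s) * m)) / (sinh (m * s) * sinh (m * s)) = - (mehler_a m s * mehler_b m s)"
   using False by (simp add: mehler_a_def mehler_b_def coth_def)
  ultimately show ?thesis unfolding e by (simp only:)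
 qed
qed

lemma mehler_lim:
 "((\<lambda>s. s * mehler_a m s) \<longlongrightarrow> 1) (at_right 0)" "((\<lambda>s. s * mehler_b m s) \<longlongrightarrow> 1) (at_right 0)"
proof -
 have pos: "\<forall>\<^sub>F s in at_right 0. s > (0::real)" by (rule eventually_at_right_less)
 have l: "((\<lambda>s. 1 + s * \<bar>m\<bar>) \<longlongrightarrow> 1 + 0 * \<bar>m\<bar>) (at_right 0)" by (intro tendsto_intros)
 show a: "((\<lambda>s. s * mehler_a m s) \<longlongrightarrow> 1) (at_right 0)"
 proof (rule tendsto_sandwich[OF _ _ tendsto_const])
  show "\<forall>\<^sub>F s in at_right 0. 1 \<le> s * mehler_a m s"
   using pos by eventually_elim (use mehler_bounds(3)[of _ m] in \<open>simp add: divide_le_eq mult.commute\<close>)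
  show "\<forall>\<^sub>F s in at_right 0. s * mehler_a m s \<le> 1 + s * \<bar>m\<bar>"
   using pos
  proof eventually_elim
   case (elim s)
   have "s * mehler_a m s \<le> s * (1 / s + \<bar>m\<bar>)" using mehler_bounds(4)[of s m] elim by (intro mult_left_mono) auto
   thus ?case using elim by (simp add: distrib_left)
  qed
  show "((\<lambda>s. 1 + s * \<bar>m\<bar>) \<longlongrightarrow> 1) (at_right 0)" using l by simp
 qed
 \<comment> \<open>By a^2 - m^2 = b^2 the limit of s b follows from that of s a.\<close>
 have "((\<lambda>s. sqrt ((s * mehler_a m s)^2 - (s * m)\<^sup>2)) \<longlongrightarrow> sqrt (1^2 - (0 * m)\<^sup>2)) (at_right 0)"
  by (intro tendsto_intros a)
 moreover have "\<forall>\<^sub>F s in at_right 0. sqrt ((s * mehler_a m s)^2 - (s * m)\<^sup>2) = s * mehler_b m s"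
  using pos
 proof eventually_elim
  case (elim s)
  have "(s * mehler_a m s)^2 - (s * m)\<^sup>2 = (s * mehler_b m s)^2"
   unfolding power_mult_distrib mehler_sq[OF elim, symmetric] by (simp add: right_diff_distrib)
  thus ?case using mehler_bounds(1)[OF elim, of m] elim by simp
 qed
 ultimately show "((\<lambda>s. s * mehler_b m s) \<longlongrightarrow> 1) (at_right 0)"
  using tendsto_cong by force
qed

section \<open>Coordinates\<close>

lemma cinner_add: "cinner (x + y) z = cinner x z + cinner y z"
 by (simp add: cinner_def distrib_right sum.distrib)

lemma cinner_cmult: "cinner (c *s x) z = c * cinner x z"
 by (simp add: cinner_def sum_distrib_left mult.assoc)

lemma cinner_cnj: "cinner x y = cnj (cinner y x)"
 by (simp add: cinner_def mult.commute)

lemma cinner_sum: "cinner (\<Sum>i\<in>I. f i) z = (\<Sum>i\<in>I. cinner (f i) z)"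
 by (induction I rule: infinite_finite_induct) (simp_all add: cinner_add, simp_all add: cinner_def)

lemma cinner_diff: "cinner (x - y) z = cinner x z - cinner y z"
 by (simp add: cinner_def left_diff_distrib sum_subtractf)

lemma scaleR_vec_cmult: "r *\<^sub>R (x :: 'n::finite cspace) = of_real r *s x"
 unfolding vec_eq_iff by (simp add: scaleR_conv_of_real[symmetric])

lemma cinner_bounded_linear: "bounded_linear (\<lambda>x::'n::finite cspace. cinner x z)"
 unfolding linear_conv_bounded_linear[symmetric]
 by (rule linearI) (simp_all add: cinner_add scaleR_vec_cmult cinner_cmult scaleR_conv_of_real)

lemma cinner_self: "cinner z z = of_real ((norm z)^2)"
proof -
 have "(norm z)^2 = (\<Sum>i\<in>UNIV. (cmod (z $ i))^2)" by (simp add: norm_vec_def L2_set_def sum_nonneg)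
 thus ?thesis by (simp only: cinner_def of_real_sum complex_norm_square)
qed

text \<open>Orthonormality says that the conjugate transpose of the basis matrix is a left inverse.
  For square matrices it is then a right inverse, which is the expansion.\<close>

lemma orthonormal_expansion:
 fixes v :: "'n::finite => 'n cspace"
 assumes "\<And>j k. cinner (v j) (v k) = (if j = k then 1 else 0)"
 shows "(\<Sum>j\<in>UNIV. cinner z (v j) *s v j) = z"
proof -
 let ?A = "(\<chi> i j. cnj (v i $ j)) :: complex ^ 'n ^ 'n" and ?B = "(\<chi> i j. v j $ i) :: complex ^ 'n ^ 'n"
 have "?A ** ?B = mat 1"
  unfolding vec_eq_iff matrix_matrix_mult_def mat_def
  using assms by (simp add: cinner_def mult.commute)
 hence BA: "?B ** ?A = mat 1" by (simp add: matrix_left_right_inverse)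
 have "z = (?B ** ?A) *v z" by (simp add: BA)
 also have "\<dots> = ?B *v (?A *v z)" by (simp add: matrix_vector_mul_assoc)
 also have "\<dots> = (\<Sum>j\<in>UNIV. cinner z (v j) *s v j)"
  by (simp add: vec_eq_iff matrix_vector_mult_def cinner_def mult.commute sum_component)
 finally show ?thesis by simp
qed

locale diag_form =
 fixes \<phi> :: "'n::{finite,linorder} cspace => 'n cspace => 'm::finite cspace"
  and \<xi> :: "'m rspace" and v :: "'n => 'n cspace" and \<mu> :: "'n => real"
 assumes sesq: "sesquilinear_form \<phi>" and diag: "diagonalizing_basis \<phi> \<xi> v \<mu>"
begin

definition crd :: "'n => 'n cspace => complex" where "crd j z = cinner z (v j)"

lemma crd_v [simp]: "crd j (v k) = (if j = k then 1 else 0)"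
 using diag by (simp add: crd_def diagonalizing_basis_def)

lemma crd_iv [simp]: "crd j (\<i> *s v k) = (if j = k then \<i> else 0)"
 using diag by (simp add: crd_def diagonalizing_basis_def cinner_cmult)

lemma crd_expansion: "(\<Sum>j\<in>UNIV. crd j z *s v j) = z"
 unfolding crd_def using diag by (intro orthonormal_expansion) (simp add: diagonalizing_basis_def)

lemma crd_linear: "bounded_linear (crd j)"
 unfolding crd_def[abs_def] by (rule cinner_bounded_linear)

lemma crd_diff: "crd j (x - y) = crd j x - crd j y"
 by (simp add: crd_def cinner_diff)

lemma norm_crd: "(norm z)^2 = (\<Sum>j\<in>UNIV. (cmod (crd j z))^2)"
proof -
 have "complex_of_real ((norm z)^2) = cinner (\<Sum>j\<in>UNIV. crd j z *s v j) z"
  by (simp only: crd_expansion cinner_self)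
 also have "\<dots> = (\<Sum>j\<in>UNIV. crd j z * cnj (crd j z))"
  unfolding cinner_sum cinner_cmult by (intro sum.cong refl) (simp add: crd_def cinner_cnj[of "v _" z])
 also have "\<dots> = of_real (\<Sum>j\<in>UNIV. (cmod (crd j z))^2)"
  by (simp only: of_real_sum complex_norm_square)
 finally show ?thesis by (simp only: of_real_eq_iff)
qed

lemma crd_le: "cmod (crd j z) \<le> norm z"
proof (rule power2_le_imp_le)
 show "(cmod (crd j z))^2 \<le> (norm z)^2" unfolding norm_crd by (rule member_le_sum) auto
qed simp

lemma phi_add: "\<phi> (x + y) z = \<phi> x z + \<phi> y z" "\<phi> x (y + z) = \<phi> x y + \<phi> x z"
 and phi_cmult: "\<phi> (c *s x) z = c *s \<phi> x z" "\<phi> x (c *s z) = cnj c *s \<phi> x z"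
 and phi_cnj: "\<phi> x z $ i = cnj (\<phi> z x $ i)"
 using sesq unfolding sesquilinear_form_def by blast+

lemma phi_zero: "\<phi> 0 z = 0" "\<phi> z 0 = 0"
 using phi_cmult[of 0 0 z] phi_cmult(2)[of z 0 0] by simp_all

lemma phi_sum: "\<phi> (\<Sum>i\<in>I. f i) z = (\<Sum>i\<in>I. \<phi> (f i) z)" "\<phi> z (\<Sum>i\<in>I. f i) = (\<Sum>i\<in>I. \<phi> z (f i))"
 by (induction I rule: infinite_finite_induct) (simp_all add: phi_add phi_zero)

lemma phi_crd: "\<phi> z (v k) $ i = (\<Sum>l\<in>UNIV. \<phi> (v l) (v k) $ i * crd l z)"
proof -
 have "\<phi> z (v k) = \<phi> (\<Sum>l\<in>UNIV. crd l z *s v l) (v k)" by (simp only: crd_expansion)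
 thus ?thesis by (simp add: phi_sum phi_cmult sum_component mult.commute)
qed

lemma form_vv: "(\<Sum>i\<in>UNIV. \<phi> (v j) (v k) $ i * of_real (\<xi> $ i)) = (if j = k then of_real (\<mu> j) else 0)"
 using diag by (simp add: diagonalizing_basis_def form_at_def)

lemma form_v: "form_at \<phi> \<xi> z (v k) = of_real (\<mu> k) * crd k z"
proof -
 have "form_at \<phi> \<xi> z (v k) = (\<Sum>l\<in>UNIV. crd l z * (\<Sum>i\<in>UNIV. \<phi> (v l) (v k) $ i * of_real (\<xi> $ i)))"
  unfolding form_at_def phi_crd[of z] sum_distrib_left sum_distrib_right
  by (subst sum.swap) (simp only: mult_ac)
 also have "\<dots> = (\<Sum>l\<in>UNIV. if l = k then crd l z * of_real (\<mu> l) else 0)"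
  unfolding form_vv by (intro sum.cong refl) simp
 also have "\<dots> = of_real (\<mu> k) * crd k z" by (simp add: mult.commute)
 finally show ?thesis .
qed

lemma form_crd: "form_at \<phi> \<xi> z w = (\<Sum>j\<in>UNIV. of_real (\<mu> j) * crd j z * cnj (crd j w))"
proof -
 have "form_at \<phi> \<xi> z w = form_at \<phi> \<xi> z (\<Sum>j\<in>UNIV. crd j w *s v j)" by (simp only: crd_expansion)
 also have "\<dots> = (\<Sum>j\<in>UNIV. cnj (crd j w) * form_at \<phi> \<xi> z (v j))"
  unfolding form_at_def phi_sum phi_cmult sum_component sum_distrib_left sum_distrib_right
  by (subst sum.swap) (simp add: mult_ac)
 finally show ?thesis by (simp add: form_v mult_ac)
qed

lemma im_form_crd: "\<xi> \<bullet> im_form \<phi> z w = Im (form_at \<phi> \<xi> z w)"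
 by (simp add: inner_vec_def im_form_def form_at_def mult.commute)

section \<open>The phase and the Mehler kernel of the diagonalized form\<close>

definition Phase :: "'n cspace => 'n cspace => complex" where
 "Phase z w = exp (- 2 * \<i> * of_real (\<xi> \<bullet> im_form \<phi> z w))"

lemma Phase_crd: "Phase z w = exp (- (\<Sum>j\<in>UNIV. of_real (\<mu> j) * (crd j z * cnj (crd j w) - cnj (crd j z) * crd j w)))"
proof -
 have "- 2 * \<i> * of_real (Im c) = - (c - cnj c)" for c by (simp add: complex_eq_iff)
 hence "- 2 * \<i> * of_real (\<xi> \<bullet> im_form \<phi> z w) = - (form_at \<phi> \<xi> z w - cnj (form_at \<phi> \<xi> z w))"
  unfolding im_form_crd .
 also have "\<dots> = - (\<Sum>j\<in>UNIV. of_real (\<mu> j) * (crd j z * cnj (crd j w) - cnj (crd j z) * crd j w))"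
  unfolding form_crd by (simp add: right_diff_distrib sum_subtractf mult_ac)
 finally show ?thesis unfolding Phase_def by (rule arg_cong)
qed

lemma Phase_norm [simp]: "cmod (Phase z w) = 1"
 by (simp add: Phase_def)

text \<open>The product of \<open>eps_sign \<mu> K j\<close> and |\<mu> j|, written without signs so
  that \<mu> j = 0 needs no special case.\<close>

definition sgn_rate :: "'n set => 'n => real" where
 "sgn_rate K j = (if j \<in> K then \<mu> j else - \<mu> j)"

text \<open>A product over j; for \<mu> j = 0 the factor is exp(-|z_j|^2 / s) / (pi s), the heat
  kernel of a quarter of the Laplacian in the plane.\<close>

definition mehler :: "'n set => real => 'n cspace => real" where
 "mehler K s z = (\<Prod>j\<in>UNIV. mehler_b (\<mu> j) s * exp (s * sgn_rate K j) / pi) *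
   exp (- (\<Sum>j\<in>UNIV. mehler_a (\<mu> j) s * (cmod (crd j z))^2))"

text \<open>The logarithmic derivative of \<open>mehler\<close> in s. It is explicit because a' =
  -b^2 and b' = -a b.\<close>

definition mehler_rate :: "'n set => real => 'n cspace => real" where
 "mehler_rate K s z = (\<Sum>j\<in>UNIV. - mehler_a (\<mu> j) s + sgn_rate K j + (mehler_b (\<mu> j) s)^2 * (cmod (crd j z))^2)"

lemma mehler_deriv_s:
 assumes s: "s > 0"
 shows "((\<lambda>s. mehler K s z) has_real_derivative mehler_rate K s z * mehler K s z) (at s)"
proof -
 define f where "f j s = mehler_b (\<mu> j) s * exp (s * sgn_rate K j) / pi" for j s
 define e where "e s = exp (- (\<Sum>j\<in>UNIV. mehler_a (\<mu> j) s * (cmod (crd j z))^2))" for s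
 have f: "(f j has_real_derivative (- mehler_a (\<mu> j) s + sgn_rate K j) * f j s) (at s)" for j
 proof -
  have "((\<lambda>s. exp (s * sgn_rate K j)) has_real_derivative exp (s * sgn_rate K j) * sgn_rate K j) (at s)"
   by (auto intro!: derivative_eq_intros)
  from DERIV_cdivide[OF DERIV_mult[OF mehler_deriv(2)[OF s, of "\<mu> j"] this], of pi]
  show ?thesis unfolding f_def[abs_def] by (rule DERIV_cong) (simp add: field_simps)
 qed
 have P: "((\<lambda>s. \<Prod>j\<in>A. f j s) has_real_derivative (\<Sum>j\<in>A. - mehler_a (\<mu> j) s + sgn_rate K j) * (\<Prod>j\<in>A. f j s)) (at s)" if "finite A" for A
  using that
 proof induction
  case (insert j A)
  show ?case unfolding prod.insert[OF insert(1,2)] sum.insert[OF insert(1,2)]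
   by (rule DERIV_cong[OF DERIV_mult[OF f[of j] insert(3)]]) (simp add: algebra_simps)
 qed simp
 have E: "(e has_real_derivative e s * (- (\<Sum>j\<in>UNIV. - (mehler_b (\<mu> j) s)\<^sup>2 * (cmod (crd j z))^2))) (at s)"
  unfolding e_def[abs_def] by (intro DERIV_fun_exp DERIV_minus DERIV_sum DERIV_cmult_right mehler_deriv s)
 have r: "mehler_rate K s z = (\<Sum>j\<in>UNIV. - mehler_a (\<mu> j) s + sgn_rate K j) + (- (\<Sum>j\<in>UNIV. - (mehler_b (\<mu> j) s)\<^sup>2 * (cmod (crd j z))^2))"
  unfolding mehler_rate_def by (simp add: sum.distrib sum_negf)
 have m: "mehler K s z = (\<Prod>j\<in>UNIV. f j s) * e s" for s by (simp add: mehler_def f_def e_def)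
 show ?thesis unfolding m[abs_def] m r
  by (rule DERIV_cong[OF DERIV_mult[OF P[OF finite] E]]) (simp only: distrib_right distrib_left mult_ac)
qed

lemma mehler_pos: "s > 0 ==> mehler K s z > 0"
 unfolding mehler_def by (intro mult_pos_pos prod_pos ballI divide_pos_pos mehler_bounds) auto

definition mu_sum :: real where "mu_sum = (\<Sum>j\<in>UNIV. \<bar>\<mu> j\<bar>)"

lemma mu_sum_nonneg: "mu_sum \<ge> 0" by (simp add: mu_sum_def sum_nonneg)

text \<open>Up to exp(s \<open>mu_sum\<close>) the right-hand side is the flat heat kernel, by b <=
  1/s and a >= 1/s in every factor.\<close>

lemma mehler_le:
 assumes s: "s > 0"
 shows "mehler K s z \<le> exp (s * mu_sum) * (1 / (pi * s)) ^ CARD('n) * exp (- ((norm z)^2 / s))"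
proof -
 have "(\<Prod>j\<in>UNIV. mehler_b (\<mu> j) s * exp (s * sgn_rate K j) / pi) \<le> (\<Prod>j\<in>UNIV. 1 / (pi * s) * exp (s * \<bar>\<mu> j\<bar>))"
 proof (intro prod_mono conjI)
  fix j
  have "mehler_b (\<mu> j) s * exp (s * sgn_rate K j) / pi \<le> (1 / s) * exp (s * \<bar>\<mu> j\<bar>) / pi"
   using mehler_bounds[OF s, of "\<mu> j"] s
   by (intro divide_right_mono mult_mono) (auto simp: sgn_rate_def)
  thus "mehler_b (\<mu> j) s * exp (s * sgn_rate K j) / pi \<le> 1 / (pi * s) * exp (s * \<bar>\<mu> j\<bar>)" by (simp add: mult.commute)
  show "0 \<le> mehler_b (\<mu> j) s * exp (s * sgn_rate K j) / pi"
   using mehler_bounds[OF s, of "\<mu> j"] by simp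
 qed
 also have "\<dots> = exp (s * mu_sum) * (1 / (pi * s)) ^ CARD('n)"
  by (simp only: prod.distrib prod_constant mu_sum_def sum_distrib_left exp_sum[OF finite] mult.commute)
 finally have 1: "(\<Prod>j\<in>UNIV. mehler_b (\<mu> j) s * exp (s * sgn_rate K j) / pi) \<le> exp (s * mu_sum) * (1 / (pi * s)) ^ CARD('n)" .
 have "(norm z)^2 / s = (\<Sum>j\<in>UNIV. 1 / s * (cmod (crd j z))^2)"
  by (simp add: norm_crd sum_divide_distrib)
 also have "\<dots> \<le> (\<Sum>j\<in>UNIV. mehler_a (\<mu> j) s * (cmod (crd j z))^2)"
  using mehler_bounds[OF s] by (intro sum_mono mult_right_mono) auto
 finally show ?thesis unfolding mehler_def
  using 1 s by (intro mult_mono) auto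
qed

lemma mehler_continuous: "continuous_on UNIV (mehler K s)"
 unfolding mehler_def[abs_def]
 by (intro continuous_intros linear_continuous_on crd_linear)


section \<open>Wirtinger derivatives in coordinates\<close>

text \<open>A derivative in Wirtinger form: \<alpha> j and \<beta> j are the derivatives in z_j and
  its conjugate, \<gamma> i the one in t_i. The maps \<pi> and \<tau> let one calculus serve both
  spaces: identity and zero for the weighted operator, \<open>fst\<close> and \<open>snd\<close> for
  the quadric.\<close>

definition gder :: "('x::euclidean_space => 'n cspace) => ('x => 'm rspace) => ('x => complex) => 'x =>
  ('n => complex) => ('n => complex) => ('m => complex) => bool" where
 "gder \<pi> \<tau> t x \<alpha> \<beta> \<gamma> \<longleftrightarrow> (t has_derivative (\<lambda>h. (\<Sum>j\<in>UNIV. \<alpha> j * crd j (\<pi> h) + \<beta> j * cnj (crd j (\<pi> h)))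
   + (\<Sum>i\<in>UNIV. \<gamma> i * of_real (\<tau> h $ i)))) (at x)"

lemma gder_differentiable: "gder \<pi> \<tau> t x \<alpha> \<beta> \<gamma> ==> t differentiable (at x)"
 unfolding gder_def differentiable_def by (rule exI)

lemma gder_frechet: "gder \<pi> \<tau> t x \<alpha> \<beta> \<gamma> ==> fder t x h =
  (\<Sum>j\<in>UNIV. \<alpha> j * crd j (\<pi> h) + \<beta> j * cnj (crd j (\<pi> h))) + (\<Sum>i\<in>UNIV. \<gamma> i * of_real (\<tau> h $ i))"
 unfolding gder_def by (drule frechet_derivative_at) (drule fun_cong[where x=h], erule sym)

lemma gder_cong:
 assumes "gder \<pi> \<tau> t x \<alpha> \<beta> \<gamma>" "\<And>j. \<alpha> j = \<alpha>' j" "\<And>j. \<beta> j = \<beta>' j" "\<And>i. \<gamma> i = \<gamma>' i"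
 shows "gder \<pi> \<tau> t x \<alpha>' \<beta>' \<gamma>'"
proof -
 have "\<alpha> = \<alpha>'" "\<beta> = \<beta>'" "\<gamma> = \<gamma>'" using assms(2-4) by (simp_all add: fun_eq_iff)
 thus ?thesis using assms(1) by simp
qed

lemma gder_const: "gder \<pi> \<tau> (\<lambda>_. c) x (\<lambda>_. 0) (\<lambda>_. 0) (\<lambda>_. 0)"
 by (simp add: gder_def)

lemma gder_add:
 assumes "gder \<pi> \<tau> t x \<alpha> \<beta> \<gamma>" "gder \<pi> \<tau> u x \<alpha>' \<beta>' \<gamma>'"
 shows "gder \<pi> \<tau> (\<lambda>x. t x + u x) x (\<lambda>j. \<alpha> j + \<alpha>' j) (\<lambda>j. \<beta> j + \<beta>' j) (\<lambda>i. \<gamma> i + \<gamma>' i)"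
 unfolding gder_def
 by (rule has_derivative_eq_rhs[OF has_derivative_add[OF assms[unfolded gder_def]]])
  (simp add: fun_eq_iff distrib_right sum.distrib)

lemma gder_mult:
 assumes "gder \<pi> \<tau> t x \<alpha> \<beta> \<gamma>" "gder \<pi> \<tau> u x \<alpha>' \<beta>' \<gamma>'"
 shows "gder \<pi> \<tau> (\<lambda>x. t x * u x) x (\<lambda>j. t x * \<alpha>' j + \<alpha> j * u x) (\<lambda>j. t x * \<beta>' j + \<beta> j * u x) (\<lambda>i. t x * \<gamma>' i + \<gamma> i * u x)"
 unfolding gder_def
 by (rule has_derivative_eq_rhs[OF has_derivative_mult[OF assms[unfolded gder_def]]])
  (simp add: fun_eq_iff algebra_simps sum.distrib sum_distrib_left)

lemma gder_cmult:
 assumes "gder \<pi> \<tau> t x \<alpha> \<beta> \<gamma>"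
 shows "gder \<pi> \<tau> (\<lambda>x. c * t x) x (\<lambda>j. c * \<alpha> j) (\<lambda>j. c * \<beta> j) (\<lambda>i. c * \<gamma> i)"
 by (rule gder_cong[OF gder_mult[OF gder_const assms]]) simp_all

lemma gder_cnj:
 assumes "gder \<pi> \<tau> t x \<alpha> \<beta> \<gamma>"
 shows "gder \<pi> \<tau> (\<lambda>x. cnj (t x)) x (\<lambda>j. cnj (\<beta> j)) (\<lambda>j. cnj (\<alpha> j)) (\<lambda>i. cnj (\<gamma> i))"
 unfolding gder_def
 by (rule has_derivative_eq_rhs[OF has_derivative_cnj[OF assms[unfolded gder_def]]])
  (simp add: fun_eq_iff algebra_simps cnj_sum)

lemma gder_exp:
 assumes "gder \<pi> \<tau> t x \<alpha> \<beta> \<gamma>"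
 shows "gder \<pi> \<tau> (\<lambda>x. exp (t x)) x (\<lambda>j. exp (t x) * \<alpha> j) (\<lambda>j. exp (t x) * \<beta> j) (\<lambda>i. exp (t x) * \<gamma> i)"
 unfolding gder_def
 by (rule has_derivative_eq_rhs[OF has_derivative_compose[OF assms[unfolded gder_def] DERIV_exp[of "t x", unfolded has_field_derivative_def]]])
  (simp add: fun_eq_iff distrib_left sum_distrib_left mult.assoc)

lemma gder_sum:
 assumes "\<And>i. i \<in> I ==> gder \<pi> \<tau> (t i) x (\<alpha> i) (\<beta> i) (\<gamma> i)"
 shows "gder \<pi> \<tau> (\<lambda>x. \<Sum>i\<in>I. t i x) x (\<lambda>j. \<Sum>i\<in>I. \<alpha> i j) (\<lambda>j. \<Sum>i\<in>I. \<beta> i j) (\<lambda>k. \<Sum>i\<in>I. \<gamma> i k)"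
 using assms
proof (induction I rule: infinite_finite_induct)
 case (insert i I)
 from gder_add[OF insert(4)[OF insertI1] insert(3)[OF insert(4)]] show ?case using insert(1,2) by simp
qed (simp_all add: gder_const)

lemma gder_crd:
 assumes "bounded_linear \<pi>"
 shows "gder \<pi> \<tau> (\<lambda>x. crd k (\<pi> x)) x (\<lambda>j. if j = k then 1 else 0) (\<lambda>_. 0) (\<lambda>_. 0)"
 unfolding gder_def
 by (rule has_derivative_eq_rhs[OF bounded_linear_imp_has_derivative[OF bounded_linear_compose[OF crd_linear assms]]])
  (simp add: fun_eq_iff if_distrib[of "\<lambda>u. u * _"] cong: if_cong)

lemma gder_tau:
 assumes "bounded_linear \<tau>"
 shows "gder \<pi> \<tau> (\<lambda>x. of_real (\<tau> x $ k)) x (\<lambda>_. 0) (\<lambda>_. 0) (\<lambda>i. if i = k then 1 else 0)"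
 unfolding gder_def
 by (rule has_derivative_eq_rhs[OF bounded_linear_imp_has_derivative[OF
    bounded_linear_compose[OF bounded_linear_of_real bounded_linear_compose[OF bounded_linear_vec_nth assms]]]])
  (simp add: fun_eq_iff if_distrib[of "\<lambda>u. u * _"] cong: if_cong)

section \<open>The weighted system\<close>

definition Xw :: "'n => 'n cspace => 'n cspace" where "Xw k z = (1/2) *\<^sub>R v k"
definition Yw :: "'n => 'n cspace => 'n cspace" where "Yw k z = (1/2) *\<^sub>R (\<i> *s v k)"
text \<open>The derivative of the weight \<open>form_at \<phi> \<xi> z z\<close>, i.e. of the sum of
  \<mu> j |z_j|^2, in the conjugate of z_k.\<close>

definition cw :: "'n => 'n cspace => complex" where "cw k z = of_real (\<mu> k) * crd k z"
definition Ww :: "'n => ('n cspace => complex) => 'n cspace => complex" where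
 "Ww k \<psi> z = d_zbar v k \<psi> z + cw k z * \<psi> z"
definition Wtw :: "'n => ('n cspace => complex) => 'n cspace => complex" where
 "Wtw k \<psi> z = d_zbar v k \<psi> z - cw k z * \<psi> z"

lemma d_zbar_XY:
 assumes "\<psi> differentiable (at z)"
 shows "d_zbar v k \<psi> z = fder \<psi> z (Xw k z) + \<i> * fder \<psi> z (Yw k z)"
proof -
 have l: "fder \<psi> z ((1/2) *\<^sub>R h) = (1/2) *\<^sub>R fder \<psi> z h" for h
  by (rule linear_cmul[OF linear_frechet_derivative[OF assms]])
 show ?thesis unfolding Xw_def Yw_def l d_zbar_def by (simp add: scaleR_conv_of_real add_divide_distrib)
qed

lemma cw_tame: "tame (cw k)"
 unfolding cw_def[abs_def] by (intro tame_cmult tame.linear crd_linear)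

lemma d_zbar_gs:
 assumes "tame_exp d \<psi>" shows "tame_exp d (d_zbar v k \<psi>)"
proof -
 have "d_zbar v k \<psi> = (\<lambda>z. (1/2) * (fder \<psi> z (v k) + \<i> * fder \<psi> z (\<i> *s v k)))"
  by (simp add: d_zbar_def fun_eq_iff)
 thus ?thesis by (simp only:) (intro tame_exp_cmult tame_exp.add tame_exp_frechet assms)
qed

lemma L2_fun_combination:
 assumes "nice \<psi>" shows "L2_fun (\<lambda>z. a * (fder \<psi> z d + b * fder \<psi> z e))"
 by (intro L2_fun_cmult L2_fun_add nice_L2 assms)

lemma gder_weight: "gder (\<lambda>x. x) (\<lambda>x. 0) (\<lambda>z. form_at \<phi> \<xi> z z) z (\<lambda>j. of_real (\<mu> j) * cnj (crd j z)) (\<lambda>j. of_real (\<mu> j) * crd j z) (\<lambda>_. 0)"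
proof -
 have "gder (\<lambda>x. x) (\<lambda>x. 0) (\<lambda>z. \<Sum>j\<in>UNIV. of_real (\<mu> j) * (crd j z * cnj (crd j z))) z
   (\<lambda>l. \<Sum>j\<in>UNIV. of_real (\<mu> j) * (crd j z * cnj 0 + (if l = j then 1 else 0) * cnj (crd j z)))
   (\<lambda>l. \<Sum>j\<in>UNIV. of_real (\<mu> j) * (crd j z * cnj (if l = j then 1 else 0) + 0 * cnj (crd j z)))
   (\<lambda>l. \<Sum>j\<in>UNIV. of_real (\<mu> j) * (crd j z * cnj 0 + 0 * cnj (crd j z)))"
  by (intro gder_sum gder_cmult gder_mult gder_cnj gder_crd bounded_linear_ident)
 thus ?thesis unfolding form_crd mult.assoc
  by (rule gder_cong) (simp_all add: if_distrib[of cnj] if_distrib[of "\<lambda>u. u * _"] if_distrib[of "\<lambda>u. _ * u"] cong: if_cong)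
qed

lemma gder_d_zbar: "gder (\<lambda>x. x) \<tau> t z \<alpha> \<beta> (\<lambda>_. 0) ==> d_zbar v k t z = \<beta> k"
 by (simp add: d_zbar_def gder_frechet if_distrib[of cnj] if_distrib[of "\<lambda>u. _ * u"] sum.distrib algebra_simps cong: if_cong)

lemma weight_tame: "tame (\<lambda>z. form_at \<phi> \<xi> z z)"
 unfolding form_crd by (intro tame_sum tame.mult tame.const tame_cnj tame.linear crd_linear)

lemma d_zbar_mult:
 assumes "t differentiable (at z)" "\<psi> differentiable (at z)"
 shows "d_zbar v k (\<lambda>z. t z * \<psi> z) z = t z * d_zbar v k \<psi> z + d_zbar v k t z * \<psi> z"
 by (simp add: d_zbar_def frechet_derivative_mult assms field_simps)

lemma d_zbar_exp_weight:
 "d_zbar v k (\<lambda>z. exp (a * form_at \<phi> \<xi> z z)) z = a * exp (a * form_at \<phi> \<xi> z z) * cw k z"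
proof -
 have "gder (\<lambda>x. x) (\<lambda>x. 0) (\<lambda>z. exp (a * form_at \<phi> \<xi> z z)) z
   (\<lambda>j. exp (a * form_at \<phi> \<xi> z z) * (a * (of_real (\<mu> j) * cnj (crd j z))))
   (\<lambda>j. exp (a * form_at \<phi> \<xi> z z) * (a * (of_real (\<mu> j) * crd j z))) (\<lambda>_. 0)"
  by (rule gder_cong[OF gder_exp[OF gder_cmult[OF gder_weight]]]) simp_all
 from gder_d_zbar[OF this, of k] show ?thesis by (simp add: cw_def)
qed

lemma exp_weight_differentiable: "(\<lambda>z. exp (a * form_at \<phi> \<xi> z z)) differentiable (at z)"
 by (rule gder_differentiable[OF gder_exp[OF gder_cmult[OF gder_weight]]])

lemma exp_weight_tame_exp: "tame_exp False (\<lambda>z. exp (a * form_at \<phi> \<xi> z z))"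
 using tame_exp.base[OF tame.const[of 1] tame_cmult[OF weight_tame, of a], of False] by simp

text \<open>Conjugation by the weight turns \<open>d_zbar\<close> into \<open>Ww\<close>. An element
  of the graph is used by inserting exp(form) \<psi> as test function, and produced by inserting
  exp(-form) \<psi>. In the second case \<psi> is an arbitrary test function and the product is
  shown to be \<open>C1c\<close>, hence \<open>nice\<close>.\<close>

sublocale weighted: dbar_system "weighted_dbar \<phi> \<xi> v" Ww Wtw Xw Yw cw "\<lambda>k z. - cw k z"
proof
 show "Ww j \<psi> x = fder \<psi> x (Xw j x) + \<i> * fder \<psi> x (Yw j x) + cw j x * \<psi> x"
  "Wtw j \<psi> x = fder \<psi> x (Xw j x) + \<i> * fder \<psi> x (Yw j x) + - cw j x * \<psi> x"
  if "\<psi> differentiable (at x)" for \<psi> x j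
  by (simp_all add: Ww_def Wtw_def d_zbar_XY[OF that])
 show "\<exists>C N. \<forall>x. norm (Xw j x) + norm (Yw j x) \<le> C * (1 + norm x) ^ N" for j
  by (rule exI[of _ "norm (Xw j 0) + norm (Yw j 0)"], rule exI[of _ 0]) (simp add: Xw_def Yw_def)
 show "gs (Ww j \<psi>)" "gs (Wtw j \<psi>)" if "gs \<psi>" for \<psi> j
 proof -
  note d = d_zbar_gs[OF that, of j] and m = tame_exp_mult[OF that cw_tame[of j]]
  show "gs (Ww j \<psi>)" unfolding Ww_def[abs_def] by (rule tame_exp.add[OF d m])
  show "gs (Wtw j \<psi>)" unfolding Wtw_def[abs_def] using tame_exp.add[OF d tame_exp_minus[OF m]] by simp
 qed
 show "L2_fun (Ww j \<psi>)" if "nice \<psi>" for \<psi> j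
  using L2_fun_add[OF L2_fun_combination[OF that, of "1/2" "v j" \<i> "\<i> *s v j"] nice_L2(1)[OF nice_tame[OF that cw_tame[of j]]]]
  by (simp add: Ww_def[abs_def] d_zbar_def)
 show "(LI x. Wtw j f x * \<psi> x) = - (LI x. f x * Ww j \<psi> x)" if f: "gs f" and p: "nice \<psi>" for f \<psi> j
 proof -
  note fn = gs_nice[OF f]
  let ?F = "\<lambda>d. LI x. fder f x d * \<psi> x" and ?P = "\<lambda>d. LI x. f x * fder \<psi> x d"
  let ?c = "LI x. f x * (cw j x * \<psi> x)"
  have i: "integrable lborel (\<lambda>x. fder f x d * \<psi> x)" "integrable lborel (\<lambda>x. f x * fder \<psi> x d)"
   "integrable lborel (\<lambda>x. f x * (cw j x * \<psi> x))" for d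
   by (intro L2_fun_mult_integrable nice_L2 fn p nice_tame cw_tame)+
  have "(LI x. Wtw j f x * \<psi> x) = (LI x. ((1/2) * (fder f x (v j) * \<psi> x) + (\<i>/2) * (fder f x (\<i> *s v j) * \<psi> x)) - f x * (cw j x * \<psi> x))"
   by (intro B_integral_cong refl) (simp add: Wtw_def d_zbar_def field_simps)
  also have "\<dots> = (1/2) * ?F (v j) + (\<i>/2) * ?F (\<i> *s v j) - ?c"
   by (simp only: Bochner_Integration.integral_diff B_integral_add B_integrable_add integrable_mult_right i integral_mult_right_zero)
  also have "\<dots> = - ((1/2) * ?P (v j) + (\<i>/2) * ?P (\<i> *s v j) + ?c)"
   unfolding nice_integration_by_parts[OF fn p] by (simp add: algebra_simps)
  also have "(1/2) * ?P (v j) + (\<i>/2) * ?P (\<i> *s v j) + ?c = (LI x. ((1/2) * (f x * fder \<psi> x (v j)) + (\<i>/2) * (f x * fder \<psi> x (\<i> *s v j))) + f x * (cw j x * \<psi> x))"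
   by (simp only: B_integral_add B_integrable_add integrable_mult_right i integral_mult_right_zero)
  also have "\<dots> = (LI x. f x * Ww j \<psi> x)"
   by (intro B_integral_cong refl) (simp add: Ww_def d_zbar_def field_simps)
  finally show ?thesis .
 qed
 show "L2_form q f \<and> L2_form (q + 1) g" if "weighted_dbar \<phi> \<xi> v q f g" for q and f g :: "('n, 'n cspace) form"
  using that by (simp add: weighted_dbar_def)
 show "(LI x. g K x * \<psi> x) = dbar_test Ww q f K \<psi>"
  if D: "weighted_dbar \<phi> \<xi> v q f g" and K: "K \<in> \<I> (q + 1)" and p: "tame_exp False \<psi>" and c: "compact (closure {x. \<psi> x \<noteq> 0})"
  for q f g K \<psi>
 proof -
  let ?e = "\<lambda>z. exp (1 * form_at \<phi> \<xi> z z)" and ?e' = "\<lambda>z. exp (- form_at \<phi> \<xi> z z)"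
  have "test_function (\<lambda>z. ?e z * \<psi> z)"
   unfolding test_function_def
   using tame_exp_smooth[OF tame_exp_exp_mult[OF p tame_cmult[OF weight_tame, of 1]]] c by simp
  hence "(LI x. (?e' x * g K x) * (?e x * \<psi> x)) = (\<Sum>J\<in>\<I> q. \<Sum>j\<in>UNIV. eps j J K * - (LI x. (?e' x * f J x) * d_zbar v j (\<lambda>z. ?e z * \<psi> z) x))"
   using D K unfolding weighted_dbar_def dbar_distr_def by blast
  moreover have "(?e' x * g K x) * (?e x * \<psi> x) = g K x * \<psi> x" for x
   by (simp add: exp_minus)
  moreover have "(?e' x * f J x) * d_zbar v j (\<lambda>z. ?e z * \<psi> z) x = f J x * Ww j \<psi> x" for J j x
  proof -
   have "d_zbar v j (\<lambda>z. ?e z * \<psi> z) x = ?e x * Ww j \<psi> x"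
    unfolding d_zbar_mult[OF exp_weight_differentiable tame_exp_differentiable[OF p]] d_zbar_exp_weight Ww_def
    by (simp add: algebra_simps)
   thus ?thesis by (simp add: exp_minus)
  qed
  ultimately show ?thesis by (simp only:)
 qed
 show "weighted_dbar \<phi> \<xi> v q f g" if f: "L2_form q f" and g: "L2_form (q + 1) g"
  and w: "\<And>K \<psi>. K \<in> \<I> (q + 1) ==> nice \<psi> ==>
    (LI x. g K x * \<psi> x) = dbar_test Ww q f K \<psi>"
  for q and f g :: "('n, 'n cspace) form"
  unfolding weighted_dbar_def dbar_distr_def
 proof (intro conjI ballI allI impI f g)
  fix K :: "'n set" and \<psi> :: "'n cspace => complex" assume K: "K \<in> \<I> (q + 1)" and p: "test_function \<psi>"
  let ?e = "\<lambda>z. exp ((-1) * form_at \<phi> \<xi> z z)"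
  note pc = test_function_C1c[OF p]
  have "nice (\<lambda>z. ?e z * \<psi> z)" by (rule C1c_nice[OF C1c_mult[OF pc exp_weight_tame_exp]])
  note w = w[OF K this]
  have "Ww j (\<lambda>z. ?e z * \<psi> z) x = ?e x * d_zbar v j \<psi> x" for j x
  proof -
   have d: "\<psi> differentiable (at x)" using pc by (simp add: C1c_def)
   show ?thesis unfolding Ww_def d_zbar_mult[OF exp_weight_differentiable d] d_zbar_exp_weight
    by (simp add: algebra_simps)
  qed
  thus "(LI x. (exp (- form_at \<phi> \<xi> x x) * g K x) * \<psi> x)
   = (\<Sum>J\<in>\<I> q. \<Sum>j\<in>UNIV. eps j J K * - (LI x. (exp (- form_at \<phi> \<xi> x x) * f J x) * d_zbar v j \<psi> x))"
   using w by (simp add: mult_ac)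
 qed
qed

section \<open>The weighted Laplacian of the kernel\<close>

text \<open>The diagonal part of the kernel that \<open>heat_kernel\<close> will turn out to
  be.\<close>

definition Pk :: "'n set => real => 'n cspace => 'n cspace => complex" where
 "Pk K s z w = of_real (mehler K s (z - w)) * Phase z w"

definition mpre :: "'n set => real => real" where
 "mpre K s = (\<Prod>j\<in>UNIV. mehler_b (\<mu> j) s * exp (s * sgn_rate K j) / pi)"

text \<open>The exponent of \<open>Pk\<close> as a polynomial in the coordinates and their
  conjugates, ready for \<open>gder\<close>.\<close>

definition Pexp :: "real => 'n cspace => 'n cspace => complex" where
 "Pexp s w z = (\<Sum>j\<in>UNIV. - of_real (mehler_a (\<mu> j) s) * ((crd j z - crd j w) * cnj (crd j z - crd j w))
   - of_real (\<mu> j) * (crd j z * cnj (crd j w) - cnj (crd j z) * crd j w))"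

lemma Pk_exp: "Pk K s z w = of_real (mpre K s) * exp (Pexp s w z)"
proof -
 have "exp (- (\<Sum>j\<in>UNIV. mehler_a (\<mu> j) s * (cmod (crd j (z - w)))^2)) * Phase z w = exp (Pexp s w z)"
  unfolding Phase_crd Pexp_def crd_diff exp_of_real[symmetric] exp_add[symmetric] of_real_minus of_real_sum of_real_mult complex_norm_square
  by (simp add: sum_subtractf sum_negf)
 thus ?thesis by (simp add: Pk_def mehler_def mpre_def mult.assoc del: of_real_prod)
qed

lemma Pexp_tame: "tame (Pexp s w)"
 unfolding Pexp_def[abs_def]
 by (intro tame_sum tame_diff tame.mult tame.const tame_cnj tame.linear crd_linear tame_minus)

lemma Re_Pexp:
 assumes s: "s > 0" shows "Re (Pexp s w z) \<le> (norm w)^2 / s - 1 / (2 * s) * (norm z)^2"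
proof -
 have "Re (- of_real (mehler_a (\<mu> j) s) * ((crd j z - crd j w) * cnj (crd j z - crd j w))
   - of_real (\<mu> j) * (crd j z * cnj (crd j w) - cnj (crd j z) * crd j w)) = - (mehler_a (\<mu> j) s * (cmod (crd j (z - w)))^2)" for j
  unfolding complex_norm_square[symmetric] crd_diff by simp
 hence "Re (Pexp s w z) = - (\<Sum>j\<in>UNIV. mehler_a (\<mu> j) s * (cmod (crd j (z - w)))^2)"
  by (simp only: Pexp_def Re_sum sum_negf)
 also have "\<dots> \<le> - (\<Sum>j\<in>UNIV. 1 / s * (cmod (crd j (z - w)))^2)"
  using mehler_bounds[OF s] by (intro le_imp_neg_le sum_mono mult_right_mono) auto
 also have "\<dots> = - ((norm (z - w))^2 / s)" by (simp add: norm_crd sum_divide_distrib)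
 also have "\<dots> \<le> (norm w)^2 / s - 1 / (2 * s) * (norm z)^2"
 proof -
  have "norm z \<le> norm (z - w) + norm w" using norm_triangle_ineq[of "z - w" w] by simp
  hence "(norm z)^2 \<le> (norm (z - w) + norm w)^2" by (intro power_mono) auto
  also have "\<dots> \<le> 2 * (norm (z - w))^2 + 2 * (norm w)^2"
   using sum_squares_bound[of "norm (z - w)" "norm w"] by (simp add: power2_sum)
  finally show ?thesis using s by (simp add: field_simps)
 qed
 finally show ?thesis .
qed

lemma Pk_gs: "s > 0 ==> gs (\<lambda>z. Pk K s z w)"
 unfolding Pk_exp
 by (rule tame_exp.base[OF tame.const Pexp_tame]) (intro exI[of _ "(norm w)^2 / s"] exI[of _ "1 / (2 * s)"] conjI allI Re_Pexp, auto)

lemma gder_Pk: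
 "gder (\<lambda>x. x) (\<lambda>x. 0) (\<lambda>z. Pk K s z w) z
  (\<lambda>j. (- of_real (mehler_a (\<mu> j) s) * cnj (crd j (z - w)) - of_real (\<mu> j) * cnj (crd j w)) * Pk K s z w)
  (\<lambda>j. (- of_real (mehler_a (\<mu> j) s) * crd j (z - w) + of_real (\<mu> j) * crd j w) * Pk K s z w) (\<lambda>_. 0)"
proof -
 let ?a = "\<lambda>j. complex_of_real (mehler_a (\<mu> j) s)" and ?m = "\<lambda>j. complex_of_real (\<mu> j)"
 have c: "gder (\<lambda>x. x) (\<lambda>x. 0 :: 'm rspace) (\<lambda>z. crd j z + - crd j w) z (\<lambda>l. (if l = j then 1 else 0) + 0) (\<lambda>_. 0 + 0) (\<lambda>_. 0 + 0)" for j
  by (intro gder_add gder_crd gder_const bounded_linear_ident)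
 have t: "gder (\<lambda>x. x) (\<lambda>x. 0 :: 'm rspace) (\<lambda>z. - ?a j * ((crd j z + - crd j w) * cnj (crd j z + - crd j w)) + ((- ?m j * cnj (crd j w)) * crd j z + (?m j * crd j w) * cnj (crd j z))) z
   (\<lambda>l. if l = j then - ?a j * cnj (crd j (z - w)) - ?m j * cnj (crd j w) else 0)
   (\<lambda>l. if l = j then - ?a j * crd j (z - w) + ?m j * crd j w else 0) (\<lambda>_. 0)" for j
  by (rule gder_cong[OF gder_add[OF gder_cmult[OF gder_mult[OF c gder_cnj[OF c]]]
    gder_add[OF gder_cmult[OF gder_crd[OF bounded_linear_ident]] gder_cmult[OF gder_cnj[OF gder_crd[OF bounded_linear_ident]]]]]])
   (auto simp: crd_diff algebra_simps)
 have e: "Pexp s w = (\<lambda>z. \<Sum>j\<in>UNIV. - ?a j * ((crd j z + - crd j w) * cnj (crd j z + - crd j w)) + ((- ?m j * cnj (crd j w)) * crd j z + (?m j * crd j w) * cnj (crd j z)))"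
  unfolding Pexp_def[abs_def] by (intro ext sum.cong refl) (simp add: algebra_simps)
 have "gder (\<lambda>x. x) (\<lambda>x. 0 :: 'm rspace) (Pexp s w) z (\<lambda>l. - ?a l * cnj (crd l (z - w)) - ?m l * cnj (crd l w)) (\<lambda>l. - ?a l * crd l (z - w) + ?m l * crd l w) (\<lambda>_. 0)"
  unfolding e by (rule gder_cong[OF gder_sum[OF t]]) simp_all
 from gder_cmult[OF gder_exp[OF this], of "of_real (mpre K s)"]
 show ?thesis unfolding Pk_exp by (rule gder_cong) (simp_all add: mult_ac)
qed

lemma Wtw_gder: "gder (\<lambda>x. x) (\<lambda>x. 0) t z \<alpha> \<beta> (\<lambda>_. 0) ==> Wtw k t z = \<beta> k - cw k z * t z"
 by (simp add: Wtw_def gder_d_zbar)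

lemma Wsw_gder: "gder (\<lambda>x. x) (\<lambda>x. 0) t z \<alpha> \<beta> (\<lambda>_. 0) ==> weighted.Ws k t z = - \<alpha> k - cnj (cw k z) * t z"
proof -
 assume g: "gder (\<lambda>x. x) (\<lambda>x. 0) t z \<alpha> \<beta> (\<lambda>_. 0)"
 have "gder (\<lambda>x. x) (\<lambda>x. 0) (\<lambda>z. cnj (t z)) z (\<lambda>j. cnj (\<beta> j)) (\<lambda>j. cnj (\<alpha> j)) (\<lambda>_. 0)"
  using gder_cnj[OF g] by simp
 from gder_d_zbar[OF this, of k] show ?thesis by (simp add: weighted.Ws_def Ww_def)
qed

lemma Lw_gder: "gder (\<lambda>x. x) (\<lambda>x. 0) t z \<alpha> \<beta> (\<lambda>_. 0) ==> weighted.L k t z = \<beta> k"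
 unfolding weighted.L_def by (subst d_zbar_XY[symmetric]) (auto intro: gder_differentiable gder_d_zbar)

text \<open>The first-order operators act on \<open>Pk\<close> by these multipliers. They depend on
  z - w only, because the phase supplies the missing terms in \<open>w\<close>; the operators are
  covariant under twisted translations.\<close>

definition ellw :: "real => 'n cspace => 'n => 'n cspace => complex" where
 "ellw s w j z = - of_real (mehler_a (\<mu> j) s + \<mu> j) * (crd j z - crd j w)"
definition emw :: "real => 'n cspace => 'n => 'n cspace => complex" where
 "emw s w j z = of_real (mehler_a (\<mu> j) s - \<mu> j) * cnj (crd j z - crd j w)"

lemma Wtw_Pk: "Wtw j (\<lambda>z. Pk K s z w) = (\<lambda>z. ellw s w j z * Pk K s z w)"
 by (rule ext) (simp add: Wtw_gder[OF gder_Pk] ellw_def cw_def crd_diff algebra_simps)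

lemma Wsw_Pk: "weighted.Ws j (\<lambda>z. Pk K s z w) = (\<lambda>z. emw s w j z * Pk K s z w)"
 by (rule ext) (simp add: Wsw_gder[OF gder_Pk] emw_def cw_def crd_diff algebra_simps)

lemma gder_ellw: "gder (\<lambda>x. x) (\<lambda>x. 0) (ellw s w j) z (\<lambda>l. if l = j then - of_real (mehler_a (\<mu> j) s + \<mu> j) else 0) (\<lambda>_. 0) (\<lambda>_. 0)"
proof -
 have "gder (\<lambda>x. x) (\<lambda>x. 0 :: 'm rspace) (\<lambda>z. crd j z + - crd j w) z (\<lambda>l. (if l = j then 1 else 0) + 0) (\<lambda>_. 0 + 0) (\<lambda>_. 0 + 0)"
  by (intro gder_add gder_crd gder_const bounded_linear_ident)
 from gder_cmult[OF this, of "- of_real (mehler_a (\<mu> j) s + \<mu> j)"]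
 have "gder (\<lambda>x. x) (\<lambda>x. 0) (ellw s w j) z (\<lambda>l. - of_real (mehler_a (\<mu> j) s + \<mu> j) * ((if l = j then 1 else 0) + 0)) (\<lambda>_. - of_real (mehler_a (\<mu> j) s + \<mu> j) * (0 + 0)) (\<lambda>_. - of_real (mehler_a (\<mu> j) s + \<mu> j) * (0 + 0))"
  unfolding ellw_def[abs_def] by simp
 thus ?thesis by (rule gder_cong) auto
qed

lemma gder_emw: "gder (\<lambda>x. x) (\<lambda>x. 0) (emw s w j) z (\<lambda>_. 0) (\<lambda>l. if l = j then of_real (mehler_a (\<mu> j) s - \<mu> j) else 0) (\<lambda>_. 0)"
proof -
 have "gder (\<lambda>x. x) (\<lambda>x. 0 :: 'm rspace) (\<lambda>z. cnj (crd j z + - crd j w)) z (\<lambda>_. cnj (0 + 0)) (\<lambda>l. cnj ((if l = j then 1 else 0) + 0)) (\<lambda>_. cnj (0 + 0))"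
  by (intro gder_cnj gder_add gder_crd gder_const bounded_linear_ident)
 from gder_cmult[OF this, of "of_real (mehler_a (\<mu> j) s - \<mu> j)"]
 have "gder (\<lambda>x. x) (\<lambda>x. 0) (emw s w j) z (\<lambda>_. of_real (mehler_a (\<mu> j) s - \<mu> j) * cnj (0 + 0)) (\<lambda>l. of_real (mehler_a (\<mu> j) s - \<mu> j) * cnj ((if l = j then 1 else 0) + 0)) (\<lambda>_. of_real (mehler_a (\<mu> j) s - \<mu> j) * cnj (0 + 0))"
  unfolding emw_def[abs_def] by simp
 thus ?thesis by (rule gder_cong) auto
qed

lemma Wsw_Wtw_Pk:
 "weighted.Ws k (Wtw j (\<lambda>z. Pk K s z w)) z =
   (ellw s w j z * emw s w k z + (if j = k then of_real (mehler_a (\<mu> j) s + \<mu> j) else 0)) * Pk K s z w"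
 unfolding Wtw_Pk
  weighted.Ws_mult[OF gder_differentiable[OF gder_cnj[OF gder_ellw]] gder_differentiable[OF gder_cnj[OF gder_Pk]]]
  Lw_gder[OF gder_cong[OF gder_cnj[OF gder_ellw] refl refl complex_cnj_zero]] Wsw_Pk
 by (simp add: algebra_simps)

lemma Wtw_Wsw_Pk:
 "Wtw j (weighted.Ws k (\<lambda>z. Pk K s z w)) z =
   (ellw s w j z * emw s w k z + (if j = k then of_real (mehler_a (\<mu> j) s - \<mu> j) else 0)) * Pk K s z w"
 unfolding Wsw_Pk weighted.Wt_mult[OF gder_differentiable[OF gder_emw] gder_differentiable[OF gder_Pk]]
  Lw_gder[OF gder_emw] Wtw_Pk
 by (simp add: algebra_simps)

lemma up_down_diag:
 assumes "J \<in> \<I> q" "K0 \<in> \<I> q"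
 shows "weighted.up_down q J K0 j j = (if J = K0 \<and> j \<in> J then 1 else 0)"
proof -
 have "(j \<in> J \<and> j \<in> K0 \<and> J - {j} = K0 - {j}) \<longleftrightarrow> (J = K0 \<and> j \<in> J)" by auto
 thus ?thesis unfolding weighted.up_down_def sum_eps_down[OF assms] by auto
qed

text \<open>The commutator of \<open>Wtw j\<close> and \<open>Ws k\<close> is -2 \<mu> j for j = k
  and 0 otherwise, so by \<open>parts_sum\<close> the Laplacian is diagonal. The result is minus the
  s-derivative of the kernel.\<close>

lemma weighted_parts_Pk:
 assumes s: "s > 0" and K0: "K0 \<in> \<I> q" and J: "J \<in> \<I> q"
 shows "weighted.up' q K0 (\<lambda>z. Pk K0 s z w) J x + weighted.down' q K0 (\<lambda>z. Pk K0 s z w) J x =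
  weighted.single K0 (\<lambda>z. - of_real (mehler_rate K0 s (z - w)) * Pk K0 s z w) J x"
proof -
 let ?V = "\<lambda>z. Pk K0 s z w"
 define \<kappa> where "\<kappa> j k z = (if j = k then - 2 * complex_of_real (\<mu> j) else 0)" for j k and z :: "'n cspace"
 have com: "Wtw j (weighted.Ws k ?V) z - weighted.Ws k (Wtw j ?V) z = \<kappa> j k z * ?V z" for j k z
  unfolding Wtw_Wsw_Pk Wsw_Wtw_Pk \<kappa>_def by (simp add: algebra_simps)
 have "(if J = K0 then \<Sum>j\<in>UNIV. weighted.Ws j (Wtw j ?V) x else 0) + (\<Sum>j\<in>UNIV. \<Sum>k\<in>UNIV. weighted.up_down q J K0 j k * \<kappa> j k x) * ?V x
   = weighted.single K0 (\<lambda>z. - of_real (mehler_rate K0 s (z - w)) * Pk K0 s z w) J x"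
 proof -
  have "(\<Sum>j\<in>UNIV. \<Sum>k\<in>UNIV. weighted.up_down q J K0 j k * \<kappa> j k x) = (\<Sum>j\<in>UNIV. weighted.up_down q J K0 j j * (- 2 * of_real (\<mu> j)))"
   by (simp add: \<kappa>_def if_distrib[of "\<lambda>u. _ * u"] cong: if_cong)
  also have "\<dots> = (\<Sum>j\<in>UNIV. if J = K0 \<and> j \<in> J then - 2 * of_real (\<mu> j) else 0)"
   unfolding up_down_diag[OF J K0] by (intro sum.cong refl) auto
  finally have c: "(\<Sum>j\<in>UNIV. \<Sum>k\<in>UNIV. weighted.up_down q J K0 j k * \<kappa> j k x) = (\<Sum>j\<in>UNIV. if J = K0 \<and> j \<in> J then - 2 * of_real (\<mu> j) else 0)" .
  have "weighted.Ws j (Wtw j ?V) x + (if j \<in> K0 then - 2 * of_real (\<mu> j) else 0) * ?V x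
    = - of_real (- mehler_a (\<mu> j) s + sgn_rate K0 j + (mehler_b (\<mu> j) s)^2 * (cmod (crd j (x - w)))^2) * ?V x" for j
  proof -
   \<comment> \<open>The quadratic term of the Laplacian is -(a^2 - \<mu>^2) |z_j - w_j|^2, and a^2
     - \<mu>^2 = b^2 is the coefficient in \<open>mehler_rate\<close>.\<close>
   have "ellw s w j x * emw s w j x = - of_real (((mehler_a (\<mu> j) s)^2 - (\<mu> j)\<^sup>2) * (cmod (crd j (x - w)))^2)"
    unfolding ellw_def emw_def of_real_mult complex_norm_square crd_diff by (simp add: power2_eq_square algebra_simps)
   thus ?thesis unfolding Wsw_Wtw_Pk mehler_sq[OF s]
    by (simp add: sgn_rate_def algebra_simps)
  qed
  hence "(\<Sum>j\<in>UNIV. weighted.Ws j (Wtw j ?V) x) + (\<Sum>j\<in>UNIV. if j \<in> K0 then - 2 * of_real (\<mu> j) else 0) * ?V x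
   = (\<Sum>j\<in>UNIV. - of_real (- mehler_a (\<mu> j) s + sgn_rate K0 j + (mehler_b (\<mu> j) s)^2 * (cmod (crd j (x - w)))^2) * ?V x)"
   unfolding sum_distrib_right sum.distrib[symmetric] by (simp only:)
  also have "\<dots> = - of_real (mehler_rate K0 s (x - w)) * ?V x"
   by (simp only: mehler_rate_def of_real_sum sum_negf mult_minus_left sum_distrib_right)
  finally have e: "(\<Sum>j\<in>UNIV. weighted.Ws j (Wtw j ?V) x) + (\<Sum>j\<in>UNIV. if j \<in> K0 then - 2 * of_real (\<mu> j) else 0) * ?V x
   = - of_real (mehler_rate K0 s (x - w)) * ?V x" .
  show ?thesis unfolding c weighted.single_def using e by (cases "J = K0") simp_all
 qed
 with weighted.parts_sum[OF Pk_gs[OF s] K0 com J] show ?thesis by (simp only:)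
qed

end

section \<open>Integral operators with Gaussian kernels\<close>

text \<open>Domination by a Gaussian in x - y makes the kernel integrable in each variable,
  uniformly in the other, which is what Schur's test asks for.\<close>

definition gker :: "('x::euclidean_space => 'x => complex) => bool" where
 "gker k \<longleftrightarrow> (\<lambda>p. k (fst p) (snd p)) \<in> borel_funs \<and>
  (\<exists>C c. C \<ge> 0 \<and> c > 0 \<and> (\<forall>x y. cmod (k x y) \<le> C * gauss c (x - y)))"

definition gop :: "('x::euclidean_space => 'x => complex) => ('x => complex) => 'x => complex" where
 "gop k f x = (LI y. k x y * f y)"

lemma gker_bound:
 assumes "gker k"
 obtains C c where "C \<ge> 0" "c > 0" "\<And>x y. cmod (k x y) \<le> C * gauss c (x - y)"
 using assms unfolding gker_def by auto

lemma gker_measurable: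
 assumes "gker k"
 shows "(\<lambda>p. k (fst p) (snd p)) \<in> borel_measurable (borel \<Otimes>\<^sub>M borel)"
  "(\<lambda>y. k x y) \<in> borel_funs" "(\<lambda>x. k x y) \<in> borel_funs"
proof -
 show 1: "(\<lambda>p. k (fst p) (snd p)) \<in> borel_measurable (borel \<Otimes>\<^sub>M borel)"
  using assms unfolding gker_def borel_prod by simp
 show "(\<lambda>y. k x y) \<in> borel_funs"
  using measurable_compose[OF measurable_Pair1'[of x borel borel] 1] by simp
 show "(\<lambda>x. k x y) \<in> borel_funs"
  using measurable_compose[OF measurable_Pair2'[of y borel borel] 1] by simp
qed

lemma gker_sections_L2:
 assumes "gker k" shows "L2_fun (\<lambda>y. k x y)" "L2_fun (\<lambda>x. k x y)"
proof -
 obtain C c where C: "C \<ge> 0" "c > 0" "\<And>x y. cmod (k x y) \<le> C * gauss c (x - y)"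
  using gker_bound[OF assms] by metis
 have sq: "(cmod (k x y))^2 \<le> C^2 * gauss (2 * c) (x - y)" for x y
 proof -
  have "(cmod (k x y))^2 \<le> (C * gauss c (x - y))^2" using C by (intro power_mono) auto
  thus ?thesis by (simp add: power_mult_distrib exp_of_nat_mult[of 2, symmetric] mult_ac)
 qed
 have i: "integrable lborel (\<lambda>y. C^2 * gauss (2 * c) (- a + y))" for a :: 'a
  using C(2) by (intro integrable_mult_right lborel_integrable_translate[of "\<lambda>y. gauss (2 * c) y"] gauss_integrable) simp
 show "L2_fun (\<lambda>y. k x y)"
  by (rule L2_fun_bound[OF i[of x] gker_measurable(2)[OF assms]]) (use sq[of x] in \<open>simp add: norm_minus_commute\<close>)
 show "L2_fun (\<lambda>x. k x y)"
  by (rule L2_fun_bound[OF i[of y] gker_measurable(3)[OF assms]]) (use sq[of _ y] in simp)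
qed

lemma gauss_conv_integrable:
 fixes h :: "'x::euclidean_space => real"
 assumes c: "c > 0" and h: "integrable lborel h"
 shows "integrable (lborel \<Otimes>\<^sub>M lborel) (\<lambda>(x, y). gauss c (y - x :: 'x) * h x)"
  "integrable (lborel \<Otimes>\<^sub>M lborel) (\<lambda>(x, y). gauss c (x - y :: 'x) * h y)"
proof -
 note [measurable] = borel_measurable_integrable[OF h]
 show 1: "integrable (lborel \<Otimes>\<^sub>M lborel) (\<lambda>(x, y). gauss c (y - x :: 'x) * h x)"
 proof (rule lborel_pair.Fubini_integrable)
  show "(\<lambda>(x, y). gauss c (y - x :: 'x) * h x) \<in> borel_measurable (lborel \<Otimes>\<^sub>M lborel)"
   by measurable
  show "integrable lborel (\<lambda>x. LI y. norm (case (x, y) of (x, y) => gauss c (y - x :: 'x) * h x))"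
   using h by (simp add: abs_mult gauss_shift(2)[OF c])
  show "AE x in lborel. integrable lborel (\<lambda>y. case (x, y) of (x, y) => gauss c (y - x :: 'x) * h x)"
   by (simp add: gauss_shift(1)[OF c])
 qed
 from lborel_pair.integrable_product_swap[OF 1]
 show "integrable (lborel \<Otimes>\<^sub>M lborel) (\<lambda>(x, y). gauss c (x - y :: 'x) * h y)"
  by (simp add: case_prod_unfold)
qed

text \<open>|b k f| is at most the Gaussian bound times |b|^2 + |f|^2, a sum of two functions whose
  double integrals are finite. This licenses Fubini in all pairings with \<open>gop\<close>.\<close>

lemma gker_bilinear_integrable:
 assumes k: "gker k" and b: "L2_fun b" and f: "L2_fun f"
 shows "integrable (lborel \<Otimes>\<^sub>M lborel) (\<lambda>(x, y). b x * k x y * f y)"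
proof -
 obtain C c where C: "C \<ge> 0" "c > 0" "\<And>x y. cmod (k x y) \<le> C * gauss c (x - y)"
  using gker_bound[OF k] by metis
 note [measurable] = L2_fun_measurable[OF b] L2_fun_measurable[OF f] gker_measurable(1)[OF k]
 let ?E = "\<lambda>x y. gauss c (x - y)"
 have "integrable (lborel \<Otimes>\<^sub>M lborel) (\<lambda>p. C * ((\<lambda>(x, y). ?E y x * (cmod (b x))^2) p + (\<lambda>(x, y). ?E x y * (cmod (f y))^2) p))"
  by (intro integrable_mult_right B_integrable_add gauss_conv_integrable C(2) L2_fun_integrable b f)
 thus ?thesis
 proof (rule B_integrable_bound)
  have "(\<lambda>p. b (fst p) * k (fst p) (snd p) * f (snd p)) \<in> borel_measurable (borel \<Otimes>\<^sub>M borel)" by measurable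
  thus "(\<lambda>(x, y). b x * k x y * f y) \<in> borel_measurable (lborel \<Otimes>\<^sub>M lborel)"
   by (simp add: case_prod_unfold cong: measurable_cong_sets)
  have "cmod (b x * k x y * f y) \<le> C * (?E y x * (cmod (b x))^2 + ?E x y * (cmod (f y))^2)" for x y
  proof -
   have ab: "cmod (b x) * cmod (f y) \<le> (cmod (b x))^2 + (cmod (f y))^2"
    using sum_squares_bound[of "cmod (b x)" "cmod (f y)"] sum_power2_ge_zero[of "cmod (b x)" "cmod (f y)"] by linarith
   have "cmod (b x * k x y * f y) = cmod (k x y) * (cmod (b x) * cmod (f y))" by (simp add: norm_mult)
   also have "\<dots> \<le> (C * ?E x y) * ((cmod (b x))^2 + (cmod (f y))^2)"
    using C ab by (intro mult_mono) auto
   finally show ?thesis by (simp add: norm_minus_commute[of y x] algebra_simps)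
  qed
  thus "AE p in lborel \<Otimes>\<^sub>M lborel. norm (case p of (x, y) => b x * k x y * f y) \<le> norm (C * ((\<lambda>(x, y). ?E y x * (cmod (b x))^2) p + (\<lambda>(x, y). ?E x y * (cmod (f y))^2) p))"
   by (intro AE_I2) (auto intro: order_trans[OF _ abs_ge_self])
 qed
qed

lemma gop_swap:
 assumes k: "gker k" and b: "L2_fun b" and f: "L2_fun f"
 shows "(LI x. b x * gop k f x) = (LI y. (LI x. b x * k x y) * f y)"
proof -
 have "(LI y. (LI x. b x * k x y * f y)) = (LI x. (LI y. b x * k x y * f y))"
  by (rule lborel_pair.Fubini_integral[OF gker_bilinear_integrable[OF assms]])
 moreover have "b x * gop k f x = (LI y. b x * k x y * f y)" for x
  by (simp only: gop_def mult.assoc integral_mult_right_zero)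
 moreover have "(LI x. b x * k x y) * f y = (LI x. b x * k x y * f y)" for y
  by (simp only: integral_mult_left_zero)
 ultimately show ?thesis by (simp only:)
qed

lemma gop_integrable: "gker k ==> L2_fun f ==> integrable lborel (\<lambda>y. k x y * f y)"
 by (rule L2_fun_mult_integrable[OF gker_sections_L2(1)])

lemma L2_fun_Cauchy_Schwarz:
 assumes "L2_fun f" "L2_fun g"
 shows "(cmod (LI x. f x * g x))^2 \<le> (LI x. (cmod (f x))^2) * (LI x. (cmod (g x))^2)"
proof -
 let ?F = "(\<lambda>K::bool set. f)" and ?G = "\<lambda>(K::bool set) x. cnj (g x)"
 have m: "\<I> 0 = {{} :: bool set}" by (auto simp: multi_indices_def)
 have "cmod (L2_inner 0 ?F ?G) \<le> L2_norm 0 ?F * L2_norm 0 ?G"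
  using assms by (intro L2_Cauchy_Schwarz) (auto simp: L2_form_def L2_fun_cnj)
 hence "(cmod (L2_inner 0 ?F ?G))^2 \<le> (L2_norm 0 ?F * L2_norm 0 ?G)^2"
  by (intro power_mono) auto
 thus ?thesis unfolding power_mult_distrib L2_norm_sq m by (simp add: L2_inner_def m)
qed

text \<open>Schur's test: Cauchy-Schwarz in y with the Gaussian split evenly between kernel and
  function, followed by integration in x.\<close>

lemma gop_L2:
 fixes k :: "'x::euclidean_space => 'x => complex"
 assumes k: "gker k" and f: "L2_fun f"
 shows "L2_fun (gop k f)"
proof -
 obtain C c where C: "C \<ge> 0" "c > 0" "\<And>x y. cmod (k x y) \<le> C * gauss c (x - y)"
  using gker_bound[OF k] by metis
 note [measurable] = L2_fun_measurable[OF f] gker_measurable(1)[OF k]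
 let ?E = "\<lambda>x y :: 'x. gauss c (x - y)"
 let ?I = "sqrt (pi / c) ^ DIM('x)"
 have ci: "integrable (lborel \<Otimes>\<^sub>M lborel) (\<lambda>(x, y). ?E x y * (cmod (f y))^2)"
  by (rule gauss_conv_integrable(2)[OF C(2) L2_fun_integrable[OF f]])
 have h: "integrable lborel (\<lambda>x. C^2 * ?I * (LI y. ?E x y * (cmod (f y))^2))"
  using lborel_pair.integrable_fst'[OF ci] by (intro integrable_mult_right) simp
 show ?thesis
 proof (rule L2_fun_bound[OF h])
  have "(\<lambda>(x, y). k x y * f y) \<in> borel_measurable (borel \<Otimes>\<^sub>M lborel)"
  proof -
   have "(\<lambda>p. k (fst p) (snd p) * f (snd p)) \<in> borel_measurable (borel \<Otimes>\<^sub>M borel)" by measurable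
   thus ?thesis by (simp add: case_prod_unfold cong: measurable_cong_sets)
  qed
  thus "gop k f \<in> borel_funs"
   unfolding gop_def[abs_def] by (rule lborel.borel_measurable_lebesgue_integral)
  fix x :: 'x
  let ?e = "\<lambda>y. gauss (c / 2) (x - y)"
  \<comment> \<open>\<open>?e\<close> is the square root of the Gaussian \<open>?E\<close>: the
    kernel divided by it is still Gaussian, and the square of \<open>?v\<close> is the integrand of
    the convolution with |f|^2.\<close>
  let ?u = "\<lambda>y. k x y * of_real (inverse (?e y))" and ?v = "\<lambda>y. of_real (?e y) * f y"
  have ee: "(?e y)^2 = ?E x y" for y by (simp flip: exp_double)
  have ub: "(cmod (?u y))^2 \<le> C^2 * gauss c (y - x)" for y
  proof -
   have "cmod (?u y) \<le> C * ?E x y * inverse (?e y)"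
    using C by (simp add: norm_mult mult_right_mono del: of_real_inverse of_real_exp)
   also have "\<dots> = C * ?e y"
   proof -
    have "?E x y = ?e y * ?e y" by (simp flip: exp_add)
    thus ?thesis by (simp only: mult.assoc right_inverse[OF exp_not_eq_zero] mult_1_right)
   qed
   finally have "(cmod (?u y))^2 \<le> (C * ?e y)^2" by (intro power_mono) auto
   thus ?thesis unfolding power_mult_distrib ee by (simp add: norm_minus_commute)
  qed
  have [measurable]: "(\<lambda>y. k x y) \<in> borel_funs" by (rule gker_measurable(2)[OF k])
  have ui: "integrable lborel (\<lambda>y. C^2 * gauss c (y - x))"
   by (intro integrable_mult_right gauss_shift C(2))
  have u: "L2_fun ?u"
  proof (rule L2_fun_bound[OF ui _ ub])
   show "?u \<in> borel_funs" by measurable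
  qed
  have v: "L2_fun ?v"
  proof (rule L2_fun_bound[OF L2_fun_integrable[OF f]])
   show "?v \<in> borel_funs" by measurable
   have "cmod (?v y) \<le> cmod (f y)" for y
    using C(2) by (simp add: norm_mult mult_left_le_one_le del: of_real_exp)
   thus "(cmod (?v y))^2 \<le> (cmod (f y))^2" for y by (intro power_mono) auto
  qed
  have "gop k f x = (LI y. ?u y * ?v y)"
   unfolding gop_def by (intro B_integral_cong refl) (simp del: of_real_exp)
  hence "(cmod (gop k f x))^2 \<le> (LI y. (cmod (?u y))^2) * (LI y. (cmod (?v y))^2)"
   using L2_fun_Cauchy_Schwarz[OF u v] by (simp only:)
  also have "(LI y. (cmod (?v y))^2) = (LI y. ?E x y * (cmod (f y))^2)"
   unfolding norm_mult power_mult_distrib norm_of_real power2_abs ee by (rule refl)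
  finally have 1: "(cmod (gop k f x))^2 \<le> (LI y. (cmod (?u y))^2) * (LI y. ?E x y * (cmod (f y))^2)" .
  have "(LI y. (cmod (?u y))^2) \<le> (LI y. C^2 * gauss c (y - x))"
   by (rule integral_mono[OF L2_fun_integrable[OF u] ui ub])
  also have "\<dots> = C^2 * ?I" by (simp add: gauss_shift(2)[OF C(2)])
  finally have "(LI y. (cmod (?u y))^2) * (LI y. ?E x y * (cmod (f y))^2) \<le> C^2 * ?I * (LI y. ?E x y * (cmod (f y))^2)"
   by (rule mult_right_mono) (auto intro!: Bochner_Integration.integral_nonneg)
  with 1 show "(cmod (gop k f x))^2 \<le> C^2 * ?I * (LI y. ?E x y * (cmod (f y))^2)" by linarith
 qed
qed

lemma gker_cmult: "gker k ==> gker (\<lambda>x y. a * k x y)"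
proof -
 assume k: "gker k"
 obtain C c where C: "C \<ge> 0" "c > 0" "\<And>x y. cmod (k x y) \<le> C * gauss c (x - y)"
  using gker_bound[OF k] by metis
 have "cmod (a * k x y) \<le> (cmod a * C) * gauss c (x - y)" for x y
  using C(3)[of x y] by (simp add: norm_mult mult_left_mono mult.assoc)
 thus ?thesis using k C unfolding gker_def
  by (intro conjI exI[of _ "cmod a * C"] exI[of _ c]) auto
qed

lemma gker_mult:
 assumes k: "gker k" and t: "continuous_on UNIV (\<lambda>p. t (fst p) (snd p))"
  and b: "\<And>x y. cmod (t x y) \<le> D * (1 + norm (x - y)) ^ N"
 shows "gker (\<lambda>x y. t x y * k x y)"
proof -
 obtain C c where C: "C \<ge> 0" "c > 0" "\<And>x y. cmod (k x y) \<le> C * gauss c (x - y)"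
  using gker_bound[OF k] by metis
 obtain B where B: "B \<ge> 0" "\<And>r. r \<ge> 0 ==> (1 + r) ^ N * exp (- (c / 2 * r^2)) \<le> B"
  using poly_gauss_bound[of "c / 2" N] C(2) by auto
 have D: "D \<ge> 0" using b[of 0 0] by (simp add: order_trans[OF norm_ge_zero])
 have "cmod (t x y * k x y) \<le> (D * B * C) * gauss (c / 2) (x - y)" for x y
 proof -
  let ?r = "norm (x - y)"
  have e: "exp (- (c * ?r^2)) = exp (- (c / 2 * ?r^2)) * exp (- (c / 2 * ?r^2))"
   by (simp flip: exp_add)
  have "cmod (t x y * k x y) \<le> (D * (1 + ?r) ^ N) * (C * exp (- (c * ?r^2)))"
   unfolding norm_mult using b C D by (intro mult_mono) auto
  also have "\<dots> = (D * C * exp (- (c / 2 * ?r^2))) * ((1 + ?r) ^ N * exp (- (c / 2 * ?r^2)))"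
   unfolding e by (simp add: mult_ac)
  also have "\<dots> \<le> (D * C * exp (- (c / 2 * ?r^2))) * B"
   using B(2)[of ?r] C D by (intro mult_left_mono) auto
  finally show ?thesis by (simp add: mult_ac)
 qed
 moreover have "(\<lambda>p. t (fst p) (snd p) * k (fst p) (snd p)) \<in> borel_funs"
  using k borel_measurable_continuous_onI[OF t] unfolding gker_def by (intro borel_measurable_times) auto
 ultimately show ?thesis unfolding gker_def using B C D
  by (intro conjI exI[of _ "D * B * C"] exI[of _ "c / 2"]) auto
qed

lemma gker_add:
 assumes k: "gker k" "gker l" shows "gker (\<lambda>x y. k x y + l x y)"
proof -
 obtain C c where C: "C \<ge> 0" "c > 0" "\<And>x y. cmod (k x y) \<le> C * gauss c (x - y)"
  using gker_bound[OF k(1)] by metis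
 obtain D d where D: "D \<ge> 0" "d > 0" "\<And>x y. cmod (l x y) \<le> D * gauss d (x - y)"
  using gker_bound[OF k(2)] by metis
 have "cmod (k x y + l x y) \<le> (C + D) * gauss (min c d) (x - y)" for x y
 proof -
  have "cmod (k x y) \<le> C * gauss (min c d) (x - y)"
   using C(1) by (intro order_trans[OF C(3)]) (auto intro!: mult_left_mono mult_right_mono)
  moreover have "cmod (l x y) \<le> D * gauss (min c d) (x - y)"
   using D(1) by (intro order_trans[OF D(3)]) (auto intro!: mult_left_mono mult_right_mono)
  ultimately show ?thesis by (intro norm_triangle_le) (simp add: distrib_right)
 qed
 moreover have "(\<lambda>p. k (fst p) (snd p) + l (fst p) (snd p)) \<in> borel_funs"
  using k unfolding gker_def by (intro borel_measurable_add) auto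
 ultimately show ?thesis unfolding gker_def using C D
  by (intro conjI exI[of _ "C + D"] exI[of _ "min c d"]) auto
qed

lemma gker_zero: "gker (\<lambda>x y. 0)"
 unfolding gker_def by (intro conjI exI[of _ 0] exI[of _ 1]) auto

lemma gker_sum: "(\<And>i. i \<in> I ==> gker (k i)) ==> gker (\<lambda>x y. \<Sum>i\<in>I. k i x y)"
 by (induction I rule: infinite_finite_induct) (auto intro: gker_add gker_zero)

lemma L2_adjoint_sum:
 assumes D: "L2_graph D" and A: "finite A" "\<And>i. i \<in> A ==> L2_adjoint D q (g i) (h i)"
 shows "L2_adjoint D q (\<lambda>K x. \<Sum>i\<in>A. g i K x) (\<lambda>K x. \<Sum>i\<in>A. h i K x)"
 using A
proof (induction A rule: finite_induct)
 case empty
 show ?case by (simp add: L2_adjoint_def L2_form_zero L2_inner_def)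
next
 case (insert i A)
 have 1: "L2_adjoint D q (g i) (h i)" and 2: "L2_adjoint D q (\<lambda>K x. \<Sum>i\<in>A. g i K x) (\<lambda>K x. \<Sum>i\<in>A. h i K x)"
  using insert by auto
 note L = L2_adjoint_L2[OF 1] L2_adjoint_L2[OF 2]
 have "L2_inner (q + 1) w (\<lambda>K x. g i K x + (\<Sum>i\<in>A. g i K x)) = L2_inner q u (\<lambda>K x. h i K x + (\<Sum>i\<in>A. h i K x))" if "D q u w" for u w
 proof -
  have uw: "L2_form q u" "L2_form (q + 1) w" using D that unfolding L2_graph_def by blast+
  show ?thesis
   using L uw L2_adjointD[OF 1, OF that] L2_adjointD[OF 2, OF that] by (simp add: L2_inner_add_right)
 qed
 hence "L2_adjoint D q (\<lambda>K x. g i K x + (\<Sum>i\<in>A. g i K x)) (\<lambda>K x. h i K x + (\<Sum>i\<in>A. h i K x))"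
  using L unfolding L2_adjoint_def by (auto intro: L2_form_add)
 thus ?case using insert(1,2) by simp
qed

section \<open>Superpositions of elements of the graph and of its adjoint\<close>

context dbar_system
begin

lemma Dn_sum:
 assumes A: "finite A" "\<And>i. i \<in> A ==> Dn q (f i) (g i)"
 shows "Dn q (\<lambda>K x. \<Sum>i\<in>A. f i K x) (\<lambda>K x. \<Sum>i\<in>A. g i K x)"
 unfolding Dn_def
proof (intro conjI ballI allI impI)
 have f: "\<And>i J. i \<in> A ==> J \<in> \<I> q ==> L2_fun (f i J)" and g: "\<And>i J. i \<in> A ==> J \<in> \<I> (q + 1) ==> L2_fun (g i J)"
  using A(2) by (auto simp: Dn_def L2_form_def)
 show "L2_form q (\<lambda>K x. \<Sum>i\<in>A. f i K x)" "L2_form (q + 1) (\<lambda>K x. \<Sum>i\<in>A. g i K x)"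
  unfolding L2_form_def by (intro ballI L2_fun_sum f g, assumption+)+
 fix K :: "'n set" and \<psi> :: "'x => complex" assume K: "K \<in> \<I> (q + 1)" and p: "nice \<psi>"
 have "(LI x. (\<Sum>i\<in>A. g i K x) * \<psi> x) = (\<Sum>i\<in>A. (LI x. g i K x * \<psi> x))"
  unfolding sum_distrib_right
  by (rule B_integral_sum) (intro L2_fun_mult_integrable g K nice_L2 p)
 also have "\<dots> = (\<Sum>i\<in>A. \<Sum>J\<in>\<I> q. \<Sum>j\<in>UNIV. eps j J K * - (LI x. f i J x * W j \<psi> x))"
  using A(2) K p by (intro sum.cong refl) (simp add: Dn_def)
 also have "\<dots> = (\<Sum>J\<in>\<I> q. \<Sum>j\<in>UNIV. \<Sum>i\<in>A. eps j J K * - (LI x. f i J x * W j \<psi> x))"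
  by (subst sum.swap, subst (2) sum.swap) (rule refl)
 also have "\<dots> = (\<Sum>J\<in>\<I> q. \<Sum>j\<in>UNIV. eps j J K * - (LI x. (\<Sum>i\<in>A. f i J x) * W j \<psi> x))"
 proof (intro sum.cong refl)
  fix J :: "'n set" and j :: 'n assume J: "J \<in> \<I> q"
  have "(LI x. (\<Sum>i\<in>A. f i J x) * W j \<psi> x) = (\<Sum>i\<in>A. (LI x. f i J x * W j \<psi> x))"
   unfolding sum_distrib_right
   by (rule B_integral_sum) (intro L2_fun_mult_integrable f J nice_W p)
  thus "(\<Sum>i\<in>A. eps j J K * - (LI x. f i J x * W j \<psi> x)) = eps j J K * - (LI x. (\<Sum>i\<in>A. f i J x) * W j \<psi> x)"
   by (simp add: sum_distrib_left sum_negf)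
 qed
 finally show "(LI x. (\<Sum>i\<in>A. g i K x) * \<psi> x) = (\<Sum>J\<in>\<I> q. \<Sum>j\<in>UNIV. eps j J K * - (LI x. (\<Sum>i\<in>A. f i J x) * W j \<psi> x))" .
qed

lemma integrable_inner_gker:
 assumes "gker k" "L2_fun b" "L2_fun a"
 shows "integrable lborel (\<lambda>y. (LI x. b x * k x y) * a y)"
 using lborel_pair.integrable_snd[OF gker_bilinear_integrable[OF assms]] by simp

text \<open>The weak equation holds for each y; it is integrated against a(y), and Fubini moves the
  test integral inside. That \<psi> and \<open>W j \<psi>\<close> are square integrable makes both
  sides legitimate.\<close>

lemma Dn_gop:
 assumes F: "\<And>J. J \<in> \<I> q ==> gker (F J)" and G: "\<And>K. K \<in> \<I> (q + 1) ==> gker (G K)"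
  and D: "\<And>y. Dn q (\<lambda>J x. F J x y) (\<lambda>K x. G K x y)" and a: "L2_fun a"
 shows "Dn q (\<lambda>J. gop (F J) a) (\<lambda>K. gop (G K) a)"
 unfolding Dn_def
proof (intro conjI ballI allI impI)
 show "L2_form q (\<lambda>J. gop (F J) a)" "L2_form (q + 1) (\<lambda>K. gop (G K) a)"
  using F G a by (auto simp: L2_form_def intro: gop_L2)
 fix K :: "'n set" and \<psi> :: "'x => complex" assume K: "K \<in> \<I> (q + 1)" and p: "nice \<psi>"
 have "(LI x. gop (G K) a x * \<psi> x) = (LI x. \<psi> x * gop (G K) a x)" by (simp only: mult.commute)
 also have "\<dots> = (LI y. (LI x. \<psi> x * G K x y) * a y)"
  by (rule gop_swap[OF G[OF K] nice_L2(1)[OF p] a])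
 also have "\<dots> = (LI y. (\<Sum>J\<in>\<I> q. \<Sum>j\<in>UNIV. eps j J K * - ((LI x. W j \<psi> x * F J x y) * a y)))"
 proof (intro B_integral_cong refl)
  fix y
  have "(LI x. G K x y * \<psi> x) = (\<Sum>J\<in>\<I> q. \<Sum>j\<in>UNIV. eps j J K * - (LI x. F J x y * W j \<psi> x))"
   using D[of y] K p unfolding Dn_def by blast
  thus "(LI x. \<psi> x * G K x y) * a y = (\<Sum>J\<in>\<I> q. \<Sum>j\<in>UNIV. eps j J K * - ((LI x. W j \<psi> x * F J x y) * a y))"
   by (simp add: mult.commute[of "\<psi> _"] mult.commute[of "W _ _ _"] sum_distrib_right mult.assoc sum_negf)
 qed
 also have "\<dots> = (\<Sum>J\<in>\<I> q. (LI y. (\<Sum>j\<in>UNIV. eps j J K * - ((LI x. W j \<psi> x * F J x y) * a y))))"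
  by (rule B_integral_sum)
   (intro B_integrable_sum integrable_mult_right integrable_minus integrable_inner_gker F nice_W p a)
 also have "\<dots> = (\<Sum>J\<in>\<I> q. \<Sum>j\<in>UNIV. (LI y. eps j J K * - ((LI x. W j \<psi> x * F J x y) * a y)))"
  by (intro sum.cong refl B_integral_sum integrable_mult_right integrable_minus integrable_inner_gker F nice_W p a)
 also have "\<dots> = (\<Sum>J\<in>\<I> q. \<Sum>j\<in>UNIV. eps j J K * - (LI x. gop (F J) a x * W j \<psi> x))"
 proof (intro sum.cong refl)
  fix J :: "'n set" and j :: 'n assume J: "J \<in> \<I> q"
  have "(LI x. gop (F J) a x * W j \<psi> x) = (LI y. (LI x. W j \<psi> x * F J x y) * a y)"
   using gop_swap[OF F[OF J] nice_W[OF p] a] by (simp only: mult.commute[of "gop _ _ _"])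
  thus "(LI y. eps j J K * - ((LI x. W j \<psi> x * F J x y) * a y)) = eps j J K * - (LI x. gop (F J) a x * W j \<psi> x)"
   by (simp only: integral_mult_right_zero Bochner_Integration.integral_minus)
 qed
 finally show "(LI x. gop (G K) a x * \<psi> x) = (\<Sum>J\<in>\<I> q. \<Sum>j\<in>UNIV. eps j J K * - (LI x. gop (F J) a x * W j \<psi> x))" .
qed

lemma L2_inner_gop:
 assumes G: "\<And>K. K \<in> \<I> q ==> gker (G K)" and w: "L2_form q w" and a: "L2_fun a"
 shows "L2_inner q w (\<lambda>K. gop (G K) a) = (LI y. L2_inner q w (\<lambda>K x. G K x y) * cnj (a y))"
proof -
 have gc: "gker (\<lambda>x y. cnj (G K x y))" if K: "K \<in> \<I> q" for K
  using G[OF K] unfolding gker_def by (auto intro!: borel_measurable_cnj)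
 have wK: "L2_fun (w K)" if "K \<in> \<I> q" for K using w that by (simp add: L2_form_def)
 have "L2_inner q w (\<lambda>K. gop (G K) a) = (\<Sum>K\<in>\<I> q. (LI x. w K x * gop (\<lambda>x y. cnj (G K x y)) (\<lambda>y. cnj (a y)) x))"
  unfolding L2_inner_def gop_def Bochner_Integration.integral_cnj[symmetric] complex_cnj_mult by (rule refl)
 also have "\<dots> = (\<Sum>K\<in>\<I> q. (LI y. (LI x. w K x * cnj (G K x y)) * cnj (a y)))"
  by (intro sum.cong refl gop_swap gc wK L2_fun_cnj a)
 also have "\<dots> = (LI y. (\<Sum>K\<in>\<I> q. (LI x. w K x * cnj (G K x y)) * cnj (a y)))"
  by (rule B_integral_sum[symmetric]) (intro integrable_inner_gker gc wK L2_fun_cnj a)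
 finally show ?thesis by (simp only: L2_inner_def sum_distrib_right)
qed

text \<open>Both pairings are integrals over y of the pairings for fixed y, by
  \<open>L2_inner_gop\<close>, and these agree.\<close>

lemma adjoint_gop:
 assumes G: "\<And>K. K \<in> \<I> (q + 1) ==> gker (G K)" and H: "\<And>J. J \<in> \<I> q ==> gker (H J)"
  and D: "\<And>y. L2_adjoint D q (\<lambda>K x. G K x y) (\<lambda>J x. H J x y)" and a: "L2_fun a"
 shows "L2_adjoint D q (\<lambda>K. gop (G K) a) (\<lambda>J. gop (H J) a)"
 unfolding L2_adjoint_def
proof (intro conjI allI impI)
 show "L2_form (q + 1) (\<lambda>K. gop (G K) a)" "L2_form q (\<lambda>J. gop (H J) a)"
  using G H a by (auto simp: L2_form_def intro: gop_L2)
 fix u w assume uw: "D q u w"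
 note L = D_L2[OF uw]
 show "L2_inner (q + 1) w (\<lambda>K. gop (G K) a) = L2_inner q u (\<lambda>J. gop (H J) a)"
  using L L2_adjointD[OF D, OF uw] by (simp add: L2_inner_gop G H a del: One_nat_def)
qed

end

section \<open>Approximate identity\<close>

lemma lborel_integral_scale:
 fixes f :: "'x::euclidean_space => complex"
 assumes c: "c \<noteq> 0" and f: "f \<in> borel_funs"
 shows "(LI x. f x) = of_real (\<bar>c\<bar> ^ DIM('x)) * (LI y. f (c *\<^sub>R y))"
proof -
 have [measurable]: "f \<in> borel_funs" by fact
 have "(LI x. f x) = (LINT x|density (distr lborel borel (\<lambda>x. 0 + c *\<^sub>R x)) (\<lambda>_. ennreal (\<bar>c\<bar> ^ DIM('x))). f x)"
  using lborel_affine[OF c, of "0::'x"] by (simp add: ennreal_power)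
 also have "\<dots> = (LINT x|distr lborel borel (\<lambda>x::'x. 0 + c *\<^sub>R x). (\<bar>c\<bar> ^ DIM('x)) *\<^sub>R f x)"
  by (rule integral_density) auto
 also have "\<dots> = (LI y. (\<bar>c\<bar> ^ DIM('x)) *\<^sub>R f (0 + c *\<^sub>R y))"
  by (rule integral_distr) auto
 finally show ?thesis by (simp add: scaleR_conv_of_real)
qed

text \<open>Sequences may be truncated to (0, r] without changing their tail, so dominating
  functions are wanted only for parameters up to r.\<close>

lemma tendsto_at_right_0_sequentially:
 fixes f :: "real => 'a::metric_space"
 assumes "\<And>X. (\<And>n. X n > 0) ==> (\<And>n. X n \<le> r) ==> X \<longlonglongrightarrow> 0 ==> (\<lambda>n. f (X n)) \<longlonglongrightarrow> L" and r: "r > 0"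
 shows "(f \<longlongrightarrow> L) (at_right 0)"
proof -
 have "(\<lambda>n. f (X n)) \<longlonglongrightarrow> L" if X: "\<And>n. X n > 0" "X \<longlonglongrightarrow> 0" for X
 proof -
  have "(\<lambda>n. min (X n) r) \<longlonglongrightarrow> min 0 r" by (intro tendsto_min X(2) tendsto_const)
  hence "(\<lambda>n. f (min (X n) r)) \<longlonglongrightarrow> L" using X r by (intro assms(1)) auto
  moreover have "\<forall>\<^sub>F n in sequentially. f (min (X n) r) = f (X n)"
   using order_tendstoD(2)[OF X(2) r] by eventually_elim simp
  ultimately show ?thesis by (rule Lim_transform_eventually)
 qed
 thus ?thesis unfolding tendsto_at_iff_sequentially o_def by auto
qed

text \<open>A form is a function on all index sets, and only those of size q matter in pairings. An
  abstract \<open>D\<close> might look at the others, hence the separate assumption on it.\<close>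

lemma laplacian_cong:
 assumes l: "laplacian D q f w" and D: "\<And>g. D q f g ==> D q f' g"
  and e: "\<And>J x. J \<in> \<I> q ==> f J x = f' J x"
 shows "laplacian D q f' w"
proof -
 obtain g h c d where v: "laplacian_via D q f w g h c d"
  using l unfolding laplacian_iff_via by (elim exE)
 have ad: "L2_adjoint D (q - 1) f' c" if q: "q \<noteq> 0"
 proof -
  have q1: "q - 1 + 1 = q" using q by simp
  have A: "L2_adjoint D (q - 1) f c" by (rule laplacian_viaD(3)[OF v q])
  have "L2_form q f'"
   using L2_adjoint_L2[OF A] e unfolding q1 L2_form_def by (metis ext)
  moreover have "L2_inner q w' f' = L2_inner q w' f" for w'
   by (rule L2_inner_cong) (simp_all add: e)
  ultimately show ?thesis using A unfolding L2_adjoint_def q1 by simp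
 qed
 have 1: "D q f' g" by (rule D[OF laplacian_viaD(1)[OF v]])
 have 2: "if q = 0 then d = (\<lambda>K x. 0) else L2_adjoint D (q - 1) f' c \<and> D (q - 1) c d"
 proof (cases "q = 0")
  case True
  show ?thesis using laplacian_viaD(5)[OF v True] True by simp
 next
  case False
  show ?thesis using ad[OF False] laplacian_viaD(4)[OF v False] False by (simp only: if_False simp_thms)
 qed
 have "laplacian_via D q f' w g h c d"
  unfolding laplacian_via_def by (intro conjI ballI allI 1 2 laplacian_viaD(2,6)[OF v])
 thus ?thesis unfolding laplacian_iff_via by (intro exI)
qed

section \<open>Differentiation under the integral sign\<close>

lemma has_vector_derivativeI_quotient:
 fixes f :: "real => complex"
 assumes "((\<lambda>h. (f (s + h) - f s) /\<^sub>R h) \<longlongrightarrow> d) (at 0)"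
 shows "(f has_vector_derivative d) (at s)"
proof -
 have lim: "((\<lambda>h. norm ((f (s + h) - f s) /\<^sub>R h - d)) \<longlongrightarrow> 0) (at 0)"
  by (rule tendsto_norm_zero[OF LIM_zero[OF assms]])
 have eq: "norm ((f (s + h) - f s) /\<^sub>R h - d) = norm (f (s + h) - f s - h *\<^sub>R d) / norm h" if "h \<noteq> 0" for h
 proof -
  have "(f (s + h) - f s) /\<^sub>R h - d = (f (s + h) - f s - h *\<^sub>R d) /\<^sub>R h"
   using that by (simp add: scaleR_diff_right)
  thus ?thesis by (simp add: divide_inverse mult.commute)
 qed
 have "((\<lambda>h. norm (f (s + h) - f s - h *\<^sub>R d) / norm h) \<longlongrightarrow> 0) (at 0)"
  by (rule Lim_transform_eventually[OF lim]) (auto simp: eventually_at_filter eq)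
 thus ?thesis
  unfolding has_vector_derivative_def has_derivative_at
  by (simp only: bounded_linear_scaleR_left simp_thms)
qed

lemma has_vector_derivativeD_quotient:
 fixes f :: "real => complex"
 assumes "(f has_vector_derivative d) (at s)"
 shows "((\<lambda>h. (f (s + h) - f s) /\<^sub>R h) \<longlongrightarrow> d) (at 0)"
proof -
 have "((\<lambda>h. norm (f (s + h) - f s - h *\<^sub>R d) / norm h) \<longlongrightarrow> 0) (at 0)"
  using assms unfolding has_vector_derivative_def has_derivative_at by simp
 moreover have "norm (f (s + h) - f s - h *\<^sub>R d) / norm h = norm ((f (s + h) - f s) /\<^sub>R h - d)" if "h \<noteq> 0" for h
 proof -
  have "(f (s + h) - f s) /\<^sub>R h - d = (f (s + h) - f s - h *\<^sub>R d) /\<^sub>R h"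
   using that by (simp add: scaleR_diff_right)
  thus ?thesis by (simp add: divide_inverse mult.commute)
 qed
 ultimately have "((\<lambda>h. norm ((f (s + h) - f s) /\<^sub>R h - d)) \<longlongrightarrow> 0) (at 0)"
  by (elim Lim_transform_eventually) (auto simp: eventually_at_filter)
 thus ?thesis by (rule LIM_zero_cancel[OF tendsto_norm_zero_cancel])
qed

lemma tendsto_at_0_sequentially:
 fixes f :: "real => 'a::metric_space"
 assumes "\<And>X. (\<And>n. X n \<noteq> 0) ==> (\<And>n. \<bar>X n\<bar> < r) ==> X \<longlonglongrightarrow> 0 ==> (\<lambda>n. f (X n)) \<longlonglongrightarrow> L" and r: "r > 0"
 shows "(f \<longlongrightarrow> L) (at 0)"
proof -
 have "(\<lambda>n. f (X n)) \<longlonglongrightarrow> L" if X: "\<And>n. X n \<noteq> 0" "X \<longlonglongrightarrow> 0" for X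
 proof -
  let ?Y = "\<lambda>n. if \<bar>X n\<bar> < r then X n else r / 2"
  have ev: "\<forall>\<^sub>F n in sequentially. X n = ?Y n"
   using order_tendstoD(2)[OF tendsto_rabs_zero[OF X(2)] r] by eventually_elim simp
  have "?Y \<longlonglongrightarrow> 0" by (rule Lim_transform_eventually[OF X(2) ev])
  hence "(\<lambda>n. f (?Y n)) \<longlonglongrightarrow> L" using X r by (intro assms(1)) auto
  moreover have "\<forall>\<^sub>F n in sequentially. f (?Y n) = f (X n)"
   using ev by eventually_elim simp
  ultimately show ?thesis by (rule Lim_transform_eventually)
 qed
 thus ?thesis unfolding tendsto_at_iff_sequentially o_def by auto
qed

lemma vector_derivative_quotient_bound:
 fixes f :: "real => complex"
 assumes "\<And>t. \<bar>t - s\<bar> < r ==> (f has_vector_derivative f' t) (at t)" "\<And>t. \<bar>t - s\<bar> < r ==> cmod (f' t) \<le> B"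
  and h: "\<bar>h\<bar> < r" "h \<noteq> 0"
 shows "cmod ((f (s + h) - f s) /\<^sub>R h) \<le> B"
proof -
 have "norm (f (s + h) - f s) \<le> B * norm (s + h - s)"
 proof (rule differentiable_bound[where f'="\<lambda>t u. u *\<^sub>R f' t" and S="{t. \<bar>t - s\<bar> < r}"])
  have "{t. \<bar>t - s\<bar> < r} = {s - r<..<s + r}" by auto
  thus "convex {t. \<bar>t - s\<bar> < r}" by simp
  show "(f has_derivative (\<lambda>u. u *\<^sub>R f' t)) (at t within {t. \<bar>t - s\<bar> < r})" if "t \<in> {t. \<bar>t - s\<bar> < r}" for t
   using assms(1)[of t] that by (auto simp: has_vector_derivative_def intro: has_derivative_at_withinI)
  show "onorm (\<lambda>u. u *\<^sub>R f' t) \<le> B" if "t \<in> {t. \<bar>t - s\<bar> < r}" for t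
   using assms(2)[of t] that by (intro onorm_le) (simp add: mult.commute[of B] mult_left_mono)
 qed (use h in auto)
 moreover have "norm ((f (s + h) - f s) /\<^sub>R h) = norm (f (s + h) - f s) / \<bar>h\<bar>"
  by (simp add: divide_inverse mult.commute)
 ultimately show ?thesis using h(2) by (simp add: pos_divide_le_eq)
qed

text \<open>The mean value inequality bounds the difference quotients by the same \<open>g\<close>
  as the derivatives, so dominated convergence applies along every sequence of steps.\<close>

lemma has_vector_derivative_integral:
 fixes F F' :: "real => 'x::euclidean_space => complex"
 assumes r: "r > 0" and i: "\<And>t. \<bar>t - s\<bar> < r ==> integrable lborel (F t)"
  and d: "\<And>t x. \<bar>t - s\<bar> < r ==> ((\<lambda>t. F t x) has_vector_derivative F' t x) (at t)"
  and b: "\<And>t x. \<bar>t - s\<bar> < r ==> cmod (F' t x) \<le> g x" and g: "integrable lborel g"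
  and m: "F' s \<in> borel_funs"
 shows "((\<lambda>t. LI x. F t x) has_vector_derivative (LI x. F' s x)) (at s)"
proof (rule has_vector_derivativeI_quotient, rule tendsto_at_0_sequentially[OF _ r])
 fix X :: "nat => real" assume X: "\<And>n. X n \<noteq> 0" "\<And>n. \<bar>X n\<bar> < r" "X \<longlonglongrightarrow> 0"
 have i1: "integrable lborel (F (s + X n))" for n using i[of "s + X n"] X(2) by simp
 have i0: "integrable lborel (F s)" using i[of s] r by simp
 have e: "((LI x. F (s + X n) x) - (LI x. F s x)) /\<^sub>R X n = (LI x. (F (s + X n) x - F s x) /\<^sub>R X n)" for n
  using i1 i0 by simp
 show "(\<lambda>n. ((LI x. F (s + X n) x) - (LI x. F s x)) /\<^sub>R X n) \<longlonglongrightarrow> (LI x. F' s x)"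
  unfolding e
 proof (rule integral_dominated_convergence[OF _ _ g])
  show "F' s \<in> borel_measurable lborel" using m by simp
  show "(\<lambda>x. (F (s + X n) x - F s x) /\<^sub>R X n) \<in> borel_measurable lborel" for n
   using borel_measurable_integrable[OF i1[of n]] borel_measurable_integrable[OF i0] by measurable
  show "AE x in lborel. (\<lambda>n. (F (s + X n) x - F s x) /\<^sub>R X n) \<longlonglongrightarrow> F' s x"
  proof (rule AE_I2)
   fix x
   have "((\<lambda>h. (F (s + h) x - F s x) /\<^sub>R h) \<longlongrightarrow> F' s x) (at 0)"
    by (rule has_vector_derivativeD_quotient[OF d]) (use r in simp)
   moreover have "filterlim X (at 0) sequentially" using X by (auto simp: filterlim_at)
   ultimately show "(\<lambda>n. (F (s + X n) x - F s x) /\<^sub>R X n) \<longlonglongrightarrow> F' s x" by (rule filterlim_compose)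
  qed
  show "AE x in lborel. norm ((F (s + X n) x - F s x) /\<^sub>R X n) \<le> g x" for n
   by (intro AE_I2 vector_derivative_quotient_bound[where f'="\<lambda>t. F' t x" and r=r for x]) (use d b X in auto)
 qed
qed

context diag_form
begin

lemma mehler_measurable [measurable]: "(\<lambda>z. mehler K s z) \<in> borel_funs"
 by (rule borel_measurable_continuous_onI[OF mehler_continuous])

lemma dim_cspace: "DIM('n cspace) = 2 * CARD('n)"
 by (simp add: mult.commute)

text \<open>In the variable z = sqrt(s) y the kernel converges to the normalized Gaussian, since s a
  and s b tend to 1, and it is dominated by a Gaussian uniformly for s <= 1.\<close>

lemma mehler_approximate_identity:
 assumes k: "k \<in> borel_funs" "\<And>z. cmod (k z) \<le> B" and c: "isCont k 0"
 shows "((\<lambda>s. LI z. of_real (mehler K s z) * k z) \<longlongrightarrow> k 0) (at_right 0)"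
proof (rule tendsto_at_right_0_sequentially[of 1])
 fix X :: "nat => real" assume X: "\<And>n. X n > 0" "\<And>n. X n \<le> 1" "X \<longlonglongrightarrow> 0"
 have Xr: "filterlim X (at_right 0) sequentially"
 proof -
  have "X n \<noteq> 0" for n using X(1)[of n] by simp
  thus ?thesis using X by (auto simp: filterlim_at)
 qed
 note [measurable] = k(1)
 let ?N = "CARD('n)"
 \<comment> \<open>The real dimension is 2 n, so the Jacobian of the scaling by sqrt(s) is
   s^n.\<close>
 define F where "F n y = of_real (X n ^ ?N * mehler K (X n) (sqrt (X n) *\<^sub>R y)) * k (sqrt (X n) *\<^sub>R y)" for n and y :: "'n cspace"
 have eq: "(LI z. of_real (mehler K (X n) z) * k z) = (LI y. F n y)" for n
 proof -
  have m: "(\<lambda>z. complex_of_real (mehler K (X n) z) * k z) \<in> borel_funs" by measurable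
  have "(LI z. of_real (mehler K (X n) z) * k z) = of_real (sqrt (X n) ^ DIM('n cspace)) * (LI y. of_real (mehler K (X n) (sqrt (X n) *\<^sub>R y)) * k (sqrt (X n) *\<^sub>R y))"
   by (rule lborel_integral_scale[OF _ m, of "sqrt (X n)", unfolded abs_of_pos[OF real_sqrt_gt_zero[OF X(1)]]]) (use X(1)[of n] in simp)
  also have "sqrt (X n) ^ DIM('n cspace) = X n ^ ?N"
   unfolding dim_cspace power_mult using X(1)[of n] by simp
  finally show ?thesis by (simp add: F_def mult.assoc)
 qed
 have mehler_scaled: "X n ^ ?N * mehler K (X n) (sqrt (X n) *\<^sub>R y)
   = (\<Prod>j\<in>UNIV. X n * mehler_b (\<mu> j) (X n) * exp (X n * sgn_rate K j) / pi) * exp (- (\<Sum>j\<in>UNIV. X n * mehler_a (\<mu> j) (X n) * (cmod (crd j y))^2))" for n y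
 proof -
  have "crd j (sqrt (X n) *\<^sub>R y) = of_real (sqrt (X n)) * crd j y" for j
   using linear_cmul[OF bounded_linear.linear[OF crd_linear[of j]], of "sqrt (X n)" y] by (simp add: scaleR_conv_of_real)
  hence 1: "mehler_a (\<mu> j) (X n) * (cmod (crd j (sqrt (X n) *\<^sub>R y)))^2 = X n * mehler_a (\<mu> j) (X n) * (cmod (crd j y))^2" for j
   using X(1)[of n] by (simp add: norm_mult power_mult_distrib)
  have "(\<Prod>j\<in>UNIV. X n * mehler_b (\<mu> j) (X n) * exp (X n * sgn_rate K j) / pi) = (\<Prod>j\<in>UNIV. X n * (mehler_b (\<mu> j) (X n) * exp (X n * sgn_rate K j) / pi))"
   by (intro prod.cong refl) simp
  also have "\<dots> = X n ^ ?N * (\<Prod>j\<in>UNIV. mehler_b (\<mu> j) (X n) * exp (X n * sgn_rate K j) / pi)"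
   by (simp only: prod.distrib prod_constant)
  finally show ?thesis unfolding mehler_def 1 by (simp only: mult.assoc)
 qed
 have lim: "(\<lambda>n. F n y) \<longlonglongrightarrow> of_real ((1 / pi) ^ ?N * gauss 1 y) * k 0" for y
 proof -
  have a: "(\<lambda>n. X n * mehler_a m (X n)) \<longlonglongrightarrow> 1" and b: "(\<lambda>n. X n * mehler_b m (X n)) \<longlonglongrightarrow> 1" for m
   using filterlim_compose[OF mehler_lim(1) Xr] filterlim_compose[OF mehler_lim(2) Xr] by auto
  have "(\<lambda>n. (\<Prod>j\<in>UNIV. X n * mehler_b (\<mu> j) (X n) * exp (X n * sgn_rate K j) / pi) * exp (- (\<Sum>j\<in>UNIV. X n * mehler_a (\<mu> j) (X n) * (cmod (crd j y))^2)))
   \<longlonglongrightarrow> (\<Prod>j::'n\<in>UNIV. 1 * exp (0 * sgn_rate K j) / pi) * exp (- (\<Sum>j\<in>UNIV. 1 * (cmod (crd j y))^2))"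
   by (intro tendsto_mult tendsto_prod tendsto_divide tendsto_exp tendsto_minus tendsto_sum tendsto_const a b X(3)) simp
  also have "(\<Prod>j::'n\<in>UNIV. 1 * exp (0 * sgn_rate K j) / pi) * exp (- (\<Sum>j\<in>UNIV. 1 * (cmod (crd j y))^2)) = (1 / pi) ^ ?N * gauss 1 y"
   by (simp add: norm_crd)
  finally have 1: "(\<lambda>n. X n ^ ?N * mehler K (X n) (sqrt (X n) *\<^sub>R y)) \<longlonglongrightarrow> (1 / pi) ^ ?N * gauss 1 y"
   unfolding mehler_scaled .
  have "(\<lambda>n. sqrt (X n) *\<^sub>R y) \<longlonglongrightarrow> sqrt 0 *\<^sub>R y" by (intro tendsto_intros X(3))
  hence "(\<lambda>n. k (sqrt (X n) *\<^sub>R y)) \<longlonglongrightarrow> k 0" using isCont_tendsto_compose[OF c] by simp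
  from tendsto_mult[OF tendsto_of_real[OF 1] this] show ?thesis unfolding F_def .
 qed
 have bound: "cmod (F n y) \<le> exp mu_sum * (1 / pi) ^ ?N * B * gauss 1 y" for n y
 proof -
  have "X n ^ ?N * mehler K (X n) (sqrt (X n) *\<^sub>R y) \<le> X n ^ ?N * (exp (X n * mu_sum) * (1 / (pi * X n)) ^ ?N * exp (- ((norm (sqrt (X n) *\<^sub>R y))^2 / X n)))"
   by (rule mult_left_mono[OF mehler_le[OF X(1)] zero_le_power[OF less_imp_le[OF X(1)]]])
  also have "\<dots> = exp (X n * mu_sum) * (1 / pi) ^ ?N * gauss 1 y"
  proof -
   have "(norm (sqrt (X n) *\<^sub>R y))^2 / X n = (norm y)^2" using X(1)[of n] by (simp add: power_mult_distrib)
   moreover have "X n ^ ?N * (1 / (pi * X n)) ^ ?N = (1 / pi) ^ ?N"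
    unfolding power_mult_distrib[symmetric] using X(1)[of n] by simp
   ultimately show ?thesis by (simp add: mult_ac)
  qed
  also have "\<dots> \<le> exp mu_sum * (1 / pi) ^ ?N * gauss 1 y"
  proof -
   have "X n * mu_sum \<le> 1 * mu_sum" using X(2)[of n] mu_sum_nonneg by (intro mult_right_mono) auto
   thus ?thesis by (intro mult_right_mono) auto
  qed
  finally have 1: "X n ^ ?N * mehler K (X n) (sqrt (X n) *\<^sub>R y) \<le> exp mu_sum * (1 / pi) ^ ?N * gauss 1 y" .
  have 2: "0 \<le> X n ^ ?N * mehler K (X n) (sqrt (X n) *\<^sub>R y)"
   using X(1)[of n] mehler_pos[OF X(1)[of n], of K "sqrt (X n) *\<^sub>R y"] by (intro mult_nonneg_nonneg) auto
  have "cmod (F n y) \<le> (exp mu_sum * (1 / pi) ^ ?N * gauss 1 y) * B"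
   unfolding F_def norm_mult norm_of_real abs_of_nonneg[OF 2] by (rule mult_mono[OF 1 k(2)]) auto
  thus ?thesis by (simp add: mult_ac)
 qed
 have "(\<lambda>n. LI y. F n y) \<longlonglongrightarrow> (LI y. of_real ((1 / pi) ^ ?N * gauss 1 (y::'n cspace)) * k 0)"
 proof (rule integral_dominated_convergence)
  show "integrable lborel (\<lambda>y::'n cspace. exp mu_sum * (1 / pi) ^ ?N * B * gauss 1 y)"
   by (intro integrable_mult_right gauss_integrable) simp
  show "F n \<in> borel_measurable lborel" for n unfolding F_def[abs_def] by measurable
 qed (use lim bound in auto)
 also have "(LI y. of_real ((1 / pi) ^ ?N * gauss 1 (y::'n cspace)) * k 0) = k 0"
 proof -
  have "(LI y. gauss 1 (y::'n cspace)) = sqrt (pi / 1) ^ DIM('n cspace)"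
   using gauss_integral[of 1, where 'a="'n cspace"] by (simp add: has_bochner_integral_iff)
  also have "\<dots> = pi ^ ?N" unfolding dim_cspace power_mult by simp
  finally have "(LI y. (1 / pi) ^ ?N * gauss 1 (y::'n cspace)) = 1"
   unfolding integral_mult_right_zero by (simp flip: power_mult_distrib)
  thus ?thesis unfolding integral_mult_left_zero integral_complex_of_real by simp
 qed
 finally show "(\<lambda>n. LI z. of_real (mehler K (X n) z) * k z) \<longlonglongrightarrow> k 0" unfolding eq .
qed simp

section \<open>The weighted heat flow\<close>

lemma Phase_continuous: "continuous_on UNIV (\<lambda>p. Phase (fst p) (snd p))"
 unfolding Phase_crd
 by (intro continuous_intros linear_continuous_on[OF crd_linear, THEN continuous_on_compose2[of UNIV]]) auto

lemma crd_continuous_diff: "continuous_on UNIV (\<lambda>p. crd j (fst p) - crd j (snd p))"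
 by (intro continuous_intros linear_continuous_on[OF crd_linear, THEN continuous_on_compose2[of UNIV]]) auto

lemma gker_Pk: assumes s: "s > 0" shows "gker (Pk K s)"
proof -
 have "continuous_on UNIV (\<lambda>p. of_real (mehler K s (fst p - snd p)) * Phase (fst p) (snd p))"
  by (intro continuous_on_mult Phase_continuous continuous_on_of_real continuous_on_compose2[OF mehler_continuous] continuous_intros) auto
 hence "(\<lambda>p. Pk K s (fst p) (snd p)) \<in> borel_funs"
  unfolding Pk_def by (rule borel_measurable_continuous_onI)
 moreover have "cmod (Pk K s x y) \<le> (exp (s * mu_sum) * (1 / (pi * s)) ^ CARD('n)) * gauss (1 / s) (x - y)" for x y
  using mehler_le[OF s, of K "x - y"] mehler_pos[OF s, of K "x - y"] by (simp add: Pk_def norm_mult)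
 ultimately show ?thesis unfolding gker_def using s
  by (intro conjI exI[of _ "exp (s * mu_sum) * (1 / (pi * s)) ^ CARD('n)"] exI[of _ "1 / s"]) auto
qed

lemma gker_ellw: "gker k ==> gker (\<lambda>z w. ellw s w j z * k z w)"
proof (rule gker_mult[where D="\<bar>mehler_a (\<mu> j) s + \<mu> j\<bar>" and N=1])
 show "continuous_on UNIV (\<lambda>p. ellw s (snd p) j (fst p))"
  unfolding ellw_def by (intro continuous_on_mult continuous_on_const crd_continuous_diff)
 fix x y
 have "cmod (crd j (x - y)) \<le> 1 + norm (x - y)" using crd_le[of j "x - y"] by simp
 thus "cmod (ellw s y j x) \<le> \<bar>mehler_a (\<mu> j) s + \<mu> j\<bar> * (1 + norm (x - y)) ^ 1"
  unfolding ellw_def crd_diff[symmetric] norm_mult norm_minus_cancel norm_of_real by (simp add: mult_left_mono)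
qed

lemma gker_emw: "gker k ==> gker (\<lambda>z w. emw s w j z * k z w)"
proof (rule gker_mult[where D="\<bar>mehler_a (\<mu> j) s - \<mu> j\<bar>" and N=1])
 show "continuous_on UNIV (\<lambda>p. emw s (snd p) j (fst p))"
  unfolding emw_def by (intro continuous_on_mult continuous_on_const continuous_on_cnj crd_continuous_diff)
 fix x y
 have "cmod (crd j (x - y)) \<le> 1 + norm (x - y)" using crd_le[of j "x - y"] by simp
 thus "cmod (emw s y j x) \<le> \<bar>mehler_a (\<mu> j) s - \<mu> j\<bar> * (1 + norm (x - y)) ^ 1"
  unfolding emw_def crd_diff[symmetric] norm_mult complex_mod_cnj norm_of_real by (simp add: mult_left_mono)
qed

lemma gker_parts:
 assumes s: "s > 0"
 shows "gker (\<lambda>z w. weighted.single L (\<lambda>z. Pk L s z w) J z)"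
  "gker (\<lambda>z w. weighted.up L (\<lambda>z. Pk L s z w) J z)"
  "gker (\<lambda>z w. weighted.down L (\<lambda>z. Pk L s z w) J z)"
  "gker (\<lambda>z w. weighted.up' q L (\<lambda>z. Pk L s z w) J z)"
  "gker (\<lambda>z w. weighted.down' q L (\<lambda>z. Pk L s z w) J z)"
proof -
 note P = gker_Pk[OF s, of L]
 show "gker (\<lambda>z w. weighted.single L (\<lambda>z. Pk L s z w) J z)"
  unfolding weighted.single_def by (cases "J = L") (simp_all add: P gker_zero)
 show "gker (\<lambda>z w. weighted.up L (\<lambda>z. Pk L s z w) J z)"
  unfolding weighted.up_def Wtw_Pk by (intro gker_sum gker_cmult gker_ellw P)
 show "gker (\<lambda>z w. weighted.down L (\<lambda>z. Pk L s z w) J z)"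
  unfolding weighted.down_def Wsw_Pk by (intro gker_sum gker_cmult gker_emw P)
 have t: "gker (\<lambda>z w. (ellw s w j z * emw s w k z + c) * Pk L s z w)" for j k c
  unfolding distrib_right mult.assoc by (intro gker_add gker_cmult gker_ellw gker_emw P)
 show "gker (\<lambda>z w. weighted.up' q L (\<lambda>z. Pk L s z w) J z)"
  unfolding weighted.up'_expand[OF Pk_gs[OF s]] Wsw_Wtw_Pk by (intro gker_sum gker_cmult t)
 show "gker (\<lambda>z w. weighted.down' q L (\<lambda>z. Pk L s z w) J z)"
  unfolding weighted.down'_expand[OF Pk_gs[OF s]] Wtw_Wsw_Pk by (intro gker_sum gker_cmult t)
qed

definition flow :: "('n, 'n cspace) form => real => ('n, 'n cspace) form" where
 "flow f s K = gop (Pk K s) (f K)"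

definition flow' :: "('n, 'n cspace) form => real => ('n, 'n cspace) form" where
 "flow' f s K = gop (\<lambda>z w. of_real (mehler_rate K s (z - w)) * Pk K s z w) (f K)"

lemma gop_single:
 "gop (\<lambda>z w. weighted.single L (\<lambda>z. k z w) J z) f x = (if J = L then gop k f x else 0)"
 by (simp add: gop_def weighted.single_def)

lemma finite_multi [simp]: "finite (\<I> q :: 'n set set)"
 by simp

text \<open>For each component L the four intermediate forms of \<open>Pk\<close> have Gaussian
  kernels in z and w; applying them to \<open>f L\<close> keeps the graph and adjoint relations, and
  the contributions are added over L.\<close>

theorem weighted_laplacian_flow:
 assumes s: "s > 0" and f: "L2_form q f"
 shows "weighted_Box \<phi> \<xi> v q (flow f s) (\<lambda>K z. - flow' f s K z)"
proof -
 let ?M = "\<I> q :: 'n set set"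
 define S where "S L J z w = weighted.single L (\<lambda>z. Pk L s z w) J z" for L J z w
 define g where "g L J = gop (\<lambda>z w. weighted.up L (\<lambda>z. Pk L s z w) J z) (f L)" for L J
 define h where "h L J = gop (\<lambda>z w. weighted.up' q L (\<lambda>z. Pk L s z w) J z) (f L)" for L J
 define c where "c L J = gop (\<lambda>z w. weighted.down L (\<lambda>z. Pk L s z w) J z) (f L)" for L J
 define d where "d L J = gop (\<lambda>z w. weighted.down' q L (\<lambda>z. Pk L s z w) J z) (f L)" for L J
 define F where "F L J = gop (S L J) (f L)" for L J
 have fL: "L2_fun (f L)" if "L \<in> ?M" for L using f that by (simp add: L2_form_def)
 note G = gker_parts[OF s]
 have SS: "S L J = (\<lambda>z w. weighted.single L (\<lambda>z. Pk L s z w) J z)" for L J by (simp add: S_def fun_eq_iff)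
 have 1: "weighted.Dn q (F L) (g L)" "L2_adjoint (weighted_dbar \<phi> \<xi> v) q (g L) (h L)" if L: "L \<in> ?M" for L
  unfolding F_def[abs_def] g_def[abs_def] h_def[abs_def] SS
  by (rule weighted.Dn_gop weighted.adjoint_gop; intro G weighted.parts(1,2)[OF Pk_gs[OF s] L] fL[OF L])+
 have 2: "L2_adjoint (weighted_dbar \<phi> \<xi> v) (q - 1) (F L) (c L)" "weighted.Dn (q - 1) (c L) (d L)" if L: "L \<in> ?M" and q: "q \<noteq> 0" for L
  unfolding F_def[abs_def] c_def[abs_def] d_def[abs_def] SS
  by (rule weighted.Dn_gop weighted.adjoint_gop; intro G weighted.parts(3,4)[OF Pk_gs[OF s] L q] fL[OF L])+
 have FF: "(\<lambda>J x. \<Sum>L\<in>?M. F L J x) J x = flow f s J x" if "J \<in> ?M" for J x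
  using that by (simp add: F_def SS gop_single flow_def)
 have hd: "(\<Sum>L\<in>?M. h L J x) + (\<Sum>L\<in>?M. d L J x) = - flow' f s J x" if J: "J \<in> ?M" for J x
 proof -
  have "h L J x + d L J x = (if J = L then - flow' f s J x else 0)" if L: "L \<in> ?M" for L
  proof -
   have "h L J x + d L J x = gop (\<lambda>z w. weighted.up' q L (\<lambda>z. Pk L s z w) J z + weighted.down' q L (\<lambda>z. Pk L s z w) J z) (f L) x"
    unfolding h_def d_def gop_def distrib_right
    by (rule B_integral_add[symmetric]) (intro gop_integrable G fL[OF L])+
   also have "\<dots> = gop (\<lambda>z w. weighted.single L (\<lambda>z. - of_real (mehler_rate L s (z - w)) * Pk L s z w) J z) (f L) x"
    by (simp only: weighted_parts_Pk[OF s L J])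
   also have "\<dots> = (if J = L then - flow' f s J x else 0)"
    unfolding gop_single by (simp add: gop_def flow'_def)
   finally show ?thesis .
  qed
  hence "(\<Sum>L\<in>?M. h L J x + d L J x) = (\<Sum>L\<in>?M. if J = L then - flow' f s J x else 0)" by (intro sum.cong refl)
  thus ?thesis using J by (simp add: sum.distrib)
 qed
 have cong: "weighted_Box \<phi> \<xi> v q (\<lambda>J x. \<Sum>L\<in>?M. F L J x) (\<lambda>K z. - flow' f s K z)"
  unfolding laplacian_iff_via laplacian_via_def
 proof (rule exI, rule exI, rule exI, rule exI, intro conjI)
  show "weighted_dbar \<phi> \<xi> v q (\<lambda>J x. \<Sum>L\<in>?M. F L J x) (\<lambda>J x. \<Sum>L\<in>?M. g L J x)"
   by (rule weighted.Dn_D[OF weighted.Dn_sum[OF finite_multi 1(1)]])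
  show "L2_adjoint (weighted_dbar \<phi> \<xi> v) q (\<lambda>J x. \<Sum>L\<in>?M. g L J x) (\<lambda>J x. \<Sum>L\<in>?M. h L J x)"
   by (rule L2_adjoint_sum[OF weighted.L2_graph finite_multi 1(2)])
  let ?d = "if q = 0 then (\<lambda>K x. 0) else (\<lambda>J x. \<Sum>L\<in>?M. d L J x)"
  show "if q = 0 then ?d = (\<lambda>K x. 0) else L2_adjoint (weighted_dbar \<phi> \<xi> v) (q - 1) (\<lambda>J x. \<Sum>L\<in>?M. F L J x) (\<lambda>J x. \<Sum>L\<in>?M. c L J x)
    \<and> weighted_dbar \<phi> \<xi> v (q - 1) (\<lambda>J x. \<Sum>L\<in>?M. c L J x) ?d"
  proof (cases "q = 0")
   case False
   have "L2_adjoint (weighted_dbar \<phi> \<xi> v) (q - 1) (\<lambda>J x. \<Sum>L\<in>?M. F L J x) (\<lambda>J x. \<Sum>L\<in>?M. c L J x)"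
    by (rule L2_adjoint_sum[OF weighted.L2_graph finite_multi 2(1)[OF _ False]])
   moreover have "weighted_dbar \<phi> \<xi> v (q - 1) (\<lambda>J x. \<Sum>L\<in>?M. c L J x) (\<lambda>J x. \<Sum>L\<in>?M. d L J x)"
    by (rule weighted.Dn_D[OF weighted.Dn_sum[OF finite_multi 2(2)[OF _ False]]])
   ultimately show ?thesis using False by simp
  qed simp
  show "\<forall>K\<in>?M. \<forall>x. - flow' f s K x = (\<Sum>L\<in>?M. h L K x) + ?d K x"
  proof (intro ballI allI)
   fix K :: "'n set" and x assume K: "K \<in> ?M"
   have "(\<Sum>L\<in>?M. d L K x) = ?d K x"
   proof (cases "q = 0")
    case True
    have "d L K x = 0" for L
     using K unfolding d_def gop_def True by (simp add: weighted.down'_0)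
    thus ?thesis using True by simp
   qed simp
   thus "- flow' f s K x = (\<Sum>L\<in>?M. h L K x) + ?d K x" using hd[OF K, of x] by (simp only:)
  qed
 qed
 have "weighted_dbar \<phi> \<xi> v q (flow f s) g" if "weighted_dbar \<phi> \<xi> v q (\<lambda>J x. \<Sum>L\<in>?M. F L J x) g" for g
 proof -
  have "L2_form q (flow f s)"
   using fL gop_L2[OF gker_Pk[OF s]] by (auto simp: L2_form_def flow_def)
  thus ?thesis using that FF unfolding weighted_dbar_def dbar_distr_def by (simp cong: sum.cong)
 qed
 thus ?thesis by (rule laplacian_cong[OF cong _ FF])
qed

lemma mehler_rate_bound:
 assumes s1: "s1 > 0" and t: "s1 \<le> t"
 shows "\<bar>mehler_rate K t x\<bar> \<le> (real CARD('n) * (1 / s1 + (1 / s1)^2) + 2 * mu_sum) * (1 + norm x) ^ 2"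
proof -
 have tp: "t > 0" using assms by simp
 have inv: "1 / t \<le> 1 / s1" using assms by (simp add: frac_le)
 have x1: "1 \<le> (1 + norm x) ^ 2" "(norm x)^2 \<le> (1 + norm x) ^ 2" by (auto intro: one_le_power power_mono)
 have "\<bar>mehler_rate K t x\<bar> \<le> (\<Sum>j\<in>UNIV. (1 / s1 + (1 / s1)^2 + 2 * \<bar>\<mu> j\<bar>) * (1 + norm x) ^ 2)"
  unfolding mehler_rate_def
 proof (rule order_trans[OF sum_abs sum_mono])
  fix j
  note B = mehler_bounds[OF tp, of "\<mu> j"]
  have "(mehler_b (\<mu> j) t)^2 * (cmod (crd j x))^2 \<le> (1 / s1)^2 * (norm x)^2"
   using B inv crd_le[of j x] by (intro mult_mono power_mono) auto
  also have "\<dots> \<le> (1 / s1)^2 * (1 + norm x) ^ 2" using x1 by (intro mult_left_mono) auto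
  finally have 1: "(mehler_b (\<mu> j) t)^2 * (cmod (crd j x))^2 \<le> (1 / s1)^2 * (1 + norm x) ^ 2" .
  have "\<bar>- mehler_a (\<mu> j) t + sgn_rate K j\<bar> \<le> 1 / s1 + 2 * \<bar>\<mu> j\<bar>"
   using B inv by (auto simp: sgn_rate_def)
  also have "\<dots> \<le> (1 / s1 + 2 * \<bar>\<mu> j\<bar>) * (1 + norm x) ^ 2"
  proof -
   have "0 \<le> 1 / s1 + 2 * \<bar>\<mu> j\<bar>" using s1 by simp
   from mult_left_mono[OF x1(1) this] show ?thesis by (simp only: mult_1_right)
  qed
  finally have 2: "\<bar>- mehler_a (\<mu> j) t + sgn_rate K j\<bar> \<le> (1 / s1 + 2 * \<bar>\<mu> j\<bar>) * (1 + norm x) ^ 2" .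
  have "\<bar>- mehler_a (\<mu> j) t + sgn_rate K j + (mehler_b (\<mu> j) t)^2 * (cmod (crd j x))^2\<bar>
    \<le> \<bar>- mehler_a (\<mu> j) t + sgn_rate K j\<bar> + (mehler_b (\<mu> j) t)^2 * (cmod (crd j x))^2"
   by (rule order_trans[OF abs_triangle_ineq]) simp
  also have "\<dots> \<le> (1 / s1 + 2 * \<bar>\<mu> j\<bar>) * (1 + norm x) ^ 2 + (1 / s1)^2 * (1 + norm x) ^ 2"
   using 1 2 by (rule add_mono[rotated])
  finally show "\<bar>- mehler_a (\<mu> j) t + sgn_rate K j + (mehler_b (\<mu> j) t)^2 * (cmod (crd j x))^2\<bar> \<le> (1 / s1 + (1 / s1)^2 + 2 * \<bar>\<mu> j\<bar>) * (1 + norm x) ^ 2"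
   by (simp add: algebra_simps)
 qed
 also have "\<dots> = (real CARD('n) * (1 / s1 + (1 / s1)^2) + 2 * mu_sum) * (1 + norm x) ^ 2"
  unfolding sum_distrib_right[symmetric] by (simp add: sum.distrib mu_sum_def sum_distrib_left)
 finally show ?thesis .
qed

lemma mehler_unif:
 assumes s1: "s1 > 0" and t: "s1 \<le> t" "t \<le> s2"
 shows "\<bar>mehler K t x\<bar> \<le> exp (s2 * mu_sum) * (1 / (pi * s1)) ^ CARD('n) * gauss (1 / s2) x"
proof -
 have tp: "t > 0" using assms by simp
 have "\<bar>mehler K t x\<bar> = mehler K t x" using mehler_pos[OF tp, of K x] by simp
 also have "\<dots> \<le> exp (t * mu_sum) * (1 / (pi * t)) ^ CARD('n) * exp (- ((norm x)^2 / t))" by (rule mehler_le[OF tp])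
 also have "\<dots> \<le> exp (s2 * mu_sum) * (1 / (pi * s1)) ^ CARD('n) * gauss (1 / s2) x"
 proof (intro mult_mono power_mono)
  show "exp (t * mu_sum) \<le> exp (s2 * mu_sum)" using t mu_sum_nonneg by (simp add: mult_right_mono)
  show "1 / (pi * t) \<le> 1 / (pi * s1)" using s1 t by (intro frac_le mult_left_mono mult_pos_pos) auto
  show "exp (- ((norm x)^2 / t)) \<le> gauss (1 / s2) x" using tp t by (simp add: frac_le)
 qed (use s1 tp in auto)
 finally show ?thesis .
qed

text \<open>One bound for all times in a compact interval away from 0. The quadratic growth of
  \<open>mehler_rate\<close> costs half of the Gaussian exponent.\<close>

lemma mehler_dominated:
 assumes s1: "0 < s1" "s1 \<le> s2"
 obtains C c where "C \<ge> 0" "c > 0"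
  "\<And>t x. s1 \<le> t ==> t \<le> s2 ==> \<bar>mehler_rate K t x * mehler K t x\<bar> \<le> C * gauss c x"
proof -
 let ?R = "real CARD('n) * (1 / s1 + (1 / s1)^2) + 2 * mu_sum" and ?A = "exp (s2 * mu_sum) * (1 / (pi * s1)) ^ CARD('n)"
 have R: "?R \<ge> 0" "?A \<ge> 0" using s1 mu_sum_nonneg by auto
 obtain B where B: "B \<ge> 0" "\<And>r. r \<ge> 0 ==> (1 + r) ^ 2 * exp (- ((1 / (2 * s2)) * r^2)) \<le> B"
  using poly_gauss_bound[of "1 / (2 * s2)" 2] s1 by auto
 have "\<bar>mehler_rate K t x * mehler K t x\<bar> \<le> (?R * ?A * B) * gauss (1 / (2 * s2)) x" if t: "s1 \<le> t" "t \<le> s2" for t x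
 proof -
  have e: "gauss (1 / s2) x = gauss (1 / (2 * s2)) x * gauss (1 / (2 * s2)) x"
   by (simp flip: exp_add)
  have "\<bar>mehler_rate K t x * mehler K t x\<bar> \<le> (?R * (1 + norm x) ^ 2) * (?A * gauss (1 / s2) x)"
   unfolding abs_mult using R by (intro mult_mono mehler_rate_bound mehler_unif s1 t) auto
  also have "\<dots> = (?R * ?A * gauss (1 / (2 * s2)) x) * ((1 + norm x) ^ 2 * gauss (1 / (2 * s2)) x)"
   unfolding e by (simp only: mult_ac)
  also have "\<dots> \<le> (?R * ?A * gauss (1 / (2 * s2)) x) * B"
   by (rule mult_left_mono[OF B(2)[OF norm_ge_zero] mult_nonneg_nonneg[OF mult_nonneg_nonneg[OF R] exp_ge_zero]])
  finally show ?thesis by (simp only: mult_ac)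
 qed
 thus thesis using that[of "?R * ?A * B" "1 / (2 * s2)"] R B(1) s1 by (simp del: of_nat_mult)
qed

lemma mehler_rate_continuous: "continuous_on UNIV (mehler_rate K s)"
 unfolding mehler_rate_def[abs_def]
 by (intro continuous_intros linear_continuous_on crd_linear)

lemma mehler_rate_measurable [measurable]: "(\<lambda>z. mehler_rate K s z) \<in> borel_funs"
 by (rule borel_measurable_continuous_onI[OF mehler_rate_continuous])

text \<open>The times with |t - s| < s/2 lie in [s/2, 2 s], where one Gaussian in z - w dominates
  the derivative of the kernel. Its product with |f K| is integrable as a product of square
  integrable functions.\<close>

theorem flow_derivative:
 assumes s: "s > 0" and f: "L2_form q f" and K: "K \<in> \<I> q"
 shows "((\<lambda>s. flow f s K z) has_vector_derivative flow' f s K z) (at s)"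
proof -
 have fK: "L2_fun (f K)" using f K by (simp add: L2_form_def)
 note [measurable] = L2_fun_measurable[OF fK]
 obtain C c where C: "C \<ge> 0" "c > 0" "\<And>t x. s / 2 \<le> t ==> t \<le> 2 * s ==> \<bar>mehler_rate K t x * mehler K t x\<bar> \<le> C * gauss c x"
  using mehler_dominated[of "s / 2" "2 * s" K] s by auto
 have "((\<lambda>t. LI w. Pk K t z w * f K w) has_vector_derivative
   (LI w. of_real (mehler_rate K s (z - w)) * Pk K s z w * f K w)) (at s)"
 proof (rule has_vector_derivative_integral[where r="s / 2" and F="\<lambda>t w. Pk K t z w * f K w"
    and F'="\<lambda>t w. of_real (mehler_rate K t (z - w)) * Pk K t z w * f K w"
    and g="\<lambda>w. C * (gauss c (z - w) * cmod (f K w))"])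
  have ge: "gker (\<lambda>z w :: 'n cspace. of_real (gauss c (z - w)))"
   unfolding gker_def
  proof (rule conjI)
   show "(\<lambda>p. complex_of_real (gauss c (fst p - snd p :: 'n cspace))) \<in> borel_funs"
    by (intro borel_measurable_continuous_onI continuous_intros)
   show "\<exists>C c'. C \<ge> 0 \<and> c' > 0 \<and> (\<forall>x y :: 'n cspace. cmod (complex_of_real (gauss c (x - y))) \<le> C * gauss c' (x - y))"
    by (rule exI[of _ 1], rule exI[of _ c]) (use C(2) in simp)
  qed
  have "integrable lborel (\<lambda>w. C * norm (of_real (gauss c (z - w)) * f K w))"
   by (intro integrable_mult_right integrable_norm gop_integrable[OF ge fK])
  thus "integrable lborel (\<lambda>w. C * (gauss c (z - w) * cmod (f K w)))" by (simp add: norm_mult)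
  fix t assume t: "\<bar>t - s\<bar> < s / 2"
  hence "t - s < s / 2" "- (t - s) < s / 2" unfolding abs_less_iff by simp_all
  hence tb: "s / 2 \<le> t" "t \<le> 2 * s" "t > 0" using s by linarith+
  show "integrable lborel (\<lambda>w. Pk K t z w * f K w)" by (rule gop_integrable[OF gker_Pk[OF tb(3)] fK])
  fix w
  have "((\<lambda>t. of_real (mehler K t (z - w))) has_vector_derivative complex_of_real (mehler_rate K t (z - w) * mehler K t (z - w))) (at t)"
   using bounded_linear.has_vector_derivative[OF bounded_linear_of_real mehler_deriv_s[OF tb(3), unfolded has_real_derivative_iff_has_vector_derivative]] .
  from has_vector_derivative_mult_left[OF this, of "Phase z w * f K w"]
  show "((\<lambda>t. Pk K t z w * f K w) has_vector_derivative of_real (mehler_rate K t (z - w)) * Pk K t z w * f K w) (at t)"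
   by (simp add: Pk_def mult_ac)
  have "cmod (of_real (mehler_rate K t (z - w)) * Pk K t z w * f K w) = \<bar>mehler_rate K t (z - w) * mehler K t (z - w)\<bar> * cmod (f K w)"
   by (simp add: Pk_def norm_mult abs_mult)
  also have "\<dots> \<le> (C * gauss c (z - w)) * cmod (f K w)"
   by (intro mult_right_mono C tb) simp
  finally show "cmod (of_real (mehler_rate K t (z - w)) * Pk K t z w * f K w) \<le> C * (gauss c (z - w) * cmod (f K w))"
   by (simp only: mult.assoc)
 next
  have [measurable]: "(\<lambda>w. Pk K s z w) \<in> borel_funs" by (rule gker_measurable(2)[OF gker_Pk[OF s]])
  show "(\<lambda>w. of_real (mehler_rate K s (z - w)) * Pk K s z w * f K w) \<in> borel_funs" by measurable
 qed (use s in auto)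
 thus ?thesis by (simp add: flow_def flow'_def gop_def)
qed

lemma Phase_self: "Phase z z = 1"
 unfolding Phase_crd by (simp add: mult.commute)

text \<open>Fubini moves the kernel to \<psi>. The transposed flow \<open>I n\<close> of \<psi>
  converges pointwise to \<psi> by the approximate identity and is dominated by a Gaussian in w, so
  square integrability of f suffices for the limit.\<close>

theorem flow_initial:
 assumes f: "L2_form q f" and K: "K \<in> \<I> q" and p: "nice \<psi>"
 shows "((\<lambda>s. LI z. flow f s K z * \<psi> z) \<longlongrightarrow> (LI z. f K z * \<psi> z)) (at_right 0)"
proof (rule tendsto_at_right_0_sequentially[of 1])
 fix X :: "nat => real" assume X: "\<And>n. X n > 0" "\<And>n. X n \<le> 1" "X \<longlonglongrightarrow> 0"
 have fK: "L2_fun (f K)" using f K by (simp add: L2_form_def)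
 note [measurable] = L2_fun_measurable[OF fK] nice_measurable(1)[OF p]
 have Xr: "filterlim X (at_right 0) sequentially"
 proof -
  have "X n \<noteq> 0" for n using X(1)[of n] by simp
  thus ?thesis using X by (auto simp: filterlim_at)
 qed
 obtain C c where C: "C \<ge> 0" "c > 0" "\<And>x. cmod (\<psi> x) \<le> C * gauss c x"
  using nice_frechet(2)[OF p] unfolding gauss_bounded_def by blast
 \<comment> \<open>Half of the heat exponent, 1/(2 s) >= 1/2 for s <= 1, and the decay rate
   \<open>c\<close> of \<psi> together produce decay in w; \<open>dl\<close> lies below
   both.\<close>
 define dl where "dl = min c (1 / 2)"
 have dl: "dl > 0" "dl \<le> c" "dl \<le> 1 / 2" using C(2) by (auto simp: dl_def)
 let ?N = "CARD('n)"
 define I where "I n w = (LI z. \<psi> z * Pk K (X n) z w)" for n w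
 have I_eq: "I n w = (LI x. of_real (mehler K (X n) x) * (Phase (w + x) w * \<psi> (w + x)))" for n w
 proof -
  have [measurable]: "(\<lambda>z. Pk K (X n) z w) \<in> borel_funs" by (rule gker_measurable(3)[OF gker_Pk[OF X(1)]])
  have "I n w = (LI x. \<psi> (w + x) * Pk K (X n) (w + x) w)"
   unfolding I_def by (rule lborel_integral_translate[symmetric]) measurable
  thus ?thesis by (simp add: Pk_def mult_ac)
 qed
 have Pc: "continuous_on UNIV (\<lambda>x. Phase (w + x) w)" for w
 proof -
  have "continuous_on UNIV (\<lambda>x. (w + x, w))" by (intro continuous_on_Pair continuous_intros)
  from continuous_on_compose2[OF Phase_continuous this] show ?thesis by simp
 qed
 have pc: "continuous_on UNIV (\<lambda>x. \<psi> (w + x))" for w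
  by (rule continuous_on_compose2[OF nice_continuous[OF p]]) (auto intro!: continuous_intros)
 have I_lim: "(\<lambda>n. I n w) \<longlonglongrightarrow> \<psi> w" for w
 proof -
  let ?k = "\<lambda>x. Phase (w + x) w * \<psi> (w + x)"
  have kc: "continuous_on UNIV ?k" by (intro continuous_on_mult Pc pc)
  have kb: "cmod (?k x) \<le> C" for x
  proof -
   have "C * gauss c (w + x) \<le> C * 1" using C by (intro mult_left_mono) auto
   thus ?thesis using C(3)[of "w + x"] by (simp add: norm_mult)
  qed
  have "((\<lambda>s. LI x. of_real (mehler K s x) * ?k x) \<longlongrightarrow> ?k 0) (at_right 0)"
   using kc by (intro mehler_approximate_identity[OF borel_measurable_continuous_onI[OF kc] kb])
    (simp add: continuous_on_eq_continuous_at)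
  from filterlim_compose[OF this Xr] show ?thesis by (simp add: I_eq Phase_self)
 qed
 have I_bound: "cmod (I n w) \<le> exp mu_sum * C * 2 ^ ?N * gauss (dl / 2) w" for n w
 proof -
  let ?G = "\<lambda>x :: 'n cspace. (exp mu_sum * C * gauss (dl / 2) w * (1 / (pi * X n)) ^ ?N) * gauss (1 / (2 * X n)) x"
  have b: "norm (of_real (mehler K (X n) x) * (Phase (w + x) w * \<psi> (w + x))) \<le> ?G x" for x
  proof -
   have m: "\<bar>mehler K (X n) x\<bar> \<le> exp mu_sum * (1 / (pi * X n)) ^ ?N * exp (- ((norm x)^2 / X n))"
   proof -
    have "exp (X n * mu_sum) \<le> exp mu_sum" using X(2)[of n] mu_sum_nonneg by (simp add: mult_left_le_one_le X(1) less_imp_le)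
    hence "exp (X n * mu_sum) * (1 / (pi * X n)) ^ ?N * exp (- ((norm x)^2 / X n)) \<le> exp mu_sum * (1 / (pi * X n)) ^ ?N * exp (- ((norm x)^2 / X n))"
     using X(1)[of n] by (intro mult_right_mono) auto
    thus ?thesis using mehler_le[OF X(1)[of n], of K x] mehler_pos[OF X(1)[of n], of K x] by simp
   qed
   have "dl * - (norm (w + x - w))\<^sup>2 \<le> dl * ((norm (w + x))^2 - (norm w)\<^sup>2 / 2)"
    using dl by (intro mult_left_mono norm_sq_shift) auto
   hence "dl / 2 * (norm w)^2 \<le> dl * (norm (w + x))^2 + dl * (norm x)^2" by (simp add: algebra_simps)
   moreover have "dl * (norm (w + x))^2 \<le> c * (norm (w + x))^2" using dl by (intro mult_right_mono) auto
   moreover have "dl * (norm x)^2 \<le> 1 / (2 * X n) * (norm x)^2"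
    using dl X(1)[of n] X(2)[of n] by (intro mult_right_mono order_trans[OF dl(3)]) (auto simp: field_simps)
   moreover have "(norm x)^2 / X n = 1 / (2 * X n) * (norm x)^2 + 1 / (2 * X n) * (norm x)^2" by simp
   ultimately have "- ((norm x)^2 / X n) + - (c * (norm (w + x))^2) \<le> - (dl / 2 * (norm w)^2) + - (1 / (2 * X n) * (norm x)^2)"
    by linarith
   hence e: "exp (- ((norm x)^2 / X n)) * gauss c (w + x) \<le> gauss (dl / 2) w * gauss (1 / (2 * X n)) x"
    unfolding exp_add[symmetric] by (simp only: exp_le_cancel_iff)
   have "norm (of_real (mehler K (X n) x) * (Phase (w + x) w * \<psi> (w + x))) = \<bar>mehler K (X n) x\<bar> * cmod (\<psi> (w + x))"
    by (simp add: norm_mult)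
   also have "\<dots> \<le> (exp mu_sum * (1 / (pi * X n)) ^ ?N * exp (- ((norm x)^2 / X n))) * (C * gauss c (w + x))"
    using m C X(1)[of n] by (intro mult_mono) auto
   also have "\<dots> = (exp mu_sum * (1 / (pi * X n)) ^ ?N * C) * (exp (- ((norm x)^2 / X n)) * gauss c (w + x))"
    by (simp only: mult_ac)
   also have "\<dots> \<le> (exp mu_sum * (1 / (pi * X n)) ^ ?N * C) * (gauss (dl / 2) w * gauss (1 / (2 * X n)) x)"
    using e C X(1)[of n] by (intro mult_left_mono) auto
   finally show ?thesis by (simp only: mult_ac)
  qed
  have gi: "has_bochner_integral lborel ?G ((exp mu_sum * C * gauss (dl / 2) w * (1 / (pi * X n)) ^ ?N) * sqrt (pi / (1 / (2 * X n))) ^ DIM('n cspace))"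
   using gauss_integral[of "1 / (2 * X n)", where 'a="'n cspace"] X(1)[of n] by (intro has_bochner_integral_mult_right) auto
  have gI: "integrable lborel ?G" using gi by (simp only: has_bochner_integral_iff)
  have iI: "integrable lborel (\<lambda>x. of_real (mehler K (X n) x) * (Phase (w + x) w * \<psi> (w + x)))"
  proof (rule B_integrable_bound[OF gI])
   show "(\<lambda>x. of_real (mehler K (X n) x) * (Phase (w + x) w * \<psi> (w + x))) \<in> borel_measurable lborel"
    using borel_measurable_continuous_onI[OF Pc] borel_measurable_continuous_onI[OF pc] by measurable
   show "AE x in lborel. norm (of_real (mehler K (X n) x) * (Phase (w + x) w * \<psi> (w + x))) \<le> norm (?G x)"
    unfolding real_norm_def by (intro AE_I2 order_trans[OF b abs_ge_self])
  qed
  have "cmod (I n w) \<le> (LI x. ?G x)"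
   unfolding I_eq by (rule Bochner_Integration.integral_norm_bound_integral[OF iI gI b])
  also have "\<dots> = exp mu_sum * C * 2 ^ ?N * gauss (dl / 2) w"
  proof -
   have "(sqrt (pi / (1 / (2 * X n))))^2 = 2 * (pi * X n)" using X(1)[of n] by simp
   hence "sqrt (pi / (1 / (2 * X n))) ^ DIM('n cspace) = (2 * (pi * X n)) ^ ?N"
    unfolding dim_cspace power_mult by (simp only:)
   moreover have "(1 / (pi * X n)) ^ ?N * (2 * (pi * X n)) ^ ?N = 2 ^ ?N"
    unfolding power_mult_distrib[symmetric] using X(1)[of n] by simp
   ultimately have q: "(1 / (pi * X n)) ^ ?N * sqrt (pi / (1 / (2 * X n))) ^ DIM('n cspace) = 2 ^ ?N" by (simp only:)
   have "(LI x. ?G x) = (exp mu_sum * C * gauss (dl / 2) w) * ((1 / (pi * X n)) ^ ?N * sqrt (pi / (1 / (2 * X n))) ^ DIM('n cspace))"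
    using gi by (simp only: has_bochner_integral_iff mult.assoc)
   thus ?thesis unfolding q by (simp only: mult_ac)
  qed
  finally show ?thesis .
 qed
 have eq: "(LI z. flow f (X n) K z * \<psi> z) = (LI w. I n w * f K w)" for n
  unfolding flow_def I_def using gop_swap[OF gker_Pk[OF X(1)[of n], of K] nice_L2(1)[OF p] fK] by (simp only: mult.commute[of "\<psi> _" "gop _ _ _"])
 have "(\<lambda>n. LI w. I n w * f K w) \<longlonglongrightarrow> (LI w. \<psi> w * f K w)"
 proof (rule integral_dominated_convergence)
  show "(\<lambda>w. \<psi> w * f K w) \<in> borel_measurable lborel" by measurable
  show "(\<lambda>w. I n w * f K w) \<in> borel_measurable lborel" for n
   using borel_measurable_integrable[OF lborel_pair.integrable_snd[OF gker_bilinear_integrable[OF gker_Pk[OF X(1)[of n], of K] nice_L2(1)[OF p] fK]]]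
   by (simp add: I_def)
  have g: "L2_fun (\<lambda>w :: 'n cspace. complex_of_real (gauss (dl / 2) w))"
  proof (rule gauss_bounded_L2)
   show "gauss_bounded (\<lambda>w :: 'n cspace. complex_of_real (gauss (dl / 2) w))"
    unfolding gauss_bounded_def by (intro exI[of _ 1] exI[of _ "dl / 2"]) (use dl in auto)
  qed measurable
  have "integrable lborel (\<lambda>w. (exp mu_sum * C * 2 ^ ?N) * norm (complex_of_real (gauss (dl / 2) w) * f K w))"
   by (intro integrable_mult_right integrable_norm L2_fun_mult_integrable g fK)
  thus "integrable lborel (\<lambda>w. (exp mu_sum * C * 2 ^ ?N * gauss (dl / 2) w) * cmod (f K w))"
   by (simp add: norm_mult mult.assoc)
  show "AE w in lborel. (\<lambda>n. I n w * f K w) \<longlonglongrightarrow> \<psi> w * f K w"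
   by (intro AE_I2 tendsto_mult I_lim tendsto_const)
  show "AE w in lborel. norm (I n w * f K w) \<le> (exp mu_sum * C * 2 ^ ?N * gauss (dl / 2) w) * cmod (f K w)" for n
   unfolding norm_mult by (intro AE_I2 mult_right_mono I_bound) simp
 qed
 thus "(\<lambda>n. LI z. flow f (X n) K z * \<psi> z) \<longlonglongrightarrow> (LI z. f K z * \<psi> z)"
  unfolding eq by (simp only: mult.commute)
qed simp

end

lemma laplacian_cong_image:
 assumes l: "laplacian D q f w" and e: "\<And>J x. J \<in> \<I> q ==> w' J x = w J x"
 shows "laplacian D q f w'"
proof -
 obtain g h c d where v: "laplacian_via D q f w g h c d"
  using l unfolding laplacian_iff_via by (elim exE)
 have "\<forall>K\<in>\<I> q. \<forall>x. w' K x = h K x + d K x"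
  using e laplacian_viaD(6)[OF v] by simp
 with v have "laplacian_via D q f w' g h c d"
  unfolding laplacian_via_def by (elim conjE) (intro conjI)
 thus ?thesis unfolding laplacian_iff_via by blast
qed

context diag_form
begin

section \<open>The Kohn Laplacian on Gaussian wave packets\<close>

text \<open>Splitting i \<phi> as -Im \<phi> + i Re \<phi> gives the two real vector fields of
  \<open>Zbar\<close>.\<close>

definition Xq :: "'n => ('n, 'm) quadric => ('n, 'm) quadric" where
 "Xq k p = ((1/2) *\<^sub>R v k, - (\<chi> i. Im (\<phi> (fst p) (v k) $ i)))"
definition Yq :: "'n => ('n, 'm) quadric => ('n, 'm) quadric" where
 "Yq k p = ((1/2) *\<^sub>R (\<i> *s v k), \<chi> i. Re (\<phi> (fst p) (v k) $ i))"

lemma linear_pair_expand: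
 fixes F :: "('n, 'm) quadric => complex"
 assumes "linear F" shows "F (a, b) = F (a, 0) + (\<Sum>i\<in>UNIV. of_real (b $ i) * F (0, axis i 1))"
proof -
 have "b = (\<Sum>i\<in>UNIV. b $ i *\<^sub>R axis i 1)"
  using basis_expansion[of b] by (simp add: scalar_mult_eq_scaleR)
 hence "(a, b) = (a, 0) + (\<Sum>i\<in>UNIV. b $ i *\<^sub>R (0, axis i 1))"
  by (simp add: prod_eq_iff fst_sum snd_sum)
 hence "F (a, b) = F ((a, 0) + (\<Sum>i\<in>UNIV. b $ i *\<^sub>R (0, axis i 1)))" by (rule arg_cong)
 also have "\<dots> = F (a, 0) + (\<Sum>i\<in>UNIV. b $ i *\<^sub>R F (0, axis i 1))"
  by (simp only: linear_add[OF assms] linear_sum[OF assms] linear_cmul[OF assms])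
 finally show ?thesis by (simp add: scaleR_conv_of_real)
qed

lemma Zbar_XY:
 assumes "\<psi> differentiable (at p)"
 shows "Zbar \<phi> v k \<psi> p = fder \<psi> p (Xq k p) + \<i> * fder \<psi> p (Yq k p)"
proof -
 let ?F = "fder \<psi> p" and ?c = "\<lambda>i. \<phi> (fst p) (v k) $ i"
 have l: "linear ?F" by (rule linear_frechet_derivative[OF assms])
 have h: "?F ((1/2) *\<^sub>R a, 0) = ?F (a, 0) / 2" for a
  using linear_cmul[OF l, of "1/2" "(a, 0)"] by (simp add: scaleR_conv_of_real)
 have "\<i> * ?c i * ?F (0, axis i 1) = of_real (- Im (?c i)) * ?F (0, axis i 1) + \<i> * (of_real (Re (?c i)) * ?F (0, axis i 1))" for i
 proof -
  have "\<i> * ?c i = of_real (- Im (?c i)) + \<i> * of_real (Re (?c i))" by (simp add: complex_eq_iff)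
  thus ?thesis by (simp only: distrib_right mult.assoc)
 qed
 hence "\<i> * (\<Sum>i\<in>UNIV. ?c i * ?F (0, axis i 1)) = (\<Sum>i\<in>UNIV. of_real (- Im (?c i)) * ?F (0, axis i 1)) + \<i> * (\<Sum>i\<in>UNIV. of_real (Re (?c i)) * ?F (0, axis i 1))"
  by (simp only: sum_distrib_left sum.distrib[symmetric] mult.assoc)
 thus ?thesis
  unfolding Zbar_def Xq_def Yq_def linear_pair_expand[OF l, of "(1/2) *\<^sub>R v k" "- (\<chi> i. Im (?c i))"]
   linear_pair_expand[OF l, of "(1/2) *\<^sub>R (\<i> *s v k)" "\<chi> i. Re (?c i)"] h
  by (simp add: add_divide_distrib distrib_left)
qed

lemma phi_linear: "bounded_linear (\<lambda>p :: ('n, 'm) quadric. \<phi> (fst p) (v k) $ i)"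
proof -
 have "(\<lambda>p :: ('n, 'm) quadric. \<phi> (fst p) (v k) $ i) = (\<lambda>p. \<Sum>l\<in>UNIV. \<phi> (v l) (v k) $ i * crd l (fst p))"
  by (rule ext, rule phi_crd)
 thus ?thesis
  by (simp only:) (intro bounded_linear_sum bounded_linear_compose[OF bounded_linear_mult_right]
   bounded_linear_compose[OF crd_linear bounded_linear_fst])
qed

lemma phi_tame: "tame (\<lambda>p :: ('n, 'm) quadric. \<phi> (fst p) (v k) $ i)"
 by (rule tame.linear[OF phi_linear])

definition Aphi :: real where
 "Aphi = (\<Sum>k\<in>UNIV. \<Sum>l\<in>UNIV. \<Sum>i\<in>UNIV. cmod (\<phi> (v l) (v k) $ i))"

lemma Aphi_nonneg: "Aphi \<ge> 0" by (simp add: Aphi_def sum_nonneg)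

lemma phi_vv_le: "(\<Sum>i\<in>UNIV. cmod (\<phi> (v l) (v k) $ i)) \<le> Aphi"
proof -
 have "(\<Sum>i\<in>UNIV. cmod (\<phi> (v l) (v k) $ i)) \<le> (\<Sum>l\<in>UNIV. \<Sum>i\<in>UNIV. cmod (\<phi> (v l) (v k) $ i))"
  by (rule member_le_sum[where f="\<lambda>l. \<Sum>i\<in>UNIV. cmod (\<phi> (v l) (v k) $ i)"]) (auto intro: sum_nonneg)
 also have "\<dots> \<le> Aphi" unfolding Aphi_def
  by (rule member_le_sum[where f="\<lambda>k. \<Sum>l\<in>UNIV. \<Sum>i\<in>UNIV. cmod (\<phi> (v l) (v k) $ i)"]) (auto intro!: sum_nonneg)
 finally show ?thesis .
qed

lemma phi_le: "(\<Sum>i\<in>UNIV. cmod (\<phi> z (v k) $ i)) \<le> Aphi * norm z"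
proof -
 have "(\<Sum>i\<in>UNIV. cmod (\<phi> z (v k) $ i)) \<le> (\<Sum>i\<in>UNIV. \<Sum>l\<in>UNIV. cmod (\<phi> (v l) (v k) $ i) * norm z)"
 proof (rule sum_mono)
  fix i
  have "cmod (\<phi> z (v k) $ i) \<le> (\<Sum>l\<in>UNIV. cmod (\<phi> (v l) (v k) $ i * crd l z))"
   unfolding phi_crd[of z] by (rule norm_sum)
  also have "\<dots> \<le> (\<Sum>l\<in>UNIV. cmod (\<phi> (v l) (v k) $ i) * norm z)"
   unfolding norm_mult by (intro sum_mono mult_left_mono crd_le) simp
  finally show "cmod (\<phi> z (v k) $ i) \<le> (\<Sum>l\<in>UNIV. cmod (\<phi> (v l) (v k) $ i) * norm z)" .
 qed
 also have "\<dots> = (\<Sum>l\<in>UNIV. \<Sum>i\<in>UNIV. cmod (\<phi> (v l) (v k) $ i)) * norm z"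
  unfolding sum_distrib_right by (rule sum.swap)
 also have "\<dots> \<le> Aphi * norm z"
  unfolding Aphi_def
  by (intro mult_right_mono member_le_sum[where f="\<lambda>k. \<Sum>l\<in>UNIV. \<Sum>i\<in>UNIV. cmod (\<phi> (v l) (v k) $ i)"]) (auto intro!: sum_nonneg)
 finally show ?thesis .
qed

lemma phi_le1: "cmod (\<phi> z (v k) $ i) \<le> Aphi * norm z"
 by (rule order_trans[OF member_le_sum[where f="\<lambda>i. cmod (\<phi> z (v k) $ i)"] phi_le]) auto

lemma XYq_growth: "\<exists>C N. \<forall>p. norm (Xq k p) + norm (Yq k p) \<le> C * (1 + norm p) ^ N"
proof (rule exI[of _ "norm (v k) + norm (\<i> *s v k) + 2 * Aphi"], rule exI[of _ 1], rule allI)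
 fix p :: "('n, 'm) quadric"
 have l1: "norm (\<chi> i. f (\<phi> (fst p) (v k) $ i)) \<le> Aphi * norm p" if "\<And>c. \<bar>f c\<bar> \<le> cmod c" for f :: "complex => real"
 proof -
  have "norm (\<chi> i. f (\<phi> (fst p) (v k) $ i)) \<le> (\<Sum>i\<in>UNIV. \<bar>f (\<phi> (fst p) (v k) $ i)\<bar>)"
   using norm_le_l1_cart[of "\<chi> i. f (\<phi> (fst p) (v k) $ i)"] by simp
  also have "\<dots> \<le> (\<Sum>i\<in>UNIV. cmod (\<phi> (fst p) (v k) $ i))" by (intro sum_mono that)
  also have "\<dots> \<le> Aphi * norm (fst p)" by (rule phi_le)
  also have "\<dots> \<le> Aphi * norm p" using norm_fst_le[of "fst p" "snd p"] by (intro mult_left_mono Aphi_nonneg) simp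
  finally show ?thesis .
 qed
 have X: "norm (Xq k p) \<le> norm (v k) + Aphi * norm p"
 proof -
  have "norm (Xq k p) \<le> norm ((1/2) *\<^sub>R v k) + norm (- (\<chi> i. Im (\<phi> (fst p) (v k) $ i)))" unfolding Xq_def by (rule norm_Pair_le)
  also have "\<dots> \<le> norm (v k) + Aphi * norm p" using l1[of Im, OF abs_Im_le_cmod] by (intro add_mono) auto
  finally show ?thesis .
 qed
 have Y: "norm (Yq k p) \<le> norm (\<i> *s v k) + Aphi * norm p"
 proof -
  have "norm (Yq k p) \<le> norm ((1/2) *\<^sub>R (\<i> *s v k)) + norm (\<chi> i. Re (\<phi> (fst p) (v k) $ i))" unfolding Yq_def by (rule norm_Pair_le)
  also have "\<dots> \<le> norm (\<i> *s v k) + Aphi * norm p" using l1[of Re, OF abs_Re_le_cmod] by (intro add_mono) auto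
  finally show ?thesis .
 qed
 have n: "0 \<le> (norm (v k) + norm (\<i> *s v k)) * norm p" by simp
 have "(norm (v k) + norm (\<i> *s v k) + 2 * Aphi) * (1 + norm p) ^ 1
   = norm (v k) + norm (\<i> *s v k) + 2 * Aphi + (norm (v k) + norm (\<i> *s v k)) * norm p + 2 * (Aphi * norm p)"
  by (simp add: algebra_simps)
 with X Y n Aphi_nonneg show "norm (Xq k p) + norm (Yq k p) \<le> (norm (v k) + norm (\<i> *s v k) + 2 * Aphi) * (1 + norm p) ^ 1"
  by linarith
qed

lemma Zbar_expand:
 "Zbar \<phi> v k f = (\<lambda>p. (1/2) * (fder f p (v k, 0) + \<i> * fder f p (\<i> *s v k, 0))
   + \<i> * (\<Sum>i\<in>UNIV. \<phi> (fst p) (v k) $ i * fder f p (0, axis i 1)))"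
 by (simp add: Zbar_def[abs_def])

lemma Zbar_gs: "tame_exp d f ==> tame_exp d (Zbar \<phi> v k f)"
 unfolding Zbar_expand
 by (intro tame_exp.add tame_exp_cmult tame_exp_sum tame_exp_mult[OF _ phi_tame] tame_exp_frechet)

lemma phi_frechet_t: "fder (\<lambda>p. \<phi> (fst p) (v k) $ i) p (0, b) = 0"
 for p :: "('n, 'm) quadric"
proof -
 have "((\<lambda>p. \<phi> (fst p) (v k) $ i) has_derivative (\<lambda>p. \<phi> (fst p) (v k) $ i)) (at p)"
  by (rule bounded_linear_imp_has_derivative[OF phi_linear])
 from fun_cong[OF frechet_derivative_at[OF this], of "(0, b)"] show ?thesis by (simp add: phi_zero)
qed

text \<open>The coefficients in front of the t-derivatives depend on z only, so they commute with
  these derivatives and \<open>Zbar\<close> is minus its own transpose.\<close>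

lemma Zbar_ibp:
 assumes f: "nice f" and p: "nice \<psi>"
 shows "(LI x. Zbar \<phi> v k f x * \<psi> x) = - (LI x. f x * Zbar \<phi> v k \<psi> x)"
proof -
 let ?c = "\<lambda>i p. \<phi> (fst p) (v k) $ i"
 let ?F = "\<lambda>d. LI x. fder f x d * \<psi> x" and ?P = "\<lambda>d. LI x. f x * fder \<psi> x d"
 let ?FT = "\<lambda>i. LI x. fder f x (0, axis i 1) * (?c i x * \<psi> x)"
 let ?PT = "\<lambda>i. LI x. f x * (?c i x * fder \<psi> x (0, axis i 1))"
 have cp: "nice (\<lambda>x. ?c i x * \<psi> x)" for i by (rule nice_tame[OF p phi_tame])
 have dc: "fder (\<lambda>x. ?c i x * \<psi> x) x (0, axis i 1) = ?c i x * fder \<psi> x (0, axis i 1)" for i x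
 proof -
  have "(\<lambda>p. ?c i p) differentiable (at x)" by (rule bounded_linear_imp_differentiable[OF phi_linear])
  moreover have "\<psi> differentiable (at x)" using p unfolding nice_def by blast
  ultimately show ?thesis by (simp add: frechet_derivative_mult phi_frechet_t)
 qed
 have t: "?FT i = - ?PT i" for i
  using nice_integration_by_parts[OF f cp[of i], of "(0, axis i 1)"] unfolding dc .
 have i: "integrable lborel (\<lambda>x. fder f x d * \<psi> x)" "integrable lborel (\<lambda>x. f x * fder \<psi> x d)" for d
  by (intro L2_fun_mult_integrable nice_L2 f p)+
 have it: "integrable lborel (\<lambda>x. fder f x (0, axis i 1) * (?c i x * \<psi> x))"
  "integrable lborel (\<lambda>x. f x * (?c i x * fder \<psi> x (0, axis i 1)))" for i
  using L2_fun_mult_integrable[OF nice_L2(2)[OF f] nice_L2(1)[OF cp]]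
   L2_fun_mult_integrable[OF nice_L2(1)[OF f] nice_L2(2)[OF cp[of i], of "(0, axis i 1)"]] unfolding dc by auto
 have "(LI x. Zbar \<phi> v k f x * \<psi> x) = (LI x. ((1/2) * (fder f x (v k, 0) * \<psi> x) + (\<i>/2) * (fder f x (\<i> *s v k, 0) * \<psi> x))
   + (\<Sum>i\<in>UNIV. \<i> * (fder f x (0, axis i 1) * (?c i x * \<psi> x))))"
  by (intro B_integral_cong refl)
   (simp add: Zbar_expand distrib_right distrib_left sum_distrib_left sum_distrib_right mult_ac)
 also have "\<dots> = (1/2) * ?F (v k, 0) + (\<i>/2) * ?F (\<i> *s v k, 0) + (\<Sum>i\<in>UNIV. \<i> * ?FT i)"
  by (simp only: B_integral_add B_integrable_add B_integral_sum B_integrable_sum integrable_mult_right i it integral_mult_right_zero)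
 also have "\<dots> = - ((1/2) * ?P (v k, 0) + (\<i>/2) * ?P (\<i> *s v k, 0) + (\<Sum>i\<in>UNIV. \<i> * ?PT i))"
  unfolding nice_integration_by_parts[OF f p] t by (simp add: sum_negf)
 also have "(1/2) * ?P (v k, 0) + (\<i>/2) * ?P (\<i> *s v k, 0) + (\<Sum>i\<in>UNIV. \<i> * ?PT i)
   = (LI x. ((1/2) * (f x * fder \<psi> x (v k, 0)) + (\<i>/2) * (f x * fder \<psi> x (\<i> *s v k, 0)))
   + (\<Sum>i\<in>UNIV. \<i> * (f x * (?c i x * fder \<psi> x (0, axis i 1)))))"
  by (simp only: B_integral_add B_integrable_add B_integral_sum B_integrable_sum integrable_mult_right i it integral_mult_right_zero)
 also have "\<dots> = (LI x. f x * Zbar \<phi> v k \<psi> x)"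
  by (intro B_integral_cong refl)
   (simp add: Zbar_expand distrib_right distrib_left sum_distrib_left sum_distrib_right mult_ac)
 finally show ?thesis .
qed

lemma Zbar_L2:
 assumes p: "nice \<psi>" shows "L2_fun (Zbar \<phi> v k \<psi>)"
proof -
 have "L2_fun (\<lambda>x. \<phi> (fst x) (v k) $ i * fder \<psi> x d)" for i d
  using tame_exp_measurable[OF tame_tame_exp[OF phi_tame]] nice_measurable(2)[OF p]
  by (intro gauss_bounded_L2 gauss_bounded_tame[OF nice_frechet(4)[OF p] phi_tame] borel_measurable_times)
 thus ?thesis unfolding Zbar_expand
  by (intro L2_fun_add L2_fun_cmult L2_fun_sum nice_L2(2)[OF p])
qed

sublocale quad: dbar_system "dbar_b \<phi> v" "Zbar \<phi> v" "Zbar \<phi> v" Xq Yq "\<lambda>k p. 0" "\<lambda>k p. 0"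
proof
 show "Zbar \<phi> v j \<psi> x = fder \<psi> x (Xq j x) + \<i> * fder \<psi> x (Yq j x) + 0 * \<psi> x"
  if "\<psi> differentiable (at x)" for \<psi> x j
  by (simp_all add: Zbar_XY[OF that])
 show "\<exists>C N. \<forall>x. norm (Xq j x) + norm (Yq j x) \<le> C * (1 + norm x) ^ N" for j by (rule XYq_growth)
 show "gs (Zbar \<phi> v j \<psi>)" if "gs \<psi>" for \<psi> j by (rule Zbar_gs[OF that])
 show "L2_fun (Zbar \<phi> v j \<psi>)" if "nice \<psi>" for \<psi> j by (rule Zbar_L2[OF that])
 show "(LI x. Zbar \<phi> v j f x * \<psi> x) = - (LI x. f x * Zbar \<phi> v j \<psi> x)" if "gs f" "nice \<psi>" for f \<psi> j
  by (rule Zbar_ibp[OF gs_nice[OF that(1)] that(2)])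
 show "L2_form q f \<and> L2_form (q + 1) g" if "dbar_b \<phi> v q f g" for q and f g :: "('n, ('n, 'm) quadric) form"
  using that by (simp add: dbar_b_def)
 show "(LI x. g K x * \<psi> x) = dbar_test (Zbar \<phi> v) q f K \<psi>"
  if D: "dbar_b \<phi> v q f g" and K: "K \<in> \<I> (q + 1)" and p: "tame_exp False \<psi>" and c: "compact (closure {x. \<psi> x \<noteq> 0})"
  for q f g K \<psi>
 proof -
  have "test_function \<psi>" using tame_exp_smooth[OF p] c by (simp add: test_function_def)
  thus ?thesis using D K unfolding dbar_b_def dbar_distr_def by blast
 qed
 show "dbar_b \<phi> v q f g" if f: "L2_form q f" and g: "L2_form (q + 1) g"
  and w: "\<And>K \<psi>. K \<in> \<I> (q + 1) ==> nice \<psi> ==>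
    (LI x. g K x * \<psi> x) = dbar_test (Zbar \<phi> v) q f K \<psi>"
  for q and f g :: "('n, ('n, 'm) quadric) form"
  unfolding dbar_b_def dbar_distr_def
  by (intro conjI ballI allI impI f g w C1c_nice test_function_C1c)
qed

lemma Zbar_gder: "gder fst snd t p \<alpha> \<beta> \<gamma> ==> Zbar \<phi> v k t p = \<beta> k + \<i> * (\<Sum>i\<in>UNIV. \<phi> (fst p) (v k) $ i * \<gamma> i)"
proof -
 assume g: "gder fst snd t p \<alpha> \<beta> \<gamma>"
 have z: "crd j 0 = 0" for j by (simp add: crd_def cinner_def)
 have 1: "fder t p (v k, 0) = \<alpha> k + \<beta> k" "fder t p (\<i> *s v k, 0) = \<i> * \<alpha> k - \<i> * \<beta> k"
  by (simp_all add: gder_frechet[OF g] if_distrib[of cnj] if_distrib[of "\<lambda>u. _ * u"] sum.distrib mult.commute cong: if_cong)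
 have 2: "fder t p (0, axis i 1) = \<gamma> i" for i
  by (simp add: gder_frechet[OF g] z axis_def if_distrib[of of_real] if_distrib[of "\<lambda>u. _ * u"] cong: if_cong)
 show ?thesis unfolding Zbar_def 1 2 by (simp add: algebra_simps)
qed

lemma Lq_gder: "gder fst snd t p \<alpha> \<beta> \<gamma> ==> quad.L k t p = \<beta> k + \<i> * (\<Sum>i\<in>UNIV. \<phi> (fst p) (v k) $ i * \<gamma> i)"
 unfolding quad.L_def by (subst Zbar_XY[symmetric]) (auto intro: gder_differentiable Zbar_gder)

lemma Wsq_gder: "gder fst snd t p \<alpha> \<beta> \<gamma> ==> quad.Ws k t p = - \<alpha> k + \<i> * (\<Sum>i\<in>UNIV. cnj (\<phi> (fst p) (v k) $ i) * \<gamma> i)"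
proof -
 assume g: "gder fst snd t p \<alpha> \<beta> \<gamma>"
 from Zbar_gder[OF gder_cnj[OF g], of k] show ?thesis by (simp add: quad.Ws_def cnj_sum)
qed

lemma cnj_Lq_gder: "gder fst snd t p \<alpha> \<beta> \<gamma> ==> cnj (quad.L k (\<lambda>p. cnj (t p)) p) = \<alpha> k - \<i> * (\<Sum>i\<in>UNIV. cnj (\<phi> (fst p) (v k) $ i) * \<gamma> i)"
proof -
 assume g: "gder fst snd t p \<alpha> \<beta> \<gamma>"
 from Lq_gder[OF gder_cnj[OF g], of k] show ?thesis by (simp add: cnj_sum)
qed

section \<open>Gaussian wave packets and the error in their heat equation\<close>

definition theta :: "real => 'm rspace => complex" where
 "theta e t = exp (\<i> * of_real (\<xi> \<bullet> t)) * of_real (gauss (e^2 / 2) t)"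

text \<open>A plane wave in t times \<open>mehler\<close> would solve the heat equation exactly; the
  envelope of width 1/e makes it square integrable.\<close>

definition Vq :: "real => 'n set => real => ('n, 'm) quadric => complex" where
 "Vq e K s p = of_real (mehler K s (fst p)) * theta e (snd p)"

definition Vexp :: "real => real => ('n, 'm) quadric => complex" where
 "Vexp e s p = (\<Sum>j\<in>UNIV. - of_real (mehler_a (\<mu> j) s) * (crd j (fst p) * cnj (crd j (fst p))))
   + (\<Sum>i\<in>UNIV. \<i> * of_real (\<xi> $ i) * of_real (snd p $ i) + - of_real (e^2 / 2) * (of_real (snd p $ i) * of_real (snd p $ i)))"

lemma norm_sq_vec: "(norm (t :: 'm rspace))^2 = (\<Sum>i\<in>UNIV. t $ i * t $ i)"
 by (simp add: power2_norm_eq_inner inner_vec_def)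

lemma Vexp_parts: "Vexp e s p = of_real (- (\<Sum>j\<in>UNIV. mehler_a (\<mu> j) s * (cmod (crd j (fst p)))^2)) + (\<i> * of_real (\<xi> \<bullet> snd p) + of_real (- (e^2 / 2 * (norm (snd p))^2)))"
proof -
 have 1: "(\<Sum>j\<in>UNIV. - of_real (mehler_a (\<mu> j) s) * (crd j (fst p) * cnj (crd j (fst p)))) = complex_of_real (- (\<Sum>j\<in>UNIV. mehler_a (\<mu> j) s * (cmod (crd j (fst p)))^2))"
  unfolding of_real_minus of_real_sum of_real_mult complex_norm_square by (simp add: sum_negf)
 have 2: "(\<Sum>i\<in>UNIV. \<i> * of_real (\<xi> $ i) * of_real (snd p $ i) + - of_real (e^2 / 2) * (of_real (snd p $ i) * of_real (snd p $ i)))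
  = \<i> * of_real (\<xi> \<bullet> snd p) + of_real (- (e^2 / 2 * (norm (snd p))^2))"
  unfolding norm_sq_vec inner_vec_def inner_real_def of_real_minus of_real_sum of_real_mult sum.distrib sum_distrib_left by (simp add: sum_negf mult.assoc)
 show ?thesis unfolding Vexp_def 1 2 ..
qed

lemma Vq_exp: "Vq e K s p = of_real (mpre K s) * exp (Vexp e s p)"
 unfolding Vexp_parts exp_add exp_of_real by (simp add: Vq_def theta_def mehler_def mpre_def mult.assoc)

lemma snd_linear: "bounded_linear (\<lambda>p :: ('n, 'm) quadric. complex_of_real (snd p $ i))"
 by (intro bounded_linear_compose[OF bounded_linear_of_real] bounded_linear_compose[OF bounded_linear_vec_nth bounded_linear_snd])

lemma Vexp_tame: "tame (Vexp e s)"
 unfolding Vexp_def[abs_def]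
 by (intro tame_sum tame.add tame.mult tame.const tame_cnj tame.linear[OF bounded_linear_compose[OF crd_linear bounded_linear_fst]] tame.linear[OF snd_linear])

lemma Re_Vexp:
 assumes s: "s > 0"
 shows "Re (Vexp e s p) \<le> - (1 / s * (norm (fst p))^2) - e\<^sup>2 / 2 * (norm (snd p))^2"
proof -
 have "(norm (fst p))^2 / s = (\<Sum>j\<in>UNIV. 1 / s * (cmod (crd j (fst p)))^2)"
  by (simp add: norm_crd sum_divide_distrib)
 also have "\<dots> \<le> (\<Sum>j\<in>UNIV. mehler_a (\<mu> j) s * (cmod (crd j (fst p)))^2)"
  using mehler_bounds[OF s] by (intro sum_mono mult_right_mono) auto
 finally show ?thesis unfolding Vexp_parts by simp
qed

lemma norm_pair_sq: "(norm p)^2 = (norm (fst p))^2 + (norm (snd p))^2"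
 by (simp add: norm_prod_def)

lemma Vq_gs:
 assumes s: "s > 0" and e: "e > 0" shows "gs (Vq e K s)"
proof -
 have "Re (Vexp e s p) \<le> 0 - min (1 / s) (e^2 / 2) * (norm p)^2" for p
 proof -
  have "min (1 / s) (e^2 / 2) * (norm p)^2 \<le> 1 / s * (norm (fst p))^2 + e^2 / 2 * (norm (snd p))^2"
   unfolding norm_pair_sq distrib_left by (intro add_mono mult_right_mono) auto
  thus ?thesis using Re_Vexp[OF s, of e p] by linarith
 qed
 thus ?thesis unfolding Vq_exp[abs_def] using s e
  by (intro tame_exp.base[OF tame.const Vexp_tame] exI[of _ 0] exI[of _ "min (1 / s) (e^2 / 2)"]) auto
qed

lemma gder_Vq:
 "gder fst snd (Vq e K s) p
  (\<lambda>j. (- of_real (mehler_a (\<mu> j) s) * cnj (crd j (fst p))) * Vq e K s p)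
  (\<lambda>j. (- of_real (mehler_a (\<mu> j) s) * crd j (fst p)) * Vq e K s p)
  (\<lambda>i. (\<i> * of_real (\<xi> $ i) - of_real (e^2) * of_real (snd p $ i)) * Vq e K s p)"
proof -
 let ?a = "\<lambda>j. complex_of_real (mehler_a (\<mu> j) s)"
 have 1: "gder fst snd (\<lambda>p. - ?a j * (crd j (fst p) * cnj (crd j (fst p)))) p
   (\<lambda>l. if l = j then - ?a j * cnj (crd j (fst p)) else 0) (\<lambda>l. if l = j then - ?a j * crd j (fst p) else 0) (\<lambda>_. 0)" for j
  by (rule gder_cong[OF gder_cmult[OF gder_mult[OF gder_crd[OF bounded_linear_fst] gder_cnj[OF gder_crd[OF bounded_linear_fst]]]]]) auto
 have 2: "gder fst snd (\<lambda>p. \<i> * of_real (\<xi> $ i) * of_real (snd p $ i) + - of_real (e^2 / 2) * (of_real (snd p $ i) * of_real (snd p $ i))) p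
   (\<lambda>_. 0) (\<lambda>_. 0) (\<lambda>l. if l = i then \<i> * of_real (\<xi> $ i) - of_real (e^2) * of_real (snd p $ i) else 0)" for i
  by (rule gder_cong[OF gder_add[OF gder_cmult[OF gder_tau[OF bounded_linear_snd]] gder_cmult[OF gder_mult[OF gder_tau[OF bounded_linear_snd] gder_tau[OF bounded_linear_snd]]]]]) auto
 have "gder fst snd (Vexp e s) p
   (\<lambda>l. - ?a l * cnj (crd l (fst p))) (\<lambda>l. - ?a l * crd l (fst p)) (\<lambda>l. \<i> * of_real (\<xi> $ l) - of_real (e^2) * of_real (snd p $ l))"
  unfolding Vexp_def[abs_def] by (rule gder_cong[OF gder_add[OF gder_sum[OF 1] gder_sum[OF 2]]]) simp_all
 from gder_cmult[OF gder_exp[OF this], of "of_real (mpre K s)"]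
 show ?thesis unfolding Vq_exp[abs_def] by (rule gder_cong) (simp_all add: mult_ac)
qed

abbreviation (input) Vdot :: "real => 'n set => real => ('n, 'm) quadric => complex" where
 "Vdot e K s \<equiv> \<lambda>p. of_real (mehler_rate K s (fst p)) * Vq e K s p"

text \<open>The terms due to the envelope: \<open>Sq\<close> comes from its t-derivative,
  \<open>Tq\<close> and \<open>Nq\<close> from differentiating \<open>Sq\<close> in z and in
  t.\<close>

definition Sq :: "'n => ('n, 'm) quadric => complex" where
 "Sq j p = (\<Sum>i\<in>UNIV. \<phi> (fst p) (v j) $ i * of_real (snd p $ i))"
definition Tq :: "'n => 'n => ('n, 'm) quadric => complex" where
 "Tq l j p = (\<Sum>i\<in>UNIV. \<phi> (v l) (v j) $ i * of_real (snd p $ i))"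
definition Nq :: "'n => 'n => ('n, 'm) quadric => complex" where
 "Nq k j p = (\<Sum>i\<in>UNIV. cnj (\<phi> (fst p) (v k) $ i) * \<phi> (fst p) (v j) $ i)"
text \<open>With e = 0 these multipliers are \<open>ellw\<close> and \<open>emw\<close> for w =
  0.\<close>

definition ellq :: "real => real => 'n => ('n, 'm) quadric => complex" where
 "ellq e s j p = - of_real (mehler_a (\<mu> j) s + \<mu> j) * crd j (fst p) + (- \<i> * of_real (e^2)) * Sq j p"
definition emq :: "real => real => 'n => ('n, 'm) quadric => complex" where
 "emq e s j p = of_real (mehler_a (\<mu> j) s - \<mu> j) * cnj (crd j (fst p)) + (- \<i> * of_real (e^2)) * cnj (Sq j p)"

lemma cnj_Tq: "cnj (Tq l j p) = Tq j l p"
 unfolding Tq_def cnj_sum complex_cnj_mult complex_cnj_complex_of_real by (simp only: phi_cnj[symmetric])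

lemma gder_phi: "gder fst snd (\<lambda>p. \<phi> (fst p) (v j) $ i) p (\<lambda>l. \<phi> (v l) (v j) $ i) (\<lambda>_. 0) (\<lambda>_. 0)"
proof -
 have "gder fst snd (\<lambda>p. \<Sum>l\<in>UNIV. \<phi> (v l) (v j) $ i * crd l (fst p)) p
   (\<lambda>k. \<Sum>l\<in>UNIV. \<phi> (v l) (v j) $ i * (if k = l then 1 else 0)) (\<lambda>_. \<Sum>l\<in>UNIV. \<phi> (v l) (v j) $ i * 0) (\<lambda>_. \<Sum>l\<in>UNIV. \<phi> (v l) (v j) $ i * 0)"
  by (intro gder_sum gder_cmult gder_crd bounded_linear_fst)
 thus ?thesis unfolding phi_crd[of "fst _"] by (rule gder_cong) (simp_all add: if_distrib[of "\<lambda>u. _ * u"] cong: if_cong)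
qed

lemma gder_Sq: "gder fst snd (Sq j) p (\<lambda>l. Tq l j p) (\<lambda>_. 0) (\<lambda>i. \<phi> (fst p) (v j) $ i)"
 unfolding Sq_def[abs_def]
 by (rule gder_cong[OF gder_sum[OF gder_mult[OF gder_phi gder_tau[OF bounded_linear_snd]]]])
  (simp_all add: Tq_def if_distrib[of "\<lambda>u. _ * u"] cong: if_cong)

lemma gder_ellq: "gder fst snd (ellq e s j) p
  (\<lambda>l. (if l = j then - of_real (mehler_a (\<mu> j) s + \<mu> j) else 0) + (- \<i> * of_real (e^2)) * Tq l j p) (\<lambda>_. 0)
  (\<lambda>i. (- \<i> * of_real (e^2)) * \<phi> (fst p) (v j) $ i)"
 unfolding ellq_def[abs_def]
 by (rule gder_cong[OF gder_add[OF gder_cmult[OF gder_crd[OF bounded_linear_fst]] gder_cmult[OF gder_Sq]]]) auto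

lemma gder_emq: "gder fst snd (emq e s j) p (\<lambda>_. 0)
  (\<lambda>l. (if l = j then of_real (mehler_a (\<mu> j) s - \<mu> j) else 0) + (- \<i> * of_real (e^2)) * Tq j l p)
  (\<lambda>i. (- \<i> * of_real (e^2)) * cnj (\<phi> (fst p) (v j) $ i))"
 unfolding emq_def[abs_def]
 by (rule gder_cong[OF gder_add[OF gder_cmult[OF gder_cnj[OF gder_crd[OF bounded_linear_fst]]] gder_cmult[OF gder_cnj[OF gder_Sq]]]])
  (auto simp: cnj_Tq)

lemma form_fst: "(\<Sum>i\<in>UNIV. \<phi> (fst p) (v j) $ i * of_real (\<xi> $ i)) = of_real (\<mu> j) * crd j (fst p)"
 using form_v[of "fst p" j] by (simp add: form_at_def)

lemma Zbar_Vq: "Zbar \<phi> v j (Vq e K s) = (\<lambda>p. ellq e s j p * Vq e K s p)"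
proof
 fix p
 have "\<i> * (\<Sum>i\<in>UNIV. \<phi> (fst p) (v j) $ i * ((\<i> * of_real (\<xi> $ i) - of_real (e^2) * of_real (snd p $ i)) * Vq e K s p))
   = (- (\<Sum>i\<in>UNIV. \<phi> (fst p) (v j) $ i * of_real (\<xi> $ i)) - \<i> * of_real (e^2) * Sq j p) * Vq e K s p"
  unfolding Sq_def sum_distrib_left sum_distrib_right sum_negf[symmetric] sum_subtractf[symmetric]
  by (intro sum.cong refl) (simp add: algebra_simps)
 thus "Zbar \<phi> v j (Vq e K s) p = ellq e s j p * Vq e K s p"
  unfolding Zbar_gder[OF gder_Vq] form_fst ellq_def by (simp add: algebra_simps)
qed

lemma Wsq_Vq: "quad.Ws j (Vq e K s) = (\<lambda>p. emq e s j p * Vq e K s p)"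
proof
 fix p :: "('n, 'm) quadric"
 have c: "(\<Sum>i\<in>UNIV. cnj (\<phi> (fst p) (v j) $ i) * of_real (\<xi> $ i)) = of_real (\<mu> j) * cnj (crd j (fst p))"
  using arg_cong[OF form_fst[of p j], of cnj] by (simp add: cnj_sum)
 have "\<i> * (\<Sum>i\<in>UNIV. cnj (\<phi> (fst p) (v j) $ i) * ((\<i> * of_real (\<xi> $ i) - of_real (e^2) * of_real (snd p $ i)) * Vq e K s p))
   = (- (\<Sum>i\<in>UNIV. cnj (\<phi> (fst p) (v j) $ i) * of_real (\<xi> $ i)) - \<i> * of_real (e^2) * cnj (Sq j p)) * Vq e K s p"
  unfolding Sq_def cnj_sum complex_cnj_mult complex_cnj_complex_of_real sum_distrib_left sum_distrib_right sum_negf[symmetric] sum_subtractf[symmetric]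
  by (intro sum.cong refl) (simp add: algebra_simps)
 thus "quad.Ws j (Vq e K s) p = emq e s j p * Vq e K s p"
  unfolding Wsq_gder[OF gder_Vq] c emq_def by (simp add: algebra_simps)
qed

lemma Nq_alt: "\<i> * (\<Sum>i\<in>UNIV. cnj (\<phi> (fst p) (v k) $ i) * ((- \<i> * of_real (e^2)) * \<phi> (fst p) (v j) $ i)) = of_real (e^2) * Nq k j p"
 "\<i> * (\<Sum>i\<in>UNIV. \<phi> (fst p) (v j) $ i * ((- \<i> * of_real (e^2)) * cnj (\<phi> (fst p) (v k) $ i))) = of_real (e^2) * Nq k j p"
proof -
 have "\<i> * (A * ((- \<i> * E) * B)) = E * (A * B)" "\<i> * (B * ((- \<i> * E) * A)) = E * (A * B)" for A B E
  by (simp_all add: complex_eq_iff algebra_simps)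
 note h = this
 show "\<i> * (\<Sum>i\<in>UNIV. cnj (\<phi> (fst p) (v k) $ i) * ((- \<i> * of_real (e^2)) * \<phi> (fst p) (v j) $ i)) = of_real (e^2) * Nq k j p"
  "\<i> * (\<Sum>i\<in>UNIV. \<phi> (fst p) (v j) $ i * ((- \<i> * of_real (e^2)) * cnj (\<phi> (fst p) (v k) $ i))) = of_real (e^2) * Nq k j p"
  unfolding Nq_def sum_distrib_left by (intro sum.cong refl, rule h)+
qed

lemma Wsq_Zbar_Vq:
 "quad.Ws k (Zbar \<phi> v j (Vq e K s)) p = (ellq e s j p * emq e s k p + (if j = k then of_real (mehler_a (\<mu> j) s + \<mu> j) else 0)
   + \<i> * of_real (e^2) * Tq k j p + of_real (e^2) * Nq k j p) * Vq e K s p"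
 unfolding Zbar_Vq quad.Ws_mult[OF gder_differentiable[OF gder_cnj[OF gder_ellq]] gder_differentiable[OF gder_cnj[OF gder_Vq]]]
  cnj_Lq_gder[OF gder_ellq] Wsq_Vq Nq_alt
 by (simp add: algebra_simps)

lemma Zbar_Wsq_Vq:
 "Zbar \<phi> v j (quad.Ws k (Vq e K s)) p = (ellq e s j p * emq e s k p + (if j = k then of_real (mehler_a (\<mu> j) s - \<mu> j) else 0)
   - \<i> * of_real (e^2) * Tq k j p + of_real (e^2) * Nq k j p) * Vq e K s p"
 unfolding Wsq_Vq quad.Wt_mult[OF gder_differentiable[OF gder_emq] gder_differentiable[OF gder_Vq]]
  Lq_gder[OF gder_emq] Zbar_Vq Nq_alt
 by (simp add: algebra_simps)

definition Eq_diag :: "real => real => 'n => ('n, 'm) quadric => complex" where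
 "Eq_diag e s j p = of_real (e^2) * (\<i> * of_real (mehler_a (\<mu> j) s + \<mu> j) * (crd j (fst p) * cnj (Sq j p))
   - \<i> * of_real (mehler_a (\<mu> j) s - \<mu> j) * (Sq j p * cnj (crd j (fst p)))
   - of_real (e^2) * (Sq j p * cnj (Sq j p)) + \<i> * Tq j j p + Nq j j p)"

text \<open>The multiplier by which the Laplacian of a packet misses minus its s-derivative; every
  term carries e^2. The double sum stems from the commutators and reaches index sets other than
  K0.\<close>

definition Eq :: "nat => 'n set => real => real => 'n set => ('n, 'm) quadric => complex" where
 "Eq q K0 e s J p = (if J = K0 then \<Sum>j\<in>UNIV. Eq_diag e s j p else 0)
   - of_real (e^2) * (2 * \<i> * (\<Sum>j\<in>UNIV. \<Sum>k\<in>UNIV. quad.up_down q J K0 j k * Tq k j p))"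

text \<open>The calculation of the weighted case. The commutator has the additional term -2 i e^2
  \<open>Tq k j\<close>, which is not diagonal in j and k, so the image has components beside
  \<open>K0\<close>.\<close>

lemma quad_laplacian_Vq:
 assumes s: "s > 0" and e: "e > 0" and K0: "K0 \<in> \<I> q"
 shows "Box_b \<phi> v q (quad.single K0 (Vq e K0 s))
  (\<lambda>J p. quad.single K0 (\<lambda>p. - of_real (mehler_rate K0 s (fst p)) * Vq e K0 s p) J p + Eq q K0 e s J p * Vq e K0 s p)"
proof -
 let ?V = "Vq e K0 s"
 define X where "X j p = - mehler_a (\<mu> j) s + sgn_rate K0 j + (mehler_b (\<mu> j) s)^2 * (cmod (crd j (fst p)))^2" for j and p :: "('n, 'm) quadric"
 have r: "mehler_rate K0 s (fst p) = (\<Sum>j\<in>UNIV. X j p)" for p :: "('n, 'm) quadric"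
  by (simp only: mehler_rate_def X_def)
 define \<kappa> where "\<kappa> j k p = (if j = k then - 2 * complex_of_real (\<mu> j) else 0) - 2 * \<i> * of_real (e^2) * Tq k j p" for j k and p :: "('n, 'm) quadric"
 have com: "Zbar \<phi> v j (quad.Ws k ?V) p - quad.Ws k (Zbar \<phi> v j ?V) p = \<kappa> j k p * ?V p" for j k p
  unfolding Zbar_Wsq_Vq Wsq_Zbar_Vq \<kappa>_def by (simp add: algebra_simps)
 note lap = quad.laplacian_single[OF Vq_gs[OF s e] K0 com]
 have eq: "quad.single K0 (\<lambda>p. - of_real (mehler_rate K0 s (fst p)) * ?V p) J p + Eq q K0 e s J p * ?V p
   = (if J = K0 then \<Sum>j\<in>UNIV. quad.Ws j (Zbar \<phi> v j ?V) p else 0) + (\<Sum>j\<in>UNIV. \<Sum>k\<in>UNIV. quad.up_down q J K0 j k * \<kappa> j k p) * ?V p"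
  if J: "J \<in> \<I> q" for J p
 proof -
  let ?T = "\<Sum>j\<in>UNIV. \<Sum>k\<in>UNIV. quad.up_down q J K0 j k * Tq k j p"
  have "(\<Sum>j\<in>UNIV. \<Sum>k\<in>UNIV. quad.up_down q J K0 j k * \<kappa> j k p)
    = (\<Sum>j\<in>UNIV. \<Sum>k\<in>UNIV. (if j = k then quad.up_down q J K0 j k * (- 2 * of_real (\<mu> j)) else 0) - (of_real (e^2) * (2 * \<i>)) * (quad.up_down q J K0 j k * Tq k j p))"
   unfolding \<kappa>_def by (intro sum.cong refl) (simp add: algebra_simps)
  also have "\<dots> = (\<Sum>j\<in>UNIV. quad.up_down q J K0 j j * (- 2 * of_real (\<mu> j))) - (of_real (e^2) * (2 * \<i>)) * ?T"
   unfolding sum_subtractf sum_distrib_left by simp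
  also have "(\<Sum>j\<in>UNIV. quad.up_down q J K0 j j * (- 2 * of_real (\<mu> j))) = (\<Sum>j\<in>UNIV. if J = K0 \<and> j \<in> J then - 2 * of_real (\<mu> j) else 0)"
   unfolding up_down_diag[OF J K0] by (intro sum.cong refl) auto
  finally have c: "(\<Sum>j\<in>UNIV. \<Sum>k\<in>UNIV. quad.up_down q J K0 j k * \<kappa> j k p) = (\<Sum>j\<in>UNIV. if J = K0 \<and> j \<in> J then - 2 * of_real (\<mu> j) else 0) - (of_real (e^2) * (2 * \<i>)) * ?T" .
  have "quad.Ws j (Zbar \<phi> v j ?V) p + (if j \<in> K0 then - 2 * of_real (\<mu> j) else 0) * ?V p
    = (- of_real (X j p) + Eq_diag e s j p) * ?V p" for j
  proof -
   have "of_real ((mehler_b (\<mu> j) s)^2 * (cmod (crd j (fst p)))^2) = of_real ((mehler_a (\<mu> j) s)^2 - (\<mu> j)\<^sup>2) * (crd j (fst p) * cnj (crd j (fst p)))"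
    unfolding mehler_sq[OF s] of_real_mult complex_norm_square ..
   hence "ellq e s j p * emq e s j p + of_real (mehler_a (\<mu> j) s + \<mu> j) + \<i> * of_real (e^2) * Tq j j p + of_real (e^2) * Nq j j p
     + (if j \<in> K0 then - 2 * of_real (\<mu> j) else 0) = - of_real (X j p) + Eq_diag e s j p"
    unfolding X_def of_real_add
    by (simp add: sgn_rate_def Eq_diag_def ellq_def emq_def power2_eq_square algebra_simps)
   from this[symmetric] show ?thesis unfolding Wsq_Zbar_Vq by (simp add: distrib_right)
  qed
  hence "(\<Sum>j\<in>UNIV. quad.Ws j (Zbar \<phi> v j ?V) p) + (\<Sum>j\<in>UNIV. if j \<in> K0 then - 2 * of_real (\<mu> j) else 0) * ?V p
   = (\<Sum>j\<in>UNIV. (- of_real (X j p) + Eq_diag e s j p) * ?V p)"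
   unfolding sum_distrib_right sum.distrib[symmetric] by (simp only:)
  also have "\<dots> = (- of_real (mehler_rate K0 s (fst p)) + (\<Sum>j\<in>UNIV. Eq_diag e s j p)) * ?V p"
   by (simp only: r of_real_sum sum_negf sum.distrib sum_distrib_right[symmetric])
  finally have f: "(\<Sum>j\<in>UNIV. quad.Ws j (Zbar \<phi> v j ?V) p) + (\<Sum>j\<in>UNIV. if j \<in> K0 then - 2 * of_real (\<mu> j) else 0) * ?V p
   = (- of_real (mehler_rate K0 s (fst p)) + (\<Sum>j\<in>UNIV. Eq_diag e s j p)) * ?V p" .
  show ?thesis
  proof (cases "J = K0")
   case True
   have "quad.single K0 (\<lambda>p. - of_real (mehler_rate K0 s (fst p)) * ?V p) J p + Eq q K0 e s J p * ?V p
     = (- of_real (mehler_rate K0 s (fst p)) + (\<Sum>j\<in>UNIV. Eq_diag e s j p)) * ?V p - (of_real (e^2) * (2 * \<i>)) * ?T * ?V p"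
    using True by (simp add: quad.single_def Eq_def algebra_simps)
   also have "\<dots> = (\<Sum>j\<in>UNIV. quad.Ws j (Zbar \<phi> v j ?V) p) + ((\<Sum>j\<in>UNIV. if J = K0 \<and> j \<in> J then - 2 * of_real (\<mu> j) else 0) - (of_real (e^2) * (2 * \<i>)) * ?T) * ?V p"
    unfolding f[symmetric] using True by (simp add: left_diff_distrib)
   finally show ?thesis unfolding c using True by simp
  next
   case False
   thus ?thesis unfolding c by (simp add: quad.single_def Eq_def)
  qed
 qed
 show ?thesis by (rule laplacian_cong_image[OF lap eq])
qed

end

section \<open>Estimates for the wave packets\<close>

lemma lborel_pair_product:
 fixes f :: "'a::euclidean_space => 'c::{real_normed_field, banach, second_countable_topology}" and g :: "'b::euclidean_space => 'c"
 assumes f: "integrable lborel f" and g: "integrable lborel g"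
 shows "integrable lborel (\<lambda>p. f (fst p) * g (snd p))"
  "(LI p. f (fst p) * g (snd p)) = (LI x. f x) * (LI y. g y)"
proof -
 note [measurable] = borel_measurable_integrable[OF f] borel_measurable_integrable[OF g]
 have i: "integrable (lborel \<Otimes>\<^sub>M lborel) (\<lambda>p :: 'a \<times> 'b. f (fst p) * g (snd p))"
 proof (rule lborel_pair.Fubini_integrable)
  show "(\<lambda>p. f (fst p) * g (snd p)) \<in> borel_measurable (lborel \<Otimes>\<^sub>M lborel)" by measurable
  show "integrable lborel (\<lambda>x. LI y. norm (f (fst (x, y)) * g (snd (x, y))))"
   using f by (simp add: norm_mult)
  show "AE x in lborel. integrable lborel (\<lambda>y. f (fst (x, y)) * g (snd (x, y)))"
   using g by simp
 qed
 thus "integrable lborel (\<lambda>p. f (fst p) * g (snd p))" by (simp add: lborel_prod)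
 have "(LI p. f (fst p) * g (snd p)) = (LINT p|(lborel \<Otimes>\<^sub>M lborel). f (fst p) * g (snd p))" by (simp add: lborel_prod)
 also have "\<dots> = (LI x. LI y. f (fst (x, y)) * g (snd (x, y)))"
  by (rule lborel_pair.integral_fst'[OF i, symmetric])
 finally show "(LI p. f (fst p) * g (snd p)) = (LI x. f x) * (LI y. g y)" by simp
qed

lemma L2_norm_pair_bound:
 fixes F :: "('n::finite, 'a::euclidean_space \<times> 'b::euclidean_space) form"
 assumes A: "A \<ge> 0" and b: "\<And>J p. J \<in> \<I> q ==> cmod (F J p) \<le> A * (a (fst p) * b (snd p))"
  and i: "integrable lborel (\<lambda>x. (a x)^2)" "integrable lborel (\<lambda>x. (b x)^2)"
 shows "L2_norm q F \<le> A * sqrt (real (card (\<I> q :: 'n set set)) * ((LI x. (a x)^2) * (LI x. (b x)^2)))"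
proof -
 let ?I = "(LI x. (a x)^2) * (LI x. (b x)^2)"
 note pi = lborel_pair_product[OF i]
 have "(LI p. (cmod (F J p))^2) \<le> A^2 * ?I" if J: "J \<in> \<I> q" for J
 proof -
  have "(LI p. (cmod (F J p))^2) \<le> (LI p. A^2 * ((a (fst p))^2 * (b (snd p))^2))"
  proof (rule integral_mono')
   show "integrable lborel (\<lambda>p. A^2 * ((a (fst p))^2 * (b (snd p))^2))" by (intro integrable_mult_right pi)
   show "(cmod (F J p))^2 \<le> A^2 * ((a (fst p))^2 * (b (snd p))^2)" for p
    using power_mono[OF b[OF J, of p] norm_ge_zero, of 2] by (simp only: power_mult_distrib)
  qed simp
  thus ?thesis by (simp add: pi(2))
 qed
 hence "(L2_norm q F)^2 \<le> (\<Sum>J\<in>(\<I> q :: 'n set set). A^2 * ?I)"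
  unfolding L2_norm_sq by (rule sum_mono)
 hence "L2_norm q F \<le> sqrt (A^2 * (real (card (\<I> q :: 'n set set)) * ?I))"
  by (intro real_le_rsqrt) (simp add: mult_ac)
 thus ?thesis using A by (simp add: real_sqrt_mult)
qed

lemma L2_norm_single:
 assumes "K0 \<in> \<I> q"
 shows "L2_norm q (\<lambda>J x. if J = K0 then F x else 0) = sqrt (LI x. (cmod (F x))^2)"
proof -
 have "(LI x. (cmod (if J = K0 then F x else 0))^2) = (if J = K0 then LI x. (cmod (F x))^2 else 0)" for J
  by simp
 thus ?thesis using assms by (simp add: L2_norm_def)
qed

text \<open>The origin of the powers e^-m in all squared norms of packets.\<close>

lemma gauss_integral_scaled:
 assumes "e > 0" "c > 0"
 shows "(LI t. gauss (c * e^2) (t :: 'm::finite rspace)) = sqrt (pi / c) ^ CARD('m) * inverse (e ^ CARD('m))"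
proof -
 have "c * e^2 > 0" using assms by simp
 from gauss_integral[OF this, where 'a="'m rspace"]
 have "(LI t. gauss (c * e^2) (t :: 'm rspace)) = sqrt (pi / (c * e^2)) ^ CARD('m)"
  by (simp add: has_bochner_integral_iff)
 also have "sqrt (pi / (c * e^2)) = sqrt (pi / c) * inverse e"
  using assms by (simp add: real_sqrt_divide real_sqrt_mult field_simps)
 finally show ?thesis by (simp add: power_mult_distrib power_inverse)
qed

context diag_form
begin

lemma theta_norm: "cmod (theta e t) = gauss (e^2 / 2) t"
 unfolding theta_def norm_mult norm_of_real by simp

lemma theta_sq: "(cmod (theta e t))^2 = gauss (1 * e^2) t"
 unfolding theta_norm by (simp add: exp_of_nat_mult[of 2, symmetric])

lemma theta_measurable [measurable]: "theta e \<in> borel_funs"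
 unfolding theta_def[abs_def] by (intro borel_measurable_continuous_onI continuous_intros)

lemma theta_integral:
 assumes "e > 0"
 shows "integrable lborel (\<lambda>t. (cmod (theta e t))^2)"
  "(LI t. (cmod (theta e t))^2) = sqrt pi ^ CARD('m) * inverse (e ^ CARD('m))"
 unfolding theta_sq using assms gauss_integral_scaled[OF assms, of 1, where 'm='m] gauss_integrable[of "1 * e^2", where 'a="'m rspace"] by auto

lemma Sq_le: "cmod (Sq j p) \<le> Aphi * norm (fst p) * norm (snd p)"
proof -
 have "cmod (Sq j p) \<le> (\<Sum>i\<in>UNIV. cmod (\<phi> (fst p) (v j) $ i) * norm (snd p))"
  unfolding Sq_def
  by (rule order_trans[OF norm_sum], intro sum_mono)
   (use component_le_norm_cart[of "snd p"] in \<open>simp add: norm_mult mult_left_mono\<close>)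
 also have "\<dots> \<le> Aphi * norm (fst p) * norm (snd p)"
  unfolding sum_distrib_right[symmetric] by (intro mult_right_mono phi_le) simp
 finally show ?thesis .
qed

lemma Tq_le: "cmod (Tq l j p) \<le> Aphi * norm (snd p)"
proof -
 have "cmod (Tq l j p) \<le> (\<Sum>i\<in>UNIV. cmod (\<phi> (v l) (v j) $ i) * norm (snd p))"
  unfolding Tq_def
  by (rule order_trans[OF norm_sum], intro sum_mono)
   (use component_le_norm_cart[of "snd p"] in \<open>simp add: norm_mult mult_left_mono\<close>)
 also have "\<dots> \<le> Aphi * norm (snd p)"
  unfolding sum_distrib_right[symmetric] by (intro mult_right_mono phi_vv_le) simp
 finally show ?thesis .
qed

lemma Nq_le: "cmod (Nq k j p) \<le> Aphi^2 * (norm (fst p))^2"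
proof -
 have "cmod (Nq k j p) \<le> (\<Sum>i\<in>UNIV. cmod (\<phi> (fst p) (v k) $ i) * (Aphi * norm (fst p)))"
  unfolding Nq_def
  by (rule order_trans[OF norm_sum], intro sum_mono) (simp add: norm_mult mult_left_mono phi_le1)
 also have "\<dots> \<le> (Aphi * norm (fst p)) * (Aphi * norm (fst p))"
  unfolding sum_distrib_right[symmetric] by (intro mult_right_mono phi_le mult_nonneg_nonneg Aphi_nonneg) simp
 finally show ?thesis by (simp add: power2_eq_square mult_ac)
qed

text \<open>Each |t| is paired with one factor e to form the scaled variable y = e |t|; of the
  overall e^2 at least one factor e is left over.\<close>

lemma Eq_diag_le:
 fixes p :: "('n, 'm) quadric"
 assumes s1: "0 < s1" and s: "s1 \<le> s" and e: "0 < e" "e \<le> 1"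
 shows "cmod (Eq_diag e s j p) \<le> e * ((2 * (1 / s1 + 2 * mu_sum) * Aphi + 2 * Aphi^2 + Aphi) * ((1 + norm (fst p))^2 * (1 + e * norm (snd p))^2))"
proof -
 let ?z = "norm (fst p)" and ?y = "e * norm (snd p)" and ?A = "1 / s1 + 2 * mu_sum"
 let ?P = "(1 + ?z)^2 * (1 + ?y)^2"
 have sp: "s > 0" using s1 s by simp
 have mj: "\<bar>\<mu> j\<bar> \<le> mu_sum" unfolding mu_sum_def by (rule member_le_sum) auto
 have "1 / s \<le> 1 / s1" using s1 s by (simp add: frac_le)
 hence a: "\<bar>mehler_a (\<mu> j) s + \<mu> j\<bar> \<le> ?A" "\<bar>mehler_a (\<mu> j) s - \<mu> j\<bar> \<le> ?A"
  using mehler_bounds(4,5)[OF sp, of "\<mu> j"] mj by auto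
 have A0: "?A \<ge> 0" using s1 mu_sum_nonneg by simp
 have y0: "?y \<ge> 0" using e by simp
 have z2: "?z^2 \<le> (1 + ?z)^2" "1 \<le> (1 + ?z)^2" by (auto intro!: power_mono one_le_power)
 have y1: "?y \<le> (1 + ?y)^2" "?y^2 \<le> (1 + ?y)^2" "1 \<le> (1 + ?y)^2"
  using y0 by (auto intro!: power_mono one_le_power simp: power2_sum)
 have P1: "?z^2 * ?y \<le> ?P" by (intro mult_mono z2 y1) (use y0 in auto)
 have P2: "?z^2 * ?y^2 \<le> ?P" by (intro mult_mono z2 y1) auto
 have P3: "1 * ?y \<le> ?P" by (intro mult_mono z2 y1) (use y0 in auto)
 have P4: "?z^2 * 1 \<le> ?P" by (intro mult_mono z2 y1) auto
 have S: "cmod (Sq j p) \<le> Aphi * ?z * norm (snd p)" by (rule Sq_le)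
 have t1: "cmod (\<i> * of_real (mehler_a (\<mu> j) s + \<mu> j) * (crd j (fst p) * cnj (Sq j p))) \<le> ?A * (?z * (Aphi * ?z * norm (snd p)))"
  unfolding norm_mult norm_of_real complex_mod_cnj norm_ii mult_1
  by (intro mult_mono a S crd_le mult_nonneg_nonneg A0) auto
 have t2: "cmod (\<i> * of_real (mehler_a (\<mu> j) s - \<mu> j) * (Sq j p * cnj (crd j (fst p)))) \<le> ?A * (?z * (Aphi * ?z * norm (snd p)))"
  unfolding norm_mult norm_of_real complex_mod_cnj norm_ii mult_1 mult.commute[of "cmod (Sq j p)"]
  by (intro mult_mono a S crd_le mult_nonneg_nonneg A0) auto
 have t3: "cmod (of_real (e^2) * (Sq j p * cnj (Sq j p))) \<le> e^2 * ((Aphi * ?z * norm (snd p)) * (Aphi * ?z * norm (snd p)))"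
  unfolding norm_mult norm_of_real complex_mod_cnj abs_power2
  by (intro mult_mono S order_refl mult_nonneg_nonneg Aphi_nonneg) auto
 have t4: "cmod (\<i> * Tq j j p) \<le> Aphi * norm (snd p)" using Tq_le by (simp add: norm_mult)
 have "cmod (Eq_diag e s j p) \<le> e^2 * (?A * (?z * (Aphi * ?z * norm (snd p))) + ?A * (?z * (Aphi * ?z * norm (snd p)))
   + e^2 * ((Aphi * ?z * norm (snd p)) * (Aphi * ?z * norm (snd p))) + Aphi * norm (snd p) + Aphi^2 * ?z^2)"
  unfolding Eq_diag_def norm_mult[of "of_real (e^2)"] norm_of_real abs_power2
  by (intro mult_left_mono norm_triangle_le norm_triangle_le_diff add_mono t1 t2 t3 t4 Nq_le) auto
 also have "\<dots> = e * (2 * ?A * Aphi * (?z^2 * ?y) + e * (Aphi^2 * (?z^2 * ?y^2)) + Aphi * ?y + e * (Aphi^2 * ?z^2))"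
  by (simp add: power2_eq_square algebra_simps)
 also have "\<dots> \<le> e * (2 * ?A * Aphi * ?P + 1 * (Aphi^2 * ?P) + Aphi * ?P + 1 * (Aphi^2 * ?P))"
  using P1 P2 P3 P4 e y0
  by (intro mult_left_mono add_mono mult_mono[of e 1] mult_nonneg_nonneg A0 Aphi_nonneg) auto
 also have "\<dots> = e * ((2 * ?A * Aphi + 2 * Aphi^2 + Aphi) * ?P)" by (simp add: algebra_simps)
 finally show ?thesis .
qed

lemma Eq_le:
 assumes s1: "0 < s1"
 shows "\<exists>C\<ge>0. \<forall>e s J p. 0 < e \<longrightarrow> e \<le> 1 \<longrightarrow> s1 \<le> s \<longrightarrow>
  cmod (Eq q K0 e s J p) \<le> e * C * ((1 + norm (fst p))^2 * (1 + e * norm (snd p))^2)"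
proof -
 define D where "D = (\<Sum>J\<in>UNIV. \<Sum>j\<in>UNIV. \<Sum>k\<in>UNIV. cmod (quad.up_down q J K0 j k))"
 define E where "E = real CARD('n) * (2 * (1 / s1 + 2 * mu_sum) * Aphi + 2 * Aphi^2 + Aphi)"
 have D0: "D \<ge> 0" unfolding D_def by (intro sum_nonneg) auto
 have E0: "E \<ge> 0" unfolding E_def using s1 mu_sum_nonneg Aphi_nonneg by (intro mult_nonneg_nonneg add_nonneg_nonneg) auto
 have "cmod (Eq q K0 e s J p) \<le> e * (E + 2 * (D * Aphi)) * ((1 + norm (fst p))^2 * (1 + e * norm (snd p))^2)"
  if e: "0 < e" "e \<le> 1" and s: "s1 \<le> s" for e s J p
 proof -
  let ?y = "e * norm (snd p)"
  let ?P = "(1 + norm (fst p))^2 * (1 + ?y)^2"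
  have y0: "?y \<ge> 0" using e by simp
  have P0: "?P \<ge> 0" by simp
  have "1 * ?y \<le> ?P" using y0 by (intro mult_mono) (auto intro!: one_le_power simp: power2_sum)
  hence yP: "?y \<le> ?P" by simp
  have "cmod (\<Sum>j\<in>UNIV. Eq_diag e s j p) \<le> (\<Sum>j\<in>(UNIV :: 'n set). e * ((2 * (1 / s1 + 2 * mu_sum) * Aphi + 2 * Aphi^2 + Aphi) * ?P))"
   by (intro order_trans[OF norm_sum] sum_mono Eq_diag_le s1 s e)
  also have "\<dots> = e * E * ?P" by (simp add: E_def mult_ac)
  finally have 1: "cmod (if J = K0 then \<Sum>j\<in>UNIV. Eq_diag e s j p else 0) \<le> e * E * ?P"
   using E0 e P0 by auto
  have "cmod (\<Sum>j\<in>UNIV. \<Sum>k\<in>UNIV. quad.up_down q J K0 j k * Tq k j p) \<le> (\<Sum>j\<in>UNIV. \<Sum>k\<in>UNIV. cmod (quad.up_down q J K0 j k) * (Aphi * norm (snd p)))"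
   by (intro order_trans[OF norm_sum] sum_mono) (auto simp: norm_mult intro!: order_trans[OF norm_sum] sum_mono mult_left_mono Tq_le)
  also have "\<dots> = (\<Sum>j\<in>UNIV. \<Sum>k\<in>UNIV. cmod (quad.up_down q J K0 j k)) * (Aphi * norm (snd p))"
   by (simp only: sum_distrib_right)
  also have "\<dots> \<le> D * (Aphi * norm (snd p))"
   unfolding D_def
   by (intro mult_right_mono mult_nonneg_nonneg Aphi_nonneg member_le_sum[where f="\<lambda>J. \<Sum>j\<in>UNIV. \<Sum>k\<in>UNIV. cmod (quad.up_down q J K0 j k)"])
    (auto intro!: sum_nonneg)
  finally have "cmod (of_real (e^2) * (2 * \<i> * (\<Sum>j\<in>UNIV. \<Sum>k\<in>UNIV. quad.up_down q J K0 j k * Tq k j p))) \<le> e^2 * (2 * (D * (Aphi * norm (snd p))))"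
   unfolding norm_mult norm_of_real abs_power2 norm_ii by (intro mult_left_mono) auto
  also have "\<dots> = e * (2 * (D * Aphi)) * ?y" by (simp add: power2_eq_square mult_ac)
  also have "\<dots> \<le> e * (2 * (D * Aphi)) * ?P"
   using e D0 Aphi_nonneg by (intro mult_left_mono[OF yP]) auto
  finally have "cmod (Eq q K0 e s J p) \<le> e * E * ?P + e * (2 * (D * Aphi)) * ?P"
   unfolding Eq_def by (intro norm_triangle_le_diff add_mono 1)
  thus ?thesis by (simp only: distrib_left distrib_right)
 qed
 moreover have "E + 2 * (D * Aphi) \<ge> 0" using D0 E0 Aphi_nonneg by auto
 ultimately show ?thesis by blast
qed

text \<open>The polynomials in |z| and e |t| are absorbed by halves of the two Gaussians, with
  constants independent of e. What remains is the spare factor e times the size e^(-m/2) of the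
  envelope.\<close>

lemma Eq_Vq_norm:
 assumes s: "0 < s1" "s1 \<le> s2"
 shows "\<exists>C\<ge>0. \<forall>e s. 0 < e \<longrightarrow> e \<le> 1 \<longrightarrow> s1 \<le> s \<longrightarrow> s \<le> s2 \<longrightarrow>
  L2_norm q (\<lambda>J p. Eq q K0 e s J p * Vq e K0 s p) \<le> e * C * sqrt (inverse (e ^ CARD('m)))"
proof -
 obtain C where C: "C \<ge> 0" "\<And>e s J p. 0 < e ==> e \<le> 1 ==> s1 \<le> s ==>
   cmod (Eq q K0 e s J p) \<le> e * C * ((1 + norm (fst p))^2 * (1 + e * norm (snd p))^2)"
  using Eq_le[OF s(1), of q K0] by blast
 define M where "M = exp (s2 * mu_sum) * (1 / (pi * s1)) ^ CARD('n)"
 have M0: "M \<ge> 0" using s by (simp add: M_def)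
 obtain B1 where B1: "B1 \<ge> 0" "\<And>r. r \<ge> 0 ==> (1 + r) ^ 2 * exp (- (1 / (2 * s2) * r^2)) \<le> B1"
  using poly_gauss_bound[of "1 / (2 * s2)" 2] s by auto
 \<comment> \<open>In y = e |t| the envelope is exp(-y^2 / 2), and one half of this exponent is
   exp(-y^2 / 4).\<close>
 have quarter: "(0::real) < 1 / 4" by simp
 obtain B2 where B2: "B2 \<ge> 0" "\<And>r::real. r \<ge> 0 ==> (1 + r) ^ 2 * exp (- (1 / 4 * r^2)) \<le> B2"
  using poly_gauss_bound[of "1 / 4" 2, OF quarter] by blast
 define Nn where "Nn = real (card (\<I> q :: 'n set set))"
 define I where "I = (LI x. (gauss (1 / (2 * s2)) (x :: 'n cspace))^2)"
 define Q where "Q = sqrt (Nn * (I * sqrt (pi / (1/2)) ^ CARD('m)))"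
 have "L2_norm q (\<lambda>J p. Eq q K0 e s J p * Vq e K0 s p) \<le> e * (C * M * B1 * B2 * Q) * sqrt (inverse (e ^ CARD('m)))"
  if e: "0 < e" "e \<le> 1" and t: "s1 \<le> s" "s \<le> s2" for e s
 proof -
  let ?a = "\<lambda>x :: 'n cspace. gauss (1 / (2 * s2)) x" and ?b = "\<lambda>x :: 'm rspace. exp (- (1 / 4 * (e * norm x)^2))"
  have b: "cmod (Eq q K0 e s J p * Vq e K0 s p) \<le> (e * (C * M * B1 * B2)) * (?a (fst p) * ?b (snd p))" for J and p :: "('n, 'm) quadric"
  proof -
   let ?x = "norm (fst p)" and ?y = "e * norm (snd p)"
   have "cmod (Vq e K0 s p) \<le> M * exp (- (1 / s2 * ?x^2)) * gauss (e^2 / 2) (snd p)"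
    unfolding Vq_def norm_mult norm_of_real theta_norm M_def by (intro mult_right_mono mehler_unif[OF s(1) t]) simp
   also have "exp (- (1 / s2 * ?x^2)) = ?a (fst p) * ?a (fst p)" by (simp add: field_simps flip: exp_add)
   also have "gauss (e^2 / 2) (snd p) = ?b (snd p) * ?b (snd p)" by (simp add: power_mult_distrib flip: exp_add)
   finally have V: "cmod (Vq e K0 s p) \<le> M * (?a (fst p) * ?a (fst p)) * (?b (snd p) * ?b (snd p))" .
   have "cmod (Eq q K0 e s J p * Vq e K0 s p) \<le> (e * C * ((1 + ?x)^2 * (1 + ?y)^2)) * (M * (?a (fst p) * ?a (fst p)) * (?b (snd p) * ?b (snd p)))"
    unfolding norm_mult using e C(1) M0 by (intro mult_mono C(2) e t V mult_nonneg_nonneg) auto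
   also have "\<dots> = (e * C * M * (?a (fst p) * ?b (snd p))) * (((1 + ?x)^2 * ?a (fst p)) * ((1 + ?y)^2 * ?b (snd p)))"
    by (simp only: mult_ac)
   also have "\<dots> \<le> (e * C * M * (?a (fst p) * ?b (snd p))) * (B1 * B2)"
    using B1(2)[of ?x] B2(2)[of ?y] e C(1) M0 B1(1) by (intro mult_left_mono mult_mono mult_nonneg_nonneg) auto
   finally show ?thesis by (simp only: mult_ac)
  qed
  have bi: "(?b x)^2 = gauss (1/2 * e^2) x" for x by (simp add: power_mult_distrib exp_of_nat_mult[of 2, symmetric])
  have ai: "(?a x)^2 = gauss (1 / s2) x" for x using s by (simp add: exp_of_nat_mult[of 2, symmetric])
  have "L2_norm q (\<lambda>J p. Eq q K0 e s J p * Vq e K0 s p) \<le> (e * (C * M * B1 * B2)) * sqrt (Nn * ((LI x. (?a x)^2) * (LI x. (?b x)^2)))"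
   unfolding Nn_def
  proof (rule L2_norm_pair_bound[where a="?a" and b="?b"])
   show "cmod (Eq q K0 e s J p * Vq e K0 s p) \<le> (e * (C * M * B1 * B2)) * (?a (fst p) * ?b (snd p))" for J and p :: "('n, 'm) quadric"
    by (rule b)
   show "0 \<le> e * (C * M * B1 * B2)" using e C(1) M0 B1(1) B2(1) by simp
   show "integrable lborel (\<lambda>x. (?a x)^2)" unfolding ai using s by (intro gauss_integrable) simp
   show "integrable lborel (\<lambda>x. (?b x)^2)" unfolding bi using e by (intro gauss_integrable) simp
  qed
  also have "(LI x. (?b x)^2) = sqrt (pi / (1/2)) ^ CARD('m) * inverse (e ^ CARD('m))"
   unfolding bi by (rule gauss_integral_scaled) (use e in auto)
  also have "Nn * ((LI x. (?a x)^2) * (sqrt (pi / (1/2)) ^ CARD('m) * inverse (e ^ CARD('m))))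
    = (Nn * (I * sqrt (pi / (1/2)) ^ CARD('m))) * inverse (e ^ CARD('m))" unfolding I_def by (simp only: mult.assoc)
  finally show ?thesis unfolding Q_def real_sqrt_mult[of "Nn * (I * sqrt (pi / (1/2)) ^ CARD('m))"] by (simp only: mult.assoc)
 qed
 moreover have "C * M * B1 * B2 * Q \<ge> 0"
  using C(1) M0 B1(1) B2(1) by (auto simp: Q_def Nn_def I_def intro!: mult_nonneg_nonneg)
 ultimately show ?thesis by blast
qed

lemma mehler_L2_derivative:
 fixes K :: "'n set"
 assumes s: "s > 0"
 defines "D \<equiv> \<lambda>h z. (complex_of_real (mehler K (s + h) z) - of_real (mehler K s z)) / of_real h - of_real (mehler_rate K s z * mehler K s z)"
 shows "((\<lambda>h. LI z. (cmod (D h z))^2) \<longlongrightarrow> 0) (at 0)"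
  "h \<noteq> 0 ==> \<bar>h\<bar> < s / 2 ==> integrable lborel (\<lambda>z. (cmod (D h z))^2)"
proof -
 obtain C c where C: "C \<ge> 0" "c > 0" "\<And>t x. s / 2 \<le> t ==> t \<le> 2 * s ==> \<bar>mehler_rate K t x * mehler K t x\<bar> \<le> C * gauss c x"
  using mehler_dominated[of "s / 2" "2 * s" K] s by auto
 have vd: "((\<lambda>t. complex_of_real (mehler K t z)) has_vector_derivative of_real (mehler_rate K t z * mehler K t z)) (at t)" if "t > 0" for t z
  by (rule has_vector_derivative_of_real) (use mehler_deriv_s[OF that] in \<open>simp add: has_real_derivative_iff_has_vector_derivative\<close>)
 have b: "cmod (D h z) \<le> 2 * C * gauss c z" if h: "h \<noteq> 0" "\<bar>h\<bar> < s / 2" for h z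
 proof -
  have "cmod ((complex_of_real (mehler K (s + h) z) - of_real (mehler K s z)) /\<^sub>R h) \<le> C * gauss c z"
  proof (rule vector_derivative_quotient_bound[where f'="\<lambda>t. of_real (mehler_rate K t z * mehler K t z)" and r="s / 2"])
   show "((\<lambda>t. complex_of_real (mehler K t z)) has_vector_derivative of_real (mehler_rate K t z * mehler K t z)) (at t)" if "\<bar>t - s\<bar> < s / 2" for t
    by (rule vd) (use that s in \<open>auto simp: abs_if split: if_splits\<close>)
   show "cmod (of_real (mehler_rate K t z * mehler K t z)) \<le> C * gauss c z" if "\<bar>t - s\<bar> < s / 2" for t
    unfolding norm_of_real by (rule C(3)) (use that s in \<open>auto simp: abs_if split: if_splits\<close>)
  qed (use h in auto)
  moreover have "cmod (of_real (mehler_rate K s z * mehler K s z)) \<le> C * gauss c z"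
   unfolding norm_of_real by (rule C(3)) (use s in auto)
  ultimately have "cmod (D h z) \<le> C * gauss c z + C * gauss c z"
   unfolding D_def by (intro norm_triangle_le_diff add_mono) (simp_all add: scaleR_conv_of_real divide_inverse mult.commute)
  thus ?thesis by simp
 qed
 have b2: "(cmod (D h z))^2 \<le> (2 * C)^2 * gauss (2 * c) z" if h: "h \<noteq> 0" "\<bar>h\<bar> < s / 2" for h z
  using power_mono[OF b[OF h, of z] norm_ge_zero, of 2] by (simp add: power_mult_distrib exp_of_nat_mult[of 2, symmetric] mult_ac)
 have gi: "integrable lborel (\<lambda>z :: 'n cspace. (2 * C)^2 * gauss (2 * c) z)"
  using C(2) by (intro integrable_mult_right gauss_integrable) simp
 have m: "(\<lambda>z. (cmod (D h z))^2) \<in> borel_funs" for h unfolding D_def by measurable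
 show "integrable lborel (\<lambda>z. (cmod (D h z))^2)" if h: "h \<noteq> 0" "\<bar>h\<bar> < s / 2" for h
  by (rule B_integrable_bound[OF gi]) (use m[of h] b2[OF h] in \<open>auto simp: abs_le_iff intro!: AE_I2 order_trans[OF b2[OF h]]\<close>)
 show "((\<lambda>h. LI z. (cmod (D h z))^2) \<longlongrightarrow> 0) (at 0)"
 proof (rule tendsto_at_0_sequentially[of "s / 2"])
  fix X :: "nat => real" assume X: "\<And>n. X n \<noteq> 0" "\<And>n. \<bar>X n\<bar> < s / 2" "X \<longlonglongrightarrow> 0"
  have Xa: "filterlim X (at 0) sequentially" using X by (auto simp: filterlim_at)
  have "(\<lambda>n. LI z. (cmod (D (X n) z))^2) \<longlonglongrightarrow> integral\<^sup>L lborel (\<lambda>z :: 'n cspace. 0 :: real)"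
  proof (rule integral_dominated_convergence[where w="\<lambda>z. (2 * C)^2 * gauss (2 * c) z"])
   show "integrable lborel (\<lambda>z :: 'n cspace. (2 * C)^2 * gauss (2 * c) z)" by (rule gi)
   show "(\<lambda>z. (cmod (D (X n) z))^2) \<in> borel_measurable lborel" for n using m by simp
   show "AE z in lborel. norm ((cmod (D (X n) z))^2) \<le> (2 * C)^2 * gauss (2 * c) z" for n
    using b2[OF X(1,2)] by (intro AE_I2) simp
   show "AE z in lborel. (\<lambda>n. (cmod (D (X n) z))^2) \<longlonglongrightarrow> 0"
   proof (rule AE_I2)
    fix z
    have "((\<lambda>h. D h z) \<longlongrightarrow> of_real (mehler_rate K s z * mehler K s z) - of_real (mehler_rate K s z * mehler K s z)) (at 0)"
     unfolding D_def using has_vector_derivativeD_quotient[OF vd[OF s, of z]]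
     by (intro tendsto_diff tendsto_const) (simp add: scaleR_conv_of_real divide_inverse mult.commute)
    hence "((\<lambda>h. (cmod (D h z))^2) \<longlongrightarrow> (cmod 0)\<^sup>2) (at 0)" by (intro tendsto_intros) simp
    thus "(\<lambda>n. (cmod (D (X n) z))^2) \<longlonglongrightarrow> 0" using filterlim_compose[OF _ Xa] by fastforce
   qed
  qed simp
  thus "(\<lambda>n. LI z. (cmod (D (X n) z))^2) \<longlonglongrightarrow> 0" by simp
 qed (use s in simp)
qed

lemma single_L2: "L2_fun V ==> L2_form q (quad.single K0 V)"
proof -
 have "quad.single K0 V K = (if K = K0 then V else (\<lambda>x. 0))" for K by (auto simp: quad.single_def)
 thus "L2_fun V ==> L2_form q (quad.single K0 V)" by (simp add: L2_form_def)
qed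

text \<open>The envelope is independent of s and factors out of the norm, so only the derivative of
  \<open>mehler\<close> in L^2 of z matters.\<close>

lemma Vq_L2_derivative:
 assumes s: "\<sigma> + s > 0" and e: "e > 0" and K0: "K0 \<in> \<I> q"
 shows "has_L2_derivative q (\<lambda>\<sigma>. quad.single K0 (Vq e K0 (\<sigma> + s)))
  (quad.single K0 (Vdot e K0 (\<sigma> + s))) \<sigma>"
 unfolding has_L2_derivative_def
proof (intro conjI)
 let ?s = "\<sigma> + s"
 let ?D = "\<lambda>h z. (complex_of_real (mehler K0 (?s + h) z) - of_real (mehler K0 ?s z)) / of_real h - of_real (mehler_rate K0 ?s z * mehler K0 ?s z)"
 have rm: "(\<lambda>p :: ('n, 'm) quadric. complex_of_real (mehler_rate K0 ?s (fst p))) \<in> borel_funs"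
  by (intro borel_measurable_continuous_onI continuous_intros continuous_on_compose2[OF mehler_rate_continuous]) auto
 let ?R = "real CARD('n) * (1 / ?s + (1 / ?s)^2) + 2 * mu_sum"
 have R0: "?R \<ge> 0" using s mu_sum_nonneg by simp
 have "gauss_bounded (Vdot e K0 ?s)"
 proof (rule gauss_bounded_growth[OF gs_gauss_bounded[OF Vq_gs[OF s e]], where D="?R" and N=2])
  fix p :: "('n, 'm) quadric"
  have "\<bar>mehler_rate K0 ?s (fst p)\<bar> \<le> ?R * (1 + norm (fst p)) ^ 2" by (rule mehler_rate_bound[OF s order_refl])
  also have "\<dots> \<le> ?R * (1 + norm p) ^ 2"
   using norm_fst_le[of "fst p" "snd p"] by (intro mult_left_mono power_mono R0) auto
  finally show "cmod (complex_of_real (mehler_rate K0 ?s (fst p))) \<le> ?R * (1 + norm p) ^ 2" by simp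
 qed
 hence "L2_fun (Vdot e K0 ?s)"
  by (rule gauss_bounded_L2) (intro borel_measurable_times rm tame_exp_measurable[OF Vq_gs[OF s e]])
 thus "L2_form q (quad.single K0 (Vdot e K0 ?s))"
  by (rule single_L2)
 have near: "\<forall>\<^sub>F h in at 0. h \<noteq> 0 \<and> \<bar>h\<bar> < ?s / 2"
  using s by (auto simp: eventually_at intro!: exI[of _ "?s / 2"])
 show "\<forall>\<^sub>F h in at 0. L2_form q (quad.single K0 (Vq e K0 (\<sigma> + h + s)))"
  using near by eventually_elim (rule single_L2[OF gs_L2[OF Vq_gs[OF _ e]]], auto simp: abs_if split: if_splits)
 show "L2_form q (quad.single K0 (Vq e K0 ?s))" by (rule single_L2[OF gs_L2[OF Vq_gs[OF s e]]])
 let ?Th = "LI t. (cmod (theta e t))^2"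
 have eq: "L2_norm q (\<lambda>K x. (quad.single K0 (Vq e K0 (\<sigma> + h + s)) K x - quad.single K0 (Vq e K0 ?s) K x) / of_real h
    - quad.single K0 (Vdot e K0 ?s) K x)
   = sqrt ((LI z. (cmod (?D h z))^2) * ?Th)" if h: "h \<noteq> 0 \<and> \<bar>h\<bar> < ?s / 2" for h
 proof -
  have c: "\<sigma> + h + s = ?s + h" by simp
  have "L2_norm q (\<lambda>K x. (quad.single K0 (Vq e K0 (\<sigma> + h + s)) K x - quad.single K0 (Vq e K0 ?s) K x) / of_real h
    - quad.single K0 (Vdot e K0 ?s) K x)
   = L2_norm q (\<lambda>K x. if K = K0 then ?D h (fst x) * theta e (snd x) else 0)"
   unfolding c by (rule L2_norm_cong) (simp add: quad.single_def Vq_def left_diff_distrib diff_divide_distrib)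
  also have "\<dots> = sqrt (LI x. (cmod (?D h (fst x) * theta e (snd x)))^2)" by (rule L2_norm_single[OF K0])
  also have "(LI x. (cmod (?D h (fst x) * theta e (snd x)))^2) = (LI x. (cmod (?D h (fst x)))^2 * (cmod (theta e (snd x)))^2)"
   by (simp only: norm_mult power_mult_distrib)
  also have "\<dots> = (LI z. (cmod (?D h z))^2) * ?Th"
   by (rule lborel_pair_product(2)[OF mehler_L2_derivative(2)[OF s] theta_integral(1)[OF e]]) (use h in auto)
  finally show ?thesis .
 qed
 have "((\<lambda>h. sqrt ((LI z. (cmod (?D h z))^2) * ?Th)) \<longlongrightarrow> sqrt (0 * ?Th)) (at 0)"
  by (intro tendsto_intros mehler_L2_derivative(1)[OF s])
 hence "((\<lambda>h. sqrt ((LI z. (cmod (?D h z))^2) * ?Th)) \<longlongrightarrow> 0) (at 0)" by simp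
 thus "((\<lambda>h. L2_norm q (\<lambda>K x. (quad.single K0 (Vq e K0 (\<sigma> + h + s)) K x - quad.single K0 (Vq e K0 ?s) K x) / of_real h
    - quad.single K0 (Vdot e K0 ?s) K x)) \<longlongrightarrow> 0) (at 0)"
 proof (rule Lim_transform_eventually)
  show "\<forall>\<^sub>F h in at 0. sqrt ((LI z. (cmod (?D h z))^2) * ?Th) = L2_norm q (\<lambda>K x. (quad.single K0 (Vq e K0 (\<sigma> + h + s)) K x - quad.single K0 (Vq e K0 ?s) K x) / of_real h
    - quad.single K0 (Vdot e K0 ?s) K x)"
   using near by eventually_elim (rule eq[symmetric])
 qed
qed

text \<open>\<open>heat_flow_pairing\<close> for the packets at the times \<sigma> + s. The shift by
  s > 0 keeps them away from the singular time 0, and the constant does not depend on e, f and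
  u.\<close>

lemma Vq_pairing:
 assumes T: "T > 0" and s: "s > 0" and K0: "K0 \<in> \<I> q"
 shows "\<exists>C\<ge>0. \<forall>e f u. 0 < e \<longrightarrow> e \<le> 1 \<longrightarrow> L2_form q f \<longrightarrow> heat_flow (Box_b \<phi> v q) q f u \<longrightarrow>
  cmod (L2_inner q (u T) (quad.single K0 (Vq e K0 s)) - L2_inner q f (quad.single K0 (Vq e K0 (T + s))))
   \<le> T * (L2_norm q f * (e * C * sqrt (inverse (e ^ CARD('m)))))"
proof -
 obtain C where C: "C \<ge> 0" "\<And>e t. 0 < e ==> e \<le> 1 ==> s \<le> t ==> t \<le> T + s ==>
  L2_norm q (\<lambda>J p. Eq q K0 e t J p * Vq e K0 t p) \<le> e * C * sqrt (inverse (e ^ CARD('m)))"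
 proof -
  have "s \<le> T + s" using T by simp
  from Eq_Vq_norm[OF s this, of q K0] show thesis using that by blast
 qed
 have "cmod (L2_inner q (u T) (quad.single K0 (Vq e K0 s)) - L2_inner q f (quad.single K0 (Vq e K0 (T + s))))
   \<le> T * (L2_norm q f * (e * C * sqrt (inverse (e ^ CARD('m)))))"
  if e: "0 < e" "e \<le> 1" and f: "L2_form q f" and u: "heat_flow (Box_b \<phi> v q) q f u" for e f u
 proof -
  have p: "\<sigma> + s > 0" if "0 \<le> \<sigma>" for \<sigma> using that s by simp
  have "cmod (L2_inner q (u T) (quad.single K0 (Vq e K0 (0 + s))) - L2_inner q f (quad.single K0 (Vq e K0 (T + s))))
    \<le> T * (L2_norm q f * (e * C * sqrt (inverse (e ^ CARD('m)))))"
  proof (rule heat_flow_pairing[OF quad.L2_graph u f T, where V="\<lambda>\<sigma>. quad.single K0 (Vq e K0 (\<sigma> + s))"])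
   show "has_L2_derivative q (\<lambda>\<sigma>. quad.single K0 (Vq e K0 (\<sigma> + s)))
    (quad.single K0 (Vdot e K0 (\<sigma> + s))) \<sigma>" if "0 \<le> \<sigma>" for \<sigma>
    by (rule Vq_L2_derivative[OF p[OF that] e(1) K0])
   show "Box_b \<phi> v q (quad.single K0 (Vq e K0 (\<sigma> + s)))
    (\<lambda>J p. quad.single K0 (\<lambda>p. - of_real (mehler_rate K0 (\<sigma> + s) (fst p)) * Vq e K0 (\<sigma> + s) p) J p + Eq q K0 e (\<sigma> + s) J p * Vq e K0 (\<sigma> + s) p)"
    if "0 \<le> \<sigma>" for \<sigma> by (rule quad_laplacian_Vq[OF p[OF that] e(1) K0])
   fix \<sigma> assume t: "0 \<le> \<sigma>" "\<sigma> \<le> T"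
   have "L2_norm q (\<lambda>J p. (quad.single K0 (\<lambda>p. - of_real (mehler_rate K0 (\<sigma> + s) (fst p)) * Vq e K0 (\<sigma> + s) p) J p + Eq q K0 e (\<sigma> + s) J p * Vq e K0 (\<sigma> + s) p)
     + quad.single K0 (Vdot e K0 (\<sigma> + s)) J p)
    = L2_norm q (\<lambda>J p. Eq q K0 e (\<sigma> + s) J p * Vq e K0 (\<sigma> + s) p)"
    by (rule L2_norm_cong) (simp add: quad.single_def)
   also have "\<dots> \<le> e * C * sqrt (inverse (e ^ CARD('m)))" by (rule C(2)) (use t e in auto)
   finally show "L2_norm q (\<lambda>J p. (quad.single K0 (\<lambda>p. - of_real (mehler_rate K0 (\<sigma> + s) (fst p)) * Vq e K0 (\<sigma> + s) p) J p + Eq q K0 e (\<sigma> + s) J p * Vq e K0 (\<sigma> + s) p)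
     + quad.single K0 (Vdot e K0 (\<sigma> + s)) J p) \<le> e * C * sqrt (inverse (e ^ CARD('m)))" .
  qed
  thus ?thesis by simp
 qed
 thus ?thesis using C(1) by blast
qed

end

section \<open>Concentration and continuity of integrals\<close>

lemma continuous_nonneg_integral_zero:
 fixes P :: "'x::euclidean_space => real"
 assumes c: "continuous_on UNIV P" and i: "integrable lborel P" and nn: "\<And>x. P x \<ge> 0" and z: "(LI x. P x) = 0"
 shows "P x = 0"
proof (rule ccontr)
 assume "P x \<noteq> 0"
 hence p: "P x > 0" using nn[of x] by linarith
 have "(P \<longlongrightarrow> P x) (at x)" using c by (simp add: continuous_on_eq_continuous_at isCont_def)
 from order_tendstoD(1)[OF this, of "P x / 2"] p obtain d where d: "d > 0" "\<And>y. y \<noteq> x ==> dist y x < d ==> P x / 2 < P y"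
  unfolding eventually_at by auto
 have b: "P x / 2 * indicator (ball x d) y \<le> P y" for y
 proof (cases "y \<in> ball x d")
  case True
  thus ?thesis using d(2)[of y] p by (cases "y = x") (auto simp: dist_commute)
 qed (simp add: nn)
 have ib: "integrable lborel (\<lambda>y. P x / 2 * indicator (ball x d) y)"
  by (intro integrable_mult_right integrable_real_indicator emeasure_bounded_finite bounded_ball) simp
 have "P x / 2 * measure lborel (ball x d) = (LI y. P x / 2 * indicator (ball x d) y)" by simp
 also have "\<dots> \<le> (LI y. P y)" by (rule integral_mono[OF ib i b])
 finally have "P x / 2 * measure lborel (ball x d) \<le> 0" using z by simp
 moreover have "measure lborel (ball x d) > 0" using content_ball_pos[OF d(1), of x] by simp
 ultimately show False using p by (simp add: mult_le_0_iff)
qed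

text \<open>The integrand is bounded on products of balls and vanishes for |x| > r, so near each y
  it is dominated by a multiple of an indicator.\<close>

lemma continuous_integral_compact:
 fixes F :: "'a::euclidean_space => 'b::euclidean_space => complex"
 assumes c: "continuous_on UNIV (\<lambda>p. F (fst p) (snd p))" and z: "\<And>x y. norm x > r ==> F x y = 0"
 shows "integrable lborel (\<lambda>x. F x y)" "continuous_on UNIV (\<lambda>y. LI x. F x y)"
proof -
 have m: "(\<lambda>x. F x y) \<in> borel_funs" for y
  using continuous_on_compose2[OF c, of UNIV "\<lambda>x. (x, y)"] by (intro borel_measurable_continuous_onI) (simp add: continuous_intros)
 have bnd: "\<exists>B. \<forall>x y. norm y \<le> b \<longrightarrow> cmod (F x y) \<le> B * indicator (cball 0 r) x" for b
 proof -
  have "compact ((\<lambda>p. F (fst p) (snd p)) ` (cball 0 r \<times> cball 0 b))"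
   by (intro compact_continuous_image continuous_on_subset[OF c] compact_Times) auto
  then obtain B where B: "\<forall>x\<in>cball 0 r. \<forall>y\<in>cball 0 b. cmod (F x y) \<le> B"
   by (auto dest!: compact_imp_bounded simp: bounded_iff)
  have "cmod (F x y) \<le> B * indicator (cball 0 r) x" if "norm y \<le> b" for x y
  proof (cases "x \<in> cball 0 r")
   case True thus ?thesis using B True that by simp
  next
   case False thus ?thesis using z[of x y] by simp
  qed
  thus ?thesis by blast
 qed
 have ii: "integrable lborel (\<lambda>x :: 'a. B * indicator (cball 0 r) x :: real)" for B
  by (intro integrable_mult_right integrable_real_indicator emeasure_bounded_finite bounded_cball) simp
 show "integrable lborel (\<lambda>x. F x y)" for y
 proof -
  obtain B where B: "\<And>x y'. norm y' \<le> norm y ==> cmod (F x y') \<le> B * indicator (cball 0 r) x"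
   using bnd[of "norm y"] by blast
  show ?thesis
   by (rule B_integrable_bound[OF ii[of B]]) (use m[of y] B[of y] in \<open>auto intro!: AE_I2 order_trans[OF B]\<close>)
 qed
 show "continuous_on UNIV (\<lambda>y. LI x. F x y)"
  unfolding continuous_on_eq_continuous_at[OF open_UNIV]
 proof (intro ballI continuous_at_sequentiallyI)
  fix y u assume u: "u \<longlonglongrightarrow> (y :: 'b)"
  obtain b where b: "\<And>n. norm (u n) \<le> b" using convergent_imp_Bseq[of u] u by (auto simp: convergent_def elim!: BseqE)
  obtain B where B: "\<And>x y'. norm y' \<le> b ==> cmod (F x y') \<le> B * indicator (cball 0 r) x"
   using bnd[of b] by blast
  show "(\<lambda>n. LI x. F x (u n)) \<longlonglongrightarrow> (LI x. F x y)"
  proof (rule integral_dominated_convergence[where w="\<lambda>x. B * indicator (cball 0 r) x"])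
   show "AE x in lborel. (\<lambda>n. F x (u n)) \<longlonglongrightarrow> F x y"
   proof (rule AE_I2)
    fix x
    have "isCont (\<lambda>p. F (fst p) (snd p)) (x, y)" using c by (simp add: continuous_on_eq_continuous_at)
    from isCont_tendsto_compose[OF this tendsto_Pair[OF tendsto_const u]]
    show "(\<lambda>n. F x (u n)) \<longlonglongrightarrow> F x y" by simp
   qed
   show "AE x in lborel. cmod (F x (u n)) \<le> B * indicator (cball 0 r) x" for n
    by (intro AE_I2 B b)
  qed (use m ii in auto)
 qed
qed

text \<open>\<open>k\<close> may grow: only its product with one fixed Gaussian is integrable. For e
  <= 1 both halves of the exponent 1/e^2 are at least 1/2; one stays as that fixed Gaussian, the
  other makes the part away from \<open>a\<close> small.\<close>

lemma gauss_concentration: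
 fixes k :: "'l::euclidean_space => complex"
 assumes k: "k \<in> borel_funs" "isCont k a"
  and i: "integrable lborel (\<lambda>x. k x * of_real (gauss (1 / 2) (x - a)))"
 shows "((\<lambda>e. of_real (inverse (e ^ DIM('l))) * (LI x. k x * of_real (gauss (1 / e^2) (x - a))))
  \<longlongrightarrow> of_real (sqrt pi ^ DIM('l)) * k a) (at_right 0)"
proof (rule tendstoI)
 fix \<epsilon> :: real assume \<epsilon>: "\<epsilon> > 0"
 let ?P = "sqrt pi ^ DIM('l)" and ?g = "\<lambda>x. gauss (1 / 2) (x - a)"
 define \<eta> where "\<eta> = \<epsilon> / (2 * ?P)"
 have P: "?P > 0" by simp
 have \<eta>: "\<eta> > 0" using \<epsilon> P by (simp add: \<eta>_def)
 obtain d where d: "d > 0" "\<And>x. dist x a < d ==> dist (k x) (k a) < \<eta>"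
  using k(2) \<eta> unfolding continuous_at_eps_delta by blast
 obtain B where B: "B \<ge> 0" "\<And>r. r \<ge> 0 ==> (1 + r) ^ (DIM('l) + 1) * exp (- (d^2 / 2 * r^2)) \<le> B"
  using poly_gauss_bound[of "d^2 / 2" "DIM('l) + 1"] d(1) by auto
 define M where "M = (LI x. (cmod (k x) + cmod (k a)) * ?g x)"
 have gi: "integrable lborel ?g" by (rule gauss_shift) simp
 have ki: "integrable lborel (\<lambda>x. cmod (k x) * ?g x)"
  using integrable_norm[OF i] by (simp add: norm_mult)
 have Mi: "integrable lborel (\<lambda>x. (cmod (k x) + cmod (k a)) * ?g x)"
  unfolding distrib_right by (intro B_integrable_add ki integrable_mult_right gi)
 have M0: "M \<ge> 0" unfolding M_def by (intro integral_nonneg_AE AE_I2) simp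
 have main: "dist (of_real (inverse (e ^ DIM('l))) * (LI x. k x * of_real (gauss (1 / e^2) (x - a)))) (of_real ?P * k a) \<le> \<eta> * ?P + e * (B * M)"
  if e: "0 < e" "e \<le> 1" for e
 proof -
  let ?E = "\<lambda>x. gauss (1 / e^2) (x - a)" and ?c = "inverse (e ^ DIM('l))"
  have ce: "1 / e^2 > 0" using e by simp
  have e2: "1 \<le> 1 / e^2" using e by (simp add: power_le_one)
  have Ei: "integrable lborel ?E" "(LI x. ?E x) = sqrt (pi / (1 / e^2)) ^ DIM('l)" by (rule gauss_shift[OF ce])+
  have "sqrt (pi / (1 / e^2)) = sqrt pi * e" using e by (simp add: real_sqrt_mult)
  hence EP: "?c * (LI x. ?E x) = ?P" unfolding Ei(2) using e by (simp add: power_mult_distrib)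
  have Eg: "?E x \<le> ?g x" for x
  proof -
   have "1 / 2 * (norm (x - a))^2 \<le> 1 / e^2 * (norm (x - a))^2" by (intro mult_right_mono, use e2 in linarith, simp)
   thus ?thesis by simp
  qed
  have Ek: "integrable lborel (\<lambda>x. k x * of_real (?E x))"
   by (rule B_integrable_bound[OF ki]) (use k(1) Eg in \<open>auto simp: norm_mult intro!: mult_left_mono AE_I2\<close>)
  have Ec: "integrable lborel (\<lambda>x. complex_of_real (?E x))" using Ei(1) by (rule integrable_of_real)
  \<comment> \<open>At distance at least d the second half of the exponent beats e^-l, with l the
    dimension. The power l + 1 in the choice of \<open>B\<close> leaves one spare factor e.\<close>
  have far: "?c * ?E x \<le> e * B * ?g x" if x: "d \<le> norm (x - a)" for x
  proof -
   let ?N = "norm (x - a)"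
   have "1 / e^2 * ?N^2 = 1 / (2 * e^2) * ?N^2 + 1 / (2 * e^2) * ?N^2" by (simp add: field_simps)
   moreover have "1 / (2 * e^2) * ?N^2 \<ge> 1 / 2 * ?N^2" using e2 by (intro mult_right_mono) auto
   moreover have "1 / (2 * e^2) * ?N^2 \<ge> 1 / (2 * e^2) * d^2" using x d(1) by (intro mult_left_mono power_mono) auto
   ultimately have "1 / e^2 * ?N^2 \<ge> 1 / 2 * ?N^2 + d^2 / 2 * (1 / e)^2" by (simp add: power_divide mult.commute)
   hence "?E x \<le> ?g x * exp (- (d^2 / 2 * (1 / e)^2))" unfolding exp_add[symmetric] exp_le_cancel_iff by linarith
   hence "?c * ?E x \<le> ?c * (?g x * exp (- (d^2 / 2 * (1 / e)^2)))" using e by (intro mult_left_mono) auto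
   also have "\<dots> = e * ((1 / e) ^ (DIM('l) + 1) * exp (- (d^2 / 2 * (1 / e)^2))) * ?g x"
    using e by (simp add: power_divide field_simps)
   also have "\<dots> \<le> e * ((1 + 1 / e) ^ (DIM('l) + 1) * exp (- (d^2 / 2 * (1 / e)^2))) * ?g x"
    using e by (intro mult_right_mono mult_left_mono power_mono) auto
   also have "\<dots> \<le> e * B * ?g x" using e B(2)[of "1 / e"] by (intro mult_right_mono mult_left_mono) auto
   finally show ?thesis .
  qed
  have nm: "cmod ((k x - k a) * of_real (?c * ?E x)) = cmod (k x - k a) * (?c * ?E x)" for x
   unfolding norm_mult norm_of_real using e by simp
  have pw: "cmod ((k x - k a) * of_real (?c * ?E x)) \<le> \<eta> * (?c * ?E x) + e * B * ((cmod (k x) + cmod (k a)) * ?g x)" for x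
  proof (cases "norm (x - a) < d")
   case True
   hence "cmod (k x - k a) \<le> \<eta>" using d(2)[of x] by (simp add: dist_norm)
   hence "cmod (k x - k a) * (?c * ?E x) \<le> \<eta> * (?c * ?E x)" using e by (intro mult_right_mono) auto
   moreover have "0 \<le> e * B * ((cmod (k x) + cmod (k a)) * ?g x)" using e B(1) by simp
   ultimately show ?thesis unfolding nm by linarith
  next
   case False
   hence "cmod (k x - k a) * (?c * ?E x) \<le> (cmod (k x) + cmod (k a)) * (e * B * ?g x)"
    using e B(1) by (intro mult_mono norm_triangle_ineq4 far) auto
   moreover have "0 \<le> \<eta> * (?c * ?E x)" using e \<eta> by simp
   moreover have "(cmod (k x) + cmod (k a)) * (e * B * ?g x) = e * B * ((cmod (k x) + cmod (k a)) * ?g x)" by (simp only: mult_ac)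
   ultimately show ?thesis unfolding nm by linarith
  qed
  have "of_real ?c * (LI x. k x * of_real (?E x)) - of_real ?P * k a
   = of_real ?c * (LI x. k x * of_real (?E x)) - of_real ?c * ((LI x. complex_of_real (?E x)) * k a)"
   unfolding EP[symmetric] integral_complex_of_real of_real_mult by (simp only: mult.assoc)
  also have "\<dots> = (LI x. of_real ?c * (k x * of_real (?E x)) - of_real ?c * (of_real (?E x) * k a))"
   using Ek Ec by simp
  also have "\<dots> = (LI x. (k x - k a) * of_real (?c * ?E x))"
   by (intro B_integral_cong refl) (simp add: algebra_simps)
  also have "cmod \<dots> \<le> (LI x. cmod ((k x - k a) * of_real (?c * ?E x)))" by (rule integral_norm_bound)
  also have "\<dots> \<le> (LI x. \<eta> * (?c * ?E x) + e * B * ((cmod (k x) + cmod (k a)) * ?g x))"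
  proof (rule integral_mono')
   show "integrable lborel (\<lambda>x. \<eta> * (?c * ?E x) + e * B * ((cmod (k x) + cmod (k a)) * ?g x))"
    by (intro B_integrable_add integrable_mult_right Ei Mi)
   show "0 \<le> \<eta> * (?c * ?E x) + e * B * ((cmod (k x) + cmod (k a)) * ?g x)" for x
    by (rule order_trans[OF norm_ge_zero pw])
  qed (rule pw)
  also have "\<dots> = \<eta> * ?P + e * (B * M)"
   unfolding EP[symmetric] M_def using Ei(1) Mi by simp
  finally show ?thesis by (simp add: dist_norm)
 qed
 define b where "b = min 1 (\<epsilon> / (2 * (B * M + 1)))"
 have BM: "B * M \<ge> 0" using B(1) M0 by simp
 have b0: "b > 0" using BM \<epsilon> by (simp add: b_def)
 have "dist (of_real (inverse (e ^ DIM('l))) * (LI x. k x * of_real (gauss (1 / e^2) (x - a)))) (of_real ?P * k a) < \<epsilon>"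
  if e: "0 < e" "e < b" for e
 proof -
  have e1: "e \<le> 1" and e2: "e < \<epsilon> / (2 * (B * M + 1))" using e by (auto simp: b_def)
  have "e * (B * M) \<le> e * (B * M + 1)" using e by simp
  also have "\<dots> < \<epsilon> / 2" using e2 BM by (simp add: field_simps)
  finally have "e * (B * M) < \<epsilon> / 2" .
  moreover have "\<eta> * ?P = \<epsilon> / 2" using P by (simp add: \<eta>_def)
  ultimately show ?thesis using main[OF e(1) e1] by linarith
 qed
 thus "\<forall>\<^sub>F e in at_right 0. dist (of_real (inverse (e ^ DIM('l))) * (LI x. k x * of_real (gauss (1 / e^2) (x - a)))) (of_real ?P * k a) < \<epsilon>"
  using b0 unfolding eventually_at_right_field by blast
qed

section \<open>Wave packets with compact support in \<open>z\<close>\<close>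

lemma sqrt_2pi_powr: "sqrt (2 * pi) ^ m = (2 * pi) powr (real m / 2)"
 by (simp add: powr_half_sqrt[symmetric] powr_powr powr_realpow[symmetric])

lemma tame_norm_sq_affine:
 fixes L :: "'x::euclidean_space => 'y::euclidean_space"
 assumes L: "bounded_linear L" shows "tame (\<lambda>x. of_real ((norm (a - L x))^2))"
proof -
 have "(\<lambda>x. complex_of_real ((norm (a - L x))^2)) = (\<lambda>x. \<Sum>b\<in>Basis. (of_real (a \<bullet> b) - of_real (L x \<bullet> b)) * (of_real (a \<bullet> b) - of_real (L x \<bullet> b)))"
 proof
  fix x
  have "(norm (a - L x))^2 = (\<Sum>b\<in>Basis. ((a - L x) \<bullet> b) * ((a - L x) \<bullet> b))"
   unfolding power2_norm_eq_inner by (rule euclidean_inner)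
  thus "complex_of_real ((norm (a - L x))^2) = (\<Sum>b\<in>Basis. (of_real (a \<bullet> b) - of_real (L x \<bullet> b)) * (of_real (a \<bullet> b) - of_real (L x \<bullet> b)))"
   by (simp only: of_real_mult of_real_sum inner_diff_left of_real_diff)
 qed
 thus ?thesis
  by (simp only:) (intro tame_sum tame.mult tame_diff tame.const tame_linear_real bounded_linear_compose[OF bounded_linear_inner_left L])
qed

lemma cutoff_affine_tame:
 fixes L :: "'x::euclidean_space => 'y::euclidean_space"
 assumes L: "bounded_linear L" shows "tame (\<lambda>x. cutoff r (a - L x))"
proof -
 have "tame (\<lambda>x. of_real (1 - (norm (a - L x))\<^sup>2 / r^2))"
  using tame_diff[OF tame.const[of 1] tame_cmult[OF tame_norm_sq_affine[OF L, of a], of "of_real (1 / r^2)"]] by simp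
 thus ?thesis unfolding cutoff_def
  by (intro tame_cmult tame.comp[OF bounded_smooth_bump])
qed

text \<open>Supported in the ball of radius r about a. The Gaussian factor is there because
  membership in \<open>gs\<close> calls for an exponent with decay.\<close>

definition packet :: "'x::euclidean_space => real => 'x => complex" where
 "packet a r y = cutoff r (a - y) * of_real (exp (- (norm y)\<^sup>2))"

lemma packet_gs: "gs (packet a r)"
proof -
 have "gs (\<lambda>y. cutoff r (a - y) * exp (- of_real ((norm y)^2)))"
  by (intro tame_exp.base cutoff_affine_tame[OF bounded_linear_ident] tame_minus tame_norm_sq exI[of _ 0] exI[of _ 1]) auto
 thus ?thesis by (simp add: packet_def[abs_def] exp_of_real[symmetric] del: exp_of_real)
qed

context diag_form
begin

lemma phi_left_linear: "bounded_linear (\<lambda>w. \<phi> w z $ i)"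
 unfolding linear_conv_bounded_linear[symmetric]
proof (rule linearI)
 have r: "r *\<^sub>R w = of_real r *s w" for r and w :: "'n cspace" by (simp add: vec_eq_iff) (simp add: scaleR_conv_of_real)
 show "\<phi> (r *\<^sub>R w) z $ i = r *\<^sub>R (\<phi> w z $ i)" for r w unfolding r phi_cmult by (simp add: scaleR_conv_of_real)
qed (simp add: phi_add)

lemma wave_phase_tame: "tame (\<lambda>p :: ('n, 'm) quadric. of_real (snd p \<bullet> (t - 2 *\<^sub>R im_form \<phi> (fst p) z)))"
proof -
 have "(\<lambda>p :: ('n, 'm) quadric. complex_of_real (snd p \<bullet> (t - 2 *\<^sub>R im_form \<phi> (fst p) z)))
   = (\<lambda>p. of_real (snd p \<bullet> t) - 2 * (\<Sum>i\<in>UNIV. of_real (snd p $ i) * of_real (Im (\<phi> (fst p) z $ i))))"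
 proof
  fix p :: "('n, 'm) quadric"
  have i: "l \<bullet> im_form \<phi> w z = (\<Sum>i\<in>UNIV. l $ i * Im (\<phi> w z $ i))" for l w by (simp add: inner_vec_def im_form_def)
  have "snd p \<bullet> (t - 2 *\<^sub>R im_form \<phi> (fst p) z) = snd p \<bullet> t - 2 * (\<Sum>i\<in>UNIV. snd p $ i * Im (\<phi> (fst p) z $ i))"
   by (simp add: inner_diff_right i)
  thus "complex_of_real (snd p \<bullet> (t - 2 *\<^sub>R im_form \<phi> (fst p) z)) = of_real (snd p \<bullet> t) - 2 * (\<Sum>i\<in>UNIV. of_real (snd p $ i) * of_real (Im (\<phi> (fst p) z $ i)))"
   by simp
 qed
 thus ?thesis
  by (simp only:) (intro tame_diff tame_cmult tame_sum tame.mult tame_linear_real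
    bounded_linear_compose[OF bounded_linear_inner_left bounded_linear_snd]
    bounded_linear_compose[OF bounded_linear_vec_nth bounded_linear_snd]
    bounded_linear_compose[OF bounded_linear_Im bounded_linear_compose[OF phi_left_linear bounded_linear_fst]])
qed

text \<open>Built so that its partial Fourier transform is the datum \<open>Fw\<close>, inverted and
  translated by the group law as in the convolution; the term 2 Im \<phi> in the phase is the twist
  of that law.\<close>

definition psi :: "real => 'n cspace => real => 'n cspace => 'm rspace => ('n, 'm) quadric => complex" where
 "psi e a r z t p = packet a r (z - fst p) * exp (\<i> * of_real (snd p \<bullet> (t - 2 *\<^sub>R im_form \<phi> (fst p) z)))
   * of_real (inverse (e ^ CARD('m)) * gauss (1 / (2 * e^2)) (snd p - \<xi>))"

lemma psi_gs: assumes e: "e > 0" shows "gs (psi e a r z t)"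
proof -
 define c where "c = 1 / (2 * e^2)"
 have c0: "c > 0" using e by (simp add: c_def)
 define Q where "Q p = - complex_of_real ((norm (z - fst p))^2) + \<i> * of_real (snd p \<bullet> (t - 2 *\<^sub>R im_form \<phi> (fst p) z))
   + - of_real c * of_real ((norm (\<xi> - snd p))^2)" for p :: "('n, 'm) quadric"
 define A where "A p = of_real (inverse (e ^ CARD('m))) * cutoff r ((a - z) - - fst p)" for p :: "('n, 'm) quadric"
 have Q: "tame Q" unfolding Q_def[abs_def]
  by (intro tame.add tame_minus tame_cmult wave_phase_tame tame_norm_sq_affine bounded_linear_fst bounded_linear_snd)
 have A: "tame A" unfolding A_def[abs_def]
  by (intro tame_cmult cutoff_affine_tame bounded_linear_minus bounded_linear_fst)
 have "Re (Q p) \<le> ((norm z)^2 + c * (norm \<xi>)^2) - min (1 / 2) (c / 2) * (norm p)^2" for p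
 proof -
  have "- (norm (z - fst p))\<^sup>2 \<le> (norm z)^2 - 1 / 2 * (norm (fst p))^2" using norm_sq_shift[of z "fst p"] by simp
  moreover have "c * - (norm (\<xi> - snd p))\<^sup>2 \<le> c * ((norm \<xi>)^2 - (norm (snd p))\<^sup>2 / 2)" using c0 by (intro mult_left_mono norm_sq_shift) simp
  moreover have "min (1 / 2) (c / 2) * (norm p)^2 \<le> 1 / 2 * (norm (fst p))^2 + c / 2 * (norm (snd p))^2"
   unfolding norm_pair_sq distrib_left by (intro add_mono mult_right_mono) auto
  moreover have "Re (Q p) = - (norm (z - fst p))\<^sup>2 + c * - (norm (\<xi> - snd p))\<^sup>2" by (simp add: Q_def)
  moreover have "c * ((norm \<xi>)^2 - (norm (snd p))\<^sup>2 / 2) = c * (norm \<xi>)^2 - c / 2 * (norm (snd p))^2"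
   by (simp add: right_diff_distrib)
  ultimately show ?thesis by linarith
 qed
 hence "gs (\<lambda>p. A p * exp (Q p))" using c0
  by (intro tame_exp.base[OF A Q] exI[of _ "(norm z)^2 + c * (norm \<xi>)^2"] exI[of _ "min (1 / 2) (c / 2)"]) auto
 moreover have "psi e a r z t p = A p * exp (Q p)" for p
 proof -
  have "exp (Q p) = of_real (exp (- (norm (z - fst p))\<^sup>2)) * exp (\<i> * of_real (snd p \<bullet> (t - 2 *\<^sub>R im_form \<phi> (fst p) z)))
    * of_real (gauss c (snd p - \<xi>))"
   unfolding Q_def exp_add exp_of_real[symmetric] norm_minus_commute[of "snd p"] by simp
  moreover have "a - (z - fst p) = (a - z) - - fst p" by simp
  ultimately show ?thesis by (simp only: psi_def c_def[symmetric] packet_def A_def of_real_mult mult_ac)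
 qed
 hence "psi e a r z t = (\<lambda>p. A p * exp (Q p))" by (rule ext)
 ultimately show ?thesis by (simp only:)
qed

text \<open>The initial datum: localized in z near \<open>a\<close>, and of frequency close to \<xi>
  in t.\<close>

definition Fw :: "real => 'n cspace => real => ('n, 'm) quadric => complex" where
 "Fw e a r p = packet a r (fst p) * theta e (snd p)"

lemma Fw_gs: assumes e: "e > 0" shows "gs (Fw e a r)"
proof -
 define Q where "Q p = - complex_of_real ((norm (0 - fst p))^2) + \<i> * of_real (\<xi> \<bullet> snd p)
   + - of_real (e^2 / 2) * of_real ((norm (0 - snd p))^2)" for p :: "('n, 'm) quadric"
 have Q: "tame Q" unfolding Q_def[abs_def]
  by (intro tame.add tame_minus tame_cmult tame_norm_sq_affine bounded_linear_fst bounded_linear_snd tame_linear_real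
    bounded_linear_compose[OF bounded_linear_inner_right bounded_linear_snd])
 have A: "tame (\<lambda>p :: ('n, 'm) quadric. cutoff r (a - fst p))" by (intro cutoff_affine_tame bounded_linear_fst)
 have "Re (Q p) \<le> 0 - min 1 (e^2 / 2) * (norm p)^2" for p
 proof -
  have "min 1 (e^2 / 2) * (norm p)^2 \<le> 1 * (norm (fst p))^2 + e^2 / 2 * (norm (snd p))^2"
   unfolding norm_pair_sq distrib_left by (intro add_mono mult_right_mono) auto
  thus ?thesis by (simp add: Q_def)
 qed
 hence "gs (\<lambda>p. cutoff r (a - fst p) * exp (Q p))" using e
  by (intro tame_exp.base[OF A Q] exI[of _ 0] exI[of _ "min 1 (e^2 / 2)"]) auto
 moreover have "Fw e a r p = cutoff r (a - fst p) * exp (Q p)" for p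
 proof -
  have "exp (Q p) = of_real (exp (- (norm (fst p))\<^sup>2)) * (exp (\<i> * of_real (\<xi> \<bullet> snd p)) * of_real (gauss (e^2 / 2) (snd p)))"
   unfolding Q_def exp_add exp_of_real[symmetric] by simp
  thus ?thesis by (simp only: Fw_def packet_def theta_def mult.assoc)
 qed
 hence "Fw e a r = (\<lambda>p. cutoff r (a - fst p) * exp (Q p))" by (rule ext)
 ultimately show ?thesis by (simp only:)
qed

lemma im_form_minus: "im_form \<phi> (- w) z = - im_form \<phi> w z"
proof -
 have "\<phi> (- w) z = - \<phi> w z" using phi_cmult(1)[of "- 1" w z] by (simp add: vector_sneg_minus1[symmetric])
 thus ?thesis by (simp add: im_form_def vec_eq_iff)
qed

text \<open>A Gaussian of width e about the frequency \<xi> transforms into the envelope of width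
  1/e with phase \<xi>, evaluated at the t-coordinate of the group product.\<close>

lemma psi_fourier:
 assumes e: "e > 0"
 shows "fourier_t (psi e a r z t) h = Fw e a r (qmul \<phi> (- h) (z, t))"
proof -
 let ?m = "CARD('m)" and ?y = "t - 2 *\<^sub>R im_form \<phi> (fst h) z - snd h" and ?c = "1 / (2 * e^2)"
 let ?C = "packet a r (z - fst h) * of_real (inverse (e ^ ?m))"
 have c: "?c > 0" using e by simp
 have q: "qmul \<phi> (- h) (z, t) = (z - fst h, ?y)" by (simp add: qmul_def im_form_minus)
 have eq: "exp (- \<i> * of_real (snd h \<bullet> l)) * psi e a r z t (fst h, l) = ?C * (exp (\<i> * of_real (?y \<bullet> l)) * of_real (gauss ?c (l - \<xi>)))" for l
 proof -
  have "- \<i> * of_real (snd h \<bullet> l) + \<i> * of_real (l \<bullet> (t - 2 *\<^sub>R im_form \<phi> (fst h) z)) = \<i> * of_real (?y \<bullet> l)"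
   by (simp add: inner_commute[of l] inner_diff_left[of _ "snd h"] algebra_simps)
  from this[symmetric] have "exp (\<i> * of_real (?y \<bullet> l)) = exp (- \<i> * of_real (snd h \<bullet> l)) * exp (\<i> * of_real (l \<bullet> (t - 2 *\<^sub>R im_form \<phi> (fst h) z)))"
   by (simp only: exp_add)
  thus ?thesis by (simp only: psi_def fst_conv snd_conv of_real_mult mult_ac)
 qed
 have sq: "sqrt (pi / ?c) = sqrt (2 * pi) * e" using e by (simp add: real_sqrt_mult power2_eq_square)
 have pw: "(2 * pi) powr (- real ?m / 2) * sqrt (2 * pi) ^ ?m = 1"
  by (simp add: sqrt_2pi_powr powr_add[symmetric])
 have I: "(LI l. exp (- \<i> * of_real (snd h \<bullet> l)) * psi e a r z t (fst h, l)) = ?C * (exp (\<i> * of_real (?y \<bullet> \<xi>)) * of_real ((sqrt (2 * pi) * e) ^ ?m * exp (- (norm ?y)\<^sup>2 / (4 * ?c))))"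
  unfolding eq integral_mult_right_zero
  using gauss_fourier_shift[OF c, of ?y \<xi>] by (simp only: has_bochner_integral_iff sq) simp
 have ee: "- (norm ?y)\<^sup>2 / (4 * ?c) = - (e^2 / 2 * (norm ?y)^2)" using e by (simp add: field_simps)
 \<comment> \<open>The normalization of \<open>fourier_t\<close> and the factor e^-m in
   \<open>psi\<close> cancel the mass of the Gaussian.\<close>
 have un: "of_real ((2 * pi) powr (- real ?m / 2)) * (of_real (inverse (e ^ ?m)) * of_real ((sqrt (2 * pi) * e) ^ ?m)) = (1 :: complex)"
 proof -
  have "(2 * pi) powr (- real ?m / 2) * (inverse (e ^ ?m) * (sqrt (2 * pi) * e) ^ ?m) = ((2 * pi) powr (- real ?m / 2) * sqrt (2 * pi) ^ ?m) * (inverse (e ^ ?m) * e ^ ?m)"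
   by (simp only: power_mult_distrib mult_ac)
  also have "\<dots> = 1" unfolding pw using e by simp
  finally show ?thesis by (simp only: of_real_mult[symmetric] of_real_1)
 qed
 have k: "of_real ((2 * pi) powr (- real ?m / 2)) * (?C * (X * of_real ((sqrt (2 * pi) * e) ^ ?m * Y))) = packet a r (z - fst h) * (X * of_real Y)" for X Y
 proof -
  have "of_real ((2 * pi) powr (- real ?m / 2)) * (?C * (X * of_real ((sqrt (2 * pi) * e) ^ ?m * Y)))
   = (of_real ((2 * pi) powr (- real ?m / 2)) * (of_real (inverse (e ^ ?m)) * of_real ((sqrt (2 * pi) * e) ^ ?m))) * (packet a r (z - fst h) * (X * of_real Y))"
   by (simp only: of_real_mult mult_ac)
  thus ?thesis unfolding un mult_1 .
 qed
 show ?thesis unfolding fourier_t_def I k q Fw_def theta_def fst_conv snd_conv ee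
  by (simp only: inner_commute)
qed

text \<open>The convolution with the datum is the distribution applied to the Fourier transform of
  \<open>psi\<close>, and \<open>has_fourier_t\<close> turns that into an integral of
  \<open>R\<close>.\<close>

lemma wave_solution:
 fixes \<rho> :: "real => 'n set => 'n set => (('n, 'm) quadric => complex) => complex"
 assumes \<rho>: "heat_fundamental_solution \<phi> v q \<rho>" and s: "s > 0" and K: "K \<in> \<I> q" and L: "L \<in> \<I> q"
  and R: "has_fourier_t (\<rho> s K L) R" and e: "e > 0"
 shows "(\<Sum>L'\<in>\<I> q. \<rho> s K L' (\<lambda>h. quad.single L (Fw e a r) L' (qmul \<phi> (- h) p))) = (LI x. R x * psi e a r (fst p) (snd p) x)"
proof -
 have sch0: "schwartz (\<lambda>x :: ('n, 'm) quadric. 0 :: complex)" by (rule gs_schwartz[OF tame_exp_zero])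
 \<comment> \<open>The other components of the datum are zero; that a tempered distribution
   annihilates 0 follows from its linearity clause with zero coefficients.\<close>
 have z: "\<rho> s K L' (\<lambda>h. 0) = 0" if "L' \<in> \<I> q" for L'
 proof -
  have "tempered (\<rho> s K L')" using \<rho> s K that by (simp add: heat_fundamental_solution_def)
  hence "\<rho> s K L' (\<lambda>x. 0 * 0 + 0 * 0) = 0 * \<rho> s K L' (\<lambda>x. 0) + 0 * \<rho> s K L' (\<lambda>x. 0)"
   using sch0 unfolding tempered_def by blast
  thus ?thesis by simp
 qed
 have "\<rho> s K L' (\<lambda>h. quad.single L (Fw e a r) L' (qmul \<phi> (- h) p)) = (if L' = L then \<rho> s K L (fourier_t (psi e a r (fst p) (snd p))) else 0)"
  if "L' \<in> \<I> q" for L'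
 proof (cases "L' = L")
  case True
  have "fourier_t (psi e a r (fst p) (snd p)) = (\<lambda>h. Fw e a r (qmul \<phi> (- h) p))" by (rule ext) (simp add: psi_fourier[OF e])
  thus ?thesis using True by (simp add: quad.single_def)
 qed (simp add: quad.single_def z[OF that])
 hence "(\<Sum>L'\<in>\<I> q. \<rho> s K L' (\<lambda>h. quad.single L (Fw e a r) L' (qmul \<phi> (- h) p))) = \<rho> s K L (fourier_t (psi e a r (fst p) (snd p)))"
  using L by simp
 also have "\<dots> = (LI x. R x * psi e a r (fst p) (snd p) x)"
  using R gs_schwartz[OF psi_gs[OF e]] unfolding has_fourier_t_def by blast
 finally show ?thesis .
qed

end

section \<open>Identification of the Fourier transform of the heat kernel\<close>

text \<open>Equal to 1 for |x| <= 1/2 and to 0 for |x| >= 1. Continuity is enough, as it only splits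
  an integral and is never differentiated.\<close>

definition plateau :: "'x::real_normed_vector => complex" where
 "plateau x = of_real (max 0 (min 1 (2 - 2 * norm x)))"

lemma plateau_supp: "plateau x \<noteq> 0 ==> norm x \<le> 1"
 by (auto simp: plateau_def max_def min_def split: if_splits)

lemma plateau_bound: "cmod (plateau x) \<le> 1" "cmod (1 - plateau x) \<le> 1"
proof -
 have r: "0 \<le> max 0 (min 1 (2 - 2 * norm x))" "max 0 (min 1 (2 - 2 * norm x)) \<le> 1" by auto
 thus "cmod (plateau x) \<le> 1" by (simp add: plateau_def)
 have "1 - plateau x = of_real (1 - max 0 (min 1 (2 - 2 * norm x)))" by (simp add: plateau_def)
 thus "cmod (1 - plateau x) \<le> 1" using r by (simp only: norm_of_real)
qed

lemma plateau_continuous: "continuous_on UNIV plateau"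
 unfolding plateau_def[abs_def] by (intro continuous_intros)

lemma packet_bound: "cmod (packet a r y) \<le> 1"
proof -
 have "cmod (cutoff r (a - y)) * exp (- (norm y)\<^sup>2) \<le> 1 * 1" by (intro mult_mono cutoff_bound) auto
 thus ?thesis by (simp add: packet_def norm_mult)
qed

lemma packet_supp: "r > 0 ==> packet a r y \<noteq> 0 ==> norm (a - y) \<le> r"
 using cutoff_supp[of r "a - y"] by (auto simp: packet_def)

lemma packet_continuous: "continuous_on UNIV (packet a r)"
 by (rule tame_exp_continuous[OF packet_gs])

context diag_form
begin

lemma L2_inner_single:
 assumes "K0 \<in> \<I> q"
 shows "L2_inner q f (quad.single K0 V) = (LI x. f K0 x * cnj (V x))"
proof -
 have "(LI x. f K x * cnj (quad.single K0 V K x)) = (if K = K0 then LI x. f K0 x * cnj (V x) else 0)" for K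
  by (simp add: quad.single_def)
 thus ?thesis using assms by (simp add: L2_inner_def)
qed

lemma phi_crd_right: "\<phi> w z $ i = (\<Sum>k\<in>UNIV. cnj (crd k z) * (\<phi> w (v k) $ i))"
proof -
 have "\<phi> w z = \<phi> w (\<Sum>k\<in>UNIV. crd k z *s v k)" by (simp only: crd_expansion)
 thus ?thesis by (simp add: phi_sum phi_cmult sum_component)
qed

lemma phase_continuous:
 assumes "continuous_on S f" "continuous_on S g" "continuous_on S h"
 shows "continuous_on S (\<lambda>x. (h x :: 'm rspace) \<bullet> im_form \<phi> (f x) (g x))"
proof -
 have "h x \<bullet> im_form \<phi> (f x) (g x) = (\<Sum>i\<in>UNIV. h x $ i * Im (\<Sum>k\<in>UNIV. cnj (crd k (g x)) * (\<phi> (f x) (v k) $ i)))" for x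
  unfolding phi_crd_right[symmetric] by (simp add: inner_vec_def im_form_def)
 moreover have "continuous_on S (\<lambda>x. \<Sum>i\<in>UNIV. h x $ i * Im (\<Sum>k\<in>UNIV. cnj (crd k (g x)) * (\<phi> (f x) (v k) $ i)))"
  by (intro continuous_intros assms
    continuous_on_compose2[OF linear_continuous_on[OF crd_linear, of UNIV] assms(2)]
    continuous_on_compose2[OF linear_continuous_on[OF phi_left_linear, of UNIV] assms(1)]) auto
 ultimately show ?thesis by (simp only:)
qed

lemma gauss_pair_gs:
 assumes c: "c > 0" shows "gs (\<lambda>p :: ('n, 'm) quadric. of_real (exp (- (norm (fst p))\<^sup>2) * gauss c (snd p - \<xi>)))"
proof -
 define Q where "Q p = - complex_of_real ((norm (0 - fst p))^2) + - of_real c * of_real ((norm (\<xi> - snd p))^2)" for p :: "('n, 'm) quadric"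
 have Q: "tame Q" unfolding Q_def[abs_def]
  by (intro tame.add tame_minus tame_cmult tame_norm_sq_affine bounded_linear_fst bounded_linear_snd)
 have "Re (Q p) \<le> c * (norm \<xi>)^2 - min 1 (c / 2) * (norm p)^2" for p
 proof -
  have "c * - (norm (\<xi> - snd p))\<^sup>2 \<le> c * ((norm \<xi>)^2 - (norm (snd p))\<^sup>2 / 2)" using c by (intro mult_left_mono norm_sq_shift) simp
  moreover have "c * ((norm \<xi>)^2 - (norm (snd p))\<^sup>2 / 2) = c * (norm \<xi>)^2 - c / 2 * (norm (snd p))^2"
   by (simp add: right_diff_distrib)
  moreover have "min 1 (c / 2) * (norm p)^2 \<le> 1 * (norm (fst p))^2 + c / 2 * (norm (snd p))^2"
   unfolding norm_pair_sq distrib_left by (intro add_mono mult_right_mono) auto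
  moreover have "Re (Q p) = - (norm (fst p))\<^sup>2 + c * - (norm (\<xi> - snd p))\<^sup>2" by (simp add: Q_def)
  ultimately show ?thesis by linarith
 qed
 hence "gs (\<lambda>p. 1 * exp (Q p))" using c
  by (intro tame_exp.base[OF tame.const Q] exI[of _ "c * (norm \<xi>)^2"] exI[of _ "min 1 (c / 2)"]) auto
 moreover have "1 * exp (Q p) = of_real (exp (- (norm (fst p))\<^sup>2) * gauss c (snd p - \<xi>))" for p
  unfolding Q_def exp_add of_real_mult exp_of_real[symmetric] norm_minus_commute[of "snd p"] by simp
 ultimately show ?thesis by (simp only:)
qed

section \<open>The wave paired with a packet, localized in z\<close>

definition Gc :: "(('n, 'm) quadric => complex) => 'n cspace => real => 'n cspace => ('n, 'm) quadric => complex" where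
 "Gc R a r w p = plateau (fst p) * R (w, snd p) * packet a r (fst p - w) * exp (- 2 * \<i> * of_real (snd p \<bullet> im_form \<phi> w (fst p)))"

text \<open>The wave at position z and frequency snd p, cut off by the plateau: a twisted
  convolution of \<open>R\<close> with the packet in the variable z.\<close>

definition Gx :: "(('n, 'm) quadric => complex) => 'n cspace => real => ('n, 'm) quadric => complex" where
 "Gx R a r p = (LI w. Gc R a r w p)"

text \<open>An L^1 norm of \<open>R\<close> over a ball at fixed frequency. It dominates
  \<open>Gx\<close> uniformly in z, and only its integrability against Gaussians in the frequency is
  under control.\<close>

definition Nx :: "(('n, 'm) quadric => complex) => real => 'm rspace => real" where
 "Nx R b l = (LI w. indicator (cball 0 b) w * cmod (R (w, l)))"

text \<open>The density over frequencies of the localized pairing; its value at \<xi> is what the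
  limit e to 0 picks out.\<close>

definition Phi :: "(('n, 'm) quadric => complex) => 'n cspace => real => 'n set => real => 'm rspace => complex" where
 "Phi R a r K s l = (LI z. Gx R a r (z, l) * of_real (mehler K s z))"

lemma mehler_integrable: assumes s: "s > 0" shows "integrable lborel (\<lambda>z. mehler K s z)"
proof (rule B_integrable_bound)
 show "integrable lborel (\<lambda>z :: 'n cspace. exp (s * mu_sum) * (1 / (pi * s)) ^ CARD('n) * gauss (1 / s) z)"
  using s by (intro integrable_mult_right gauss_integrable) simp
 show "AE z in lborel. norm (mehler K s z) \<le> norm (exp (s * mu_sum) * (1 / (pi * s)) ^ CARD('n) * gauss (1 / s) z)"
  by (rule AE_I2, unfold real_norm_def, rule order_trans[OF mehler_unif[OF s order_refl order_refl] abs_ge_self])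
qed simp

context
 fixes R :: "('n, 'm) quadric => complex" and a :: "'n cspace" and r :: real
 assumes Rc: "continuous_on UNIV R" and Ri: "\<And>\<psi>. gs \<psi> ==> integrable lborel (\<lambda>p. R p * \<psi> p)" and r: "r > 0"
begin

text \<open>Where \<open>Gc\<close> is nonzero, |z| <= 1 by the plateau and |a - (z - w)| <= r by
  the packet; hence |w| is at most this radius.\<close>

abbreviation (input) "rad \<equiv> 1 + norm a + r"

lemma Gc_continuous: "continuous_on UNIV (\<lambda>x. Gc R a r (fst x) (snd x))"
 unfolding Gc_def
 by (intro continuous_on_mult continuous_on_exp continuous_on_of_real phase_continuous continuous_on_const
   continuous_on_compose2[OF Rc] continuous_on_compose2[OF packet_continuous] continuous_on_compose2[OF plateau_continuous]
   continuous_intros) auto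

lemma Gc_supp: assumes "norm w > rad" shows "Gc R a r w p = 0"
proof (rule ccontr)
 assume "Gc R a r w p \<noteq> 0"
 hence c: "plateau (fst p) \<noteq> 0" and g: "packet a r (fst p - w) \<noteq> 0" by (auto simp: Gc_def)
 have "norm (fst p) \<le> 1" by (rule plateau_supp[OF c])
 moreover have "norm (a - (fst p - w)) \<le> r" by (rule packet_supp[OF r g])
 moreover have "norm w \<le> norm (a - (fst p - w)) + norm (fst p - a)" using norm_triangle_ineq[of "a - (fst p - w)" "fst p - a"] by simp
 moreover have "norm (fst p - a) \<le> norm (fst p) + norm a" by (rule norm_triangle_ineq4)
 ultimately show False using assms by linarith
qed

lemma Gx_continuous: "continuous_on UNIV (Gx R a r)"
 unfolding Gx_def[abs_def] by (rule continuous_integral_compact(2)[OF Gc_continuous Gc_supp])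

lemma Gx_supp: assumes "norm z > 1" shows "Gx R a r (z, l) = 0"
proof -
 have "plateau z = 0" using plateau_supp[of z] assms by auto
 thus ?thesis by (simp add: Gx_def Gc_def)
qed

lemma Nx_integrable: "integrable lborel (\<lambda>w. indicator (cball 0 b) w * cmod (R (w, l)))"
proof -
 have "integrable lborel (\<lambda>w. indicator (cball 0 b) w *\<^sub>R cmod (R (w, l)))"
  by (intro borel_integrable_compact continuous_intros continuous_on_compose2[OF Rc]) auto
 thus ?thesis by simp
qed

lemma Nx_nonneg: "Nx R b l \<ge> 0"
 unfolding Nx_def by (intro integral_nonneg_AE AE_I2) simp

lemma Gx_le: "cmod (Gx R a r (z, l)) \<le> Nx R rad l"
proof -
 have "cmod (Gc R a r w (z, l)) \<le> indicator (cball 0 rad) w * cmod (R (w, l))" for w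
 proof (cases "w \<in> cball 0 rad")
  case True
  have "cmod (Gc R a r w (z, l)) = cmod (plateau z) * cmod (packet a r (z - w)) * cmod (R (w, l))"
   by (simp add: Gc_def norm_mult)
  also have "\<dots> \<le> 1 * 1 * cmod (R (w, l))" by (intro mult_mono plateau_bound packet_bound) auto
  finally show ?thesis using True by simp
 next
  case False thus ?thesis using Gc_supp[of w "(z, l)"] by simp
 qed
 hence "(LI w. cmod (Gc R a r w (z, l))) \<le> Nx R rad l"
  unfolding Nx_def by (intro integral_mono' Nx_integrable) auto
 thus ?thesis unfolding Gx_def by (rule order_trans[OF integral_norm_bound])
qed

text \<open>The indicator of the ball is at most exp(b^2 - |w|^2), so integrability of
  \<open>R\<close> against a Gaussian in both variables yields the claim by Fubini.\<close>

lemma Nx_gauss_integrable: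
 assumes c: "c > 0" shows "integrable lborel (\<lambda>l. Nx R b l * gauss c (l - \<xi>))"
proof -
 let ?g = "\<lambda>p :: ('n, 'm) quadric. of_real (exp (- (norm (fst p))\<^sup>2) * gauss c (snd p - \<xi>))"
 let ?f = "\<lambda>w l. (indicator (cball 0 b) w * cmod (R (w, l))) * gauss c (l - \<xi>)"
 have m: "R \<in> borel_funs" by (rule borel_measurable_continuous_onI[OF Rc])
 have "integrable lborel (\<lambda>p. ?f (fst p) (snd p))"
 proof (rule B_integrable_bound)
  show "integrable lborel (\<lambda>p. exp (b^2) * cmod (R p * ?g p))"
   by (intro integrable_mult_right integrable_norm Ri gauss_pair_gs c)
  have "(\<lambda>p :: ('n, 'm) quadric. indicator (cball 0 b) (fst p) :: real) = indicator (cball 0 b \<times> UNIV)"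
   by (auto simp: indicator_def fun_eq_iff)
  moreover have "(indicator (cball 0 b \<times> UNIV) :: ('n, 'm) quadric => real) \<in> borel_funs"
   by (intro borel_measurable_indicator borel_closed closed_Times) auto
  ultimately have i: "(\<lambda>p :: ('n, 'm) quadric. indicator (cball 0 b) (fst p) :: real) \<in> borel_funs" by (simp only:)
  have e: "(\<lambda>p :: ('n, 'm) quadric. gauss c (snd p - \<xi>)) \<in> borel_funs"
   by (intro borel_measurable_continuous_onI continuous_intros)
  have "(\<lambda>p. cmod (R (fst p, snd p))) \<in> borel_funs" using m by simp
  from borel_measurable_times[OF borel_measurable_times[OF i this] e]
  show "(\<lambda>p :: ('n, 'm) quadric. ?f (fst p) (snd p)) \<in> borel_measurable lborel" by simp
  show "AE p in lborel. norm (?f (fst p) (snd p)) \<le> norm (exp (b^2) * cmod (R p * ?g p))"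
  proof (rule AE_I2)
   fix p :: "('n, 'm) quadric"
   have "indicator (cball 0 b) (fst p) \<le> exp (b^2) * exp (- (norm (fst p))\<^sup>2)"
   proof (cases "fst p \<in> cball 0 b")
    case True
    hence "(norm (fst p))^2 \<le> b^2" by (intro power_mono) auto
    thus ?thesis using True by (simp flip: exp_add)
   qed simp
   hence "indicator (cball 0 b) (fst p) * (cmod (R p) * gauss c (snd p - \<xi>))
     \<le> (exp (b^2) * exp (- (norm (fst p))\<^sup>2)) * (cmod (R p) * gauss c (snd p - \<xi>))"
    by (rule mult_right_mono) simp
   thus "norm (?f (fst p) (snd p)) \<le> norm (exp (b^2) * cmod (R p * ?g p))"
    by (simp add: norm_mult abs_mult mult_ac del: of_real_mult)
  qed
 qed
 hence "integrable (lborel \<Otimes>\<^sub>M lborel) (\<lambda>(w, l). ?f w l)" by (simp add: lborel_prod case_prod_beta')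
 hence "integrable lborel (\<lambda>l. LI w. ?f w l)" by (rule lborel_pair.integrable_snd)
 thus ?thesis by (simp add: Nx_def)
qed

lemma Phi_continuous: assumes s: "s > 0" shows "continuous_on UNIV (Phi R a r K s)"
 unfolding Phi_def[abs_def]
proof (rule continuous_integral_compact(2)[where r=1])
 show "continuous_on UNIV (\<lambda>p. Gx R a r (fst p, snd p) * of_real (mehler K s (fst p)))"
  by (intro continuous_on_mult continuous_on_of_real continuous_on_compose2[OF mehler_continuous] continuous_on_compose2[OF Gx_continuous] continuous_intros) auto
qed (simp add: Gx_supp)

lemma Phi_le: assumes s: "s > 0" shows "cmod (Phi R a r K s l) \<le> Nx R rad l * (LI z. mehler K s z)"
proof -
 have "(LI z. cmod (Gx R a r (z, l) * of_real (mehler K s z))) \<le> (LI z. Nx R rad l * mehler K s z)"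
 proof (rule integral_mono')
  show "integrable lborel (\<lambda>z. Nx R rad l * mehler K s z)" by (intro integrable_mult_right mehler_integrable s)
  fix z
  show "cmod (Gx R a r (z, l) * of_real (mehler K s z)) \<le> Nx R rad l * mehler K s z"
   unfolding norm_mult norm_of_real using mehler_pos[OF s, of K z] by (simp add: mult_right_mono Gx_le)
  show "0 \<le> Nx R rad l * mehler K s z" using mehler_pos[OF s, of K z] Nx_nonneg by simp
 qed
 thus ?thesis unfolding Phi_def by (intro order_trans[OF integral_norm_bound]) simp
qed

lemma Phi_concentration:
 assumes s: "s > 0"
 shows "((\<lambda>e. of_real (inverse (e ^ CARD('m))) * (LI l. Phi R a r K s l * of_real (gauss (1 / e^2) (l - \<xi>))))
  \<longlongrightarrow> of_real (sqrt pi ^ CARD('m)) * Phi R a r K s \<xi>) (at_right 0)"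
proof -
 have m: "Phi R a r K s \<in> borel_funs" by (rule borel_measurable_continuous_onI[OF Phi_continuous[OF s]])
 have c: "isCont (Phi R a r K s) \<xi>" using Phi_continuous[OF s] by (simp add: continuous_on_eq_continuous_at)
 have "integrable lborel (\<lambda>l. Phi R a r K s l * of_real (gauss (1 / 2) (l - \<xi>)))"
 proof (rule B_integrable_bound)
  show "integrable lborel (\<lambda>l. (LI z. mehler K s z) * (Nx R rad l * gauss (1 / 2) (l - \<xi>)))"
   by (intro integrable_mult_right Nx_gauss_integrable) simp
  show "(\<lambda>l. Phi R a r K s l * of_real (gauss (1 / 2) (l - \<xi>))) \<in> borel_measurable lborel"
   using m by simp
  show "AE l in lborel. norm (Phi R a r K s l * of_real (gauss (1 / 2) (l - \<xi>)))
    \<le> norm ((LI z. mehler K s z) * (Nx R rad l * gauss (1 / 2) (l - \<xi>)))"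
  proof (rule AE_I2)
   fix l
   have "cmod (Phi R a r K s l) * gauss (1 / 2) (l - \<xi>) \<le> (Nx R rad l * (LI z. mehler K s z)) * gauss (1 / 2) (l - \<xi>)"
    by (intro mult_right_mono Phi_le s) simp
   also have "\<dots> \<le> norm ((LI z. mehler K s z) * (Nx R rad l * gauss (1 / 2) (l - \<xi>)))"
    unfolding real_norm_def by (rule order_trans[OF _ abs_ge_self]) (simp only: mult_ac order_refl)
   finally show "norm (Phi R a r K s l * of_real (gauss (1 / 2) (l - \<xi>)))
    \<le> norm ((LI z. mehler K s z) * (Nx R rad l * gauss (1 / 2) (l - \<xi>)))"
    by (simp only: norm_mult[of "Phi R a r K s l"] norm_of_real abs_exp_cancel)
  qed
 qed
 from gauss_concentration[OF m c this] show ?thesis by simp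
qed

lemma theta_transform:
 assumes e: "e > 0"
 shows "integrable lborel (\<lambda>t. exp (\<i> * of_real (l \<bullet> t)) * cnj (theta e t))"
  "(LI t. exp (\<i> * of_real (l \<bullet> t)) * cnj (theta e t)) = of_real (sqrt (2 * pi) ^ CARD('m) * inverse (e ^ CARD('m)) * gauss (1 / (2 * e^2)) (l - \<xi>))"
proof -
 have c: "e^2 / 2 > 0" using e by simp
 have eq: "exp (\<i> * of_real ((l - \<xi>) \<bullet> t)) * of_real (gauss (e^2 / 2) (t - 0)) = exp (\<i> * of_real (l \<bullet> t)) * cnj (theta e t)" for t
 proof -
  have "\<i> * of_real ((l - \<xi>) \<bullet> t) = \<i> * of_real (l \<bullet> t) + - \<i> * of_real (\<xi> \<bullet> t)" by (simp add: inner_diff_left algebra_simps)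
  hence "exp (\<i> * of_real ((l - \<xi>) \<bullet> t)) = exp (\<i> * of_real (l \<bullet> t)) * exp (- \<i> * of_real (\<xi> \<bullet> t))" by (simp only: exp_add)
  thus ?thesis by (simp add: theta_def exp_cnj del: of_real_mult)
 qed
 have sq: "sqrt (pi / (e^2 / 2)) = sqrt (2 * pi) * inverse e"
 proof -
  have "pi / (e^2 / 2) = (2 * pi) * (inverse e)^2" using e by (simp add: field_simps)
  thus ?thesis using e by (simp only: real_sqrt_mult real_sqrt_abs abs_inverse abs_of_pos)
 qed
 have ex: "- (norm (l - \<xi>))\<^sup>2 / (4 * (e^2 / 2)) = - (1 / (2 * e^2) * (norm (l - \<xi>))^2)" by simp
 have "has_bochner_integral lborel (\<lambda>t. exp (\<i> * of_real (l \<bullet> t)) * cnj (theta e t)) (of_real (sqrt (2 * pi) ^ CARD('m) * inverse (e ^ CARD('m)) * gauss (1 / (2 * e^2)) (l - \<xi>)))"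
  using gauss_fourier_shift[OF c, of "l - \<xi>" "0 :: 'm rspace"] unfolding eq sq ex by (simp add: power_mult_distrib power_inverse)
 thus "integrable lborel (\<lambda>t. exp (\<i> * of_real (l \<bullet> t)) * cnj (theta e t))"
  "(LI t. exp (\<i> * of_real (l \<bullet> t)) * cnj (theta e t)) = of_real (sqrt (2 * pi) ^ CARD('m) * inverse (e ^ CARD('m)) * gauss (1 / (2 * e^2)) (l - \<xi>))"
  by (simp_all only: has_bochner_integral_iff)
qed

text \<open>Multiplication by the plateau makes it possible to integrate over w first, at fixed
  frequency.\<close>

lemma wave_slice:
 assumes e: "e > 0"
 shows "(LI x. R x * psi e a r z t x) * plateau z
  = (LI l. Gx R a r (z, l) * (exp (\<i> * of_real (l \<bullet> t)) * of_real (inverse (e ^ CARD('m)) * gauss (1 / (2 * e^2)) (l - \<xi>))))"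
proof -
 let ?f = "\<lambda>w l. R (w, l) * psi e a r z t (w, l) * plateau z" and ?E = "\<lambda>l. exp (\<i> * of_real (l \<bullet> t)) * of_real (inverse (e ^ CARD('m)) * gauss (1 / (2 * e^2)) (l - \<xi>))"
 have i: "integrable lborel (\<lambda>x. R x * psi e a r z t x)" by (rule Ri[OF psi_gs[OF e]])
 have i2: "integrable (lborel \<Otimes>\<^sub>M lborel) (\<lambda>(w, l). ?f w l)"
  using integrable_mult_left[OF i, of "plateau z"] by (simp add: lborel_prod case_prod_beta')
 have eq: "?f w l = Gc R a r w (z, l) * ?E l" for w l
 proof -
  have "\<i> * of_real (l \<bullet> (t - 2 *\<^sub>R im_form \<phi> w z)) = \<i> * of_real (l \<bullet> t) + - 2 * \<i> * of_real (l \<bullet> im_form \<phi> w z)"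
   by (simp add: inner_diff_right algebra_simps)
  hence "exp (\<i> * of_real (l \<bullet> (t - 2 *\<^sub>R im_form \<phi> w z))) = exp (\<i> * of_real (l \<bullet> t)) * exp (- 2 * \<i> * of_real (l \<bullet> im_form \<phi> w z))"
   by (simp only: exp_add)
  thus ?thesis unfolding psi_def Gc_def fst_conv snd_conv by (simp only: mult_ac)
 qed
 have "(LI x. R x * psi e a r z t x) * plateau z = (LI x. R x * psi e a r z t x * plateau z)" by simp
 also have "\<dots> = (LINT x|(lborel \<Otimes>\<^sub>M lborel). (\<lambda>(w, l). ?f w l) x)" by (simp add: lborel_prod case_prod_beta')
 also have "\<dots> = (LI l. LI w. ?f w l)" by (rule lborel_pair.integral_snd[OF i2, symmetric])
 also have "\<dots> = (LI l. Gx R a r (z, l) * ?E l)" unfolding eq Gx_def integral_mult_left_zero ..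
 finally show ?thesis .
qed

text \<open>The wave carries a Gaussian of width e about \<xi>, and integrating the envelope over t
  gives another, each with a factor e^-m; their product has the exponent 1/e^2.\<close>

lemma wave_inner:
 assumes e: "e > 0" and s: "s > 0"
 shows "(LI p. (LI x. R x * psi e a r (fst p) (snd p) x) * cnj (plateau (fst p) * Vq e K s p))
  = of_real (sqrt (2 * pi) ^ CARD('m) * (inverse (e ^ CARD('m)))^2) * (LI l. Phi R a r K s l * of_real (gauss (1 / e^2) (l - \<xi>)))"
proof -
 let ?c = "1 / (2 * e^2)" and ?i = "inverse (e ^ CARD('m))"
 let ?E = "\<lambda>l. gauss ?c (l - \<xi>)"
 have c: "?c > 0" using e by simp
 define H where "H p l = Gx R a r (fst p, l) * (exp (\<i> * of_real (l \<bullet> snd p)) * of_real (?i * ?E l)) * (of_real (mehler K s (fst p)) * cnj (theta e (snd p)))" for p :: "('n, 'm) quadric" and l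
 have cc: "cnj (plateau z) = plateau z" for z :: "'n cspace" by (simp add: plateau_def)
 have th: "continuous_on UNIV (theta e)" unfolding theta_def[abs_def] by (intro continuous_intros)
 have 1: "(LI x. R x * psi e a r (fst p) (snd p) x) * cnj (plateau (fst p) * Vq e K s p) = (LI l. H p l)" for p
 proof -
  have "(LI x. R x * psi e a r (fst p) (snd p) x) * cnj (plateau (fst p) * Vq e K s p)
   = ((LI x. R x * psi e a r (fst p) (snd p) x) * plateau (fst p)) * (of_real (mehler K s (fst p)) * cnj (theta e (snd p)))"
   by (simp add: Vq_def cc)
  thus ?thesis unfolding wave_slice[OF e] H_def integral_mult_left_zero .
 qed
 have Hi: "integrable (lborel \<Otimes>\<^sub>M lborel) (\<lambda>(p, l). H p l)"
 proof -
  have ti: "integrable lborel (\<lambda>t. cmod (theta e t))"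
   unfolding theta_norm using e by (intro gauss_integrable) simp
  have A: "integrable lborel (\<lambda>p. mehler K s (fst p) * cmod (theta e (snd p)))"
   by (rule lborel_pair_product(1)[OF mehler_integrable[OF s] ti])
  have "integrable lborel (\<lambda>x. H (fst x) (snd x))"
  proof (rule B_integrable_bound)
   show "integrable lborel (\<lambda>x. (mehler K s (fst (fst x)) * cmod (theta e (snd (fst x)))) * (?i * (Nx R rad (snd x) * ?E (snd x))))"
    by (rule lborel_pair_product(1)[OF A]) (intro integrable_mult_right Nx_gauss_integrable c)
   have "continuous_on UNIV (\<lambda>x. H (fst x) (snd x))"
    unfolding H_def
    by (intro continuous_on_mult continuous_on_of_real continuous_on_exp continuous_on_cnj continuous_on_const
      continuous_on_compose2[OF mehler_continuous] continuous_on_compose2[OF Gx_continuous] continuous_on_compose2[OF th]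
      continuous_intros) auto
   thus "(\<lambda>x. H (fst x) (snd x)) \<in> borel_measurable lborel" by (simp add: borel_measurable_continuous_onI)
   show "AE x in lborel. norm (H (fst x) (snd x)) \<le> norm ((mehler K s (fst (fst x)) * cmod (theta e (snd (fst x)))) * (?i * (Nx R rad (snd x) * ?E (snd x))))"
   proof (rule AE_I2)
    fix x :: "('n, 'm) quadric \<times> 'm rspace"
    have mp: "\<bar>mehler K s (fst (fst x))\<bar> = mehler K s (fst (fst x))" using mehler_pos[OF s, of K "fst (fst x)"] by simp
    have ip: "\<bar>?i * ?E (snd x)\<bar> = ?i * ?E (snd x)" using e by simp
    have "norm (H (fst x) (snd x)) = cmod (Gx R a r (fst (fst x), snd x)) * (?i * ?E (snd x)) * (mehler K s (fst (fst x)) * cmod (theta e (snd (fst x))))"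
     unfolding H_def norm_mult norm_of_real complex_mod_cnj mp ip norm_exp_i_times by simp
    also have "\<dots> \<le> Nx R rad (snd x) * (?i * ?E (snd x)) * (mehler K s (fst (fst x)) * cmod (theta e (snd (fst x))))"
     using e mehler_pos[OF s, of K "fst (fst x)"] by (intro mult_right_mono Gx_le) auto
    also have "\<dots> \<le> norm ((mehler K s (fst (fst x)) * cmod (theta e (snd (fst x)))) * (?i * (Nx R rad (snd x) * ?E (snd x))))"
     unfolding real_norm_def by (rule order_trans[OF _ abs_ge_self]) (simp only: mult_ac order_refl)
    finally show "norm (H (fst x) (snd x)) \<le> norm ((mehler K s (fst (fst x)) * cmod (theta e (snd (fst x)))) * (?i * (Nx R rad (snd x) * ?E (snd x))))" .
   qed
  qed
  thus ?thesis by (simp add: lborel_prod case_prod_beta')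
 qed
 have 2: "(LI p. H p l) = of_real (sqrt (2 * pi) ^ CARD('m) * ?i^2) * (Phi R a r K s l * of_real (gauss (1 / e^2) (l - \<xi>)))" for l
 proof -
  have gz: "integrable lborel (\<lambda>z. Gx R a r (z, l) * of_real (mehler K s z))"
  proof (rule continuous_integral_compact(1)[where r=1 and F="\<lambda>z l. Gx R a r (z, l) * of_real (mehler K s z)"])
   show "continuous_on UNIV (\<lambda>p. Gx R a r (fst p, snd p) * of_real (mehler K s (fst p)))"
    by (intro continuous_on_mult continuous_on_of_real continuous_on_compose2[OF mehler_continuous] continuous_on_compose2[OF Gx_continuous] continuous_intros) auto
  qed (simp add: Gx_supp)
  have "(LI p. H p l) = (LI p. ((Gx R a r (fst p, l) * of_real (mehler K s (fst p))) * (exp (\<i> * of_real (l \<bullet> snd p)) * cnj (theta e (snd p)))) * of_real (?i * ?E l))"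
   unfolding H_def by (intro B_integral_cong refl) (simp only: mult_ac)
  also have "\<dots> = (Phi R a r K s l * of_real (sqrt (2 * pi) ^ CARD('m) * ?i * ?E l)) * of_real (?i * ?E l)"
   unfolding integral_mult_left_zero lborel_pair_product(2)[OF gz theta_transform(1)[OF e]] theta_transform(2)[OF e] Phi_def ..
  also have "\<dots> = of_real (sqrt (2 * pi) ^ CARD('m) * ?i^2) * (Phi R a r K s l * of_real (?E l * ?E l))"
   by (simp only: of_real_mult power2_eq_square mult_ac)
  also have "?E l * ?E l = gauss (1 / e^2) (l - \<xi>)" unfolding exp_add[symmetric] exp_inj_iff by simp
  finally show ?thesis .
 qed
 have "(LI p. (LI x. R x * psi e a r (fst p) (snd p) x) * cnj (plateau (fst p) * Vq e K s p)) = (LI p. LI l. H p l)"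
  unfolding 1 ..
 also have "\<dots> = (LI l. LI p. H p l)" by (rule lborel_pair.Fubini_integral[OF Hi, symmetric])
 finally show ?thesis unfolding 2 integral_mult_right_zero .
qed

end

end

section \<open>The limits e to 0 and s to 0\<close>

context diag_form
begin

lemma Vq_plateau_L2:
 assumes s: "s > 0" and e: "e > 0"
 shows "L2_fun (\<lambda>p. plateau (fst p) * Vq e K s p)" "L2_fun (\<lambda>p. (1 - plateau (fst p)) * Vq e K s p)"
proof -
 have V: "L2_fun (Vq e K s)" by (rule gs_L2[OF Vq_gs[OF s e]])
 have m: "(\<lambda>p :: ('n, 'm) quadric. plateau (fst p)) \<in> borel_funs"
  by (intro borel_measurable_continuous_onI continuous_on_compose2[OF plateau_continuous] continuous_intros) auto
 have L: "L2_fun (\<lambda>p. k p * Vq e K s p)" if k: "k \<in> borel_funs" "\<And>p. cmod (k p) \<le> 1" for k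
 proof (rule L2_fun_bound[OF L2_fun_integrable[OF V]])
  show "(\<lambda>p. k p * Vq e K s p) \<in> borel_funs" using k(1) L2_fun_measurable[OF V] by simp
  show "(cmod (k p * Vq e K s p))^2 \<le> (cmod (Vq e K s p))^2" for p
   unfolding norm_mult using k(2)[of p] by (intro power_mono mult_left_le_one_le) auto
 qed
 show "L2_fun (\<lambda>p. plateau (fst p) * Vq e K s p)" "L2_fun (\<lambda>p. (1 - plateau (fst p)) * Vq e K s p)"
  by (intro L m plateau_bound borel_measurable_diff borel_measurable_const)+
qed

text \<open>The squared norm in z of the part of the packet that the plateau cuts off.\<close>

definition tail :: "'n set => real => real" where
 "tail K s = (LI z. (cmod ((1 - plateau z) * of_real (mehler K s z)))^2)"

lemma tail_integrable:
 assumes s: "s > 0" shows "integrable lborel (\<lambda>z. (cmod ((1 - plateau z) * complex_of_real (mehler K s z)))^2)"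
proof -
 define M where "M = exp (s * mu_sum) * (1 / (pi * s)) ^ CARD('n)"
 have b: "(cmod ((1 - plateau z) * complex_of_real (mehler K s z)))^2 \<le> M^2 * gauss (2 / s) z" for z
 proof -
  have "cmod ((1 - plateau z) * complex_of_real (mehler K s z)) \<le> 1 * (M * gauss (1 / s) z)"
   unfolding norm_mult norm_of_real M_def by (intro mult_mono plateau_bound mehler_unif s) auto
  from power_mono[OF this norm_ge_zero, of 2] show ?thesis by (simp add: power_mult_distrib exp_of_nat_mult[of 2, symmetric])
 qed
 have m: "(\<lambda>z. (cmod ((1 - plateau z) * complex_of_real (mehler K s z)))^2) \<in> borel_funs"
  by (intro borel_measurable_continuous_onI continuous_intros mehler_continuous plateau_continuous)
 have g: "integrable lborel (\<lambda>z :: 'n cspace. M^2 * gauss (2 / s) z)"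
  using s by (intro integrable_mult_right gauss_integrable) simp
 show ?thesis
  by (rule B_integrable_bound[OF g]) (use m b in \<open>auto intro!: AE_I2 order_trans[OF b]\<close>)
qed

text \<open>Where 1 - plateau is nonzero, |z| > 1/2 and \<open>mehler\<close> is at most
  \<open>C\<close> for all s <= 1. Its square is then at most \<open>C\<close> times itself, and the
  integral of \<open>mehler\<close> against 1 - plateau tends to the value of 1 - plateau at 0,
  which is 0.\<close>

lemma tail_lim: "(tail K \<longlongrightarrow> 0) (at_right 0)"
proof -
 have quarter: "(0::real) < 1 / 4" by simp
 obtain B where B: "B \<ge> 0" "\<And>x::real. x \<ge> 0 ==> (1 + x) ^ (2 * CARD('n)) * exp (- (1 / 4 * x^2)) \<le> B"
  using poly_gauss_bound[of "1 / 4" "2 * CARD('n)", OF quarter] by blast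
 define C where "C = exp mu_sum * B"
 have C0: "C \<ge> 0" using B(1) by (simp add: C_def)
 let ?k = "\<lambda>z :: 'n cspace. 1 - plateau z"
 have far: "mehler K s z \<le> C" if s: "0 < s" "s \<le> 1" and z: "norm z \<ge> 1 / 2" for s and z :: "'n cspace"
 proof -
  \<comment> \<open>With x = s^(-1/2) the prefactor s^-n is x^(2 n), and the Gaussian at |z| >= 1/2
    is at most exp(-x^2 / 4).\<close>
  let ?x = "sqrt (1 / s)"
  have x2: "?x^2 = 1 / s" using s by simp
  have "(1 / (pi * s)) ^ CARD('n) \<le> (1 / s) ^ CARD('n)"
  proof (intro power_mono)
   have "1 * s \<le> pi * s" using s pi_gt3 by (intro mult_right_mono) auto
   thus "1 / (pi * s) \<le> 1 / s" using s by (intro divide_left_mono) auto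
  qed (use s in auto)
  also have "(1 / s) ^ CARD('n) = ?x ^ (2 * CARD('n))" unfolding power_mult x2 ..
  also have "\<dots> \<le> (1 + ?x) ^ (2 * CARD('n))" using s by (intro power_mono) auto
  finally have 1: "(1 / (pi * s)) ^ CARD('n) \<le> (1 + ?x) ^ (2 * CARD('n))" .
  have "(1 / 2)^2 / s \<le> (norm z)^2 / s" using z s by (intro divide_right_mono power_mono) auto
  hence 2: "exp (- ((norm z)^2 / s)) \<le> exp (- (1 / 4 * ?x^2))" unfolding x2 by (simp add: power2_eq_square)
  have 3: "exp (s * mu_sum) \<le> exp mu_sum" using s mu_sum_nonneg by (simp add: mult_left_le_one_le)
  have "mehler K s z \<le> exp (s * mu_sum) * (1 / (pi * s)) ^ CARD('n) * exp (- ((norm z)^2 / s))" by (rule mehler_le[OF s(1)])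
  also have "\<dots> \<le> exp mu_sum * (1 + ?x) ^ (2 * CARD('n)) * exp (- (1 / 4 * ?x^2))"
   using s by (intro mult_mono 1 2 3) auto
  also have "\<dots> \<le> C" unfolding C_def mult.assoc using B(2)[of ?x] s by (intro mult_left_mono) auto
  finally show ?thesis .
 qed
 have b: "tail K s \<le> C * cmod (LI z. of_real (mehler K s z) * ?k z)" if s: "0 < s" "s \<le> 1" for s
 proof -
  have k: "?k z = of_real (cmod (?k z))" for z
  proof -
   have "?k z = of_real (1 - max 0 (min 1 (2 - 2 * norm z)))" "0 \<le> 1 - max 0 (min 1 (2 - 2 * norm z))" by (auto simp: plateau_def)
   thus ?thesis by (simp only: norm_of_real abs_of_nonneg)
  qed
  have i: "integrable lborel (\<lambda>z. mehler K s z * cmod (?k z))"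
  proof (rule B_integrable_bound[OF mehler_integrable[OF s(1), of K]])
   show "(\<lambda>z. mehler K s z * cmod (?k z)) \<in> borel_measurable lborel"
    by (simp, intro borel_measurable_continuous_onI continuous_intros mehler_continuous plateau_continuous)
   show "AE z in lborel. norm (mehler K s z * cmod (?k z)) \<le> norm (mehler K s z)"
    by (intro AE_I2) (simp add: abs_mult mult_left_le plateau_bound(2))
  qed
  have "tail K s \<le> (LI z. C * (mehler K s z * cmod (?k z)))"
   unfolding tail_def
  proof (rule integral_mono')
   show "integrable lborel (\<lambda>z. C * (mehler K s z * cmod (?k z)))" by (intro integrable_mult_right i)
   fix z :: "'n cspace"
   have mp: "mehler K s z > 0" by (rule mehler_pos[OF s(1)])
   show "0 \<le> C * (mehler K s z * cmod (?k z))" using C0 mp by simp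
   show "(cmod (?k z * complex_of_real (mehler K s z)))^2 \<le> C * (mehler K s z * cmod (?k z))"
   proof (cases "norm z \<ge> 1 / 2")
    case True
    have "cmod (?k z) * mehler K s z \<le> 1 * C" using mp by (intro mult_mono plateau_bound far s True) auto
    hence "(cmod (?k z) * mehler K s z) * (cmod (?k z) * mehler K s z) \<le> C * (cmod (?k z) * mehler K s z)"
     using mp by (intro mult_right_mono) auto
    thus ?thesis using mp by (simp add: norm_mult power2_eq_square mult_ac)
   next
    case False
    hence "?k z = 0" by (simp add: plateau_def)
    thus ?thesis by simp
   qed
  qed
  also have "\<dots> = C * (LI z. mehler K s z * cmod (?k z))" by simp
  also have "(LI z. mehler K s z * cmod (?k z)) \<le> cmod (LI z. complex_of_real (mehler K s z * cmod (?k z)))"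
   unfolding integral_complex_of_real by simp
  also have "(LI z. complex_of_real (mehler K s z * cmod (?k z))) = (LI z. of_real (mehler K s z) * ?k z)"
   by (intro B_integral_cong refl) (simp only: of_real_mult k[symmetric])
  finally show ?thesis using C0 by (simp add: mult_left_mono)
 qed
 have "((\<lambda>s. LI z. of_real (mehler K s z) * ?k z) \<longlongrightarrow> ?k 0) (at_right 0)"
 proof (rule mehler_approximate_identity)
  show "?k \<in> borel_funs" by (intro borel_measurable_continuous_onI continuous_intros plateau_continuous)
  have "continuous_on UNIV ?k" by (intro continuous_intros plateau_continuous)
  thus "isCont ?k 0" by (simp add: continuous_on_eq_continuous_at)
 qed (rule plateau_bound(2))
 hence "((\<lambda>s. C * cmod (LI z. of_real (mehler K s z) * ?k z)) \<longlongrightarrow> C * cmod (?k 0)) (at_right 0)"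
  by (intro tendsto_intros)
 moreover have "?k 0 = 0" by (simp add: plateau_def)
 ultimately have l: "((\<lambda>s. C * cmod (LI z. of_real (mehler K s z) * ?k z)) \<longlongrightarrow> 0) (at_right 0)" by simp
 show ?thesis
 proof (rule tendsto_sandwich[OF _ _ tendsto_const l])
  show "\<forall>\<^sub>F s in at_right 0. 0 \<le> tail K s" unfolding tail_def by (intro always_eventually allI integral_nonneg_AE AE_I2) simp
  show "\<forall>\<^sub>F s in at_right 0. tail K s \<le> C * cmod (LI z. of_real (mehler K s z) * ?k z)"
   unfolding eventually_at_right_field using b by (intro exI[of _ 1]) auto
 qed
qed

lemma mehler_L2:
 assumes s: "s > 0" shows "L2_fun (\<lambda>z. complex_of_real (mehler K s z))"
proof (rule gauss_bounded_L2)
 show "gauss_bounded (\<lambda>z. complex_of_real (mehler K s z))"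
  unfolding gauss_bounded_def norm_of_real using s mehler_unif[OF s order_refl order_refl, of K]
  by (intro exI[of _ "exp (s * mu_sum) * (1 / (pi * s)) ^ CARD('n)"] exI[of _ "1 / s"]) auto
qed simp

lemma packet_L2: "L2_fun (packet a r)"
 by (rule gs_L2[OF packet_gs])

text \<open>The packet is split by the plateau. The inner part of the pairing is computed exactly,
  the outer part is estimated by Cauchy-Schwarz, and after normalization the error of the pairing
  vanishes with e.\<close>

lemma wave_inequality:
 assumes \<rho>: "heat_fundamental_solution \<phi> v q \<rho>" and T: "T > 0" and K: "K \<in> \<I> q" and L: "L \<in> \<I> q"
  and R: "has_fourier_t (\<rho> T K L) R" and r: "r > 0" and s: "s > 0"
 shows "cmod (of_real (sqrt (2 * pi) ^ CARD('m)) * (of_real (sqrt pi ^ CARD('m)) * Phi R a r K s \<xi>)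
   - (if K = L then of_real (sqrt pi ^ CARD('m)) * (LI z. packet a r z * of_real (mehler K (T + s) z)) else 0))
  \<le> sqrt pi ^ CARD('m) * (sqrt (LI z. (cmod (packet a r z))^2) * sqrt (tail K s))"
proof -
 let ?P = "sqrt pi ^ CARD('m)" and ?A = "sqrt (2 * pi) ^ CARD('m)" and ?I = "LI z. packet a r z * of_real (mehler K (T + s) z)"
 let ?J = "\<lambda>e. LI l. Phi R a r K s l * of_real (gauss (1 / e^2) (l - \<xi>))"
 define G where "G = (LI z. (cmod (packet a r z))^2)"
 have G0: "G \<ge> 0" unfolding G_def by (intro integral_nonneg_AE AE_I2) simp
 have t0: "tail K s \<ge> 0" unfolding tail_def by (intro integral_nonneg_AE AE_I2) simp
 have Rc: "continuous_on UNIV R" using R by (simp add: has_fourier_t_def)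
 have Ri: "integrable lborel (\<lambda>p. R p * \<psi> p)" if "gs \<psi>" for \<psi> using R gs_schwartz[OF that] by (simp add: has_fourier_t_def)
 obtain C where C: "C \<ge> 0" "\<forall>e f u. 0 < e \<longrightarrow> e \<le> 1 \<longrightarrow> L2_form q f \<longrightarrow> heat_flow (Box_b \<phi> v q) q f u \<longrightarrow>
  cmod (L2_inner q (u T) (quad.single K (Vq e K s)) - L2_inner q f (quad.single K (Vq e K (T + s))))
   \<le> T * (L2_norm q f * (e * C * sqrt (inverse (e ^ CARD('m)))))"
  using Vq_pairing[OF T s K] by blast
 have main: "cmod (of_real ?A * (of_real (inverse (e ^ CARD('m))) * ?J e) - (if K = L then of_real ?P * ?I else 0))
   \<le> e * (T * (sqrt (G * ?P) * C)) + ?P * (sqrt G * sqrt (tail K s))" if e: "0 < e" "e \<le> 1" for e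
 proof -
  let ?i = "inverse (e ^ CARD('m))"
  have i0: "?i > 0" using e by simp
  define f where "f = quad.single L (Fw e a r)"
  define u where "u t K p = (\<Sum>L'\<in>\<I> q. \<rho> t K L' (\<lambda>h. f L' (qmul \<phi> (- h) p)))" for t K p
  have f2: "L2_form q f" unfolding f_def by (rule single_L2[OF gs_L2[OF Fw_gs[OF e(1)]]])
  have "gs (f L')" for L'
  proof -
   have "f L' = (if L' = L then Fw e a r else (\<lambda>x. 0))" by (auto simp: f_def quad.single_def)
   thus ?thesis by (simp add: tame_exp_zero Fw_gs[OF e(1)])
  qed
  hence u: "heat_flow (Box_b \<phi> v q) q f u"
   using \<rho> gs_schwartz unfolding heat_fundamental_solution_def u_def[abs_def] by blast
  have uT: "u T K p = (LI x. R x * psi e a r (fst p) (snd p) x)" for p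
   unfolding u_def f_def by (rule wave_solution[OF \<rho> T K L R e(1)])
  have u2: "L2_form q (u T)" by (rule heat_flow_L2_form[OF quad.L2_graph u T])
  have Th: "(LI t. (cmod (theta e t))^2) = ?P * ?i" by (rule theta_integral(2)[OF e(1)])
  have fn: "L2_norm q f = sqrt (G * (?P * ?i))"
  proof -
   have "L2_norm q f = sqrt (LI x. (cmod (Fw e a r x))^2)"
    unfolding f_def quad.single_def[abs_def] by (rule L2_norm_single[OF L])
   also have "(LI x. (cmod (Fw e a r x))^2) = (LI x. (cmod (packet a r (fst x)))^2 * (cmod (theta e (snd x)))^2)"
    by (simp only: Fw_def norm_mult power_mult_distrib)
   also have "\<dots> = G * (?P * ?i)"
    unfolding lborel_pair_product(2)[OF L2_fun_integrable[OF packet_L2] theta_integral(1)[OF e(1)]] Th G_def ..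
   finally show ?thesis .
  qed
  define V1 where "V1 = quad.single K (\<lambda>p. plateau (fst p) * Vq e K s p)"
  define V2 where "V2 = quad.single K (\<lambda>p. (1 - plateau (fst p)) * Vq e K s p)"
  have V: "L2_form q V1" "L2_form q V2" unfolding V1_def V2_def by (intro single_L2 Vq_plateau_L2 s e)+
  have V2n: "L2_norm q V2 = sqrt (tail K s * (?P * ?i))"
  proof -
   have "L2_norm q V2 = sqrt (LI x. (cmod ((1 - plateau (fst x)) * Vq e K s x))^2)"
    unfolding V2_def quad.single_def[abs_def] by (rule L2_norm_single[OF K])
   also have "(LI x. (cmod ((1 - plateau (fst x)) * Vq e K s x))^2)
     = (LI x. (cmod ((1 - plateau (fst x)) * of_real (mehler K s (fst x))))^2 * (cmod (theta e (snd x)))^2)"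
    by (simp only: Vq_def norm_mult power_mult_distrib mult.assoc)
   also have "\<dots> = tail K s * (?P * ?i)"
    unfolding lborel_pair_product(2)[OF tail_integrable[OF s] theta_integral(1)[OF e(1)]] Th tail_def ..
   finally show ?thesis .
  qed
  let ?X1 = "L2_inner q (u T) V1" and ?X2 = "L2_inner q (u T) V2" and ?Y = "L2_inner q f (quad.single K (Vq e K (T + s)))"
  have "(\<lambda>K x. V1 K x + V2 K x) = quad.single K (Vq e K s)"
   by (intro ext) (simp add: V1_def V2_def quad.single_def algebra_simps)
  hence X: "L2_inner q (u T) (quad.single K (Vq e K s)) = ?X1 + ?X2"
   using L2_inner_add_right[OF V u2] by simp
  \<comment> \<open>Beyond the plateau nothing is known about the wave pointwise; contraction bounds
    its norm, and the norm of \<open>V2\<close> is small for small s.\<close>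
  have "cmod ?X2 \<le> L2_norm q (u T) * L2_norm q V2" by (rule L2_Cauchy_Schwarz[OF u2 V(2)])
  also have "\<dots> \<le> L2_norm q f * L2_norm q V2"
   by (intro mult_right_mono heat_flow_contractive[OF quad.L2_graph u f2 T]) simp
  also have "\<dots> = (sqrt G * sqrt (tail K s)) * (sqrt (?P * ?i) * sqrt (?P * ?i))" unfolding fn V2n real_sqrt_mult[of G] real_sqrt_mult[of "tail K s"] by (simp only: mult_ac)
  also have "sqrt (?P * ?i) * sqrt (?P * ?i) = ?P * ?i" using i0 by (intro real_sqrt_mult_self[THEN trans]) simp
  finally have x2: "cmod ?X2 \<le> (sqrt G * sqrt (tail K s)) * (?P * ?i)" .
  have x1: "?X1 = of_real (?A * ?i^2) * ?J e"
   unfolding V1_def L2_inner_single[OF K] uT by (rule wave_inner[OF Rc Ri r e(1) s])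
  have y: "?Y = (if K = L then of_real (?P * ?i) * ?I else 0)"
  proof (cases "K = L")
   case True
   have pm: "integrable lborel (\<lambda>z. packet a r z * complex_of_real (mehler K (T + s) z))"
    using T s by (intro L2_fun_mult_integrable packet_L2 mehler_L2) auto
   have th: "integrable lborel (\<lambda>t. complex_of_real ((cmod (theta e t))^2))" by (intro integrable_of_real theta_integral e)
   have "?Y = (LI p. (packet a r (fst p) * of_real (mehler K (T + s) (fst p))) * of_real ((cmod (theta e (snd p)))^2))"
    unfolding L2_inner_single[OF K] complex_norm_square using True
    by (intro B_integral_cong refl) (simp add: f_def quad.single_def Fw_def Vq_def mult_ac)
   also have "\<dots> = ?I * of_real (?P * ?i)"
    unfolding lborel_pair_product(2)[OF pm th] integral_complex_of_real Th ..
   finally show ?thesis unfolding if_P[OF True] by (simp only: mult.commute)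
  next
   case False
   hence "f K = (\<lambda>x. 0)" by (auto simp: f_def quad.single_def)
   thus ?thesis unfolding L2_inner_single[OF K] using False by simp
  qed
  have "cmod (?X1 + ?X2 - ?Y) \<le> T * (L2_norm q f * (e * C * sqrt ?i))"
   using C(2) e f2 u unfolding X[symmetric] by blast
  also have "\<dots> = (e * (T * (sqrt (G * ?P) * C))) * (sqrt ?i * sqrt ?i)"
   unfolding fn mult.assoc[symmetric, of G] real_sqrt_mult[of "G * ?P"] by (simp only: mult_ac)
  also have "sqrt ?i * sqrt ?i = ?i" using i0 by simp
  finally have "cmod (?X1 + ?X2 - ?Y) \<le> (e * (T * (sqrt (G * ?P) * C))) * ?i" .
  moreover have "cmod (?X1 - ?Y) \<le> cmod (?X1 + ?X2 - ?Y) + cmod ?X2"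
   using norm_triangle_ineq4[of "?X1 + ?X2 - ?Y" ?X2] by (simp add: algebra_simps)
  ultimately have "cmod (?X1 - ?Y) \<le> (e * (T * (sqrt (G * ?P) * C)) + ?P * (sqrt G * sqrt (tail K s))) * ?i"
   using x2 by (simp add: algebra_simps)
  \<comment> \<open>Each of the two norms in a pairing carries e^(-m/2); multiplication by e^m makes
    all terms converge.\<close>
  hence "e ^ CARD('m) * cmod (?X1 - ?Y) \<le> e ^ CARD('m) * ((e * (T * (sqrt (G * ?P) * C)) + ?P * (sqrt G * sqrt (tail K s))) * ?i)"
   using e by (intro mult_left_mono) auto
  also have "\<dots> = e * (T * (sqrt (G * ?P) * C)) + ?P * (sqrt G * sqrt (tail K s))" using e by simp
  finally have b: "e ^ CARD('m) * cmod (?X1 - ?Y) \<le> e * (T * (sqrt (G * ?P) * C)) + ?P * (sqrt G * sqrt (tail K s))" .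
  have en: "complex_of_real (e ^ CARD('m)) * of_real ?i = 1" using e by simp
  have "of_real (e ^ CARD('m)) * (?X1 - ?Y) = of_real ?A * (of_real ?i * ?J e) - (if K = L then of_real ?P * ?I else 0)"
  proof -
   have "of_real (e ^ CARD('m)) * ?X1 = (of_real (e ^ CARD('m)) * of_real ?i) * (of_real ?A * (of_real ?i * ?J e))"
    unfolding x1 of_real_mult power2_eq_square by (simp only: mult_ac)
   moreover have "of_real (e ^ CARD('m)) * ?Y = (of_real (e ^ CARD('m)) * of_real ?i) * (if K = L then of_real ?P * ?I else 0)"
    unfolding y of_real_mult by (cases "K = L") (simp_all add: mult_ac)
   ultimately show ?thesis unfolding en mult_1 right_diff_distrib by simp
  qed
  from arg_cong[OF this, of cmod] b e show ?thesis by (simp only: norm_mult norm_of_real abs_of_pos zero_less_power)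
 qed
 have l1: "((\<lambda>e. cmod (of_real ?A * (of_real (inverse (e ^ CARD('m))) * ?J e) - (if K = L then of_real ?P * ?I else 0)))
  \<longlongrightarrow> cmod (of_real ?A * (of_real ?P * Phi R a r K s \<xi>) - (if K = L then of_real ?P * ?I else 0))) (at_right 0)"
  by (intro tendsto_norm tendsto_diff tendsto_const tendsto_mult Phi_concentration[OF Rc Ri r s])
 have "((\<lambda>e. e * (T * (sqrt (G * ?P) * C)) + ?P * (sqrt G * sqrt (tail K s))) \<longlongrightarrow> 0 * (T * (sqrt (G * ?P) * C)) + ?P * (sqrt G * sqrt (tail K s))) (at_right 0)"
  by (intro tendsto_intros)
 hence l2: "((\<lambda>e. e * (T * (sqrt (G * ?P) * C)) + ?P * (sqrt G * sqrt (tail K s))) \<longlongrightarrow> ?P * (sqrt G * sqrt (tail K s))) (at_right 0)" by simp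
 have "cmod (of_real ?A * (of_real ?P * Phi R a r K s \<xi>) - (if K = L then of_real ?P * ?I else 0)) \<le> ?P * (sqrt G * sqrt (tail K s))"
 proof (rule tendsto_le[OF _ l2 l1])
  show "\<forall>\<^sub>F e in at_right 0. cmod (of_real ?A * (of_real (inverse (e ^ CARD('m))) * ?J e) - (if K = L then of_real ?P * ?I else 0))
   \<le> e * (T * (sqrt (G * ?P) * C)) + ?P * (sqrt G * sqrt (tail K s))"
   unfolding eventually_at_right_field using main by (intro exI[of _ 1]) auto
 qed simp
 thus ?thesis unfolding G_def .
qed

lemma crd_minus: "crd j (- z) = - crd j z"
 using linear_neg[OF bounded_linear.linear[OF crd_linear]] .

lemma mehler_even: "mehler K s (- z) = mehler K s z"
 unfolding mehler_def crd_minus norm_minus_cancel ..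

text \<open>As s tends to 0, \<open>mehler\<close> concentrates at z = 0, where the plateau is 1 and
  the twist vanishes, and the tail disappears.\<close>

lemma wave_identity:
 assumes \<rho>: "heat_fundamental_solution \<phi> v q \<rho>" and T: "T > 0" and K: "K \<in> \<I> q" and L: "L \<in> \<I> q"
  and R: "has_fourier_t (\<rho> T K L) R" and r: "r > 0"
 shows "of_real (sqrt (2 * pi) ^ CARD('m)) * (LI w. R (w, \<xi>) * packet a r (- w))
   = (if K = L then LI z. packet a r z * of_real (mehler K T z) else 0)"
proof -
 let ?P = "complex_of_real (sqrt pi ^ CARD('m))" and ?A = "complex_of_real (sqrt (2 * pi) ^ CARD('m))" and ?I = "\<lambda>t. LI z. packet a r z * of_real (mehler K t z)"
 have Rc: "continuous_on UNIV R" using R by (simp add: has_fourier_t_def)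
 have Ri: "integrable lborel (\<lambda>p. R p * \<psi> p)" if "gs \<psi>" for \<psi> using R gs_schwartz[OF that] by (simp add: has_fourier_t_def)
 have gc: "continuous_on UNIV (\<lambda>z. Gx R a r (z, \<xi>))"
  by (intro continuous_on_compose2[OF Gx_continuous[OF Rc Ri r]] continuous_intros) auto
 have "((\<lambda>s. LI z. of_real (mehler K s z) * Gx R a r (z, \<xi>)) \<longlongrightarrow> Gx R a r (0, \<xi>)) (at_right 0)"
 proof (rule mehler_approximate_identity)
  show "(\<lambda>z. Gx R a r (z, \<xi>)) \<in> borel_funs" by (rule borel_measurable_continuous_onI[OF gc])
  show "cmod (Gx R a r (z, \<xi>)) \<le> Nx R (1 + norm a + r) \<xi>" for z by (rule Gx_le[OF Rc Ri r])
  show "isCont (\<lambda>z. Gx R a r (z, \<xi>)) 0" using gc by (simp add: continuous_on_eq_continuous_at)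
 qed
 hence Ph: "((\<lambda>s. Phi R a r K s \<xi>) \<longlongrightarrow> Gx R a r (0, \<xi>)) (at_right 0)" unfolding Phi_def by (simp only: mult.commute)
 have G0: "Gx R a r (0, \<xi>) = (LI w. R (w, \<xi>) * packet a r (- w))"
 proof -
  have "im_form \<phi> w 0 = 0" for w by (simp add: im_form_def phi_zero vec_eq_iff)
  thus ?thesis by (simp add: Gx_def Gc_def plateau_def)
 qed
 \<comment> \<open>At z = 0 the integral is a \<open>flow\<close> of the packet, whose derivative in
   time was established; this gives the continuity at T.\<close>
 have It: "?I t = flow (\<lambda>K. packet a r) t K 0" for t
 proof -
  have "Phase 0 y = 1" for y by (simp add: Phase_def im_form_def phi_zero inner_vec_def)
  thus ?thesis by (simp add: flow_def gop_def Pk_def mehler_even mult.commute)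
 qed
 have pf: "L2_form q (\<lambda>K. packet a r)" by (simp add: L2_form_def packet_L2)
 have "isCont ?I T"
  unfolding It using has_vector_derivative_continuous[OF flow_derivative[OF T pf K]] by simp
 moreover have "((\<lambda>s. T + s) \<longlongrightarrow> T) (at_right 0)" by (rule tendsto_eq_intros | simp)+
 ultimately have Il: "((\<lambda>s. ?I (T + s)) \<longlongrightarrow> ?I T) (at_right 0)" by (rule isCont_tendsto_compose)
 have l1: "((\<lambda>s. cmod (?A * (?P * Phi R a r K s \<xi>) - (if K = L then ?P * ?I (T + s) else 0)))
   \<longlongrightarrow> cmod (?A * (?P * Gx R a r (0, \<xi>)) - (if K = L then ?P * ?I T else 0))) (at_right 0)"
 proof (cases "K = L")
  case True
  show ?thesis unfolding if_P[OF True] by (intro tendsto_intros Ph Il)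
 next
  case False
  show ?thesis unfolding if_not_P[OF False] by (intro tendsto_intros Ph)
 qed
 have "((\<lambda>s. sqrt pi ^ CARD('m) * (sqrt (LI z. (cmod (packet a r z))^2) * sqrt (tail K s)))
   \<longlongrightarrow> sqrt pi ^ CARD('m) * (sqrt (LI z. (cmod (packet a r z))^2) * sqrt 0)) (at_right 0)"
  by (intro tendsto_intros tail_lim)
 hence l2: "((\<lambda>s. sqrt pi ^ CARD('m) * (sqrt (LI z. (cmod (packet a r z))^2) * sqrt (tail K s))) \<longlongrightarrow> 0) (at_right 0)" by simp
 have "cmod (?A * (?P * Gx R a r (0, \<xi>)) - (if K = L then ?P * ?I T else 0)) \<le> 0"
 proof (rule tendsto_le[OF _ l2 l1])
  show "\<forall>\<^sub>F s in at_right 0. cmod (?A * (?P * Phi R a r K s \<xi>) - (if K = L then ?P * ?I (T + s) else 0))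
   \<le> sqrt pi ^ CARD('m) * (sqrt (LI z. (cmod (packet a r z))^2) * sqrt (tail K s))"
   unfolding eventually_at_right_field using wave_inequality[OF \<rho> T K L R r] by (intro exI[of _ 1]) auto
 qed simp
 hence "?P * (?A * Gx R a r (0, \<xi>)) = ?P * (if K = L then ?I T else 0)" by (auto simp: mult_ac split: if_splits)
 thus ?thesis unfolding G0 by simp
qed

text \<open>Both sides are continuous in w and have equal integrals against all packets. If they
  differed at w, a nonnegative packet supported near w would detect it.\<close>

theorem fourier_heat_kernel:
 assumes \<rho>: "heat_fundamental_solution \<phi> v q \<rho>" and T: "T > 0" and K: "K \<in> \<I> q" and L: "L \<in> \<I> q"
  and R: "has_fourier_t (\<rho> T K L) R"
 shows "of_real (sqrt (2 * pi) ^ CARD('m)) * R (w, \<xi>) = (if K = L then of_real (mehler K T w) else 0)"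
proof (rule ccontr)
 let ?A = "complex_of_real (sqrt (2 * pi) ^ CARD('m))"
 define F where "F w = ?A * R (w, \<xi>) - (if K = L then of_real (mehler K T w) else 0)" for w
 assume "?A * R (w, \<xi>) \<noteq> (if K = L then of_real (mehler K T w) else 0)"
 hence c0: "F w \<noteq> 0" by (simp add: F_def)
 have Rc: "continuous_on UNIV R" using R by (simp add: has_fourier_t_def)
 have Fc: "continuous_on UNIV F"
 proof -
  have 1: "continuous_on UNIV (\<lambda>w. ?A * R (w, \<xi>))" by (intro continuous_intros continuous_on_compose2[OF Rc]) auto
  show ?thesis
  proof (cases "K = L")
   case True
   show ?thesis unfolding F_def[abs_def] if_P[OF True] by (intro continuous_intros 1 mehler_continuous)
  next
   case False
   show ?thesis unfolding F_def[abs_def] if_not_P[OF False] by (intro continuous_intros 1)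
  qed
 qed
 hence "isCont F w" by (simp add: continuous_on_eq_continuous_at)
 then obtain d where d: "d > 0" "\<And>x. dist x w < d ==> dist (F x) (F w) < cmod (F w)"
  using c0 unfolding continuous_at_eps_delta by (metis zero_less_norm_iff)
 \<comment> \<open>Packets enter reflected, as \<open>?p (- x)\<close>, hence the centre -w. The
   radius d/2 stays inside the ball where F is within |F w| of F w.\<close>
 let ?p = "packet (- w) (d / 2)"
 define h where "h x = exp 1 * bump (1 - (norm (- w - x))\<^sup>2 / (d / 2)^2) * exp (- (norm x)\<^sup>2)" for x
 have ph: "?p x = of_real (h x)" for x unfolding packet_def cutoff_def h_def by simp
 have h0: "h x \<ge> 0" for x by (simp add: h_def bump_deriv_def)
 define P where "P x = Re (cnj (F w) * (F x * ?p (- x)))" for x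
 have pc: "continuous_on UNIV (\<lambda>x. ?p (- x))" by (intro continuous_on_compose2[OF packet_continuous] continuous_intros) auto
 have Pc: "continuous_on UNIV P" unfolding P_def[abs_def] by (intro continuous_intros Fc pc)
 have supp: "?p (- x) = 0" if "dist x w \<ge> d" for x
 proof (rule ccontr)
  assume "?p (- x) \<noteq> 0"
  hence "norm (- w - - x) \<le> d / 2" using packet_supp[of "d / 2" "- w" "- x"] d(1) by simp
  thus False using that d(1) by (simp add: dist_norm)
 qed
 have int: "integrable lborel (\<lambda>x. k x * ?p (- x))" if k: "continuous_on UNIV k" for k
 proof (rule continuous_integral_compact(1)[where F="\<lambda>x (y :: real). k x * ?p (- x)" and r="norm w + d"])
  show "continuous_on UNIV (\<lambda>p. k (fst p) * ?p (- fst p))"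
   by (intro continuous_intros continuous_on_compose2[OF k] continuous_on_compose2[OF pc]) auto
  show "k x * ?p (- x) = 0" if "norm x > norm w + d" for x
  proof -
   have "norm x \<le> norm w + dist x w" using norm_triangle_ineq[of w "x - w"] by (simp add: dist_norm)
   thus ?thesis using that supp[of x] by simp
  qed
 qed
 have "(LI x. F x * ?p (- x)) = 0"
 proof -
  have i1: "integrable lborel (\<lambda>x. R (x, \<xi>) * ?p (- x))" by (intro int continuous_on_compose2[OF Rc] continuous_intros) auto
  have i2: "integrable lborel (\<lambda>x. of_real (mehler K T x) * ?p (- x))" by (intro int continuous_intros mehler_continuous)
  have "(LI x. F x * ?p (- x)) = (LI x. ?A * (R (x, \<xi>) * ?p (- x)) - (if K = L then of_real (mehler K T x) * ?p (- x) else 0))"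
   by (intro B_integral_cong refl) (simp add: F_def left_diff_distrib mult.assoc)
  also have "\<dots> = ?A * (LI x. R (x, \<xi>) * ?p (- x)) - (if K = L then LI x. of_real (mehler K T x) * ?p (- x) else 0)"
   using i1 i2 by (cases "K = L") simp_all
  also have "(LI x. of_real (mehler K T x) * ?p (- x)) = (LI x. ?p x * of_real (mehler K T x))"
  proof -
   have "(\<lambda>x. ?p x * complex_of_real (mehler K T x)) \<in> borel_funs"
    by (intro borel_measurable_continuous_onI continuous_intros mehler_continuous packet_continuous)
   from lborel_integral_scale[of "- 1", OF _ this] show ?thesis by (simp add: mehler_even mult.commute)
  qed
  also have "?A * (LI x. R (x, \<xi>) * ?p (- x)) = (if K = L then LI x. ?p x * of_real (mehler K T x) else 0)"
   using wave_identity[OF \<rho> T K L R, of "d / 2" "- w"] d(1) by simp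
  finally show ?thesis by simp
 qed
 moreover have Fi: "integrable lborel (\<lambda>x. F x * ?p (- x))" by (rule int[OF Fc])
 moreover have "(LI x. P x) = Re (LI x. cnj (F w) * (F x * ?p (- x)))"
  unfolding P_def by (rule integral_Re[OF integrable_mult_right[OF Fi]])
 ultimately have P0: "(LI x. P x) = 0" by simp
 have Pi: "integrable lborel P" unfolding P_def[abs_def] by (intro integrable_Re integrable_mult_right Fi)
 have nn: "P x \<ge> 0" for x
 proof (cases "dist x w < d")
  case True
  have "cmod (cnj (F w) * (F x - F w)) \<le> cmod (F w) * cmod (F w)"
   using d(2)[OF True] by (simp add: norm_mult dist_norm mult_left_mono)
  moreover have "Re (cnj (F w) * F w) = cmod (F w) * cmod (F w)"
   by (metis Re_complex_of_real complex_norm_square mult.commute power2_eq_square)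
  moreover have "Re (cnj (F w) * F x) = Re (cnj (F w) * F w) + Re (cnj (F w) * (F x - F w))" by (simp add: algebra_simps)
  moreover have "\<bar>Re (cnj (F w) * (F x - F w))\<bar> \<le> cmod (cnj (F w) * (F x - F w))" by (rule abs_Re_le_cmod)
  ultimately have "0 \<le> Re (cnj (F w) * F x)" by linarith
  moreover have "P x = Re (cnj (F w) * F x) * h (- x)"
  proof -
   have "Re (c * complex_of_real t) = Re c * t" for c t by simp
   thus ?thesis unfolding P_def ph mult.assoc[symmetric] .
  qed
  ultimately show ?thesis using h0 by simp
 next
  case False thus ?thesis using supp[of x] by (simp add: P_def)
 qed
 have "P w = 0" by (rule continuous_nonneg_integral_zero[OF Pc Pi nn P0])
 moreover have "P w = (cmod (F w))^2 * h (- w)"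
 proof -
  have "cnj (F w) * (F w * ?p (- w)) = of_real ((cmod (F w))^2 * h (- w))"
   unfolding ph of_real_mult complex_norm_square by (simp only: mult_ac)
  thus ?thesis by (simp only: P_def Re_complex_of_real)
 qed
 moreover have "h (- w) > 0" by (simp add: h_def bump_deriv_def)
 ultimately show False using c0 by simp
qed

end

section \<open>The kernel in coordinates\<close>

lemma pos_bij: "bij_betw (pos :: 'n::{finite,linorder} => nat) UNIV {1..CARD('n)}"
proof -
 have lt: "pos i < pos j" if "i < j" for i j :: 'n
  unfolding pos_def using that by (intro psubset_card_mono) auto
 have inj: "inj (pos :: 'n => nat)" by (rule linorder_injI) (auto dest: lt)
 have sub: "range (pos :: 'n => nat) \<subseteq> {1..CARD('n)}"
 proof
  fix k assume "k \<in> range (pos :: 'n => nat)"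
  then obtain j :: 'n where k: "k = card {..j}" by (auto simp: pos_def)
  have "card {j} \<le> card {..j}" "card {..j} \<le> CARD('n)" by (intro card_mono; simp)+
  thus "k \<in> {1..CARD('n)}" by (simp add: k)
 qed
 have "range (pos :: 'n => nat) = {1..CARD('n)}"
  by (rule card_subset_eq[OF _ sub]) (simp_all add: card_image inj)
 with inj show ?thesis by (simp add: bij_betw_def)
qed

text \<open>\<open>pos\<close> enumerates the indices by 1, ..., n, so this counts the zero
  eigenvalues.\<close>

lemma card_pos_greater: "card {j :: 'n::{finite,linorder}. pos j > k} = CARD('n) - k"
proof -
 have "bij_betw pos {j :: 'n. pos j > k} {Suc k..CARD('n)}"
 proof (rule bij_betw_subset[OF pos_bij])
  have "pos j \<le> CARD('n)" for j :: 'n using bij_betwE[OF pos_bij] by auto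
  moreover have "\<exists>j :: 'n. i = pos j" if "Suc k \<le> i" "i \<le> CARD('n)" for i
  proof -
   have "i \<in> range (pos :: 'n => nat)" unfolding bij_betw_imp_surj_on[OF pos_bij] using that by simp
   thus ?thesis by blast
  qed
  ultimately show "pos ` {j :: 'n. pos j > k} = {Suc k..CARD('n)}" by (force simp: image_iff)
 qed simp
 thus ?thesis by (simp add: bij_betw_same_card)
qed

context diag_form
begin

text \<open>The product is split at \<open>\<nu>\<close>. A factor with \<mu> j = 0 contributes
  1/(pi s) = 2/(2 pi s), one with nonzero \<mu> j contributes 1/(2 pi); this accounts for the powers
  of 2, 2 pi and s.\<close>

lemma mehler_formula:
 fixes K :: "'n set"
 assumes s: "s > 0"
 defines "\<nu> \<equiv> form_rank \<phi> \<xi>"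
 shows "mehler K s (z - z') = 2 ^ (CARD('n) - \<nu>) / (2 * pi) ^ CARD('n) / s ^ (CARD('n) - \<nu>) *
      exp (- (\<Sum>j | pos j > \<nu>. (cmod (cinner z (v j) - cinner z' (v j)))^2) / s) *
      (\<Prod>j | pos j \<le> \<nu>.
        2 * exp (s * eps_sign \<mu> K j * \<bar>\<mu> j\<bar>) * \<mu> j / sinh (s * \<mu> j) *
        exp (- \<mu> j * coth (\<mu> j * s) * (cmod (cinner z (v j) - cinner z' (v j)))^2))"
proof -
 define d where "d j = (cmod (cinner z (v j) - cinner z' (v j)))^2" for j
 define X where "X j = mehler_b (\<mu> j) s * exp (s * sgn_rate K j) / pi * exp (- (mehler_a (\<mu> j) s * d j))" for j
 define Y where "Y j = 2 * exp (s * eps_sign \<mu> K j * \<bar>\<mu> j\<bar>) * \<mu> j / sinh (s * \<mu> j) * exp (- \<mu> j * coth (\<mu> j * s) * d j)" for j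
 let ?B = "{j :: 'n. pos j > \<nu>}" and ?S = "{j :: 'n. pos j \<le> \<nu>}"
 have mu: "\<mu> j \<noteq> 0 \<longleftrightarrow> pos j \<le> \<nu>" for j using diag by (simp add: diagonalizing_basis_def \<nu>_def)
 have dc: "(cmod (crd j (z - z')))^2 = d j" for j by (simp add: d_def crd_diff) (simp add: crd_def)
 have "mehler K s (z - z') = (\<Prod>j\<in>UNIV. X j)"
  unfolding mehler_def dc X_def prod.distrib sum_negf[symmetric] exp_sum[OF finite] ..
 also have "UNIV = ?B \<union> ?S" by auto
 also have "(\<Prod>j\<in>?B \<union> ?S. X j) = (\<Prod>j\<in>?B. X j) * (\<Prod>j\<in>?S. X j)" by (rule prod.union_disjoint) auto
 also have "(\<Prod>j\<in>?B. X j) = (\<Prod>j\<in>?B. 1 / (pi * s) * exp (- (d j / s)))"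
 proof (rule prod.cong[OF refl])
  fix j assume "j \<in> ?B"
  hence "\<mu> j = 0" using mu[of j] by auto
  thus "X j = 1 / (pi * s) * exp (- (d j / s))" by (simp add: X_def mehler_a_def mehler_b_def sgn_rate_def)
 qed
 also have "\<dots> = (1 / (pi * s)) ^ card ?B * exp (- (\<Sum>j\<in>?B. d j) / s)"
 proof -
  have "- (\<Sum>j\<in>?B. d j) / s = (\<Sum>j\<in>?B. - (d j / s))" by (simp add: sum_negf sum_divide_distrib)
  thus ?thesis unfolding prod.distrib prod_constant by (simp only: exp_sum[OF finite])
 qed
 also have "(\<Prod>j\<in>?S. X j) = (\<Prod>j\<in>?S. 1 / (2 * pi) * Y j)"
 proof (rule prod.cong[OF refl])
  fix j assume "j \<in> ?S"
  hence m: "\<mu> j \<noteq> 0" using mu[of j] by auto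
  have "sgn_rate K j = eps_sign \<mu> K j * \<bar>\<mu> j\<bar>" by (simp add: sgn_rate_def eps_sign_def sgn_mult_abs)
  thus "X j = 1 / (2 * pi) * Y j" using m
   by (simp add: X_def Y_def mehler_a_def mehler_b_def mult_ac)
 qed
 also have "\<dots> = (1 / (2 * pi)) ^ card ?S * (\<Prod>j\<in>?S. Y j)" unfolding prod.distrib prod_constant ..
 also have "card ?B = CARD('n) - \<nu>" by (rule card_pos_greater)
 finally have m: "mehler K s (z - z') = (1 / (pi * s)) ^ (CARD('n) - \<nu>) * exp (- (\<Sum>j\<in>?B. d j) / s) * ((1 / (2 * pi)) ^ card ?S * (\<Prod>j\<in>?S. Y j))" .
 have "card ?B + card ?S = CARD('n)"
  by (subst card_Un_disjoint[symmetric]) (auto intro: arg_cong[of _ _ card])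
 hence n: "(CARD('n) - \<nu>) + card ?S = CARD('n)" unfolding card_pos_greater .
 have "(1 / (pi * s)) ^ (CARD('n) - \<nu>) * (1 / (2 * pi)) ^ card ?S = 2 ^ (CARD('n) - \<nu>) / (2 * pi) ^ ((CARD('n) - \<nu>) + card ?S) / s ^ (CARD('n) - \<nu>)"
  using s by (simp add: power_add power_divide power_mult_distrib field_simps)
 hence c: "(1 / (pi * s)) ^ (CARD('n) - \<nu>) * (1 / (2 * pi)) ^ card ?S = 2 ^ (CARD('n) - \<nu>) / (2 * pi) ^ CARD('n) / s ^ (CARD('n) - \<nu>)"
  unfolding n .
 have "mehler K s (z - z') = ((1 / (pi * s)) ^ (CARD('n) - \<nu>) * (1 / (2 * pi)) ^ card ?S) * exp (- (\<Sum>j\<in>?B. d j) / s) * (\<Prod>j\<in>?S. Y j)"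
  unfolding m by (simp only: mult_ac)
 thus ?thesis unfolding c d_def Y_def .
qed

section \<open>From the identified kernel to the weighted heat equation\<close>

lemma weighted_dbar_cong:
 assumes e: "\<And>J x. J \<in> \<I> q ==> f J x = f' J x" and D: "weighted_dbar \<phi> \<xi> v q f g"
 shows "weighted_dbar \<phi> \<xi> v q f' g"
proof -
 have e': "f J = f' J" if "J \<in> \<I> q" for J by (rule ext) (rule e[OF that])
 show ?thesis using D unfolding weighted_dbar_def dbar_distr_def L2_form_def by (simp add: e' cong: sum.cong ball_cong)
qed

lemma apply_kernel_flow:
 assumes H: "\<And>s K L z z'. s > 0 ==> K \<in> \<I> q ==> L \<in> \<I> q ==> H s K L z z' = (if K = L then Pk K s z z' else 0)"
  and s: "s > 0" and K: "K \<in> \<I> q"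
 shows "apply_kernel q H f s K z = flow f s K z"
proof -
 have "apply_kernel q H f s K z = (\<Sum>L\<in>\<I> q. if K = L then flow f s K z else 0)"
  unfolding apply_kernel_def by (intro sum.cong refl) (auto simp: H[OF s K] flow_def gop_def)
 thus ?thesis using K by simp
qed

text \<open>For s > 0 and components of size q such a kernel acts as \<open>flow\<close>. The other
  components of \<open>apply_kernel\<close> are uncontrolled, so the properties of
  \<open>flow\<close> are carried over by congruence.\<close>

theorem kernel_solves_heat_equation:
 assumes H: "\<And>s K L z z'. s > 0 ==> K \<in> \<I> q ==> L \<in> \<I> q ==> H s K L z z' = (if K = L then Pk K s z z' else 0)"
  and f: "L2_form q f"
 shows "\<And>s K L z. s > 0 ==> K \<in> \<I> q ==> L \<in> \<I> q ==> integrable lborel (\<lambda>z'. H s K L z z' * f L z')"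
  and "\<And>s. s > 0 ==> \<exists>w. weighted_Box \<phi> \<xi> v q (apply_kernel q H f s) w \<and>
     (\<forall>K\<in>\<I> q. \<forall>z. ((\<lambda>s. apply_kernel q H f s K z) has_vector_derivative - w K z) (at s))"
  and "\<And>K \<psi>. K \<in> \<I> q ==> test_function \<psi> ==>
     ((\<lambda>s. LI z. apply_kernel q H f s K z * \<psi> z) \<longlongrightarrow> (LI z. f K z * \<psi> z)) (at_right 0)"
proof -
 note ak = apply_kernel_flow[where H=H and q=q, OF H]
 show "integrable lborel (\<lambda>z'. H s K L z z' * f L z')" if "s > 0" "K \<in> \<I> q" "L \<in> \<I> q" for s K L z
  using gop_integrable[OF gker_Pk[OF that(1)] L2_formD[OF f that(3)]] unfolding H[OF that] by (cases "K = L") simp_all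
 show "\<exists>w. weighted_Box \<phi> \<xi> v q (apply_kernel q H f s) w \<and>
   (\<forall>K\<in>\<I> q. \<forall>z. ((\<lambda>s. apply_kernel q H f s K z) has_vector_derivative - w K z) (at s))" if s: "s > 0" for s
 proof (intro exI conjI ballI allI)
  show "weighted_Box \<phi> \<xi> v q (apply_kernel q H f s) (\<lambda>K z. - flow' f s K z)"
  proof (rule laplacian_cong[OF weighted_laplacian_flow[OF s f]])
   show e: "flow f s J x = apply_kernel q H f s J x" if "J \<in> \<I> q" for J x by (rule ak[OF _ _ _ s that, symmetric])
   show "weighted_dbar \<phi> \<xi> v q (apply_kernel q H f s) g" if "weighted_dbar \<phi> \<xi> v q (flow f s) g" for g
    by (rule weighted_dbar_cong[OF e that])
  qed
  fix K z assume K: "K \<in> (\<I> q :: 'n set set)"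
  have "((\<lambda>s. apply_kernel q H f s K z) has_vector_derivative flow' f s K z) (at s)"
   by (rule has_vector_derivative_transform_within_open[OF flow_derivative[OF s f K], of "{0<..}"]) (use s ak K in auto)
  thus "((\<lambda>s. apply_kernel q H f s K z) has_vector_derivative - (- flow' f s K z)) (at s)" by simp
 qed
 show "((\<lambda>s. LI z. apply_kernel q H f s K z * \<psi> z) \<longlongrightarrow> (LI z. f K z * \<psi> z)) (at_right 0)"
  if K: "K \<in> \<I> q" and t: "test_function \<psi>" for K \<psi>
 proof (rule Lim_transform_eventually[OF flow_initial[OF f K C1c_nice[OF test_function_C1c[OF t]]]])
  show "\<forall>\<^sub>F s in at_right 0. (LI z. flow f s K z * \<psi> z) = (LI z. apply_kernel q H f s K z * \<psi> z)"
   using eventually_at_right_less[of 0] by eventually_elim (simp add: ak K)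
 qed
qed

end

theorem corollary1:
  fixes \<phi> :: "'n::{finite,linorder} cspace \<Rightarrow> 'n cspace \<Rightarrow> 'm::finite cspace"
    and v :: "'n \<Rightarrow> 'n cspace" and \<mu> :: "'n \<Rightarrow> real"
    and \<xi> :: "'m rspace" and q :: nat
    and \<rho> :: "real \<Rightarrow> 'n set \<Rightarrow> 'n set \<Rightarrow> (('n, 'm) quadric \<Rightarrow> complex) \<Rightarrow> complex"
    and \<rho>hat :: "real \<Rightarrow> 'n set \<Rightarrow> 'n set \<Rightarrow> ('n, 'm) quadric \<Rightarrow> complex"
  defines "H \<equiv> heat_kernel \<phi> \<xi> \<rho>hat"
    and "\<nu> \<equiv> form_rank \<phi> \<xi>"
  assumes "sesquilinear_form \<phi>"
    and "q \<le> CARD('n)"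
    and "diagonalizing_basis \<phi> \<xi> v \<mu>"
    and "heat_fundamental_solution \<phi> v q \<rho>"
    and "\<And>s K L. s > 0 \<Longrightarrow> K \<in> multi_indices q \<Longrightarrow> L \<in> multi_indices q \<Longrightarrow>
           has_fourier_t (\<rho> s K L) (\<rho>hat s K L)"
  shows "(\<forall>f. L2_form q f \<longrightarrow>
      (\<forall>s>0. \<forall>K\<in>multi_indices q. \<forall>L\<in>multi_indices q. \<forall>z.
         integrable lborel (\<lambda>z'. H s K L z z' * f L z')) \<and>
      (\<forall>s>0. \<exists>w. weighted_Box \<phi> \<xi> v q (apply_kernel q H f s) w \<and>
         (\<forall>K\<in>multi_indices q. \<forall>z.
            ((\<lambda>s. apply_kernel q H f s K z) has_vector_derivative - w K z) (at s))) \<and>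
      (\<forall>K\<in>multi_indices q. \<forall>\<psi>. test_function \<psi> \<longrightarrow>
         ((\<lambda>s. LINT z|lborel. apply_kernel q H f s K z * \<psi> z) \<longlongrightarrow> (LINT z|lborel. f K z * \<psi> z))
           (at_right 0))) \<and>
    (\<forall>s>0. \<forall>K\<in>multi_indices q. \<forall>L\<in>multi_indices q. \<forall>z z'.
      H s K L z z' = (if K = L then
          of_real (2 ^ (CARD('n) - \<nu>) / (2 * pi) ^ CARD('n) / s ^ (CARD('n) - \<nu>) *
            exp (- (\<Sum>j | pos j > \<nu>. (cmod (cinner z (v j) - cinner z' (v j)))\<^sup>2) / s) *
            (\<Prod>j | pos j \<le> \<nu>.
               2 * exp (s * eps_sign \<mu> L j * \<bar>\<mu> j\<bar>) * \<mu> j / sinh (s * \<mu> j) *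
               exp (- \<mu> j * coth (\<mu> j * s) * (cmod (cinner z (v j) - cinner z' (v j)))\<^sup>2))) *
          exp (- 2 * \<i> * of_real (\<xi> \<bullet> im_form \<phi> z z'))
        else 0))"
proof -
  interpret diag_form \<phi> \<xi> v \<mu> by unfold_locales (fact assms)+
  have kernel: "H s K L z z' = (if K = L then Pk K s z z' else 0)"
    if "s > 0" "K \<in> multi_indices q" "L \<in> multi_indices q" for s K L z z'
  proof -
    \<comment> \<open>\<open>fourier_heat_kernel\<close> at the point z - z', with the factor of
      \<open>heat_kernel\<close> written as a power of sqrt(2 pi).\<close>
    have "of_real ((2 * pi) powr (real CARD('m) / 2)) * \<rho>hat s K L (z - z', \<xi>) = (if K = L then of_real (mehler K s (z - z')) else 0)"
      using fourier_heat_kernel[OF \<open>heat_fundamental_solution \<phi> v q \<rho>\<close> that assms(7)[OF that]] unfolding sqrt_2pi_powr .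
    then show ?thesis unfolding H_def heat_kernel_def by (simp add: Pk_def Phase_def)
  qed
  have "H s K L z z' = (if K = L then
          of_real (2 ^ (CARD('n) - \<nu>) / (2 * pi) ^ CARD('n) / s ^ (CARD('n) - \<nu>) *
            exp (- (\<Sum>j | pos j > \<nu>. (cmod (cinner z (v j) - cinner z' (v j)))\<^sup>2) / s) *
            (\<Prod>j | pos j \<le> \<nu>.
               2 * exp (s * eps_sign \<mu> L j * \<bar>\<mu> j\<bar>) * \<mu> j / sinh (s * \<mu> j) *
               exp (- \<mu> j * coth (\<mu> j * s) * (cmod (cinner z (v j) - cinner z' (v j)))\<^sup>2))) *
          exp (- 2 * \<i> * of_real (\<xi> \<bullet> im_form \<phi> z z'))
        else 0)"
    if "s > 0" "K \<in> multi_indices q" "L \<in> multi_indices q" for s K L z z'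
    unfolding kernel[OF that] Pk_def Phase_def \<nu>_def mehler_formula[OF that(1), symmetric] by (rule if_cong) auto
  with kernel_solves_heat_equation[where H=H, OF kernel] show ?thesis by blast
qed

end
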